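(* The contractad $\mathsf{gcHyper}:=\mathcal S^{-1}(\mathsf{gcGrav})^{!}$ is generated by symmetric elements $\nu_\Gamma\in\mathsf{gcHyper}(\Gamma)$ of degree $2(|V_\Gamma|-2)$, one for each connected graph $\Gamma$ with at least two vertices, subject to the following relations: for each connected graph $\Gamma$ and each pair of edges $e,e'\in E_\Gamma$, $$\sum_{G:\ e\subset G}\nu_{\Gamma/G}\circ^\Gamma_G\nu_{\Gamma|_G}=\sum_{G:\ e'\subset G}\nu_{\Gamma/G}\circ^\Gamma_G\nu_{\Gamma|_G},$$ where the sums range over proper tubes $G\subsetneq V_\Gamma$ containing $e$, respectively $e'$.
   Context: Graphs are finite, simple, undirected. A tube of $\Gamma$ is a non-empty $G\subset V_\Gamma$ with $\Gamma|_G$ connected. A partition $I\vdash\Gamma$ is a set partition of $V_\Gamma$ into tubes; $\Gamma/I$ has the blocks as vertices, two distinct blocks adjacent iff their union is a tube; $\Gamma/G$ is $\Gamma/I$ for $I=\{G\}\cup\{\{v\}:v\notin G\}$. A graphical collection is a contravariant functor from the groupoid of non-empty connected graphs to graded vector spaces over a field $\mathsf k$. The contraction product is $(\mathcal P\circ\mathcal Q)(\Gamma)=\bigoplus_{I\vdash\Gamma}\mathcal P(\Gamma/I)\otimes\bigotimes_{G\in I}\mathcal Q(\Gamma|_G)$; its unit is concentrated on the one-vertex graph. A contractad is a monoid for $\circ$ (equivalently given by infinitesimal compositions $\circ^\Gamma_G:\mathcal P(\Gamma/G)\otimes\mathcal P(\Gamma|_G)\to\mathcal P(\Gamma)$); a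 cocontractad is a comonoid. A $\Gamma$-admissible tree is a rooted tree with leaves labelled by $V_\Gamma$ such that for each edge the leaves above it form a tube; $\mathrm{In}(v)$ is the graph on the incoming edges of $v$, two being adjacent iff the union of their leaf sets is a tube. The free contractad is $\mathbb T(\mathcal E)(\Gamma)=\bigoplus_T\bigotimes_v\mathcal E(\mathrm{In}(v))$; $\mathcal P(\mathcal E,\mathcal R)=\mathbb T(\mathcal E)/\langle\mathcal R\rangle$ is quadratic if $\mathcal R$ lies in the span of trees with two vertices. An element is symmetric if fixed by $\mathrm{Aut}(\Gamma)$. Suspension: $\mathcal S^{n}$ is the contractad $\mathcal S^n(\Gamma)=\mathrm{Hom}((\mathsf k s^n)^{\otimes V_\Gamma},\mathsf ks^n)$ with $s^n$ of degree $n$ and composition of maps; $\mathcal S^n\mathcal P$ is the componentwise tensor product. For a quadratic contractad $\mathcal P=\mathcal P(\mathcal E,\mathcal R)$, the Koszul dual cocontractad $\mathcal P^{\text{!`}}$ is the quadratic cocontractad with cogenerators $s\mathcal E$ and corelations $s^2\mathcal R$, and the Koszul dual contractad is $\mathcal P^!:=\mathcal S^{-1}(\mathcal P^{\text{!`}})^*$ (componentwise linear dual). $\mathsf{gcGrav}$: the little 2-disks contractad $\mathcal D_2$ has $\mathcal D_2(\Gamma)$ the space of rectilinear embeddings of disks $(\mathbb D_v)_{v\in V_\Gamma}$ into the unit disk such that disks labelled by adjacent vertices have disjoint interiors, with compositions by insertion. $\mathsf{gcGerst}=H_\bullet(\mathcal D_2)$, and rotation of the unit disk induces a degree $1$ square-zero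 derivation $\Delta$ of $\mathsf{gcGerst}$ (action of the fundamental class of $S^1$). $\mathsf{gcGrav}:=\ker\Delta\subset\mathsf{gcGerst}$; it is a quadratic contractad, presented by symmetric degree $1$ generators $\lambda_\Gamma$ (one for each connected $\Gamma$ with at least two vertices) with relations $\sum_{e\in E_\Gamma}\lambda_{\Gamma/e}\circ^\Gamma_e\lambda_{\Gamma|_e}=0$ and $\sum_{e\in E_{\Gamma|_G}}\lambda_{\Gamma/e}\circ^\Gamma_e\lambda_{\Gamma|_e}=\lambda_{\Gamma/G}\circ^\Gamma_G\lambda_{\Gamma|_G}$ for proper tubes $G$ with $|G|\ge3$; the Koszul dual is taken with respect to this presentation. *)

theory Defs
  imports Complex_Main "HOL-Library.Function_Algebras"
begin

section \<open>Graphs\<close>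

text \<open>
  Vertices are finite non-empty sets of natural numbers, and distinct vertices of a graph are
  disjoint. The block \<open>A\<close> of a partition is named \<open>\<Union>A\<close> in the contracted graph (so a singleton
  block \<open>{v}\<close> keeps the name \<open>v\<close>). Every finite graph is isomorphic to one of this form, and
  iterated contractions agree on the nose: the canonical isomorphism between
  \<open>(\<Gamma>/K)/(G/K)\<close> and \<open>\<Gamma>/G\<close> is an equality.
\<close>

type_synonym vert = "nat set"
type_synonym graph = "vert set \<times> vert set set"

abbreviation verts :: "graph \<Rightarrow> vert set" where "verts \<equiv> fst"
abbreviation edges :: "graph \<Rightarrow> vert set set" where "edges \<equiv> snd"

definition simple_graph :: "graph \<Rightarrow> bool" where
  "simple_graph \<Gamma> \<longleftrightarrow>
     finite (verts \<Gamma>) \<and> verts \<Gamma> \<noteq> {} \<and>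
     (\<forall>v\<in>verts \<Gamma>. finite v \<and> v \<noteq> {}) \<and>
     (\<forall>v\<in>verts \<Gamma>. \<forall>w\<in>verts \<Gamma>. v \<noteq> w \<longrightarrow> v \<inter> w = {}) \<and>
     (\<forall>e\<in>edges \<Gamma>. e \<subseteq> verts \<Gamma> \<and> card e = 2)"

definition connected_graph :: "graph \<Rightarrow> bool" where
  "connected_graph \<Gamma> \<longleftrightarrow>
     simple_graph \<Gamma> \<and>
     (\<forall>v\<in>verts \<Gamma>. \<forall>w\<in>verts \<Gamma>. (v, w) \<in> {(x, y). {x, y} \<in> edges \<Gamma>}\<^sup>*)"

definition induced :: "graph \<Rightarrow> vert set \<Rightarrow> graph" where
  "induced \<Gamma> G = (G, {e \<in> edges \<Gamma>. e \<subseteq> G})"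

definition tube :: "graph \<Rightarrow> vert set \<Rightarrow> bool" where
  "tube \<Gamma> G \<longleftrightarrow> G \<subseteq> verts \<Gamma> \<and> G \<noteq> {} \<and> connected_graph (induced \<Gamma> G)"

definition proper_tube :: "graph \<Rightarrow> vert set \<Rightarrow> bool" where
  "proper_tube \<Gamma> G \<longleftrightarrow> tube \<Gamma> G \<and> G \<noteq> verts \<Gamma>"

definition contract_partition :: "graph \<Rightarrow> vert set set \<Rightarrow> graph" where
  "contract_partition \<Gamma> I =
     (Union ` I, {{\<Union>A, \<Union>B} | A B. A \<in> I \<and> B \<in> I \<and> A \<noteq> B \<and> tube \<Gamma> (A \<union> B)})"

definition contract :: "graph \<Rightarrow> vert set \<Rightarrow> graph" where
  "contract \<Gamma> G = contract_partition \<Gamma> (insert G ((\<lambda>v. {v}) ` (verts \<Gamma> - G)))"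

text \<open>The image of a tube \<open>G\<close> in the contraction by a tube \<open>K \<subseteq> G\<close>.\<close>

definition contract_tube :: "vert set \<Rightarrow> vert set \<Rightarrow> vert set" where
  "contract_tube K G = insert (\<Union>K) (G - K)"

definition graph_iso :: "graph \<Rightarrow> graph \<Rightarrow> (vert \<Rightarrow> vert) \<Rightarrow> bool" where
  "graph_iso \<Gamma> \<Gamma>' f \<longleftrightarrow>
     bij_betw f (verts \<Gamma>) (verts \<Gamma>') \<and>
     (\<forall>u\<in>verts \<Gamma>. \<forall>v\<in>verts \<Gamma>. {u, v} \<in> edges \<Gamma> \<longleftrightarrow> {f u, f v} \<in> edges \<Gamma>')"

text \<open>The set of vertices that have been merged into \<open>N\<close>, and the map induced by \<open>f\<close> on
  names of sets of vertices (in particular on the vertices of contractions).\<close>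

definition leaves :: "graph \<Rightarrow> vert \<Rightarrow> vert set" where
  "leaves \<Gamma> N = {v \<in> verts \<Gamma>. v \<subseteq> N}"

definition lift :: "graph \<Rightarrow> (vert \<Rightarrow> vert) \<Rightarrow> vert \<Rightarrow> vert" where
  "lift \<Gamma> f N = \<Union>(f ` leaves \<Gamma> N)"


section \<open>Graded vector spaces\<close>

text \<open>
  A graded vector space is a family, indexed by the degree, of linear subspaces of a space of
  functions \<open>'b \<Rightarrow> 'k\<close>. The tensor product of \<open>V \<le> 'k\<^sup>B\<close> and \<open>W \<le> 'k\<^sup>C\<close> is the span of the
  products \<open>v x * w y\<close> in \<open>'k\<^bsup>B \<times> C\<^esup>\<close>.
\<close>

definition fscale :: "'k::field \<Rightarrow> ('b \<Rightarrow> 'k) \<Rightarrow> 'b \<Rightarrow> 'k" where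
  "fscale c f = (\<lambda>x. c * f x)"

global_interpretation fs: vector_space "fscale :: 'k::field \<Rightarrow> ('b \<Rightarrow> 'k) \<Rightarrow> 'b \<Rightarrow> 'k"
  by unfold_locales (auto simp: fscale_def fun_eq_iff algebra_simps)

definition linear_on :: "('b \<Rightarrow> 'k::field) set \<Rightarrow> (('b \<Rightarrow> 'k) \<Rightarrow> 'c \<Rightarrow> 'k) \<Rightarrow> bool" where
  "linear_on V f \<longleftrightarrow>
     (\<forall>x\<in>V. \<forall>y\<in>V. f (x + y) = f x + f y) \<and> (\<forall>c. \<forall>x\<in>V. f (fscale c x) = fscale c (f x))"

definition tensor :: "('b \<Rightarrow> 'k::field) set \<Rightarrow> ('c \<Rightarrow> 'k) set \<Rightarrow> ('b \<times> 'c \<Rightarrow> 'k) set" where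
  "tensor V W = fs.span {\<lambda>(x, y). v x * w y | v w. v \<in> V \<and> w \<in> W}"

definition sgnp :: "int \<Rightarrow> 'k::field" where
  "sgnp m = (if even m then 1 else -1)"

text \<open>Koszul sign exponent for moving the entries of a list that satisfy \<open>P\<close> behind all the
  others, where \<open>w\<close> gives the degrees of the entries.\<close>

definition unshuffle_exp :: "('x \<Rightarrow> bool) \<Rightarrow> ('x \<Rightarrow> int) \<Rightarrow> 'x list \<Rightarrow> int" where
  "unshuffle_exp P w xs =
     (\<Sum>(p, q) \<in> {(p, q). p < q \<and> q < length xs \<and> P (xs ! p) \<and> \<not> P (xs ! q)}.
        w (xs ! p) * w (xs ! q))"

definition before :: "'x list \<Rightarrow> 'x \<Rightarrow> 'x \<Rightarrow> bool" where
  "before xs a b \<longleftrightarrow> (\<exists>p q. p < q \<and> q < length xs \<and> xs ! p = a \<and> xs ! q = b)"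

text \<open>Koszul sign exponent between two orderings of the same set.\<close>

definition koszul_exp :: "('x \<Rightarrow> int) \<Rightarrow> 'x list \<Rightarrow> 'x list \<Rightarrow> int" where
  "koszul_exp w xs ys = (\<Sum>(a, b) \<in> {(a, b). before xs a b \<and> before ys b a}. w a * w b)"


section \<open>Graphical collections, contractads and cocontractads\<close>

text \<open>
  \<open>homog P \<Gamma> d\<close> is the component of degree \<open>d\<close> of \<open>P(\<Gamma>)\<close>; an isomorphism \<open>f : \<Gamma> \<rightarrow> \<Gamma>'\<close> acts
  by \<open>pull P \<Gamma> \<Gamma>' f d : P(\<Gamma>')\<^sub>d \<rightarrow> P(\<Gamma>)\<^sub>d\<close>. All fields are meaningful on connected graphs and on
  elements of the indicated components only.
\<close>

record ('b, 'k) collection =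
  homog :: "graph \<Rightarrow> int \<Rightarrow> ('b \<Rightarrow> 'k) set"
  pull :: "graph \<Rightarrow> graph \<Rightarrow> (vert \<Rightarrow> vert) \<Rightarrow> int \<Rightarrow> ('b \<Rightarrow> 'k) \<Rightarrow> 'b \<Rightarrow> 'k"

text \<open>\<open>pcomp P \<Gamma> G i j\<close> is the component
  \<open>P(\<Gamma>/G)\<^sub>i \<otimes> P(\<Gamma>|\<^sub>G)\<^sub>j \<rightarrow> P(\<Gamma>)\<^bsub>i+j\<^esub>\<close> of the infinitesimal composition, as a bilinear map;
  \<open>iden\<close> is the unit, an element of \<open>P(\<Gamma>)\<^sub>0\<close> for every one-vertex graph \<open>\<Gamma>\<close>.\<close>

record ('b, 'k) contractad_data = "('b, 'k) collection" +
  pcomp :: "graph \<Rightarrow> vert set \<Rightarrow> int \<Rightarrow> int \<Rightarrow> ('b \<Rightarrow> 'k) \<Rightarrow> ('b \<Rightarrow> 'k) \<Rightarrow> 'b \<Rightarrow> 'k"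
  iden :: "graph \<Rightarrow> 'b \<Rightarrow> 'k"

text \<open>\<open>decomp Q \<Gamma> G i j\<close> is the component
  \<open>Q(\<Gamma>)\<^bsub>i+j\<^esub> \<rightarrow> Q(\<Gamma>/G)\<^sub>i \<otimes> Q(\<Gamma>|\<^sub>G)\<^sub>j\<close> of the infinitesimal decomposition.\<close>

record ('b, 'k) cocontractad_data = "('b, 'k) collection" +
  decomp :: "graph \<Rightarrow> vert set \<Rightarrow> int \<Rightarrow> int \<Rightarrow> ('b \<Rightarrow> 'k) \<Rightarrow> 'b \<times> 'b \<Rightarrow> 'k"
  counit :: "graph \<Rightarrow> ('b \<Rightarrow> 'k) \<Rightarrow> 'k"

definition graphical_collection :: "('b, 'k::field, 'm) collection_scheme \<Rightarrow> bool" where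
  "graphical_collection P \<longleftrightarrow>
     (\<forall>\<Gamma> d. connected_graph \<Gamma> \<longrightarrow> fs.subspace (homog P \<Gamma> d)) \<and>
     (\<forall>\<Gamma> \<Gamma>' f d. connected_graph \<Gamma> \<and> connected_graph \<Gamma>' \<and> graph_iso \<Gamma> \<Gamma>' f \<longrightarrow>
        linear_on (homog P \<Gamma>' d) (pull P \<Gamma> \<Gamma>' f d) \<and>
        pull P \<Gamma> \<Gamma>' f d ` homog P \<Gamma>' d \<subseteq> homog P \<Gamma> d) \<and>
     (\<forall>\<Gamma> \<Gamma>' f g d. connected_graph \<Gamma> \<and> connected_graph \<Gamma>' \<and> graph_iso \<Gamma> \<Gamma>' f \<and>
        (\<forall>v\<in>verts \<Gamma>. f v = g v) \<longrightarrow>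
        (\<forall>x\<in>homog P \<Gamma>' d. pull P \<Gamma> \<Gamma>' f d x = pull P \<Gamma> \<Gamma>' g d x)) \<and>
     (\<forall>\<Gamma> d. connected_graph \<Gamma> \<longrightarrow> (\<forall>x\<in>homog P \<Gamma> d. pull P \<Gamma> \<Gamma> id d x = x)) \<and>
     (\<forall>\<Gamma> \<Gamma>' \<Gamma>'' f g d. connected_graph \<Gamma> \<and> connected_graph \<Gamma>' \<and> connected_graph \<Gamma>'' \<and>
        graph_iso \<Gamma> \<Gamma>' f \<and> graph_iso \<Gamma>' \<Gamma>'' g \<longrightarrow>
        (\<forall>x\<in>homog P \<Gamma>'' d.
           pull P \<Gamma> \<Gamma>'' (g \<circ> f) d x = pull P \<Gamma> \<Gamma>' f d (pull P \<Gamma>' \<Gamma>'' g d x)))"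

definition contractad :: "('b, 'k::field) contractad_data \<Rightarrow> bool" where
  "contractad P \<longleftrightarrow>
     graphical_collection P \<and>
     \<comment> \<open>bilinearity\<close>
     (\<forall>\<Gamma> G i j. connected_graph \<Gamma> \<and> tube \<Gamma> G \<longrightarrow>
        (\<forall>a\<in>homog P (contract \<Gamma> G) i. \<forall>b\<in>homog P (induced \<Gamma> G) j.
           pcomp P \<Gamma> G i j a b \<in> homog P \<Gamma> (i + j)) \<and>
        (\<forall>a\<in>homog P (contract \<Gamma> G) i. linear_on (homog P (induced \<Gamma> G) j) (pcomp P \<Gamma> G i j a)) \<and>
        (\<forall>b\<in>homog P (induced \<Gamma> G) j.
           linear_on (homog P (contract \<Gamma> G) i) (\<lambda>a. pcomp P \<Gamma> G i j a b))) \<and>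
     \<comment> \<open>equivariance\<close>
     (\<forall>\<Gamma> \<Gamma>' f G i j.
        connected_graph \<Gamma> \<and> connected_graph \<Gamma>' \<and> graph_iso \<Gamma> \<Gamma>' f \<and> tube \<Gamma> G \<longrightarrow>
        (\<forall>a\<in>homog P (contract \<Gamma>' (f ` G)) i. \<forall>b\<in>homog P (induced \<Gamma>' (f ` G)) j.
           pull P \<Gamma> \<Gamma>' f (i + j) (pcomp P \<Gamma>' (f ` G) i j a b) =
           pcomp P \<Gamma> G i j
             (pull P (contract \<Gamma> G) (contract \<Gamma>' (f ` G)) (lift \<Gamma> f) i a)
             (pull P (induced \<Gamma> G) (induced \<Gamma>' (f ` G)) f j b))) \<and>
     \<comment> \<open>sequential composition\<close>
     (\<forall>\<Gamma> K G i j k. connected_graph \<Gamma> \<and> tube \<Gamma> K \<and> tube \<Gamma> G \<and> K \<subseteq> G \<longrightarrow>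
        (\<forall>a\<in>homog P (contract \<Gamma> G) i. \<forall>b\<in>homog P (contract (induced \<Gamma> G) K) j.
         \<forall>c\<in>homog P (induced \<Gamma> K) k.
           pcomp P \<Gamma> K (i + j) k (pcomp P (contract \<Gamma> K) (contract_tube K G) i j a b) c =
           pcomp P \<Gamma> G i (j + k) a (pcomp P (induced \<Gamma> G) K j k b c))) \<and>
     \<comment> \<open>parallel composition\<close>
     (\<forall>\<Gamma> G H i j k. connected_graph \<Gamma> \<and> tube \<Gamma> G \<and> tube \<Gamma> H \<and> G \<inter> H = {} \<longrightarrow>
        (\<forall>a\<in>homog P (contract (contract \<Gamma> G) H) i. \<forall>b\<in>homog P (induced \<Gamma> G) j.
         \<forall>c\<in>homog P (induced \<Gamma> H) k.
           pcomp P \<Gamma> H (i + j) k (pcomp P (contract \<Gamma> H) G i j a b) c =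
           fscale (sgnp (j * k))
             (pcomp P \<Gamma> G (i + k) j (pcomp P (contract \<Gamma> G) H i k a c) b))) \<and>
     \<comment> \<open>units\<close>
     (\<forall>\<Gamma>. connected_graph \<Gamma> \<and> card (verts \<Gamma>) = 1 \<longrightarrow> iden P \<Gamma> \<in> homog P \<Gamma> 0) \<and>
     (\<forall>\<Gamma> \<Gamma>' f. connected_graph \<Gamma> \<and> connected_graph \<Gamma>' \<and> card (verts \<Gamma>) = 1 \<and>
        graph_iso \<Gamma> \<Gamma>' f \<longrightarrow> pull P \<Gamma> \<Gamma>' f 0 (iden P \<Gamma>') = iden P \<Gamma>) \<and>
     (\<forall>\<Gamma> d. connected_graph \<Gamma> \<longrightarrow>
        (\<forall>x\<in>homog P \<Gamma> d. pcomp P \<Gamma> (verts \<Gamma>) 0 d (iden P (contract \<Gamma> (verts \<Gamma>))) x = x)) \<and>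
     (\<forall>\<Gamma> v d. connected_graph \<Gamma> \<and> v \<in> verts \<Gamma> \<longrightarrow>
        (\<forall>x\<in>homog P \<Gamma> d. pcomp P \<Gamma> {v} d 0 x (iden P (induced \<Gamma> {v})) = x))"

definition contractad_morphism ::
  "('b, 'k::field) contractad_data \<Rightarrow> ('c, 'k) contractad_data \<Rightarrow>
     (graph \<Rightarrow> int \<Rightarrow> ('b \<Rightarrow> 'k) \<Rightarrow> 'c \<Rightarrow> 'k) \<Rightarrow> bool" where
  "contractad_morphism P Q \<phi> \<longleftrightarrow>
     (\<forall>\<Gamma> d. connected_graph \<Gamma> \<longrightarrow>
        linear_on (homog P \<Gamma> d) (\<phi> \<Gamma> d) \<and> \<phi> \<Gamma> d ` homog P \<Gamma> d \<subseteq> homog Q \<Gamma> d) \<and>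
     (\<forall>\<Gamma> \<Gamma>' f d. connected_graph \<Gamma> \<and> connected_graph \<Gamma>' \<and> graph_iso \<Gamma> \<Gamma>' f \<longrightarrow>
        (\<forall>x\<in>homog P \<Gamma>' d. \<phi> \<Gamma> d (pull P \<Gamma> \<Gamma>' f d x) = pull Q \<Gamma> \<Gamma>' f d (\<phi> \<Gamma>' d x))) \<and>
     (\<forall>\<Gamma> G i j. connected_graph \<Gamma> \<and> tube \<Gamma> G \<longrightarrow>
        (\<forall>a\<in>homog P (contract \<Gamma> G) i. \<forall>b\<in>homog P (induced \<Gamma> G) j.
           \<phi> \<Gamma> (i + j) (pcomp P \<Gamma> G i j a b) =
           pcomp Q \<Gamma> G i j (\<phi> (contract \<Gamma> G) i a) (\<phi> (induced \<Gamma> G) j b))) \<and>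
     (\<forall>\<Gamma>. connected_graph \<Gamma> \<and> card (verts \<Gamma>) = 1 \<longrightarrow> \<phi> \<Gamma> 0 (iden P \<Gamma>) = iden Q \<Gamma>)"

definition symmetric_element ::
  "('b, 'k::field, 'm) collection_scheme \<Rightarrow> graph \<Rightarrow> int \<Rightarrow> ('b \<Rightarrow> 'k) \<Rightarrow> bool" where
  "symmetric_element P \<Gamma> d x \<longleftrightarrow> (\<forall>f. graph_iso \<Gamma> \<Gamma> f \<longrightarrow> pull P \<Gamma> \<Gamma> f d x = x)"

definition contractad_ideal ::
  "('b, 'k::field) contractad_data \<Rightarrow> (graph \<Rightarrow> int \<Rightarrow> ('b \<Rightarrow> 'k) set) \<Rightarrow> bool" where
  "contractad_ideal P J \<longleftrightarrow>
     (\<forall>\<Gamma> d. connected_graph \<Gamma> \<longrightarrow> fs.subspace (J \<Gamma> d) \<and> J \<Gamma> d \<subseteq> homog P \<Gamma> d) \<and>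
     (\<forall>\<Gamma> \<Gamma>' f d. connected_graph \<Gamma> \<and> connected_graph \<Gamma>' \<and> graph_iso \<Gamma> \<Gamma>' f \<longrightarrow>
        pull P \<Gamma> \<Gamma>' f d ` J \<Gamma>' d \<subseteq> J \<Gamma> d) \<and>
     (\<forall>\<Gamma> G i j a b. connected_graph \<Gamma> \<and> tube \<Gamma> G \<and>
        a \<in> homog P (contract \<Gamma> G) i \<and> b \<in> homog P (induced \<Gamma> G) j \<and>
        (a \<in> J (contract \<Gamma> G) i \<or> b \<in> J (induced \<Gamma> G) j) \<longrightarrow>
        pcomp P \<Gamma> G i j a b \<in> J \<Gamma> (i + j))"

definition generated_ideal ::
  "('b, 'k::field) contractad_data \<Rightarrow> (graph \<Rightarrow> int \<Rightarrow> ('b \<Rightarrow> 'k) set) \<Rightarrow>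
     graph \<Rightarrow> int \<Rightarrow> ('b \<Rightarrow> 'k) set" where
  "generated_ideal P R \<Gamma> d =
     \<Inter>{J \<Gamma> d | J. contractad_ideal P J \<and> (\<forall>\<Gamma> d. connected_graph \<Gamma> \<longrightarrow> R \<Gamma> d \<subseteq> J \<Gamma> d)}"

text \<open>\<open>C\<close> is a subcocontractad of \<open>Q\<close>.\<close>

definition subcocontractad ::
  "('b, 'k::field) cocontractad_data \<Rightarrow> (graph \<Rightarrow> int \<Rightarrow> ('b \<Rightarrow> 'k) set) \<Rightarrow> bool" where
  "subcocontractad Q C \<longleftrightarrow>
     (\<forall>\<Gamma> d. connected_graph \<Gamma> \<longrightarrow> fs.subspace (C \<Gamma> d) \<and> C \<Gamma> d \<subseteq> homog Q \<Gamma> d) \<and>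
     (\<forall>\<Gamma> \<Gamma>' f d. connected_graph \<Gamma> \<and> connected_graph \<Gamma>' \<and> graph_iso \<Gamma> \<Gamma>' f \<longrightarrow>
        pull Q \<Gamma> \<Gamma>' f d ` C \<Gamma>' d \<subseteq> C \<Gamma> d) \<and>
     (\<forall>\<Gamma> G i j. connected_graph \<Gamma> \<and> tube \<Gamma> G \<longrightarrow>
        decomp Q \<Gamma> G i j ` C \<Gamma> (i + j) \<subseteq> tensor (C (contract \<Gamma> G) i) (C (induced \<Gamma> G) j))"


section \<open>Trees, free contractads and cofree cocontractads\<close>

text \<open>
  A rooted tree with leaves labelled by \<open>verts \<Gamma>\<close>, all of whose vertices have at least two
  inputs, is given by its set of vertices, each vertex being named by the union of the labels of
  the leaves above it. This suffices for collections of generators that vanish on the one-vertex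
  graph, since a tree with a vertex with a single input does not contribute for those. Leaf edges
  satisfy the tube condition automatically. The root vertex is \<open>\<Union>(verts \<Gamma>)\<close>; the only tree on a
  one-vertex graph is the one without vertices.
\<close>

definition admissible_tree :: "graph \<Rightarrow> vert set \<Rightarrow> bool" where
  "admissible_tree \<Gamma> T \<longleftrightarrow>
     (\<forall>N\<in>T. N = \<Union>(leaves \<Gamma> N) \<and> 2 \<le> card (leaves \<Gamma> N) \<and> tube \<Gamma> (leaves \<Gamma> N)) \<and>
     (\<forall>N\<in>T. \<forall>M\<in>T. N \<subseteq> M \<or> M \<subseteq> N \<or> N \<inter> M = {}) \<and>
     (2 \<le> card (verts \<Gamma>) \<longrightarrow> \<Union>(verts \<Gamma>) \<in> T)"

text \<open>The incoming edges of \<open>N\<close> come from its children: the maximal vertices or leaves of the tree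
  strictly above \<open>N\<close>.\<close>

definition in_graph :: "graph \<Rightarrow> vert set \<Rightarrow> vert \<Rightarrow> graph" where
  "in_graph \<Gamma> T N =
     (let W = {M \<in> T \<union> verts \<Gamma>. M \<subset> N \<and> \<not> (\<exists>M'\<in>T. M \<subset> M' \<and> M' \<subset> N)}
      in (W, {{A, B} | A B. A \<in> W \<and> B \<in> W \<and> A \<noteq> B \<and> tube \<Gamma> (leaves \<Gamma> A \<union> leaves \<Gamma> B)}))"

text \<open>
  A vector in the unordered tensor product of the spaces \<open>E(In(N))\<close> over the vertices \<open>N\<close> of a
  tree is a function of an ordering of the vertices together with a degree and an index
  \<open>x :: 'b\<close> for each of them; changing the ordering changes the value by the Koszul sign.
  \<open>tree_tensor ns d e\<close> is the product, in the order \<open>ns\<close>, of elements \<open>e N\<close> of degree \<open>d N\<close>.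
\<close>

type_synonym 'b decoration = "(vert \<times> int \<times> 'b) list"

definition nodes :: "'b decoration \<Rightarrow> vert set" where
  "nodes L = fst ` set L"

definition total_degree :: "'b decoration \<Rightarrow> int" where
  "total_degree L = (\<Sum>(N, i, x)\<leftarrow>L. i)"

definition tree_tensor ::
  "vert list \<Rightarrow> (vert \<Rightarrow> int) \<Rightarrow> (vert \<Rightarrow> 'b \<Rightarrow> 'k::field) \<Rightarrow> 'b decoration \<Rightarrow> 'k" where
  "tree_tensor ns d e L =
     (if distinct (map fst L) \<and> nodes L = set ns \<and> (\<forall>(N, i, x)\<in>set L. i = d N)
      then sgnp (koszul_exp d ns (map fst L)) * (\<Prod>(N, i, x)\<leftarrow>L. e N x)
      else 0)"

text \<open>\<open>(a\<^sub>1 \<otimes> \<dots> \<otimes> a\<^sub>m) F\<close> for linear maps \<open>a\<^sub>i\<close> depending on the vertex and its degree.\<close>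

fun map_slots ::
  "(vert \<Rightarrow> int \<Rightarrow> ('b \<Rightarrow> 'k) \<Rightarrow> 'b \<Rightarrow> 'k) \<Rightarrow> ('b decoration \<Rightarrow> 'k) \<Rightarrow> 'b decoration \<Rightarrow> 'k" where
  "map_slots a F [] = F []"
| "map_slots a F ((N, i, x) # L) =
     a N i (\<lambda>y. map_slots a (\<lambda>L'. F ((N, i, y) # L')) L) x"

definition tree_homog ::
  "('b, 'k::field) collection \<Rightarrow> graph \<Rightarrow> int \<Rightarrow> ('b decoration \<Rightarrow> 'k) set" where
  "tree_homog E \<Gamma> n =
     fs.span {tree_tensor ns d e | ns d e.
       distinct ns \<and> admissible_tree \<Gamma> (set ns) \<and>
       (\<forall>N\<in>set ns. e N \<in> homog E (in_graph \<Gamma> (set ns) N) (d N)) \<and> (\<Sum>N\<in>set ns. d N) = n}"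

definition tree_pull ::
  "('b, 'k::field) collection \<Rightarrow> graph \<Rightarrow> graph \<Rightarrow> (vert \<Rightarrow> vert) \<Rightarrow> int \<Rightarrow>
     ('b decoration \<Rightarrow> 'k) \<Rightarrow> 'b decoration \<Rightarrow> 'k" where
  "tree_pull E \<Gamma> \<Gamma>' f n F L =
     (if admissible_tree \<Gamma> (nodes L)
      then map_slots
             (\<lambda>N i. pull E (in_graph \<Gamma> (nodes L) N)
                      (in_graph \<Gamma>' (lift \<Gamma> f ` nodes L) (lift \<Gamma> f N)) (lift \<Gamma> f) i)
             (\<lambda>L'. F (map (\<lambda>(N, i, x). (lift \<Gamma> f N, i, x)) L')) L
      else 0)"

text \<open>Grafting: the vertices of the upper tree are those contained in \<open>\<Union>G\<close>; grafting
  is the union of the sets of vertices, and decorations are concatenated.\<close>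

definition free_contractad ::
  "('b, 'k::field) collection \<Rightarrow> ('b decoration, 'k) contractad_data" where
  "free_contractad E =
     \<lparr>homog = tree_homog E, pull = tree_pull E,
      pcomp = (\<lambda>\<Gamma> G i j F F' L.
        sgnp (unshuffle_exp (\<lambda>(N, d, x). N \<subseteq> \<Union>G) (\<lambda>(N, d, x). d) L) *
        F (filter (\<lambda>(N, d, x). \<not> N \<subseteq> \<Union>G) L) * F' (filter (\<lambda>(N, d, x). N \<subseteq> \<Union>G) L)),
      iden = (\<lambda>\<Gamma> L. if L = [] then 1 else 0)\<rparr>"

definition cofree_cocontractad ::
  "('b, 'k::field) collection \<Rightarrow> ('b decoration, 'k) cocontractad_data" where
  "cofree_cocontractad E =
     \<lparr>homog = tree_homog E, pull = tree_pull E,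
      decomp = (\<lambda>\<Gamma> G i j F (L, L').
        if admissible_tree (contract \<Gamma> G) (nodes L) \<and> admissible_tree (induced \<Gamma> G) (nodes L') \<and>
           total_degree L = i \<and> total_degree L' = j
        then F (L @ L') else 0),
      counit = (\<lambda>\<Gamma> F. F [])\<rparr>"

text \<open>\<open>\<phi>\<close> exhibits \<open>P\<close> as the quotient of the free contractad on \<open>E\<close> by the ideal
  generated by \<open>R\<close>.\<close>

definition is_presentation ::
  "('b, 'k::field) collection \<Rightarrow> (graph \<Rightarrow> int \<Rightarrow> ('b decoration \<Rightarrow> 'k) set) \<Rightarrow>
     ('c, 'k) contractad_data \<Rightarrow>
     (graph \<Rightarrow> int \<Rightarrow> ('b decoration \<Rightarrow> 'k) \<Rightarrow> 'c \<Rightarrow> 'k) \<Rightarrow> bool" where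
  "is_presentation E R P \<phi> \<longleftrightarrow>
     contractad_morphism (free_contractad E) P \<phi> \<and>
     (\<forall>\<Gamma> d. connected_graph \<Gamma> \<longrightarrow>
        \<phi> \<Gamma> d ` homog (free_contractad E) \<Gamma> d = homog P \<Gamma> d \<and>
        {x \<in> homog (free_contractad E) \<Gamma> d. \<phi> \<Gamma> d x = 0} =
          generated_ideal (free_contractad E) R \<Gamma> d)"


section \<open>Suspension and Koszul duality\<close>

text \<open>\<open>suspension_space n \<Gamma>\<close> is \<open>Hom((k s\<^sup>n)\<^bsup>\<otimes>V\<^esup>, k s\<^sup>n)\<close>, which is concentrated in degree
  \<open>n (1 - |V|)\<close>: a map is given by its values on the products of the generators \<open>s\<^sup>n\<close> in each
  ordering of \<open>V\<close>.\<close>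

definition is_ordering :: "graph \<Rightarrow> vert list \<Rightarrow> bool" where
  "is_ordering \<Gamma> l \<longleftrightarrow> distinct l \<and> set l = verts \<Gamma>"

definition suspension_space :: "int \<Rightarrow> graph \<Rightarrow> (vert list \<Rightarrow> 'k::field) set" where
  "suspension_space n \<Gamma> =
     {s. (\<forall>l. \<not> is_ordering \<Gamma> l \<longrightarrow> s l = 0) \<and>
         (\<forall>xs u v ys. is_ordering \<Gamma> (xs @ u # v # ys) \<longrightarrow>
            s (xs @ v # u # ys) = sgnp n * s (xs @ u # v # ys))}"

definition suspension_degree :: "int \<Rightarrow> graph \<Rightarrow> int" where
  "suspension_degree n \<Gamma> = n * (1 - int (card (verts \<Gamma>)))"

text \<open>
  The componentwise tensor product of the contractads \<open>S\<^sup>n\<close> and \<open>P\<close>. The composite of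
  \<open>s \<otimes> p\<close> and \<open>t \<otimes> q\<close> is \<open>(-1)\<^bsup>|p| |t|\<^esup> (s \<circ> t) \<otimes> (p \<circ> q)\<close>, and the value of \<open>s \<circ> t\<close> on an
  ordering is computed by moving the elements of \<open>G\<close> to the front.
\<close>

definition suspend ::
  "int \<Rightarrow> ('b, 'k::field) contractad_data \<Rightarrow> (vert list \<times> 'b, 'k) contractad_data" where
  "suspend n P =
     \<lparr>homog = (\<lambda>\<Gamma> d. tensor (suspension_space n \<Gamma>) (homog P \<Gamma> (d - suspension_degree n \<Gamma>))),
      pull = (\<lambda>\<Gamma> \<Gamma>' f d F (l, x).
        if is_ordering \<Gamma> l
        then pull P \<Gamma> \<Gamma>' f (d - suspension_degree n \<Gamma>) (\<lambda>y. F (map f l, y)) x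
        else 0),
      pcomp = (\<lambda>\<Gamma> G i j F F' (l, x).
        let p = i - suspension_degree n (contract \<Gamma> G);
            t = suspension_degree n (induced \<Gamma> G)
        in sgnp (p * t) * sgnp (unshuffle_exp (\<lambda>v. v \<notin> G) (\<lambda>_. n) l) *
           pcomp P \<Gamma> G p (j - t)
             (\<lambda>y. F (\<Union>G # filter (\<lambda>v. v \<notin> G) l, y))
             (\<lambda>z. F' (filter (\<lambda>v. v \<in> G) l, z)) x),
      iden = (\<lambda>\<Gamma> (l, x). if is_ordering \<Gamma> l then iden P \<Gamma> x else 0)\<rparr>"

text \<open>
  The componentwise linear dual, with \<open>(V\<^sup>*)\<^sub>d = Hom(V\<^bsub>-d\<^esub>, k)\<close>; a functional is extended by zero
  outside \<open>V\<^bsub>-d\<^esub>\<close>. The composition is the transpose of the decomposition, where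
  \<open>(\<phi> \<otimes> \<psi>)(x \<otimes> y) = (-1)\<^bsup>|\<psi>| |x|\<^esup> \<phi>(x) \<psi>(y)\<close>.
\<close>

definition dual_contractad ::
  "('b, 'k::field) cocontractad_data \<Rightarrow> ('b \<Rightarrow> 'k, 'k) contractad_data" where
  "dual_contractad Q =
     \<lparr>homog = (\<lambda>\<Gamma> d. {\<phi>.
        (\<forall>x\<in>homog Q \<Gamma> (-d). \<forall>y\<in>homog Q \<Gamma> (-d). \<phi> (x + y) = \<phi> x + \<phi> y) \<and>
        (\<forall>c. \<forall>x\<in>homog Q \<Gamma> (-d). \<phi> (fscale c x) = c * \<phi> x) \<and>
        (\<forall>x. x \<notin> homog Q \<Gamma> (-d) \<longrightarrow> \<phi> x = 0)}),
      pull = (\<lambda>\<Gamma> \<Gamma>' f d \<phi> x.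
        if x \<in> homog Q \<Gamma> (-d) then \<phi> (pull Q \<Gamma>' \<Gamma> (inv_into (verts \<Gamma>) f) (-d) x) else 0),
      pcomp = (\<lambda>\<Gamma> G i j \<phi> \<psi> x.
        if x \<in> homog Q \<Gamma> (-(i + j))
        then sgnp (i * j) * \<psi> (\<lambda>z. \<phi> (\<lambda>y. decomp Q \<Gamma> G (-i) (-j) x (y, z)))
        else 0),
      iden = (\<lambda>\<Gamma> x. if x \<in> homog Q \<Gamma> 0 then counit Q \<Gamma> x else 0)\<rparr>"

text \<open>The collection \<open>s E\<close>.\<close>

definition shift :: "('b, 'k) collection \<Rightarrow> ('b, 'k) collection" where
  "shift E =
     \<lparr>homog = (\<lambda>\<Gamma> d. homog E \<Gamma> (d - 1)), pull = (\<lambda>\<Gamma> \<Gamma>' f d. pull E \<Gamma> \<Gamma>' f (d - 1))\<rparr>"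

text \<open>
  The map \<open>s\<^sup>2 = s \<otimes> s\<close> from trees with two vertices decorated by \<open>E\<close> to those decorated by
  \<open>s E\<close>: for \<open>a\<close> at the root and \<open>b\<close> at the upper vertex, \<open>a \<otimes> b\<close> is sent to
  \<open>(-1)\<^bsup>|a|\<^esup> s a \<otimes> s b\<close>. If the ordering has the upper vertex first, the Koszul signs of exchanging
  the factors before and after applying \<open>s\<^sup>2\<close> combine to the sign in the second case.
\<close>

definition shift_squared :: "('b decoration \<Rightarrow> 'k::field) \<Rightarrow> 'b decoration \<Rightarrow> 'k" where
  "shift_squared F L =
     (case L of
        [(N, i, x), (M, j, y)] \<Rightarrow>
          (if M \<subseteq> N then sgnp (i - 1) else sgnp i) * F [(N, i - 1, x), (M, j - 1, y)]
      | _ \<Rightarrow> 0)"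

definition weight_two_part :: "('b decoration \<Rightarrow> 'k::field) \<Rightarrow> 'b decoration \<Rightarrow> 'k" where
  "weight_two_part F L = (if length L = 2 then F L else 0)"

text \<open>The quadratic cocontractad with cogenerators \<open>E\<close> and corelations \<open>R\<close>: the largest
  subcocontractad \<open>C\<close> of the cofree cocontractad on \<open>E\<close> such that \<open>C\<close> maps to zero in the quotient
  of the span of the trees with two vertices by (the span of) \<open>R\<close>.\<close>

definition quadratic_cocontractad ::
  "('b, 'k::field) collection \<Rightarrow> (graph \<Rightarrow> int \<Rightarrow> ('b decoration \<Rightarrow> 'k) set) \<Rightarrow>
     ('b decoration, 'k) cocontractad_data" where
  "quadratic_cocontractad E R =
     (cofree_cocontractad E)
       \<lparr>homog := (\<lambda>\<Gamma> d. fs.span (\<Union>{C \<Gamma> d | C.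
          subcocontractad (cofree_cocontractad E) C \<and>
          (\<forall>\<Gamma> d. connected_graph \<Gamma> \<longrightarrow>
             (\<forall>F\<in>C \<Gamma> d. weight_two_part F \<in> fs.span (R \<Gamma> d)))}))\<rparr>"

text \<open>The Koszul duals of the quadratic contractad with generators \<open>E\<close> and relations \<open>R\<close>.\<close>

definition koszul_dual_cocontractad ::
  "('b, 'k::field) collection \<Rightarrow> (graph \<Rightarrow> int \<Rightarrow> ('b decoration \<Rightarrow> 'k) set) \<Rightarrow>
     ('b decoration, 'k) cocontractad_data" where
  "koszul_dual_cocontractad E R =
     quadratic_cocontractad (shift E) (\<lambda>\<Gamma> d. shift_squared ` R \<Gamma> (d - 2))"

definition koszul_dual ::
  "('b, 'k::field) collection \<Rightarrow> (graph \<Rightarrow> int \<Rightarrow> ('b decoration \<Rightarrow> 'k) set) \<Rightarrow>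
     (vert list \<times> ('b decoration \<Rightarrow> 'k), 'k) contractad_data" where
  "koszul_dual E R = suspend (-1) (dual_contractad (koszul_dual_cocontractad E R))"


section \<open>Gravity and hypercommutative contractads\<close>

text \<open>The collection spanned by one symmetric generator of degree \<open>deg \<Gamma>\<close> for each connected
  graph \<open>\<Gamma>\<close> with at least two vertices.\<close>

definition symmetric_generators :: "(graph \<Rightarrow> int) \<Rightarrow> (unit, 'k::field) collection" where
  "symmetric_generators deg =
     \<lparr>homog = (\<lambda>\<Gamma> d. if 2 \<le> card (verts \<Gamma>) \<and> d = deg \<Gamma> then UNIV else {0}),
      pull = (\<lambda>\<Gamma> \<Gamma>' f d x. x)\<rparr>"

text \<open>The generator of \<open>\<Gamma>\<close> in the free contractad (a tree with one vertex), and the composite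
  of two generators.\<close>

definition generator :: "(graph \<Rightarrow> int) \<Rightarrow> graph \<Rightarrow> unit decoration \<Rightarrow> 'k::field" where
  "generator deg \<Gamma> = tree_tensor [\<Union>(verts \<Gamma>)] (\<lambda>_. deg \<Gamma>) (\<lambda>_ _. 1)"

definition generator_comp ::
  "(graph \<Rightarrow> int) \<Rightarrow> graph \<Rightarrow> vert set \<Rightarrow> unit decoration \<Rightarrow> 'k::field" where
  "generator_comp deg \<Gamma> G =
     pcomp (free_contractad (symmetric_generators deg)) \<Gamma> G
       (deg (contract \<Gamma> G)) (deg (induced \<Gamma> G))
       (generator deg (contract \<Gamma> G)) (generator deg (induced \<Gamma> G))"

definition grav_degree :: "graph \<Rightarrow> int" where
  "grav_degree \<Gamma> = 1"

text \<open>An edge of a graph with at least three vertices is a proper tube; on two vertices the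
  first relation would involve a generator on the one-vertex graph and is void.\<close>

definition grav_relations :: "graph \<Rightarrow> int \<Rightarrow> (unit decoration \<Rightarrow> 'k::field) set" where
  "grav_relations \<Gamma> d =
     (if d = 2 \<and> 3 \<le> card (verts \<Gamma>)
      then insert (\<Sum>e\<in>edges \<Gamma>. generator_comp grav_degree \<Gamma> e)
             {(\<Sum>e\<in>edges (induced \<Gamma> G). generator_comp grav_degree \<Gamma> e) -
                generator_comp grav_degree \<Gamma> G | G. proper_tube \<Gamma> G \<and> 3 \<le> card G}
      else {})"

definition gcHyper ::
  "(vert list \<times> vert list \<times> (unit decoration \<Rightarrow> 'k), 'k::field) contractad_data" where
  "gcHyper = suspend (-1) (koszul_dual (symmetric_generators grav_degree) grav_relations)"

definition hyper_degree :: "graph \<Rightarrow> int" where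
  "hyper_degree \<Gamma> = 2 * (int (card (verts \<Gamma>)) - 2)"

text \<open>All composites in these relations have degree \<open>2 (|V| - 3)\<close>.\<close>

definition hyper_relations :: "graph \<Rightarrow> int \<Rightarrow> (unit decoration \<Rightarrow> 'k::field) set" where
  "hyper_relations \<Gamma> d =
     {(\<Sum>G | proper_tube \<Gamma> G \<and> e \<subseteq> G. generator_comp hyper_degree \<Gamma> G) -
      (\<Sum>G | proper_tube \<Gamma> G \<and> e' \<subseteq> G. generator_comp hyper_degree \<Gamma> G) | e e'.
        e \<in> edges \<Gamma> \<and> e' \<in> edges \<Gamma> \<and> d = 2 * (int (card (verts \<Gamma>)) - 3)}"

end

theory Submission
  imports Defs "HOL-Library.Multiset"
begin

text \<open>
  The cogenerators \<open>s E\<close> of the Koszul dual cocontractad have degree 2, so no signs occur and the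
  cofree cocontractad is spanned by the admissible trees. Pairing trees with trees makes it dual
  to the free contractad on generators of even degree. A combination \<open>\<Sum> c(G) [G]\<close> of trees with two
  vertices lies in the span of the gravity relations iff the sum of \<open>c(G)\<close> over the proper tubes
  containing an edge \<open>e\<close> does not depend on \<open>e\<close>, that is, iff it annihilates the hypercommutative
  relations. Hence the Koszul dual cocontractad is the annihilator of the ideal \<open>J\<close> generated by
  these relations, and, everything being finite-dimensional, its dual is the quotient of the free
  contractad by \<open>J\<close>. The signs of reorderings in the two desuspensions cancel, so that up to the
  sign \<open>kappa\<close> they only shift degrees.
\<close>

text \<open>Degrees are complementary. The numbers of inputs of the vertices of a tree
  \<open>T\<close> on \<Gamma> sum to \<open>card T + card (verts \<Gamma>) - 1\<close>, so
  \<open>T\<close> has degree \<open>2 * rank \<Gamma> - 2 * card T\<close> with hypercommutative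
  decorations and \<open>2 * card T\<close> with shifted ones. Hence \<open>pairing\<close> matches
  degree \<open>d\<close> with \<open>2 * rank \<Gamma> - d\<close>, and
  \<open>2 * rank \<Gamma>\<close> is the shift of the two desuspensions. That the Koszul dual
  cocontractad is the whole annihilator of \<open>J\<close> needs two inclusions. The annihilator is
  a subcocontractad because composites of \<open>J\<close> with a basis tree stay in
  \<open>J\<close>, so every slice of a decomposition is annihilated; a tensor with finitely many
  non-zero rows whose slices lie in two subspaces lies in their tensor product. Conversely, the
  annihilator of any subcocontractad with the right two-vertex part is an ideal that contains the
  relations, hence contains \<open>J\<close>. The contractad axioms of \<open>gcHyper\<close> are
  not checked through suspensions and dual spaces: they hold in the free contractad and pass along
  the surjective morphism \<open>hyper_map\<close>.\<close>

section \<open>Connectedness by cuts\<close>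

text \<open>Connectedness of \<open>A\<close> inside \<Gamma>, stated by cuts instead of paths: a
  cut can be pushed through unions, quotients and isomorphisms without choosing any path.\<close>

definition joined :: "graph \<Rightarrow> vert set \<Rightarrow> bool" where
  "joined \<Gamma> A \<longleftrightarrow> A \<noteq> {} \<and>
     (\<forall>B. B \<subseteq> A \<and> B \<noteq> {} \<and> B \<noteq> A \<longrightarrow> (\<exists>u\<in>B. \<exists>v\<in>A - B. {u, v} \<in> edges \<Gamma>))"

lemma rtrancl_cut:
  assumes "(v, w) \<in> R\<^sup>*" "v \<in> B" "w \<notin> B"
  shows "\<exists>x y. (x, y) \<in> R \<and> x \<in> B \<and> y \<notin> B"
  using assms by (induction rule: rtrancl_induct) auto

text \<open>A path leaving a set crosses its boundary; conversely the vertices reachable from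
  \<open>v\<close> form a set with no edge out of it, so they are all the vertices.\<close>

lemma connected_graph_iff: "connected_graph \<Gamma> \<longleftrightarrow> simple_graph \<Gamma> \<and> joined \<Gamma> (verts \<Gamma>)"
proof (cases "simple_graph \<Gamma>")
  case True
  let ?R = "{(x, y). {x, y} \<in> edges \<Gamma>}"
  have E: "x \<in> verts \<Gamma> \<and> y \<in> verts \<Gamma>" if "{x, y} \<in> edges \<Gamma>" for x y
    using True that unfolding simple_graph_def by auto
  have "joined \<Gamma> (verts \<Gamma>)" if c: "connected_graph \<Gamma>"
    unfolding joined_def
  proof (intro conjI allI impI)
    show "verts \<Gamma> \<noteq> {}" using True unfolding simple_graph_def by auto
    fix B assume B: "B \<subseteq> verts \<Gamma> \<and> B \<noteq> {} \<and> B \<noteq> verts \<Gamma>"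
    then obtain v w where "v \<in> B" "w \<in> verts \<Gamma>" "w \<notin> B" by auto
    moreover have "(v, w) \<in> ?R\<^sup>*" using c B calculation unfolding connected_graph_def by auto
    ultimately show "\<exists>u\<in>B. \<exists>v\<in>verts \<Gamma> - B. {u, v} \<in> edges \<Gamma>"
      using rtrancl_cut[of v w ?R B] E by blast
  qed
  moreover have "(v, w) \<in> ?R\<^sup>*" if j: "joined \<Gamma> (verts \<Gamma>)" and v: "v \<in> verts \<Gamma>" and w: "w \<in> verts \<Gamma>" for v w
  proof (rule ccontr)
    assume n: "(v, w) \<notin> ?R\<^sup>*"
    let ?B = "{u \<in> verts \<Gamma>. (v, u) \<in> ?R\<^sup>*}"
    have "?B \<subseteq> verts \<Gamma>" "v \<in> ?B" "w \<notin> ?B" using v n by auto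
    then obtain x y where "x \<in> ?B" "y \<in> verts \<Gamma> - ?B" "{x, y} \<in> edges \<Gamma>"
      using j w unfolding joined_def by (metis (no_types, lifting) empty_iff)
    then show False by (auto intro: rtrancl_into_rtrancl)
  qed
  ultimately show ?thesis using True unfolding connected_graph_def by auto
qed (simp add: connected_graph_def)

context
  fixes \<Gamma> :: graph
  assumes simple: "simple_graph \<Gamma>"
begin

lemma finite_verts: "finite (verts \<Gamma>)"
  and vert_nonempty: "v \<in> verts \<Gamma> \<Longrightarrow> v \<noteq> {}"
  and vert_finite: "v \<in> verts \<Gamma> \<Longrightarrow> finite v"
  and vert_disjoint: "v \<in> verts \<Gamma> \<Longrightarrow> w \<in> verts \<Gamma> \<Longrightarrow> p \<in> v \<Longrightarrow> p \<in> w \<Longrightarrow> v = w"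
  and edge_verts: "{u, v} \<in> edges \<Gamma> \<Longrightarrow> u \<in> verts \<Gamma> \<and> v \<in> verts \<Gamma> \<and> u \<noteq> v"
  and edge_subset: "e \<in> edges \<Gamma> \<Longrightarrow> e \<subseteq> verts \<Gamma>"
  and edge_card: "e \<in> edges \<Gamma> \<Longrightarrow> card e = 2"
  using simple unfolding simple_graph_def by (blast, blast, blast, blast, force, blast, blast)

lemma tube_iff: "tube \<Gamma> A \<longleftrightarrow> A \<subseteq> verts \<Gamma> \<and> joined \<Gamma> A"
proof -
  have "simple_graph (induced \<Gamma> A)" if "A \<subseteq> verts \<Gamma>" "A \<noteq> {}"
    using simple that unfolding simple_graph_def induced_def
    by (auto simp: finite_subset subset_iff)
  moreover have "joined (induced \<Gamma> A) A \<longleftrightarrow> joined \<Gamma> A"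
    unfolding joined_def induced_def
    by (intro arg_cong2[where f="(\<and>)"] refl all_cong bex_cong) auto
  ultimately show ?thesis
    unfolding tube_def connected_graph_iff by (auto simp: induced_def joined_def)
qed

lemma simple_induced: "A \<subseteq> verts \<Gamma> \<Longrightarrow> A \<noteq> {} \<Longrightarrow> simple_graph (induced \<Gamma> A)"
  using simple unfolding simple_graph_def induced_def by (auto simp: finite_subset subset_iff)

text \<open>Distinct vertices are disjoint and non-empty, so a vertex contained in the union of
  \<open>A\<close> shares a point with a member of \<open>A\<close> and equals it. This is why a set
  of vertices can be recovered from its name.\<close>

lemma leaves_Union: "A \<subseteq> verts \<Gamma> \<Longrightarrow> leaves \<Gamma> (\<Union>A) = A"
  unfolding leaves_def using vert_nonempty vert_disjoint by fastforce

lemma vert_sub_Union: "v \<in> verts \<Gamma> \<Longrightarrow> A \<subseteq> verts \<Gamma> \<Longrightarrow> v \<subseteq> \<Union>A \<longleftrightarrow> v \<in> A"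
  using leaves_Union[of A] unfolding leaves_def by auto

lemma Union_sub_iff: "A \<subseteq> verts \<Gamma> \<Longrightarrow> B \<subseteq> verts \<Gamma> \<Longrightarrow> \<Union>A \<subseteq> \<Union>B \<longleftrightarrow> A \<subseteq> B"
  using vert_sub_Union[of _ B] by (meson Sup_upper Union_mono order_trans subset_iff)

lemma joined_singleton: "joined \<Gamma> {v}"
  unfolding joined_def by blast

text \<open>Any cut splits \<open>A\<close>, or splits \<open>B\<close>, or separates
  \<open>u\<close> from \<open>v\<close>; in the last case the given edge crosses it.\<close>

lemma joined_Un:
  assumes A: "joined \<Gamma> A" and B: "joined \<Gamma> B" and e: "u \<in> A" "v \<in> B" "{u, v} \<in> edges \<Gamma>"
  shows "joined \<Gamma> (A \<union> B)"
  unfolding joined_def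
proof (intro conjI allI impI)
  show "A \<union> B \<noteq> {}" using e by auto
  fix C assume C: "C \<subseteq> A \<union> B \<and> C \<noteq> {} \<and> C \<noteq> A \<union> B"
  have 1: "\<exists>x\<in>C. \<exists>y\<in>A \<union> B - C. {x, y} \<in> edges \<Gamma>" if "C \<inter> A \<noteq> {}" "\<not> A \<subseteq> C"
  proof -
    have "C \<inter> A \<subseteq> A \<and> C \<inter> A \<noteq> {} \<and> C \<inter> A \<noteq> A" using that by auto
    then obtain x y where "x \<in> C \<inter> A" "y \<in> A - C \<inter> A" "{x, y} \<in> edges \<Gamma>" using A unfolding joined_def by blast
    then show ?thesis by auto
  qed
  have 2: "\<exists>x\<in>C. \<exists>y\<in>A \<union> B - C. {x, y} \<in> edges \<Gamma>" if "C \<inter> B \<noteq> {}" "\<not> B \<subseteq> C"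
  proof -
    have "C \<inter> B \<subseteq> B \<and> C \<inter> B \<noteq> {} \<and> C \<inter> B \<noteq> B" using that by auto
    then obtain x y where "x \<in> C \<inter> B" "y \<in> B - C \<inter> B" "{x, y} \<in> edges \<Gamma>" using B unfolding joined_def by blast
    then show ?thesis by auto
  qed
  have e': "{v, u} \<in> edges \<Gamma>" using e by (simp add: insert_commute)
  show "\<exists>x\<in>C. \<exists>y\<in>A \<union> B - C. {x, y} \<in> edges \<Gamma>"
  proof (cases "u \<in> C"; cases "v \<in> C")
    assume "u \<in> C" "v \<in> C"
    then have "C \<inter> A \<noteq> {}" "C \<inter> B \<noteq> {}" "\<not> A \<subseteq> C \<or> \<not> B \<subseteq> C" using C e by auto
    then show ?thesis using 1 2 by iprover
  next
    assume "u \<in> C" "v \<notin> C" then show ?thesis using e by blast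
  next
    assume "u \<notin> C" "v \<in> C" then show ?thesis using e e' by blast
  next
    assume "u \<notin> C" "v \<notin> C"
    moreover have "C \<inter> A \<noteq> {} \<or> C \<inter> B \<noteq> {}" using C by auto
    moreover have "\<not> A \<subseteq> C" "\<not> B \<subseteq> C" using e calculation by auto
    ultimately show ?thesis using 1 2 by iprover
  qed
qed

end

section \<open>Quotients of a graph along a map on its vertices\<close>

definition image_graph :: "(vert \<Rightarrow> vert) \<Rightarrow> graph \<Rightarrow> graph" where
  "image_graph q \<Gamma> = (q ` verts \<Gamma>, {{q u, q v} |u v. {u, v} \<in> edges \<Gamma> \<and> q u \<noteq> q v})"

lemma image_graph_edge:
  "{x, y} \<in> edges (image_graph q \<Gamma>) \<longleftrightarrow> (\<exists>u v. {u, v} \<in> edges \<Gamma> \<and> q u = x \<and> q v = y \<and> x \<noteq> y)"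
proof
  assume "{x, y} \<in> edges (image_graph q \<Gamma>)"
  then obtain u v where "{u, v} \<in> edges \<Gamma>" "q u \<noteq> q v" "{x, y} = {q u, q v}"
    unfolding image_graph_def by auto
  then show "\<exists>u v. {u, v} \<in> edges \<Gamma> \<and> q u = x \<and> q v = y \<and> x \<noteq> y"
    by (metis doubleton_eq_iff insert_commute)
qed (auto simp: image_graph_def)

lemma image_graph_edgeI: "{u, v} \<in> edges \<Gamma> \<Longrightarrow> q u \<noteq> q v \<Longrightarrow> {q u, q v} \<in> edges (image_graph q \<Gamma>)"
  unfolding image_graph_edge by metis

text \<open>A loop dropped by the first quotient would also be a loop in the second, so quotients
  compose. Equalities of iterated contractions thus reduce to equalities of composed maps on
  vertices.\<close>

lemma image_graph_comp: "image_graph p (image_graph q \<Gamma>) = image_graph (p \<circ> q) \<Gamma>"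
proof (rule prod_eqI)
  show "edges (image_graph p (image_graph q \<Gamma>)) = edges (image_graph (p \<circ> q) \<Gamma>)"
  proof (rule set_eqI, rule iffI)
    fix e assume "e \<in> edges (image_graph p (image_graph q \<Gamma>))"
    then obtain x y where "{x, y} \<in> edges (image_graph q \<Gamma>)" "p x \<noteq> p y" "e = {p x, p y}"
      by (auto simp: image_graph_def[of p])
    then show "e \<in> edges (image_graph (p \<circ> q) \<Gamma>)"
      unfolding image_graph_edge by (auto simp: image_graph_def)
  next
    fix e assume "e \<in> edges (image_graph (p \<circ> q) \<Gamma>)"
    then obtain u v where "{u, v} \<in> edges \<Gamma>" "p (q u) \<noteq> p (q v)" "e = {p (q u), p (q v)}"
      by (auto simp: image_graph_def)
    moreover from this have "{q u, q v} \<in> edges (image_graph q \<Gamma>)"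
      unfolding image_graph_edge by metis
    ultimately show "e \<in> edges (image_graph p (image_graph q \<Gamma>))"
      unfolding image_graph_def[of p] snd_conv by blast
  qed
qed (auto simp: image_graph_def)

lemma image_graph_cong:
  assumes "simple_graph \<Gamma>" "\<And>v. v \<in> verts \<Gamma> \<Longrightarrow> p v = q v"
  shows "image_graph p \<Gamma> = image_graph q \<Gamma>"
proof -
  have "p u = q u \<and> p v = q v" if "{u, v} \<in> edges \<Gamma>" for u v
    using that assms edge_verts by blast
  then have "{{p u, p v} |u v. {u, v} \<in> edges \<Gamma> \<and> p u \<noteq> p v} = {{q u, q v} |u v. {u, v} \<in> edges \<Gamma> \<and> q u \<noteq> q v}"
    by (intro Collect_cong) metis
  then show ?thesis unfolding image_graph_def using assms(2) by simp
qed

lemma image_graph_ident: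
  assumes "simple_graph \<Gamma>" "\<And>v. v \<in> verts \<Gamma> \<Longrightarrow> q v = v"
  shows "image_graph q \<Gamma> = \<Gamma>"
proof -
  have 1: "q u = u \<and> q v = v \<and> u \<noteq> v" if "{u, v} \<in> edges \<Gamma>" for u v
    using that assms edge_verts by blast
  have "{{q u, q v} |u v. {u, v} \<in> edges \<Gamma> \<and> q u \<noteq> q v} = edges \<Gamma>"
  proof (rule set_eqI, rule iffI)
    fix e assume "e \<in> edges \<Gamma>"
    moreover from this obtain u v where "e = {u, v}" using edge_card[OF assms(1)] by (metis card_2_iff)
    ultimately have uv: "{u, v} \<in> edges \<Gamma>" "e = {u, v}" by simp_all
    then have "e = {q u, q v}" "q u \<noteq> q v" using 1[of u v] by simp_all
    with uv show "e \<in> {{q u, q v} |u v. {u, v} \<in> edges \<Gamma> \<and> q u \<noteq> q v}" by blast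
  qed (use 1 in fastforce)
  then show ?thesis unfolding image_graph_def using assms(2) by (simp add: prod_eq_iff)
qed

text \<open>With connected fibres, a cut of the preimage either splits a fibre, which provides a
  crossing edge, or is a union of fibres and descends to a cut of \<open>B\<close>.\<close>

lemma joined_image_graph:
  assumes simple: "simple_graph \<Gamma>" and B: "B \<subseteq> q ` verts \<Gamma>"
    and fib: "\<And>x. x \<in> B \<Longrightarrow> joined \<Gamma> {v \<in> verts \<Gamma>. q v = x}"
  shows "joined (image_graph q \<Gamma>) B \<longleftrightarrow> joined \<Gamma> {v \<in> verts \<Gamma>. q v \<in> B}"
proof
  assume j: "joined \<Gamma> {v \<in> verts \<Gamma>. q v \<in> B}"
  show "joined (image_graph q \<Gamma>) B"
    unfolding joined_def
  proof (intro conjI allI impI)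
    show "B \<noteq> {}" using j unfolding joined_def by auto
    fix C assume C: "C \<subseteq> B \<and> C \<noteq> {} \<and> C \<noteq> B"
    let ?C = "{v \<in> verts \<Gamma>. q v \<in> C}"
    have "?C \<subseteq> {v \<in> verts \<Gamma>. q v \<in> B} \<and> ?C \<noteq> {} \<and> ?C \<noteq> {v \<in> verts \<Gamma>. q v \<in> B}"
    proof (intro conjI)
      show "?C \<noteq> {}" using C B by blast
      obtain x where "x \<in> B" "x \<notin> C" using C by auto
      moreover obtain v where "v \<in> verts \<Gamma>" "q v = x" using B calculation by auto
      ultimately have "v \<in> {v \<in> verts \<Gamma>. q v \<in> B}" "v \<notin> ?C" by auto
      then show "?C \<noteq> {v \<in> verts \<Gamma>. q v \<in> B}" by blast
    qed (use C in auto)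
    then obtain u v where "u \<in> ?C" "v \<in> {v \<in> verts \<Gamma>. q v \<in> B} - ?C" "{u, v} \<in> edges \<Gamma>"
      using j unfolding joined_def by meson
    then have q: "q u \<in> C" "q v \<in> B - C" "{u, v} \<in> edges \<Gamma>" by auto
    then have "q u \<noteq> q v" by auto
    then have "{q u, q v} \<in> edges (image_graph q \<Gamma>)" using q image_graph_edgeI by blast
    with q
    show "\<exists>x\<in>C. \<exists>y\<in>B - C. {x, y} \<in> edges (image_graph q \<Gamma>)" by blast
  qed
next
  assume j: "joined (image_graph q \<Gamma>) B"
  let ?A = "{v \<in> verts \<Gamma>. q v \<in> B}"
  show "joined \<Gamma> ?A"
    unfolding joined_def
  proof (intro conjI allI impI)
    obtain x where "x \<in> B" using j unfolding joined_def by auto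
    moreover from this obtain v where "v \<in> verts \<Gamma>" "q v = x" using B by auto
    ultimately have "v \<in> ?A" by simp
    then show "?A \<noteq> {}" by blast
    fix X assume X: "X \<subseteq> ?A \<and> X \<noteq> {} \<and> X \<noteq> ?A"
    show "\<exists>u\<in>X. \<exists>v\<in>?A - X. {u, v} \<in> edges \<Gamma>"
    proof (cases "\<exists>u\<in>X. \<exists>v\<in>?A - X. q u = q v")
      case True
      then obtain u v where uv: "u \<in> X" "v \<in> ?A - X" "q u = q v" by auto
      let ?F = "{w \<in> verts \<Gamma>. q w = q u}"
      have "joined \<Gamma> ?F" using fib[of "q u"] uv X by auto
      moreover have "X \<inter> ?F \<subseteq> ?F \<and> X \<inter> ?F \<noteq> {} \<and> X \<inter> ?F \<noteq> ?F" using uv X by auto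
      ultimately obtain a b where "a \<in> X \<inter> ?F" "b \<in> ?F - X \<inter> ?F" "{a, b} \<in> edges \<Gamma>"
        unfolding joined_def by meson
      then show ?thesis using uv X by auto
    next
      case False
      have "q ` X \<subseteq> B \<and> q ` X \<noteq> {} \<and> q ` X \<noteq> B"
      proof (intro conjI)
        obtain v where "v \<in> ?A - X" using X by auto
        then have "q v \<in> B" "q v \<notin> q ` X" using False by auto
        then show "q ` X \<noteq> B" by blast
      qed (use X in auto)
      then obtain x y where "x \<in> q ` X" "y \<in> B - q ` X" "{x, y} \<in> edges (image_graph q \<Gamma>)"
        using j unfolding joined_def by meson
      then obtain u v where uv: "{u, v} \<in> edges \<Gamma>" "q u \<in> q ` X" "q v \<in> B - q ` X"
        unfolding image_graph_edge by auto
      have "u \<in> verts \<Gamma>" "v \<in> verts \<Gamma>" using uv edge_verts[OF simple] by blast+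
      then have v: "v \<in> ?A - X" and "q u \<in> B" using uv X by auto
      obtain x where "x \<in> X" "q x = q u" using uv by auto
      \<comment> \<open>In this case \<open>X\<close> is a union of fibres: it meets the fibre of
        \<open>u\<close>, hence contains it.\<close>
      then have "u \<in> X" using False \<open>u \<in> verts \<Gamma>\<close> \<open>q u \<in> B\<close> by blast
      then show ?thesis using uv v by blast
    qed
  qed
qed

section \<open>Contraction as a quotient graph\<close>

lemma joinedD:
  "joined \<Gamma> A \<Longrightarrow> B \<subseteq> A \<Longrightarrow> B \<noteq> {} \<Longrightarrow> B \<noteq> A \<Longrightarrow> \<exists>u\<in>B. \<exists>v\<in>A - B. {u, v} \<in> edges \<Gamma>"
  unfolding joined_def by simp

text \<open>The quotient map whose image graph is the contraction by \<open>G\<close>.\<close>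

definition block_name :: "vert set \<Rightarrow> vert \<Rightarrow> vert" where
  "block_name G v = (if v \<in> G then \<Union>G else v)"

lemma verts_contract: "verts (contract \<Gamma> G) = insert (\<Union>G) (verts \<Gamma> - G)"
  unfolding contract_def contract_partition_def by (simp add: image_image)

lemma verts_induced [simp]: "verts (induced \<Gamma> G) = G"
  by (simp add: induced_def)

context
  fixes \<Gamma> :: graph and G :: "vert set"
  assumes simple: "simple_graph \<Gamma>" and tube: "tube \<Gamma> G"
begin

lemma tube_subset: "G \<subseteq> verts \<Gamma>" and tube_nonempty: "G \<noteq> {}" and tube_finite: "finite G"
  using tube finite_verts[OF simple] finite_subset unfolding tube_def by auto

text \<open>An outside vertex with this name would be contained in the union of \<open>G\<close> and
  hence belong to \<open>G\<close>; so the name of the new vertex is fresh.\<close>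

lemma Union_tube_notin: "\<Union>G \<notin> verts \<Gamma> - G"
proof
  assume "\<Union>G \<in> verts \<Gamma> - G"
  then show False
    using vert_sub_Union[OF simple _ tube_subset, of "\<Union>G"] by simp
qed

lemma block_name_image: "block_name G ` verts \<Gamma> = insert (\<Union>G) (verts \<Gamma> - G)"
  using tube_subset tube_nonempty unfolding block_name_def by auto

lemma block_fibre: "v \<in> verts \<Gamma> \<Longrightarrow> block_name G v = \<Union>G \<longleftrightarrow> v \<in> G"
  using Union_tube_notin unfolding block_name_def by auto

text \<open>Blocks are connected, so by the cut criterion the union of two of them is a tube iff
  some edge joins them. Adjacency of blocks is therefore adjacency in a quotient graph.\<close>

lemma contract_eq_image: "contract \<Gamma> G = image_graph (block_name G) \<Gamma>"
proof (rule prod_eqI)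
  show "verts (contract \<Gamma> G) = verts (image_graph (block_name G) \<Gamma>)"
    using block_name_image by (simp add: verts_contract image_graph_def)
  let ?I = "insert G ((\<lambda>v. {v}) ` (verts \<Gamma> - G))"
  let ?q = "block_name G"
  have tub: "A \<subseteq> verts \<Gamma> \<and> joined \<Gamma> A" if "A \<in> ?I" for A
    using that tube joined_singleton[OF simple] unfolding tube_iff[OF simple] by auto
  have dis: "A \<inter> B = {}" if "A \<in> ?I" "B \<in> ?I" "A \<noteq> B" for A B using that by auto
  have q: "?q v = \<Union>A" if "A \<in> ?I" "v \<in> A" for A v using that unfolding block_name_def by auto
  have ex: "\<exists>A\<in>?I. v \<in> A" if "v \<in> verts \<Gamma>" for v using that by auto
  have adj: "tube \<Gamma> (A \<union> B) \<longleftrightarrow> (\<exists>u\<in>A. \<exists>v\<in>B. {u, v} \<in> edges \<Gamma>)" if "A \<in> ?I" "B \<in> ?I" "A \<noteq> B" for A B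
  proof
    assume "tube \<Gamma> (A \<union> B)"
    moreover have "A \<noteq> {}" "B \<noteq> {}" "A \<inter> B = {}" using tub that dis unfolding joined_def by auto
    moreover from this have "A \<noteq> A \<union> B" by auto
    ultimately have "\<exists>u\<in>A. \<exists>v\<in>A \<union> B - A. {u, v} \<in> edges \<Gamma>"
      unfolding tube_iff[OF simple] by (intro joinedD) auto
    then show "\<exists>u\<in>A. \<exists>v\<in>B. {u, v} \<in> edges \<Gamma>" by blast
  next
    assume "\<exists>u\<in>A. \<exists>v\<in>B. {u, v} \<in> edges \<Gamma>"
    then show "tube \<Gamma> (A \<union> B)"
      unfolding tube_iff[OF simple] using tub that joined_Un[OF simple] by (metis Un_subset_iff)
  qed
  have inj: "A = B" if "A \<in> ?I" "B \<in> ?I" "\<Union>A = \<Union>B" for A B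
    using that tub leaves_Union[OF simple] by metis
  have ec: "edges (contract \<Gamma> G) = {{\<Union>A, \<Union>B} |A B. A \<in> ?I \<and> B \<in> ?I \<and> A \<noteq> B \<and> tube \<Gamma> (A \<union> B)}"
    unfolding contract_def contract_partition_def by simp
  show "edges (contract \<Gamma> G) = edges (image_graph ?q \<Gamma>)"
  proof (rule set_eqI, rule iffI)
    fix e assume "e \<in> edges (contract \<Gamma> G)"
    then obtain A B where AB: "e = {\<Union>A, \<Union>B}" "A \<in> ?I" "B \<in> ?I" "A \<noteq> B" "tube \<Gamma> (A \<union> B)"
      unfolding ec by blast
    then obtain u v where uv: "u \<in> A" "v \<in> B" "{u, v} \<in> edges \<Gamma>" using adj[OF AB(2-4)] by blast
    have "\<Union>A \<noteq> \<Union>B" using inj[OF AB(2,3)] AB(4) by argo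
    moreover have "?q u = \<Union>A" "?q v = \<Union>B" using q[OF AB(2) uv(1)] q[OF AB(3) uv(2)] by simp_all
    ultimately show "e \<in> edges (image_graph ?q \<Gamma>)"
      using AB(1) image_graph_edgeI[OF uv(3), of ?q] by simp
  next
    fix e assume "e \<in> edges (image_graph ?q \<Gamma>)"
    then obtain u v where uv: "{u, v} \<in> edges \<Gamma>" "?q u \<noteq> ?q v" "e = {?q u, ?q v}"
      unfolding image_graph_def snd_conv by blast
    then have "u \<in> verts \<Gamma>" "v \<in> verts \<Gamma>" using edge_verts[OF simple] by blast+
    then obtain A B where AB: "A \<in> ?I" "u \<in> A" "B \<in> ?I" "v \<in> B" using ex[of u] ex[of v] by blast
    have qq: "?q u = \<Union>A" "?q v = \<Union>B" using q[OF AB(1,2)] q[OF AB(3,4)] by simp_all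
    then have n: "A \<noteq> B" using uv by auto
    have "\<exists>u\<in>A. \<exists>v\<in>B. {u, v} \<in> edges \<Gamma>" using AB uv by blast
    then have "tube \<Gamma> (A \<union> B)" using adj[OF AB(1,3) n] by simp
    then show "e \<in> edges (contract \<Gamma> G)"
      using AB n unfolding ec uv(3) qq by blast
  qed
qed

lemma fibre_leaves:
  assumes "B \<subseteq> verts (contract \<Gamma> G)"
  shows "{v \<in> verts \<Gamma>. block_name G v \<in> B} = leaves \<Gamma> (\<Union>B)"
proof -
  have "block_name G v \<in> B \<longleftrightarrow> v \<subseteq> \<Union>B" if v: "v \<in> verts \<Gamma>" for v
  proof
    assume "block_name G v \<in> B" then show "v \<subseteq> \<Union>B"
      unfolding block_name_def by (auto split: if_splits)
  next
    assume s: "v \<subseteq> \<Union>B"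
    obtain p where p: "p \<in> v" using vert_nonempty[OF simple v] by auto
    then obtain b where b: "b \<in> B" "p \<in> b" using s by auto
    then have "b \<in> insert (\<Union>G) (verts \<Gamma> - G)" using assms by (auto simp: verts_contract)
    then consider "b = \<Union>G" | "b \<in> verts \<Gamma> - G" by auto
    then show "block_name G v \<in> B"
    proof cases
      case 1
      then obtain g where "g \<in> G" "p \<in> g" using b by auto
      then have "v = g" using vert_disjoint[OF simple v] p tube_subset by auto
      then show ?thesis using 1 b \<open>g \<in> G\<close> unfolding block_name_def by auto
    next
      case 2
      then have "v = b" using vert_disjoint[OF simple v] p b by auto
      then show ?thesis using 2 b unfolding block_name_def by auto
    qed
  qed
  then show ?thesis unfolding leaves_def by auto
qed

lemma simple_contract: "simple_graph (contract \<Gamma> G)"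
  unfolding simple_graph_def
proof (intro conjI ballI impI)
  let ?C = "contract \<Gamma> G"
  show "finite (verts ?C)" using finite_verts[OF simple] by (simp add: verts_contract)
  show "verts ?C \<noteq> {}" by (simp add: verts_contract)
  fix v assume v: "v \<in> verts ?C"
  have "finite g \<and> g \<noteq> {}" if "g \<in> G" for g
    using that tube_subset vert_finite[OF simple] vert_nonempty[OF simple] by blast
  then have G: "finite (\<Union>G)" "\<Union>G \<noteq> {}"
    using tube_finite tube_nonempty by auto
  then show "finite v" "v \<noteq> {}"
    using v vert_finite[OF simple] vert_nonempty[OF simple] unfolding verts_contract by auto
  fix w assume "w \<in> verts ?C" "v \<noteq> w"
  then show "v \<inter> w = {}"
    using v vert_disjoint[OF simple] tube_subset unfolding verts_contract by blast
next
  fix e assume "e \<in> edges (contract \<Gamma> G)"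
  then obtain u v where "{u, v} \<in> edges \<Gamma>" "block_name G u \<noteq> block_name G v" "e = {block_name G u, block_name G v}"
    unfolding contract_eq_image image_graph_def by auto
  then show "e \<subseteq> verts (contract \<Gamma> G)" "card e = 2"
    using edge_verts[OF simple] unfolding contract_eq_image by (auto simp: image_graph_def)
qed

text \<open>The fibres of \<open>block_name G\<close> are \<open>G\<close> and singletons, all of
  them connected, so the criterion for quotients with connected fibres applies.\<close>

lemma tube_contract_iff:
  "tube (contract \<Gamma> G) B \<longleftrightarrow> B \<subseteq> verts (contract \<Gamma> G) \<and> tube \<Gamma> (leaves \<Gamma> (\<Union>B))"
proof (cases "B \<subseteq> verts (contract \<Gamma> G)")
  case True
  have B: "B \<subseteq> block_name G ` verts \<Gamma>" using True block_name_image by (simp add: verts_contract)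
  have "joined \<Gamma> {v \<in> verts \<Gamma>. block_name G v = x}" if "x \<in> B" for x
  proof (cases "x = \<Union>G")
    case True
    then have "{v \<in> verts \<Gamma>. block_name G v = x} = G" using block_fibre tube_subset by auto
    then show ?thesis using tube tube_iff[OF simple] by auto
  next
    case False
    then have "{v \<in> verts \<Gamma>. block_name G v = x} = {x}"
      using B that block_name_image unfolding block_name_def by auto
    then show ?thesis using joined_singleton[OF simple] by auto
  qed
  then have "joined (contract \<Gamma> G) B \<longleftrightarrow> joined \<Gamma> (leaves \<Gamma> (\<Union>B))"
    using joined_image_graph[OF simple B] fibre_leaves[OF True] contract_eq_image by auto
  then show ?thesis
    using True tube_iff[OF simple] tube_iff[OF simple_contract] by (auto simp: leaves_def)
qed (simp add: tube_def)

lemma Union_verts_contract: "\<Union>(verts (contract \<Gamma> G)) = \<Union>(verts \<Gamma>)"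
  using tube_subset by (auto simp: verts_contract)

lemma card_verts_contract: "card (verts (contract \<Gamma> G)) = card (verts \<Gamma>) - card G + 1"
  using Union_tube_notin finite_verts[OF simple] tube_subset tube_finite
  by (simp add: verts_contract card_Diff_subset)

lemma tube_induced_iff: "tube (induced \<Gamma> G) A \<longleftrightarrow> A \<subseteq> G \<and> tube \<Gamma> A"
proof -
  have "joined (induced \<Gamma> G) A \<longleftrightarrow> joined \<Gamma> A" if "A \<subseteq> G"
    unfolding joined_def induced_def
    by (intro arg_cong2[where f="(\<and>)"] refl all_cong bex_cong) (use that in auto)
  then show ?thesis
    unfolding tube_iff[OF simple] tube_iff[OF simple_induced[OF simple tube_subset tube_nonempty]]
    using tube_subset by auto
qed

lemma connected_induced: "connected_graph (induced \<Gamma> G)"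
  using tube unfolding tube_def by auto

end

lemma tube_verts: "connected_graph \<Gamma> \<Longrightarrow> tube \<Gamma> (verts \<Gamma>)"
  using tube_iff connected_graph_iff by auto

lemma connected_simple: "connected_graph \<Gamma> \<Longrightarrow> simple_graph \<Gamma>"
  unfolding connected_graph_def by auto

lemma connected_contract:
  assumes "connected_graph \<Gamma>" "tube \<Gamma> G"
  shows "connected_graph (contract \<Gamma> G)"
proof -
  note s = connected_simple[OF assms(1)]
  have "tube (contract \<Gamma> G) (verts (contract \<Gamma> G))"
    unfolding tube_contract_iff[OF s assms(2)] Union_verts_contract[OF s assms(2)]
    using leaves_Union[OF s] tube_verts[OF assms(1)] by auto
  then show ?thesis
    using tube_iff[OF simple_contract[OF s assms(2)]] connected_graph_iff simple_contract[OF s assms(2)] by auto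
qed

section \<open>Iterated contractions and isomorphisms\<close>

lemma induced_verts: "simple_graph \<Gamma> \<Longrightarrow> induced \<Gamma> (verts \<Gamma>) = \<Gamma>"
  using edge_subset[of \<Gamma>] unfolding induced_def by (auto simp: prod_eq_iff)

lemma induced_induced: "K \<subseteq> G \<Longrightarrow> induced (induced \<Gamma> G) K = induced \<Gamma> K"
  unfolding induced_def by auto

lemma contract_singleton:
  assumes "simple_graph \<Gamma>" "v \<in> verts \<Gamma>"
  shows "contract \<Gamma> {v} = \<Gamma>"
proof -
  have t: "tube \<Gamma> {v}" using assms joined_singleton[OF assms(1)] tube_iff[OF assms(1)] by auto
  show ?thesis unfolding contract_eq_image[OF assms(1) t]
    by (rule image_graph_ident[OF assms(1)]) (simp add: block_name_def)
qed

lemma tube_singleton: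
  assumes "simple_graph \<Gamma>" "v \<in> verts \<Gamma>"
  shows "tube \<Gamma> {v}"
  using assms joined_singleton[OF assms(1)] tube_iff[OF assms(1)] by auto

lemma Union_contract_tube: "K \<noteq> {} \<Longrightarrow> K \<subseteq> G \<Longrightarrow> \<Union>(contract_tube K G) = \<Union>G"
  unfolding contract_tube_def by (simp add: Union_Un_distrib[symmetric] Un_absorb1)

context
  fixes \<Gamma> :: graph and K G :: "vert set"
  assumes simple: "simple_graph \<Gamma>" and K: "tube \<Gamma> K" and G: "tube \<Gamma> G" and KG: "K \<subseteq> G"
begin

lemma contract_tube_subset: "contract_tube K G \<subseteq> verts (contract \<Gamma> K)"
  using tube_subset[OF simple G] unfolding contract_tube_def verts_contract by auto

lemma tube_contract_tube: "tube (contract \<Gamma> K) (contract_tube K G)"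
  unfolding tube_contract_iff[OF simple K] Union_contract_tube[OF tube_nonempty[OF simple K] KG]
    leaves_Union[OF simple tube_subset[OF simple G]]
  using contract_tube_subset G by simp

lemma block_name_contract_tube:
  "v \<in> verts \<Gamma> \<Longrightarrow> block_name K v \<in> contract_tube K G \<longleftrightarrow> v \<in> G"
  using fibre_leaves[OF simple K contract_tube_subset]
  unfolding Union_contract_tube[OF tube_nonempty[OF simple K] KG]
    leaves_Union[OF simple tube_subset[OF simple G]] by auto

text \<open>Renaming by \<open>K\<close> and then by the image of \<open>G\<close> has the same
  effect on vertices as renaming by \<open>G\<close>, because names are unions of the original
  vertices.\<close>

lemma contract_contract: "contract (contract \<Gamma> K) (contract_tube K G) = contract \<Gamma> G"
proof -
  have "block_name (contract_tube K G) (block_name K v) = block_name G v" if "v \<in> verts \<Gamma>" for v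
    using block_name_contract_tube[OF that] Union_contract_tube[OF tube_nonempty[OF simple K] KG] KG
    by (auto simp: block_name_def)
  then show ?thesis
    unfolding contract_eq_image[OF simple_contract[OF simple K] tube_contract_tube]
    unfolding contract_eq_image[OF simple K] contract_eq_image[OF simple G] image_graph_comp
    by (intro image_graph_cong simple) simp
qed

lemma tube_induced: "tube (induced \<Gamma> G) K"
  using tube_induced_iff[OF simple G] K KG by simp

text \<open>An edge of the contraction lies in the image of \<open>G\<close> iff the edge above it
  lies in \<open>G\<close>, because \<open>block_name K\<close> preserves and reflects
  membership.\<close>

lemma induced_contract: "induced (contract \<Gamma> K) (contract_tube K G) = contract (induced \<Gamma> G) K"
proof (rule prod_eqI)
  have si: "simple_graph (induced \<Gamma> G)"
    using simple_induced[OF simple tube_subset[OF simple G] tube_nonempty[OF simple G]] .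
  show "verts (induced (contract \<Gamma> K) (contract_tube K G)) = verts (contract (induced \<Gamma> G) K)"
    by (simp add: verts_contract contract_tube_def)
  have L: "edges (induced (contract \<Gamma> K) (contract_tube K G)) =
     {e \<in> {{block_name K u, block_name K v} |u v. {u, v} \<in> edges \<Gamma> \<and> block_name K u \<noteq> block_name K v}.
       e \<subseteq> contract_tube K G}"
    unfolding contract_eq_image[OF simple K] induced_def image_graph_def by simp
  have R: "edges (contract (induced \<Gamma> G) K) =
     {{block_name K u, block_name K v} |u v. ({u, v} \<in> edges \<Gamma> \<and> {u, v} \<subseteq> G) \<and> block_name K u \<noteq> block_name K v}"
    unfolding contract_eq_image[OF si tube_induced] unfolding induced_def image_graph_def by simp
  have k: "{block_name K u, block_name K v} \<subseteq> contract_tube K G \<longleftrightarrow> {u, v} \<subseteq> G" if "{u, v} \<in> edges \<Gamma>" for u v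
    using block_name_contract_tube edge_verts[OF simple that] by simp
  show "edges (induced (contract \<Gamma> K) (contract_tube K G)) = edges (contract (induced \<Gamma> G) K)"
    unfolding L R
  proof (rule set_eqI, rule iffI)
    fix e assume "e \<in> {e \<in> {{block_name K u, block_name K v} |u v. {u, v} \<in> edges \<Gamma> \<and> block_name K u \<noteq> block_name K v}. e \<subseteq> contract_tube K G}"
    then obtain u v where uv: "e = {block_name K u, block_name K v}" "{u, v} \<in> edges \<Gamma>" "block_name K u \<noteq> block_name K v" "e \<subseteq> contract_tube K G"
      by blast
    then have "{u, v} \<subseteq> G" using k by simp
    then show "e \<in> {{block_name K u, block_name K v} |u v. ({u, v} \<in> edges \<Gamma> \<and> {u, v} \<subseteq> G) \<and> block_name K u \<noteq> block_name K v}"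
      using uv by blast
  next
    fix e assume "e \<in> {{block_name K u, block_name K v} |u v. ({u, v} \<in> edges \<Gamma> \<and> {u, v} \<subseteq> G) \<and> block_name K u \<noteq> block_name K v}"
    then obtain u v where uv: "e = {block_name K u, block_name K v}" "{u, v} \<in> edges \<Gamma>" "block_name K u \<noteq> block_name K v" "{u, v} \<subseteq> G"
      by blast
    then have "e \<subseteq> contract_tube K G" using k by simp
    then show "e \<in> {e \<in> {{block_name K u, block_name K v} |u v. {u, v} \<in> edges \<Gamma> \<and> block_name K u \<noteq> block_name K v}. e \<subseteq> contract_tube K G}"
      using uv by blast
  qed
qed

end

section \<open>Contraction by two disjoint tubes\<close>

context
  fixes \<Gamma> :: graph and G H :: "vert set"
  assumes simple: "simple_graph \<Gamma>" and G: "tube \<Gamma> G" and H: "tube \<Gamma> H" and GH: "G \<inter> H = {}"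
begin

lemma tube_contract_disjoint: "tube (contract \<Gamma> G) H"
  unfolding tube_contract_iff[OF simple G] leaves_Union[OF simple tube_subset[OF simple H]]
  using H GH tube_subset[OF simple H] by (auto simp: verts_contract)

lemma Union_notin_disjoint: "\<Union>G \<notin> H"
  using Union_tube_notin[OF simple G] GH tube_subset[OF simple H] by auto

lemma induced_contract_disjoint: "induced (contract \<Gamma> G) H = induced \<Gamma> H"
proof (rule prod_eqI)
  have k: "u = block_name G u" if "block_name G u \<in> H" for u
    using that Union_notin_disjoint unfolding block_name_def by (auto split: if_splits)
  have h: "block_name G u = u" if "u \<in> H" for u
    using that GH unfolding block_name_def by auto
  have "e \<in> edges (contract \<Gamma> G) \<longleftrightarrow> e \<in> edges \<Gamma>" if e: "e \<subseteq> H" for e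
  proof
    assume "e \<in> edges (contract \<Gamma> G)"
    then obtain u v where uv: "{u, v} \<in> edges \<Gamma>" "e = {block_name G u, block_name G v}"
      unfolding contract_eq_image[OF simple G] image_graph_def snd_conv by blast
    then have "e = {u, v}" using k[of u] k[of v] e by simp
    then show "e \<in> edges \<Gamma>" using uv by simp
  next
    assume a: "e \<in> edges \<Gamma>"
    then obtain u v where uv: "e = {u, v}" "u \<noteq> v" using edge_card[OF simple] by (meson card_2_iff)
    then show "e \<in> edges (contract \<Gamma> G)"
      using a e h image_graph_edgeI[of u v \<Gamma> "block_name G"] unfolding contract_eq_image[OF simple G] by simp
  qed
  then show "edges (induced (contract \<Gamma> G) H) = edges (induced \<Gamma> H)"
    unfolding induced_def by auto
qed simp

end

text \<open>The two renamings commute, since \<open>\<Union>G\<close> is no member of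
  \<open>H\<close> and \<open>\<Union>H\<close> is no member of \<open>G\<close>.\<close>

lemma contract_commute:
  assumes simple: "simple_graph \<Gamma>" and G: "tube \<Gamma> G" and H: "tube \<Gamma> H" and GH: "G \<inter> H = {}"
  shows "contract (contract \<Gamma> G) H = contract (contract \<Gamma> H) G"
proof -
  have HG: "H \<inter> G = {}" using GH by auto
  have "block_name H (block_name G v) = block_name G (block_name H v)" for v
    using Union_notin_disjoint[OF simple G H GH] Union_notin_disjoint[OF simple H G HG] GH
    by (auto simp: block_name_def)
  then show ?thesis
    unfolding contract_eq_image[OF simple_contract[OF simple G] tube_contract_disjoint[OF simple G H GH]]
      contract_eq_image[OF simple_contract[OF simple H] tube_contract_disjoint[OF simple H G HG]]
    unfolding contract_eq_image[OF simple G] contract_eq_image[OF simple H] image_graph_comp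
    by (intro image_graph_cong simple) simp
qed

section \<open>Graph isomorphisms and the maps they induce on names\<close>

context
  fixes \<Gamma> \<Gamma>' :: graph and f :: "vert \<Rightarrow> vert"
  assumes simple: "simple_graph \<Gamma>" and simple': "simple_graph \<Gamma>'" and iso: "graph_iso \<Gamma> \<Gamma>' f"
begin

lemma iso_inj: "inj_on f (verts \<Gamma>)" and iso_image: "f ` verts \<Gamma> = verts \<Gamma>'"
  and iso_edge: "u \<in> verts \<Gamma> \<Longrightarrow> v \<in> verts \<Gamma> \<Longrightarrow> {f u, f v} \<in> edges \<Gamma>' \<longleftrightarrow> {u, v} \<in> edges \<Gamma>"
  using iso unfolding graph_iso_def bij_betw_def by auto

lemma iso_in: "v \<in> verts \<Gamma> \<Longrightarrow> f v \<in> verts \<Gamma>'"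
  using iso_image by auto

lemma iso_card: "card (verts \<Gamma>') = card (verts \<Gamma>)"
  using iso_image iso_inj card_image by metis

lemma lift_Union: "A \<subseteq> verts \<Gamma> \<Longrightarrow> lift \<Gamma> f (\<Union>A) = \<Union>(f ` A)"
  unfolding lift_def using leaves_Union[OF simple] by simp

lemma lift_vert: "v \<in> verts \<Gamma> \<Longrightarrow> lift \<Gamma> f v = f v"
  using lift_Union[of "{v}"] by simp

lemma leaves_lift: "leaves \<Gamma>' (lift \<Gamma> f N) = f ` leaves \<Gamma> N"
proof -
  have "f ` leaves \<Gamma> N \<subseteq> verts \<Gamma>'" using iso_in unfolding leaves_def by auto
  then show ?thesis unfolding lift_def using leaves_Union[OF simple'] by simp
qed

lemma joined_iso:
  assumes A: "A \<subseteq> verts \<Gamma>" and j: "joined \<Gamma> A"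
  shows "joined \<Gamma>' (f ` A)"
  unfolding joined_def
proof (intro conjI allI impI)
  show "f ` A \<noteq> {}" using j unfolding joined_def by auto
  fix B assume B: "B \<subseteq> f ` A \<and> B \<noteq> {} \<and> B \<noteq> f ` A"
  let ?C = "{v \<in> A. f v \<in> B}"
  have fC: "f ` ?C = B" using B by auto
  have "?C \<noteq> {}" "?C \<noteq> A" using B fC by auto
  then obtain u v where uv: "u \<in> ?C" "v \<in> A - ?C" "{u, v} \<in> edges \<Gamma>"
    using joinedD[OF j, of ?C] by auto
  then have "f u \<in> B" "f v \<in> f ` A - B" "{f u, f v} \<in> edges \<Gamma>'"
    using A iso_edge[of u v] by auto
  then show "\<exists>u\<in>B. \<exists>v\<in>f ` A - B. {u, v} \<in> edges \<Gamma>'" by blast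
qed

lemma tube_iso: "tube \<Gamma> A \<Longrightarrow> tube \<Gamma>' (f ` A)"
  using joined_iso iso_in unfolding tube_iff[OF simple] tube_iff[OF simple'] by blast

lemma iso_induced:
  assumes "G \<subseteq> verts \<Gamma>"
  shows "graph_iso (induced \<Gamma> G) (induced \<Gamma>' (f ` G)) f"
proof -
  have "{f u, f v} \<in> edges (induced \<Gamma>' (f ` G)) \<longleftrightarrow> {u, v} \<in> edges (induced \<Gamma> G)"
    if "u \<in> G" "v \<in> G" for u v
    using that assms iso_edge[of u v] by (auto simp: induced_def)
  then show ?thesis
    unfolding graph_iso_def verts_induced
    using inj_on_subset[OF iso_inj assms] by (auto simp: bij_betw_def)
qed

context
  fixes G assumes G: "tube \<Gamma> G"
begin

text \<open>The commuting square that makes \<open>lift \<Gamma> f\<close> an isomorphism between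
  the contractions by \<open>G\<close> and by its image.\<close>

lemma lift_block_name:
  assumes v: "v \<in> verts \<Gamma>"
  shows "lift \<Gamma> f (block_name G v) = block_name (f ` G) (f v)"
proof -
  have "f v \<in> f ` G \<longleftrightarrow> v \<in> G" using inj_on_image_mem_iff[OF iso_inj v tube_subset[OF simple G]] .
  then show ?thesis
    using lift_Union[OF tube_subset[OF simple G]] lift_vert[OF v] unfolding block_name_def by simp
qed

text \<open>Lifting through the contraction collects, block by block, the same original vertices as
  lifting in \<Gamma>. The hypothesis says that \<open>N\<close> is made of whole blocks, as the
  vertices of trees on the contraction are.\<close>

lemma lift_contract:
  "N = \<Union>(leaves (contract \<Gamma> G) N) \<Longrightarrow> lift (contract \<Gamma> G) (lift \<Gamma> f) N = lift \<Gamma> f N"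
proof -
  assume N: "N = \<Union>(leaves (contract \<Gamma> G) N)"
  let ?B = "leaves (contract \<Gamma> G) N"
  have "\<Union>(lift \<Gamma> f ` ?B) = \<Union>(\<Union>((\<lambda>x. f ` leaves \<Gamma> x) ` ?B))" unfolding lift_def by auto
  also have "\<dots> = \<Union>(f ` (\<Union>x\<in>?B. leaves \<Gamma> x))" by auto
  also have "(\<Union>x\<in>?B. leaves \<Gamma> x) = leaves \<Gamma> N"
  proof (rule set_eqI, rule iffI)
    fix v assume "v \<in> (\<Union>x\<in>?B. leaves \<Gamma> x)" then show "v \<in> leaves \<Gamma> N" unfolding leaves_def by auto
  next
    fix v assume "v \<in> leaves \<Gamma> N"
    then have v: "v \<in> verts \<Gamma>" "v \<subseteq> \<Union>?B" using N unfolding leaves_def by auto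
    then have "block_name G v \<in> ?B"
      using fibre_leaves[OF simple G, of ?B] unfolding leaves_def by auto
    moreover have "v \<subseteq> block_name G v" unfolding block_name_def by auto
    ultimately show "v \<in> (\<Union>x\<in>?B. leaves \<Gamma> x)" using v unfolding leaves_def[of \<Gamma>] by blast
  qed
  finally show ?thesis unfolding lift_def[of "contract \<Gamma> G"] lift_def[of \<Gamma> f N] .
qed

lemma iso_contract: "graph_iso (contract \<Gamma> G) (contract \<Gamma>' (f ` G)) (lift \<Gamma> f)"
proof -
  have im: "lift \<Gamma> f ` block_name G ` verts \<Gamma> = block_name (f ` G) ` verts \<Gamma>'"
    unfolding image_image iso_image[symmetric] using lift_block_name by simp
  have v: "verts (contract \<Gamma> G) = block_name G ` verts \<Gamma>"
    using block_name_image[OF simple G] by (simp add: verts_contract)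
  have v': "verts (contract \<Gamma>' (f ` G)) = block_name (f ` G) ` verts \<Gamma>'"
    using block_name_image[OF simple' tube_iso[OF G]] by (simp add: verts_contract)
  \<comment> \<open>Injectivity is tested on leaves: equal lifts have equal leaves, these are images
    under the injective \<open>f\<close>, and a name is the union of its leaves.\<close>
  have inj: "x = y" if x: "x \<in> verts (contract \<Gamma> G)" and y: "y \<in> verts (contract \<Gamma> G)"
    and eq: "lift \<Gamma> f x = lift \<Gamma> f y" for x y
  proof -
    have s: "leaves \<Gamma> z \<subseteq> verts \<Gamma>" for z unfolding leaves_def by auto
    have "f ` leaves \<Gamma> x = f ` leaves \<Gamma> y" unfolding leaves_lift[symmetric] eq ..
    then have "leaves \<Gamma> x = leaves \<Gamma> y"
      using inj_on_image_eq_iff[OF iso_inj s s] by simp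
    moreover have "\<Union>(leaves \<Gamma> z) = z" if "z \<in> verts (contract \<Gamma> G)" for z
      using that leaves_Union[OF simple tube_subset[OF simple G]] leaves_Union[OF simple, of "{z}"]
      unfolding verts_contract by auto
    ultimately show ?thesis using x y by metis
  qed
  have b: "bij_betw (lift \<Gamma> f) (verts (contract \<Gamma> G)) (verts (contract \<Gamma>' (f ` G)))"
    unfolding bij_betw_def v' using inj_onI[of "verts (contract \<Gamma> G)", OF inj] im v by simp
  have "{x, y} \<in> edges (contract \<Gamma> G) \<longleftrightarrow> {lift \<Gamma> f x, lift \<Gamma> f y} \<in> edges (contract \<Gamma>' (f ` G))"
    if x: "x \<in> verts (contract \<Gamma> G)" and y: "y \<in> verts (contract \<Gamma> G)" for x y
  proof
    assume "{x, y} \<in> edges (contract \<Gamma> G)"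
    then obtain u v where uv: "{u, v} \<in> edges \<Gamma>" "block_name G u = x" "block_name G v = y" "x \<noteq> y"
      unfolding contract_eq_image[OF simple G] image_graph_edge by blast
    then have V: "u \<in> verts \<Gamma>" "v \<in> verts \<Gamma>" using edge_verts[OF simple uv(1)] by auto
    then have "{f u, f v} \<in> edges \<Gamma>'" using iso_edge uv by simp
    moreover have "block_name (f ` G) (f u) = lift \<Gamma> f x" "block_name (f ` G) (f v) = lift \<Gamma> f y"
      using lift_block_name V uv by auto
    moreover have "lift \<Gamma> f x \<noteq> lift \<Gamma> f y" using inj x y uv by blast
    ultimately show "{lift \<Gamma> f x, lift \<Gamma> f y} \<in> edges (contract \<Gamma>' (f ` G))"
      unfolding contract_eq_image[OF simple' tube_iso[OF G]] image_graph_edge by blast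
  next
    assume "{lift \<Gamma> f x, lift \<Gamma> f y} \<in> edges (contract \<Gamma>' (f ` G))"
    then obtain u v where uv: "{u, v} \<in> edges \<Gamma>'" "block_name (f ` G) u = lift \<Gamma> f x"
      "block_name (f ` G) v = lift \<Gamma> f y" "lift \<Gamma> f x \<noteq> lift \<Gamma> f y"
      unfolding contract_eq_image[OF simple' tube_iso[OF G]] image_graph_edge by blast
    have "u \<in> f ` verts \<Gamma>" "v \<in> f ` verts \<Gamma>" using edge_verts[OF simple' uv(1)] iso_image by simp_all
    then obtain a b where ab: "a \<in> verts \<Gamma>" "b \<in> verts \<Gamma>" "u = f a" "v = f b" by blast
    then have "{a, b} \<in> edges \<Gamma>" using uv iso_edge by simp
    moreover have "block_name G a \<in> verts (contract \<Gamma> G)" "block_name G b \<in> verts (contract \<Gamma> G)"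
      using ab v by auto
    moreover have "block_name G a = x" "block_name G b = y"
      using inj lift_block_name ab uv x y calculation by metis+
    moreover have "x \<noteq> y" using uv by auto
    ultimately show "{x, y} \<in> edges (contract \<Gamma> G)"
      unfolding contract_eq_image[OF simple G] image_graph_edge by blast
  qed
  then show ?thesis unfolding graph_iso_def using b by blast
qed

end
end

section \<open>Admissible trees\<close>

lemma admissible_node:
  assumes "admissible_tree \<Gamma> T" "N \<in> T"
  shows "N = \<Union>(leaves \<Gamma> N)" "2 \<le> card (leaves \<Gamma> N)" "tube \<Gamma> (leaves \<Gamma> N)"
  using assms unfolding admissible_tree_def by blast+

lemma admissible_nested:
  assumes "admissible_tree \<Gamma> T" "N \<in> T" "M \<in> T"
  shows "N \<subseteq> M \<or> M \<subseteq> N \<or> N \<inter> M = {}"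
  using assms unfolding admissible_tree_def by blast

lemma admissible_root: "admissible_tree \<Gamma> T \<Longrightarrow> 2 \<le> card (verts \<Gamma>) \<Longrightarrow> \<Union>(verts \<Gamma>) \<in> T"
  unfolding admissible_tree_def by blast

lemma leaves_subset: "leaves \<Gamma> N \<subseteq> verts \<Gamma>"
  unfolding leaves_def by auto

lemma finite_admissible:
  assumes "simple_graph \<Gamma>"
  shows "finite {T. admissible_tree \<Gamma> T}"
proof (rule finite_subset)
  show "{T. admissible_tree \<Gamma> T} \<subseteq> Pow (Union ` Pow (verts \<Gamma>))"
  proof
    fix T assume T: "T \<in> {T. admissible_tree \<Gamma> T}"
    have "N \<in> Union ` Pow (verts \<Gamma>)" if "N \<in> T" for N
      using admissible_node(1)[of \<Gamma> T N] T that leaves_subset[of \<Gamma> N] by auto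
    then show "T \<in> Pow (Union ` Pow (verts \<Gamma>))" by blast
  qed
  show "finite (Pow (Union ` Pow (verts \<Gamma>)))" using finite_verts[OF assms] by simp
qed

lemma admissible_finite:
  assumes "simple_graph \<Gamma>" "admissible_tree \<Gamma> T"
  shows "finite T"
proof (rule finite_subset)
  show "T \<subseteq> Union ` Pow (verts \<Gamma>)"
  proof
    fix N assume "N \<in> T"
    then show "N \<in> Union ` Pow (verts \<Gamma>)"
      using admissible_node(1)[OF assms(2)] leaves_subset[of \<Gamma> N] by auto
  qed
  show "finite (Union ` Pow (verts \<Gamma>))" using finite_verts[OF assms(1)] by simp
qed

lemma verts_in_graph:
  "verts (in_graph \<Gamma> T N) = {M \<in> T \<union> verts \<Gamma>. M \<subset> N \<and> \<not> (\<exists>M'\<in>T. M \<subset> M' \<and> M' \<subset> N)}"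
  unfolding in_graph_def Let_def by simp

lemma admissible_one_vertex:
  assumes "simple_graph \<Gamma>" "card (verts \<Gamma>) = 1"
  shows "admissible_tree \<Gamma> T \<longleftrightarrow> T = {}"
proof
  assume T: "admissible_tree \<Gamma> T"
  have "False" if "N \<in> T" for N
    using admissible_node(2)[OF T that] card_mono[OF finite_verts[OF assms(1)] leaves_subset[of \<Gamma> N]] assms by simp
  then show "T = {}" by blast
qed (use assms in \<open>simp add: admissible_tree_def\<close>)

context
  fixes \<Gamma> :: graph and T :: "vert set"
  assumes simple: "simple_graph \<Gamma>" and adm: "admissible_tree \<Gamma> T"
begin

lemma node_nonempty: "N \<in> T \<Longrightarrow> N \<noteq> {}"
  using admissible_node[OF adm] vert_nonempty[OF simple] leaves_subset[of \<Gamma> N]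
  by (metis card.empty ccpo_Sup_singleton leaves_Union[OF simple] not_numeral_le_zero subset_empty Union_empty empty_subsetI)

lemma vert_node_nested:
  assumes v: "v \<in> verts \<Gamma>" and N: "N \<in> T"
  shows "v \<subseteq> N \<or> v \<inter> N = {}"
proof (rule disjCI)
  assume "v \<inter> N \<noteq> {}"
  then obtain p where p: "p \<in> v" "p \<in> N" by auto
  then obtain w where w: "w \<in> leaves \<Gamma> N" "p \<in> w" using admissible_node(1)[OF adm N] by blast
  then have "v = w" using vert_disjoint[OF simple v] p by (auto simp: leaves_def)
  then show "v \<subseteq> N" using w by (simp add: leaves_def)
qed

text \<open>A node inside a single vertex could have only that vertex as a leaf, against the bound
  of two leaves.\<close>

lemma vert_node_proper:
  assumes v: "v \<in> verts \<Gamma>" and N: "N \<in> T"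
  shows "\<not> N \<subseteq> v"
proof
  assume "N \<subseteq> v"
  have "leaves \<Gamma> N \<subseteq> {v}"
  proof
    fix w assume "w \<in> leaves \<Gamma> N"
    then have "w \<in> verts \<Gamma>" "w \<subseteq> v" using \<open>N \<subseteq> v\<close> unfolding leaves_def by auto
    then have "w = v" using vert_disjoint[OF simple _ v] vert_nonempty[OF simple] by blast
    then show "w \<in> {v}" by simp
  qed
  then have "card (leaves \<Gamma> N) \<le> 1" using card_mono[of "{v}"] by simp
  then show False using admissible_node(2)[OF adm N] by simp
qed

lemma node_root: "N \<in> T \<Longrightarrow> N \<subseteq> \<Union>(verts \<Gamma>)"
  using admissible_node(1)[OF adm, of N] leaves_subset[of \<Gamma> N] by blast

lemma node_card_verts:
  assumes "N \<in> T" shows "2 \<le> card (verts \<Gamma>)"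
  using admissible_node(2)[OF adm assms] card_mono[OF finite_verts[OF simple] leaves_subset[of \<Gamma> N]] by simp

lemma member_nonempty: "M \<in> T \<union> verts \<Gamma> \<Longrightarrow> M \<noteq> {}"
  using node_nonempty vert_nonempty[OF simple] by auto

lemma finite_members: "finite (T \<union> verts \<Gamma>)"
  using admissible_finite[OF simple adm] finite_verts[OF simple] by simp

text \<open>A maximal member of the tree that contains \<open>M\<close> and lies properly inside
  \<open>N\<close> has no node strictly between itself and \<open>N\<close>.\<close>

lemma child_above:
  assumes "M \<in> T \<union> verts \<Gamma>" "M \<subset> N"
  shows "\<exists>M'\<in>verts (in_graph \<Gamma> T N). M \<subseteq> M'"
proof -
  let ?X = "{M' \<in> T \<union> verts \<Gamma>. M \<subseteq> M' \<and> M' \<subset> N}"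
  have fin: "finite ?X" using finite_members by simp
  have ne: "?X \<noteq> {}" using assms by blast
  obtain A where A: "A \<in> ?X" "\<forall>B\<in>?X. A \<subseteq> B \<longrightarrow> A = B"
    by (rule bexE[OF finite_has_maximal[OF fin ne]])
  have "\<not> (\<exists>M'\<in>T. A \<subset> M' \<and> M' \<subset> N)"
  proof
    assume "\<exists>M'\<in>T. A \<subset> M' \<and> M' \<subset> N"
    then obtain B where "B \<in> T" "A \<subset> B" "B \<subset> N" by blast
    moreover from this have "B \<in> ?X" using A by auto
    ultimately show False using A(2) by blast
  qed
  then show ?thesis using A(1) unfolding verts_in_graph by blast
qed

lemma Union_children:
  assumes N: "N \<in> T"
  shows "\<Union>(verts (in_graph \<Gamma> T N)) = N"
proof
  show "\<Union>(verts (in_graph \<Gamma> T N)) \<subseteq> N" unfolding verts_in_graph by blast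
  show "N \<subseteq> \<Union>(verts (in_graph \<Gamma> T N))"
  proof
    fix p assume "p \<in> N"
    then obtain v where v: "v \<in> leaves \<Gamma> N" "p \<in> v" using admissible_node(1)[OF adm N] by blast
    then have "v \<in> T \<union> verts \<Gamma>" "v \<subseteq> N" "v \<in> verts \<Gamma>" unfolding leaves_def by auto
    moreover from this have "v \<noteq> N" using vert_node_proper[OF _ N] by auto
    ultimately obtain M where "M \<in> verts (in_graph \<Gamma> T N)" "v \<subseteq> M" using child_above[of v N] by blast
    then show "p \<in> \<Union>(verts (in_graph \<Gamma> T N))" using v by blast
  qed
qed

lemma children_finite: "finite (verts (in_graph \<Gamma> T N))"
  unfolding verts_in_graph using finite_members by simp

text \<open>The children are properly contained in \<open>N\<close> but cover it, so one child or
  none cannot suffice.\<close>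

lemma card_children:
  assumes N: "N \<in> T"
  shows "2 \<le> card (verts (in_graph \<Gamma> T N))"
proof (rule ccontr)
  let ?W = "verts (in_graph \<Gamma> T N)"
  assume "\<not> 2 \<le> card ?W"
  then have "card ?W = 0 \<or> card ?W = 1" by linarith
  then consider "?W = {}" | M where "?W = {M}" using children_finite by (metis card_0_eq card_1_singletonE)
  then show False
  proof cases
    case 1 then show False using Union_children[OF N] node_nonempty[OF N] by simp
  next
    case 2
    then have "M = N" using Union_children[OF N] by simp
    moreover have "M \<subset> N" using 2 unfolding verts_in_graph by blast
    ultimately show False by simp
  qed
qed

text \<open>The parent is a minimal node properly containing \<open>M\<close>; the root shows that
  such nodes exist.\<close>

lemma parent_exists:
  assumes "M \<in> T \<union> verts \<Gamma>" "M \<noteq> \<Union>(verts \<Gamma>)" "2 \<le> card (verts \<Gamma>)"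
  shows "\<exists>N\<in>T. M \<in> verts (in_graph \<Gamma> T N)"
proof -
  let ?X = "{N \<in> T. M \<subset> N}"
  have fin: "finite ?X" using admissible_finite[OF simple adm] by simp
  have "M \<subseteq> \<Union>(verts \<Gamma>)" using assms(1) node_root by blast
  then have "\<Union>(verts \<Gamma>) \<in> ?X" using assms admissible_root[OF adm] by auto
  then have ne: "?X \<noteq> {}" by blast
  obtain A where A: "A \<in> ?X" "\<forall>B\<in>?X. B \<subseteq> A \<longrightarrow> A = B"
    by (rule bexE[OF finite_has_minimal[OF fin ne]])
  have "\<not> (\<exists>M'\<in>T. M \<subset> M' \<and> M' \<subset> A)"
  proof
    assume "\<exists>M'\<in>T. M \<subset> M' \<and> M' \<subset> A"
    then obtain B where "B \<in> ?X" "B \<subset> A" by blast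
    then show False using A(2) by blast
  qed
  then show ?thesis using A(1) assms(1) unfolding verts_in_graph by blast
qed

text \<open>Two nodes with a common child are comparable, and then the smaller one lies strictly
  between the child and the larger one.\<close>

lemma children_disjoint:
  assumes "N \<in> T" "N' \<in> T" "N \<noteq> N'"
  shows "verts (in_graph \<Gamma> T N) \<inter> verts (in_graph \<Gamma> T N') = {}"
proof (rule ccontr)
  assume "verts (in_graph \<Gamma> T N) \<inter> verts (in_graph \<Gamma> T N') \<noteq> {}"
  then obtain M where M: "M \<in> verts (in_graph \<Gamma> T N)" "M \<in> verts (in_graph \<Gamma> T N')" by blast
  then have MN: "M \<in> T \<union> verts \<Gamma>" "M \<subset> N" "M \<subset> N'" unfolding verts_in_graph by auto
  then have "N \<inter> N' \<noteq> {}" using member_nonempty[of M] by blast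
  then have "N \<subset> N' \<or> N' \<subset> N" using admissible_nested[OF adm assms(1,2)] assms(3) by blast
  then show False using M MN assms(1,2) unfolding verts_in_graph by blast
qed

text \<open>Every node or leaf other than the root is an input of exactly one node. Through this
  count the hypercommutative degree depends on the tree only by its number of nodes.\<close>

lemma sum_card_children:
  "(\<Sum>N\<in>T. int (card (verts (in_graph \<Gamma> T N)))) = int (card T) + int (card (verts \<Gamma>)) - 1"
proof (cases "2 \<le> card (verts \<Gamma>)")
  case True
  have fT: "finite T" using admissible_finite[OF simple adm] .
  have root: "\<Union>(verts \<Gamma>) \<in> T" using admissible_root[OF adm True] .
  have U: "(\<Union>N\<in>T. verts (in_graph \<Gamma> T N)) = T \<union> verts \<Gamma> - {\<Union>(verts \<Gamma>)}"
  proof (rule set_eqI, rule iffI)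
    fix M assume "M \<in> (\<Union>N\<in>T. verts (in_graph \<Gamma> T N))"
    then obtain N where "N \<in> T" "M \<in> T \<union> verts \<Gamma>" "M \<subset> N" unfolding verts_in_graph by auto
    moreover have "N \<subseteq> \<Union>(verts \<Gamma>)" using node_root calculation by simp
    ultimately show "M \<in> T \<union> verts \<Gamma> - {\<Union>(verts \<Gamma>)}" by auto
  next
    fix M assume "M \<in> T \<union> verts \<Gamma> - {\<Union>(verts \<Gamma>)}"
    then show "M \<in> (\<Union>N\<in>T. verts (in_graph \<Gamma> T N))" using parent_exists[of M] True by auto
  qed
  have "T \<inter> verts \<Gamma> = {}" using vert_node_proper by blast
  then have "card (T \<union> verts \<Gamma>) = card T + card (verts \<Gamma>)"
    using fT finite_verts[OF simple] by (intro card_Un_disjoint)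
  moreover have "card (T \<union> verts \<Gamma> - {\<Union>(verts \<Gamma>)}) = card (T \<union> verts \<Gamma>) - 1"
    using root by (intro card_Diff_singleton) auto
  moreover have "card (\<Union>N\<in>T. verts (in_graph \<Gamma> T N)) = (\<Sum>N\<in>T. card (verts (in_graph \<Gamma> T N)))"
    using fT children_disjoint children_finite by (intro card_UN_disjoint) auto
  ultimately have "(\<Sum>N\<in>T. card (verts (in_graph \<Gamma> T N))) = card T + card (verts \<Gamma>) - 1"
    using U by simp
  then show ?thesis using True by (simp flip: of_nat_sum add: of_nat_diff)
next
  case False
  \<comment> \<open>A one-vertex graph carries only the tree without nodes, and both sides are
    zero.\<close>
  then have "T = {}" using node_card_verts by blast
  moreover have "card (verts \<Gamma>) \<noteq> 0" using simple finite_verts[OF simple] unfolding simple_graph_def by auto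
  ultimately show ?thesis using False by simp
qed

end

section \<open>Grafting a tree on a tube onto a tree on the contraction\<close>

context
  fixes \<Gamma> :: graph and G :: "vert set"
  assumes simple: "simple_graph \<Gamma>" and G: "tube \<Gamma> G"
begin

lemma leaves_in_tube:
  assumes "N \<subseteq> \<Union>G" shows "leaves (induced \<Gamma> G) N = leaves \<Gamma> N"
  using vert_sub_Union[OF simple _ tube_subset[OF simple G]] tube_subset[OF simple G] assms
  unfolding leaves_def verts_induced by blast

lemma leaves_leaves_contract:
  assumes "N = \<Union>(leaves (contract \<Gamma> G) N)"
  shows "leaves \<Gamma> N = {v \<in> verts \<Gamma>. block_name G v \<in> leaves (contract \<Gamma> G) N}"
    and "\<Union>(leaves \<Gamma> N) = N"
proof -
  show 1: "leaves \<Gamma> N = {v \<in> verts \<Gamma>. block_name G v \<in> leaves (contract \<Gamma> G) N}"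
    using fibre_leaves[OF simple G leaves_subset[of "contract \<Gamma> G" N]] assms by simp
  show "\<Union>(leaves \<Gamma> N) = N"
  proof
    show "\<Union>(leaves \<Gamma> N) \<subseteq> N" unfolding leaves_def by blast
    show "N \<subseteq> \<Union>(leaves \<Gamma> N)"
    proof
      fix p assume "p \<in> N"
      then obtain b where b: "b \<in> leaves (contract \<Gamma> G) N" "p \<in> b" using assms by blast
      then have "b \<in> insert (\<Union>G) (verts \<Gamma> - G)" "b \<subseteq> N" unfolding leaves_def verts_contract by auto
      then have "\<exists>v\<in>verts \<Gamma>. v \<subseteq> b \<and> p \<in> v" using b tube_subset[OF simple G] by blast
      then show "p \<in> \<Union>(leaves \<Gamma> N)" using \<open>b \<subseteq> N\<close> unfolding leaves_def by blast
    qed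
  qed
qed

context
  fixes T1 T2 :: "vert set"
  assumes T1: "admissible_tree (contract \<Gamma> G) T1" and T2: "admissible_tree (induced \<Gamma> G) T2"
begin

lemma upper_node: "N \<in> T2 \<Longrightarrow> N \<subseteq> \<Union>G"
  using node_root[OF simple_induced[OF simple tube_subset[OF simple G] tube_nonempty[OF simple G]] T2]
  by simp

lemma Union_tube_vert: "\<Union>G \<in> verts (contract \<Gamma> G)"
  by (simp add: verts_contract)

lemma lower_node: "N \<in> T1 \<Longrightarrow> \<not> N \<subseteq> \<Union>G"
  using vert_node_proper[OF simple_contract[OF simple G] T1 Union_tube_vert] by blast

text \<open>\<open>\<Union>G\<close> is a leaf of the lower tree, and a leaf lies in a node or is
  disjoint from it; equality is excluded because no node is contained in a leaf.\<close>

lemma lower_node_nested: "N \<in> T1 \<Longrightarrow> \<Union>G \<subset> N \<or> \<Union>G \<inter> N = {}"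
  using vert_node_nested[OF simple_contract[OF simple G] T1 Union_tube_vert, of N] lower_node[of N] by blast

lemma Union_tube_node: "card G \<noteq> 1 \<Longrightarrow> \<Union>G \<in> T2"
proof -
  assume "card G \<noteq> 1"
  moreover have "card G \<noteq> 0" using tube_nonempty[OF simple G] tube_finite[OF simple G] by simp
  ultimately show ?thesis using admissible_root[OF T2] by simp
qed

text \<open>Both trees can be read off their union by comparing names with \<open>\<Union>G\<close>,
  so grafting is injective.\<close>

lemma lower_part: "{N \<in> T1 \<union> T2. \<not> N \<subseteq> \<Union>G} = T1" and upper_part: "{N \<in> T1 \<union> T2. N \<subseteq> \<Union>G} = T2"
  using upper_node lower_node by blast+

lemma graft_admissible: "admissible_tree \<Gamma> (T1 \<union> T2)"
  unfolding admissible_tree_def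
proof (intro conjI ballI impI)
  note sc = simple_contract[OF simple G]
  fix N assume N: "N \<in> T1 \<union> T2"
  have "N = \<Union>(leaves \<Gamma> N) \<and> 2 \<le> card (leaves \<Gamma> N) \<and> tube \<Gamma> (leaves \<Gamma> N)"
  proof (cases "N \<in> T2")
    case True
    show ?thesis
      using admissible_node[OF T2 True] unfolding leaves_in_tube[OF upper_node[OF True]]
        tube_induced_iff[OF simple G] by auto
  next
    case False
    then have N1: "N \<in> T1" using N by simp
    note n = admissible_node[OF T1 N1]
    note l = leaves_leaves_contract[OF n(1)]
    have "block_name G ` leaves \<Gamma> N = leaves (contract \<Gamma> G) N"
    proof
      show "block_name G ` leaves \<Gamma> N \<subseteq> leaves (contract \<Gamma> G) N" unfolding l(1) by auto
      show "leaves (contract \<Gamma> G) N \<subseteq> block_name G ` leaves \<Gamma> N"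
      proof
        fix b assume b: "b \<in> leaves (contract \<Gamma> G) N"
        then have "b \<in> block_name G ` verts \<Gamma>"
          using block_name_image[OF simple G] leaves_subset[of "contract \<Gamma> G" N] by (auto simp: verts_contract)
        then show "b \<in> block_name G ` leaves \<Gamma> N" using b unfolding l(1) by auto
      qed
    qed
    moreover have "finite (leaves \<Gamma> N)" using finite_subset[OF leaves_subset finite_verts[OF simple]] .
    ultimately have "card (leaves (contract \<Gamma> G) N) \<le> card (leaves \<Gamma> N)" using card_image_le by metis
    then have "2 \<le> card (leaves \<Gamma> N)" using n(2) by linarith
    moreover have "tube \<Gamma> (leaves \<Gamma> N)"
      using n(3) n(1)[symmetric] unfolding tube_contract_iff[OF simple G] by simp
    ultimately show ?thesis using l(2) by simp
  qed
  then show "N = \<Union>(leaves \<Gamma> N)" "2 \<le> card (leaves \<Gamma> N)" "tube \<Gamma> (leaves \<Gamma> N)" by blast+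
  fix M assume M: "M \<in> T1 \<union> T2"
  consider "N \<in> T1" "M \<in> T1" | "N \<in> T2" "M \<in> T2" | "N \<in> T1" "M \<in> T2" | "N \<in> T2" "M \<in> T1" using N M by blast
  then show "N \<subseteq> M \<or> M \<subseteq> N \<or> N \<inter> M = {}"
  proof cases
    case 1 then show ?thesis by (rule admissible_nested[OF T1])
  next
    case 2 then show ?thesis by (rule admissible_nested[OF T2])
  next
    case 3 then show ?thesis using lower_node_nested[OF 3(1)] upper_node[OF 3(2)] by blast
  next
    case 4 then show ?thesis using lower_node_nested[OF 4(2)] upper_node[OF 4(1)] by blast
  qed
next
  assume c: "2 \<le> card (verts \<Gamma>)"
  show "\<Union>(verts \<Gamma>) \<in> T1 \<union> T2"
  proof (cases "2 \<le> card (verts (contract \<Gamma> G))")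
    case True
    then show ?thesis using admissible_root[OF T1 True] Union_verts_contract[OF simple G] by simp
  next
    case False
    \<comment> \<open>If the contraction has a single vertex, the tube is the whole vertex set and
      the root of the upper tree serves as the root.\<close>
    then have "card (verts \<Gamma>) - card G = 0" using card_verts_contract[OF simple G] by simp
    moreover have "card G \<le> card (verts \<Gamma>)" using card_mono[OF finite_verts[OF simple] tube_subset[OF simple G]] .
    ultimately have "card G = card (verts \<Gamma>)" by simp
    then have "G = verts \<Gamma>" using card_subset_eq[OF finite_verts[OF simple] tube_subset[OF simple G]] by simp
    then show ?thesis using Union_tube_node c by auto
  qed
qed

lemma graft_children_upper:
  assumes N: "N \<in> T2"
  shows "verts (in_graph \<Gamma> (T1 \<union> T2) N) = verts (in_graph (induced \<Gamma> G) T2 N)"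
proof -
  have "M \<in> G" if "M \<in> verts \<Gamma>" "M \<subset> N" for M
    using that upper_node[OF N] vert_sub_Union[OF simple that(1) tube_subset[OF simple G]] by blast
  then have 1: "M \<in> T1 \<union> T2 \<union> verts \<Gamma> \<longleftrightarrow> M \<in> T2 \<union> G" if "M \<subset> N" for M
    using that upper_node[OF N] lower_node tube_subset[OF simple G] by blast
  have 2: "M \<in> T1 \<union> T2 \<longleftrightarrow> M \<in> T2" if "M \<subset> N" for M
    using that upper_node[OF N] lower_node by blast
  have 3: "(\<exists>M'\<in>T1 \<union> T2. M \<subset> M' \<and> M' \<subset> N) \<longleftrightarrow> (\<exists>M'\<in>T2. M \<subset> M' \<and> M' \<subset> N)" for M
    using 2 by (metis Un_iff)
  have "(M \<in> T1 \<union> T2 \<union> verts \<Gamma> \<and> M \<subset> N \<and> \<not> (\<exists>M'\<in>T1 \<union> T2. M \<subset> M' \<and> M' \<subset> N)) \<longleftrightarrow>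
      (M \<in> T2 \<union> G \<and> M \<subset> N \<and> \<not> (\<exists>M'\<in>T2. M \<subset> M' \<and> M' \<subset> N))" for M
    unfolding 3 using 1[of M] by argo
  then show ?thesis unfolding verts_in_graph verts_induced by (rule Collect_cong)
qed

text \<open>The leaf \<open>\<Union>G\<close> of the lower tree bears the same name as the root of
  the upper tree, or as the only vertex of \<open>G\<close> when \<open>G\<close> is a singleton.
  Hence grafting leaves the names of the children of lower nodes unchanged.\<close>

lemma graft_children_lower:
  assumes N: "N \<in> T1"
  shows "verts (in_graph \<Gamma> (T1 \<union> T2) N) = verts (in_graph (contract \<Gamma> G) T1 N)"
proof (rule set_eqI, rule iffI)
  note adm = graft_admissible
  have below: "\<Union>G \<subset> N" if "M \<in> T2 \<union> G" "M \<subset> N" for M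
  proof -
    have "M \<noteq> {}" "M \<subseteq> \<Union>G"
      using that(1) member_nonempty[OF simple adm, of M] upper_node tube_subset[OF simple G] by blast+
    then show ?thesis using that(2) lower_node_nested[OF N] by blast
  qed
  {
    fix M assume M: "M \<in> verts (in_graph \<Gamma> (T1 \<union> T2) N)"
    then have M': "M \<subset> N" "\<not> (\<exists>M'\<in>T1 \<union> T2. M \<subset> M' \<and> M' \<subset> N)" "M \<in> T1 \<union> T2 \<union> verts \<Gamma>"
      unfolding verts_in_graph by blast+
    have "M \<in> T1 \<union> insert (\<Union>G) (verts \<Gamma> - G)"
    proof (rule ccontr)
      assume n: "M \<notin> T1 \<union> insert (\<Union>G) (verts \<Gamma> - G)"
      then have m: "M \<in> T2 \<union> G" "M \<noteq> \<Union>G" using M'(3) by blast+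
      have sub: "M \<subset> \<Union>G" using m upper_node by blast
      \<comment> \<open>For a singleton \<open>G\<close> the upper tree is empty and its only leaf
        is \<open>\<Union>G\<close> itself, which was excluded.\<close>
      have "card G \<noteq> 1"
      proof
        assume "card G = 1"
        then obtain g where g: "G = {g}" by (meson card_1_singletonE)
        then have "T2 = {}"
          using T2 admissible_one_vertex[OF simple_induced[OF simple tube_subset[OF simple G] tube_nonempty[OF simple G]]]
          by simp
        then show False using m g by simp
      qed
      then have "\<Union>G \<in> T2" by (rule Union_tube_node)
      then show False using M'(2) sub below[OF m(1) M'(1)] by blast
    qed
    then show "M \<in> verts (in_graph (contract \<Gamma> G) T1 N)"
      using M' unfolding verts_in_graph verts_contract by blast
  next
    fix M assume "M \<in> verts (in_graph (contract \<Gamma> G) T1 N)"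
    then have M: "M \<in> T1 \<union> insert (\<Union>G) (verts \<Gamma> - G)" "M \<subset> N" "\<not> (\<exists>M'\<in>T1. M \<subset> M' \<and> M' \<subset> N)"
      unfolding verts_in_graph verts_contract by blast+
    have "\<Union>G \<in> T2 \<union> verts \<Gamma>"
    proof (cases "card G = 1")
      case True
      then obtain g where "G = {g}" by (meson card_1_singletonE)
      then show ?thesis using tube_subset[OF simple G] by simp
    qed (use Union_tube_node in simp)
    then have 1: "M \<in> T1 \<union> T2 \<union> verts \<Gamma>" using M(1) by blast
    have "\<not> M \<subset> M'" if "M' \<in> T2" for M'
    proof
      assume MM: "M \<subset> M'"
      then have MG: "M \<subset> \<Union>G" using upper_node[OF that] by blast
      then have "M \<in> verts \<Gamma> - G" using M(1) lower_node by blast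
      then show False using MG vert_sub_Union[OF simple _ tube_subset[OF simple G], of M] by auto
    qed
    then show "M \<in> verts (in_graph \<Gamma> (T1 \<union> T2) N)"
      using 1 M(2,3) unfolding verts_in_graph by blast
  }
qed

end
end

section \<open>Transport of admissible trees along isomorphisms\<close>

context
  fixes \<Gamma> \<Gamma>' :: graph and f :: "vert \<Rightarrow> vert"
  assumes simple: "simple_graph \<Gamma>" and simple': "simple_graph \<Gamma>'" and iso: "graph_iso \<Gamma> \<Gamma>' f"
begin

text \<open>For names that are unions of vertices, inclusion of names is inclusion of leaf sets,
  which the injective \<open>f\<close> preserves and reflects.\<close>

lemma lift_mono_iff:
  assumes "M = \<Union>(leaves \<Gamma> M)" "N = \<Union>(leaves \<Gamma> N)"
  shows "lift \<Gamma> f M \<subseteq> lift \<Gamma> f N \<longleftrightarrow> M \<subseteq> N"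
proof -
  have i: "f ` leaves \<Gamma> K \<subseteq> verts \<Gamma>'" for K
    using iso_image[OF simple simple' iso] leaves_subset[of \<Gamma> K] by blast
  have "lift \<Gamma> f M \<subseteq> lift \<Gamma> f N \<longleftrightarrow> f ` leaves \<Gamma> M \<subseteq> f ` leaves \<Gamma> N"
    unfolding lift_def using Union_sub_iff[OF simple' i i] .
  also have "\<dots> \<longleftrightarrow> leaves \<Gamma> M \<subseteq> leaves \<Gamma> N"
  proof -
    have "f a \<in> f ` leaves \<Gamma> N \<longleftrightarrow> a \<in> leaves \<Gamma> N" if "a \<in> leaves \<Gamma> M" for a
      using inj_on_image_mem_iff[OF iso_inj[OF simple simple' iso] _ leaves_subset]
        subsetD[OF leaves_subset that] by simp
    then show ?thesis by (simp add: image_subset_iff subset_eq)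
  qed
  also have "\<dots> \<longleftrightarrow> \<Union>(leaves \<Gamma> M) \<subseteq> \<Union>(leaves \<Gamma> N)"
    using Union_sub_iff[OF simple leaves_subset leaves_subset] by simp
  finally show ?thesis using assms by simp
qed

lemma lift_disjoint:
  assumes "M = \<Union>(leaves \<Gamma> M)" "N = \<Union>(leaves \<Gamma> N)" "M \<inter> N = {}"
  shows "lift \<Gamma> f M \<inter> lift \<Gamma> f N = {}"
proof (rule ccontr)
  assume "lift \<Gamma> f M \<inter> lift \<Gamma> f N \<noteq> {}"
  then obtain p u v where p: "u \<in> leaves \<Gamma> M" "v \<in> leaves \<Gamma> N" "p \<in> f u" "p \<in> f v"
    unfolding lift_def by blast
  then have uv: "u \<in> verts \<Gamma>" "v \<in> verts \<Gamma>" using leaves_subset by blast+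
  then have "f u = f v"
    using vert_disjoint[OF simple' iso_in[OF simple simple' iso uv(1)] iso_in[OF simple simple' iso uv(2)]] p by simp
  then have "u = v" using inj_onD[OF iso_inj[OF simple simple' iso]] uv by simp
  then have "u \<subseteq> M \<inter> N" using p unfolding leaves_def by simp
  then show False using assms(3) vert_nonempty[OF simple uv(1)] by simp
qed

lemma lift_admissible:
  assumes T: "admissible_tree \<Gamma> T"
  shows "admissible_tree \<Gamma>' (lift \<Gamma> f ` T)"
  unfolding admissible_tree_def
proof (intro conjI ballI impI)
  fix N' assume "N' \<in> lift \<Gamma> f ` T"
  then obtain N where N: "N \<in> T" "N' = lift \<Gamma> f N" by blast
  note l = leaves_lift[OF simple simple' iso, of N]
  show "N' = \<Union>(leaves \<Gamma>' N')" unfolding N l unfolding lift_def ..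
  have "card (f ` leaves \<Gamma> N) = card (leaves \<Gamma> N)"
    by (rule card_image[OF inj_on_subset[OF iso_inj[OF simple simple' iso] leaves_subset]])
  then show "2 \<le> card (leaves \<Gamma>' N')" unfolding N l using admissible_node(2)[OF T N(1)] by simp
  show "tube \<Gamma>' (leaves \<Gamma>' N')" unfolding N l
    using tube_iso[OF simple simple' iso admissible_node(3)[OF T N(1)]] .
  fix M' assume "M' \<in> lift \<Gamma> f ` T"
  then obtain M where M: "M \<in> T" "M' = lift \<Gamma> f M" by blast
  note nm = admissible_node(1)[OF T N(1)] admissible_node(1)[OF T M(1)]
  show "N' \<subseteq> M' \<or> M' \<subseteq> N' \<or> N' \<inter> M' = {}"
    unfolding N M lift_mono_iff[OF nm] lift_mono_iff[OF nm(2,1)]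
    using lift_disjoint[OF nm] admissible_nested[OF T N(1) M(1)] by blast
next
  assume "2 \<le> card (verts \<Gamma>')"
  then have "\<Union>(verts \<Gamma>) \<in> T" using admissible_root[OF T] iso_card[OF simple simple' iso] by simp
  moreover have "lift \<Gamma> f (\<Union>(verts \<Gamma>)) = \<Union>(verts \<Gamma>')"
    using lift_Union[OF simple simple' iso] iso_image[OF simple simple' iso] by simp
  ultimately show "\<Union>(verts \<Gamma>') \<in> lift \<Gamma> f ` T" by (metis imageI)
qed

lemma member_spanned:
  assumes "admissible_tree \<Gamma> T" "M \<in> T \<union> verts \<Gamma>"
  shows "M = \<Union>(leaves \<Gamma> M)"
  using assms admissible_node(1)[OF assms(1), of M] leaves_Union[OF simple, of "{M}"] by auto

lemma lift_children:
  assumes T: "admissible_tree \<Gamma> T" and N: "N \<in> T"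
  shows "verts (in_graph \<Gamma>' (lift \<Gamma> f ` T) (lift \<Gamma> f N)) = lift \<Gamma> f ` verts (in_graph \<Gamma> T N)"
proof -
  have m: "lift \<Gamma> f A \<subset> lift \<Gamma> f B \<longleftrightarrow> A \<subset> B" if "A \<in> T \<union> verts \<Gamma>" "B \<in> T \<union> verts \<Gamma>" for A B
    using lift_mono_iff[OF member_spanned[OF T that(1)] member_spanned[OF T that(2)]]
      lift_mono_iff[OF member_spanned[OF T that(2)] member_spanned[OF T that(1)]] by blast
  have c: "{M \<in> T \<union> verts \<Gamma>. lift \<Gamma> f M \<subset> lift \<Gamma> f N \<and> \<not> (\<exists>M'\<in>T. lift \<Gamma> f M \<subset> lift \<Gamma> f M' \<and> lift \<Gamma> f M' \<subset> lift \<Gamma> f N)} =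
      {M \<in> T \<union> verts \<Gamma>. M \<subset> N \<and> \<not> (\<exists>M'\<in>T. M \<subset> M' \<and> M' \<subset> N)}"
  proof (rule Collect_cong, rule conj_cong[OF refl])
    fix A assume A: "A \<in> T \<union> verts \<Gamma>"
    have "(\<exists>M'\<in>T. lift \<Gamma> f A \<subset> lift \<Gamma> f M' \<and> lift \<Gamma> f M' \<subset> lift \<Gamma> f N) \<longleftrightarrow> (\<exists>M'\<in>T. A \<subset> M' \<and> M' \<subset> N)"
      by (rule bex_cong[OF refl]) (use m A N in simp)
    then show "(lift \<Gamma> f A \<subset> lift \<Gamma> f N \<and> \<not> (\<exists>M'\<in>T. lift \<Gamma> f A \<subset> lift \<Gamma> f M' \<and> lift \<Gamma> f M' \<subset> lift \<Gamma> f N)) =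
      (A \<subset> N \<and> \<not> (\<exists>M'\<in>T. A \<subset> M' \<and> M' \<subset> N))"
      using m[OF A, of N] N by simp
  qed
  have V: "verts \<Gamma>' = lift \<Gamma> f ` verts \<Gamma>"
    unfolding iso_image[OF simple simple' iso, symmetric]
    using lift_vert[OF simple simple' iso] by (intro image_cong) auto
  have "lift \<Gamma> f ` T \<union> verts \<Gamma>' = lift \<Gamma> f ` (T \<union> verts \<Gamma>)" unfolding V by blast
  then have "verts (in_graph \<Gamma>' (lift \<Gamma> f ` T) (lift \<Gamma> f N)) =
     {M \<in> lift \<Gamma> f ` (T \<union> verts \<Gamma>). M \<subset> lift \<Gamma> f N \<and> \<not> (\<exists>M'\<in>lift \<Gamma> f ` T. M \<subset> M' \<and> M' \<subset> lift \<Gamma> f N)}"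
    unfolding verts_in_graph by simp
  also have "\<dots> = lift \<Gamma> f ` {M \<in> T \<union> verts \<Gamma>. lift \<Gamma> f M \<subset> lift \<Gamma> f N \<and> \<not> (\<exists>M'\<in>T. lift \<Gamma> f M \<subset> lift \<Gamma> f M' \<and> lift \<Gamma> f M' \<subset> lift \<Gamma> f N)}"
    unfolding Compr_image_eq by simp
  also have "\<dots> = lift \<Gamma> f ` {M \<in> T \<union> verts \<Gamma>. M \<subset> N \<and> \<not> (\<exists>M'\<in>T. M \<subset> M' \<and> M' \<subset> N)}"
    unfolding c ..
  finally show ?thesis unfolding verts_in_graph .
qed

lemma lift_inj: "inj_on (lift \<Gamma> f) {N. N = \<Union>(leaves \<Gamma> N)}"
proof (rule inj_onI)
  fix M N assume "M \<in> {N. N = \<Union>(leaves \<Gamma> N)}" "N \<in> {N. N = \<Union>(leaves \<Gamma> N)}" "lift \<Gamma> f M = lift \<Gamma> f N"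
  then show "M = N" using lift_mono_iff[of M N] lift_mono_iff[of N M] by simp
qed

lemma card_lift_children:
  assumes T: "admissible_tree \<Gamma> T" and N: "N \<in> T"
  shows "card (verts (in_graph \<Gamma>' (lift \<Gamma> f ` T) (lift \<Gamma> f N))) = card (verts (in_graph \<Gamma> T N))"
proof -
  have "verts (in_graph \<Gamma> T N) \<subseteq> {N. N = \<Union>(leaves \<Gamma> N)}"
  proof
    fix M assume "M \<in> verts (in_graph \<Gamma> T N)"
    then have "M \<in> T \<union> verts \<Gamma>" unfolding verts_in_graph by simp
    then show "M \<in> {N. N = \<Union>(leaves \<Gamma> N)}" by (intro CollectI) (rule member_spanned[OF T])
  qed
  then show ?thesis
    unfolding lift_children[OF T N] by (intro card_image inj_on_subset[OF lift_inj])
qed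

end

section \<open>Trees decorated in even degrees\<close>

lemma sgnp_even [simp]: "even m \<Longrightarrow> sgnp m = 1"
  by (simp add: sgnp_def)

lemma sum_fun_apply: "(\<Sum>i\<in>A. f i) x = (\<Sum>i\<in>A. f i x)"
  by (induction A rule: infinite_finite_induct) auto

lemma unshuffle_exp_even:
  assumes "\<And>x. x \<in> set xs \<Longrightarrow> even (w x)"
  shows "even (unshuffle_exp P w xs)"
  unfolding unshuffle_exp_def by (rule dvd_sum) (use assms in auto)

lemma koszul_exp_even:
  assumes "\<And>x. x \<in> set xs \<Longrightarrow> even (w x)"
  shows "even (koszul_exp w xs ys)"
  unfolding koszul_exp_def
proof (rule dvd_sum, clarify)
  fix a b assume "before xs a b"
  then have "a \<in> set xs" unfolding before_def by (meson less_trans nth_mem)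
  then show "even (w a * w b)" using assms by simp
qed

lemma map_slots_ident: "map_slots (\<lambda>N i x. x) F L = F L"
proof (induction L arbitrary: F)
  case (Cons a L)
  obtain N i x where "a = (N, i, x)" by (cases a)
  then show ?case using Cons[of "\<lambda>L'. F ((N, i, x) # L')"] by simp
qed simp

definition relabel :: "(vert \<Rightarrow> vert) \<Rightarrow> 'b decoration \<Rightarrow> 'b decoration" where
  "relabel g = map (\<lambda>(N, i, x). (g N, i, x))"

text \<open>The lists on which a vector decorated by one-dimensional spaces of generators can be
  non-zero: up to order they are determined by the tree.\<close>

definition decorates :: "(graph \<Rightarrow> int) \<Rightarrow> graph \<Rightarrow> unit decoration \<Rightarrow> bool" where
  "decorates deg \<Gamma> L \<longleftrightarrow> distinct (map fst L) \<and> admissible_tree \<Gamma> (nodes L) \<and>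
     (\<forall>(N, i, x)\<in>set L. i = deg (in_graph \<Gamma> (nodes L) N))"

definition tree_degree :: "(graph \<Rightarrow> int) \<Rightarrow> graph \<Rightarrow> vert set \<Rightarrow> int" where
  "tree_degree deg \<Gamma> T = (\<Sum>N\<in>T. deg (in_graph \<Gamma> T N))"

text \<open>One chosen ordering of the nodes. In even degrees values do not depend on the ordering,
  so evaluating here gives the coefficient of the tree \<open>T\<close>.\<close>

definition decoration_of :: "(graph \<Rightarrow> int) \<Rightarrow> graph \<Rightarrow> vert set \<Rightarrow> unit decoration" where
  "decoration_of deg \<Gamma> T =
     map (\<lambda>N. (N, deg (in_graph \<Gamma> T N), ())) (SOME ns. distinct ns \<and> set ns = T)"

lemma some_list:
  assumes "finite T"
  shows "distinct (SOME ns. distinct ns \<and> set ns = T)" "set (SOME ns. distinct ns \<and> set ns = T) = T"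
proof -
  have "\<exists>ns. distinct ns \<and> set ns = T" using finite_distinct_list[OF assms] by blast
  from someI_ex[OF this]
  show "distinct (SOME ns. distinct ns \<and> set ns = T)" "set (SOME ns. distinct ns \<and> set ns = T) = T"
    by blast+
qed

lemma nodes_decoration_of: "finite T \<Longrightarrow> nodes (decoration_of deg \<Gamma> T) = T"
  using some_list(2)[of T] unfolding decoration_of_def nodes_def by (simp add: image_image)

lemma decorates_decoration_of:
  assumes "finite T" "admissible_tree \<Gamma> T"
  shows "decorates deg \<Gamma> (decoration_of deg \<Gamma> T)"
proof -
  have "map fst (decoration_of deg \<Gamma> T) = (SOME ns. distinct ns \<and> set ns = T)"
    unfolding decoration_of_def by (simp add: comp_def)
  then show ?thesis
    unfolding decorates_def nodes_decoration_of[OF assms(1)]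
    using assms(2) some_list(1)[OF assms(1)] by (simp add: decoration_of_def)
qed

lemma decorates_set:
  assumes "decorates deg \<Gamma> L"
  shows "set L = (\<lambda>N. (N, deg (in_graph \<Gamma> (nodes L) N), ())) ` nodes L"
proof (rule set_eqI, rule iffI)
  fix y assume y: "y \<in> set L"
  obtain N i where N: "y = (N, i, ())" by (metis old.unit.exhaust surj_pair)
  then have "i = deg (in_graph \<Gamma> (nodes L) N)" using assms y unfolding decorates_def by blast
  moreover have "N \<in> nodes L" using N y unfolding nodes_def by force
  ultimately show "y \<in> (\<lambda>N. (N, deg (in_graph \<Gamma> (nodes L) N), ())) ` nodes L" using N by blast
next
  fix y assume "y \<in> (\<lambda>N. (N, deg (in_graph \<Gamma> (nodes L) N), ())) ` nodes L"
  then obtain N where N: "N \<in> nodes L" "y = (N, deg (in_graph \<Gamma> (nodes L) N), ())" by blast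
  then obtain i where i: "(N, i, ()) \<in> set L" unfolding nodes_def by force
  then have "i = deg (in_graph \<Gamma> (nodes L) N)" using assms unfolding decorates_def by blast
  then show "y \<in> set L" using i N by simp
qed

lemma decorates_mset_eq:
  assumes "decorates deg \<Gamma> L" "decorates deg \<Gamma> L'" "nodes L = nodes L'"
  shows "mset L = mset L'"
proof -
  have "set L = set L'" using decorates_set[OF assms(1)] decorates_set[OF assms(2)] assms(3) by simp
  moreover have "distinct L" "distinct L'" using assms unfolding decorates_def distinct_map by blast+
  ultimately show ?thesis using set_eq_iff_mset_eq_distinct by blast
qed

lemma decorates_mset_cong:
  assumes "mset L = mset L'"
  shows "decorates deg \<Gamma> L \<longleftrightarrow> decorates deg \<Gamma> L'"
proof -
  have s: "set L = set L'" using assms by (rule mset_eq_setD)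
  have "mset (map fst L) = mset (map fst L')" using assms by simp
  then have "distinct (map fst L) \<longleftrightarrow> distinct (map fst L')" by (metis mset_eq_imp_distinct_iff)
  then show ?thesis unfolding decorates_def nodes_def s by simp
qed

lemma decorates_total_degree:
  assumes "decorates deg \<Gamma> L"
  shows "total_degree L = tree_degree deg \<Gamma> (nodes L)"
proof -
  have "total_degree L = (\<Sum>y\<in>set L. case y of (N, i, x) \<Rightarrow> i)"
    unfolding total_degree_def
    using assms unfolding decorates_def distinct_map by (subst sum_list_distinct_conv_sum_set) blast+
  also have "\<dots> = tree_degree deg \<Gamma> (nodes L)"
    unfolding decorates_set[OF assms] tree_degree_def by (subst sum.reindex) (auto simp: inj_on_def)
  finally show ?thesis .
qed

text \<open>Evenness removes all Koszul signs. Dependence on the number of vertices alone makes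
  degrees invariant under isomorphisms and grafting as soon as the sets of children match.\<close>

locale even_degrees =
  fixes deg :: "graph \<Rightarrow> int"
  assumes even_deg: "even (deg \<Gamma>)"
    and deg_cong: "card (verts \<Gamma>) = card (verts \<Gamma>') \<Longrightarrow> deg \<Gamma> = deg \<Gamma>'"
begin

lemma decorates_even: "decorates deg \<Gamma> L \<Longrightarrow> (N, i, x) \<in> set L \<Longrightarrow> even i"
proof -
  assume "decorates deg \<Gamma> L" "(N, i, x) \<in> set L"
  then have "i = deg (in_graph \<Gamma> (nodes L) N)" unfolding decorates_def by blast
  then show "even i" using even_deg by simp
qed

text \<open>An explicit form of the span \<open>tree_homog\<close>: without signs, the unordered
  tensor products of one-dimensional spaces are the order-independent functions on
  decorations.\<close>

definition tree_space :: "graph \<Rightarrow> int \<Rightarrow> (unit decoration \<Rightarrow> 'k::field) set" where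
  "tree_space \<Gamma> n = {F. (\<forall>L. F L \<noteq> 0 \<longrightarrow> decorates deg \<Gamma> L \<and> tree_degree deg \<Gamma> (nodes L) = n) \<and>
     (\<forall>L L'. mset L = mset L' \<longrightarrow> F L = F L')}"

lemma tree_spaceD:
  assumes "F \<in> tree_space \<Gamma> n"
  shows "F L \<noteq> 0 \<Longrightarrow> decorates deg \<Gamma> L" "F L \<noteq> 0 \<Longrightarrow> tree_degree deg \<Gamma> (nodes L) = n"
    "mset L = mset L' \<Longrightarrow> F L = F L'"
  using assms unfolding tree_space_def by blast+

lemma tree_spaceI:
  assumes "\<And>L. F L \<noteq> 0 \<Longrightarrow> decorates deg \<Gamma> L" "\<And>L. F L \<noteq> 0 \<Longrightarrow> tree_degree deg \<Gamma> (nodes L) = n"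
    "\<And>L L'. mset L = mset L' \<Longrightarrow> F L = F L'"
  shows "F \<in> tree_space \<Gamma> n"
  using assms unfolding tree_space_def by blast

lemma subspace_tree_space: "fs.subspace (tree_space \<Gamma> n :: (_ \<Rightarrow> 'k::field) set)"
proof (rule fs.subspaceI)
  show "0 \<in> tree_space \<Gamma> n" by (rule tree_spaceI) auto
  fix F F' :: "unit decoration \<Rightarrow> 'k" and c :: 'k
  assume F: "F \<in> tree_space \<Gamma> n"
  show "fscale c F \<in> tree_space \<Gamma> n"
  proof (rule tree_spaceI)
    fix L assume "fscale c F L \<noteq> 0"
    then have "F L \<noteq> 0" by (auto simp: fscale_def)
    then show "decorates deg \<Gamma> L" "tree_degree deg \<Gamma> (nodes L) = n" using tree_spaceD(1,2)[OF F] by simp_all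
  next
    fix L L' :: "unit decoration" assume "mset L = mset L'"
    from tree_spaceD(3)[OF F this] show "fscale c F L = fscale c F L'" by (simp add: fscale_def)
  qed
  assume F': "F' \<in> tree_space \<Gamma> n"
  show "F + F' \<in> tree_space \<Gamma> n"
  proof (rule tree_spaceI)
    fix L assume "(F + F') L \<noteq> 0"
    then have "F L \<noteq> 0 \<or> F' L \<noteq> 0" by auto
    then show "decorates deg \<Gamma> L" "tree_degree deg \<Gamma> (nodes L) = n"
      using tree_spaceD(1,2)[OF F, of L] tree_spaceD(1,2)[OF F', of L] by argo+
  next
    fix L L' :: "unit decoration" assume m: "mset L = mset L'"
    from tree_spaceD(3)[OF F m] tree_spaceD(3)[OF F' m] show "(F + F') L = (F + F') L'" by simp
  qed
qed

definition basis_tree :: "graph \<Rightarrow> vert set \<Rightarrow> unit decoration \<Rightarrow> 'k::field" where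
  "basis_tree \<Gamma> T L = (if decorates deg \<Gamma> L \<and> nodes L = T then 1 else 0)"

lemma basis_tree_in: "basis_tree \<Gamma> T \<in> tree_space \<Gamma> (tree_degree deg \<Gamma> T)"
proof (rule tree_spaceI)
  fix L L' :: "unit decoration" assume m: "mset L = mset L'"
  then have "nodes L = nodes L'" unfolding nodes_def by (metis mset_eq_setD)
  then show "basis_tree \<Gamma> T L = basis_tree \<Gamma> T L'"
    unfolding basis_tree_def using decorates_mset_cong[OF m] by simp
qed (auto simp: basis_tree_def split: if_splits)

text \<open>Order-independence makes \<open>F\<close> constant on the decorations of each tree, and
  the basis trees are the indicator functions of these finitely many classes.\<close>

lemma tree_space_expand:
  fixes F :: "unit decoration \<Rightarrow> 'k::field"
  assumes simple: "simple_graph \<Gamma>" and F: "F \<in> tree_space \<Gamma> n"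
  shows "F = (\<Sum>T | admissible_tree \<Gamma> T \<and> tree_degree deg \<Gamma> T = n.
     fscale (F (decoration_of deg \<Gamma> T)) (basis_tree \<Gamma> T))"
proof
  fix L
  let ?A = "{T. admissible_tree \<Gamma> T \<and> tree_degree deg \<Gamma> T = n}"
  have fin: "finite ?A" using finite_admissible[OF simple] by simp
  have "(\<Sum>T\<in>?A. fscale (F (decoration_of deg \<Gamma> T)) (basis_tree \<Gamma> T)) L =
      (\<Sum>T\<in>?A. F (decoration_of deg \<Gamma> T) * basis_tree \<Gamma> T L)"
    unfolding sum_fun_apply fscale_def ..
  also have "\<dots> = F L"
  proof (cases "decorates deg \<Gamma> L \<and> tree_degree deg \<Gamma> (nodes L) = n")
    case True
    then have a: "nodes L \<in> ?A" unfolding decorates_def by blast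
    have "(\<Sum>T\<in>?A. F (decoration_of deg \<Gamma> T) * basis_tree \<Gamma> T L) =
        (\<Sum>T\<in>?A. if T = nodes L then F (decoration_of deg \<Gamma> T) else 0)"
      by (rule sum.cong) (use True in \<open>auto simp: basis_tree_def\<close>)
    also have "\<dots> = F (decoration_of deg \<Gamma> (nodes L))" using fin a by (simp add: sum.delta')
    also have "\<dots> = F L"
    proof (rule tree_spaceD(3)[OF F], rule decorates_mset_eq)
      have f: "finite (nodes L)" unfolding nodes_def by simp
      show "decorates deg \<Gamma> (decoration_of deg \<Gamma> (nodes L))"
        using decorates_decoration_of[OF f] a by blast
      show "nodes (decoration_of deg \<Gamma> (nodes L)) = nodes L" by (rule nodes_decoration_of[OF f])
    qed (use True in blast)
    finally show ?thesis .
  next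
    case False
    then have "F L = 0" using tree_spaceD(1,2)[OF F, of L] by blast
    moreover have "basis_tree \<Gamma> T L = (0 :: 'k)" if "T \<in> ?A" for T
      using False that unfolding basis_tree_def by auto
    then have "(\<Sum>T\<in>?A. F (decoration_of deg \<Gamma> T) * basis_tree \<Gamma> T L) = 0"
      by (intro sum.neutral ballI) (metis mult_zero_right)
    ultimately show ?thesis by simp
  qed
  finally show "F L = (\<Sum>T\<in>?A. fscale (F (decoration_of deg \<Gamma> T)) (basis_tree \<Gamma> T)) L" ..
qed

lemma tree_tensor_in:
  assumes ns: "distinct ns" "admissible_tree \<Gamma> (set ns)" and simple: "simple_graph \<Gamma>"
    and e: "\<forall>N\<in>set ns. e N \<in> homog (symmetric_generators deg) (in_graph \<Gamma> (set ns) N) (d N)"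
    and n: "(\<Sum>N\<in>set ns. d N) = n"
  shows "(tree_tensor ns d e :: _ \<Rightarrow> 'k::field) \<in> tree_space \<Gamma> n"
proof (cases "\<forall>N\<in>set ns. d N = deg (in_graph \<Gamma> (set ns) N)")
  case True
  have even: "even (koszul_exp d ns ys)" for ys by (rule koszul_exp_even) (use True even_deg in simp)
  show ?thesis
  proof (rule tree_spaceI)
    fix L assume "tree_tensor ns d e L \<noteq> 0"
    then have L: "distinct (map fst L)" "nodes L = set ns" "\<forall>(N, i, x)\<in>set L. i = d N"
      unfolding tree_tensor_def by (auto split: if_splits)
    moreover have "i = deg (in_graph \<Gamma> (nodes L) N)" if "(N, i, x) \<in> set L" for N i x
    proof -
      have "N \<in> set ns" using that L(2) unfolding nodes_def by force
      then show ?thesis using that L True by auto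
    qed
    ultimately show "decorates deg \<Gamma> L" using ns unfolding decorates_def by auto
    show "tree_degree deg \<Gamma> (nodes L) = n"
      unfolding tree_degree_def L n[symmetric] by (rule sum.cong) (use True in auto)
  next
    fix L L' :: "unit decoration" assume m: "mset L = mset L'"
    then have s: "set L = set L'" by (rule mset_eq_setD)
    have "mset (map fst L) = mset (map fst L')" using m by simp
    then have dd: "distinct (map fst L) \<longleftrightarrow> distinct (map fst L')" by (metis mset_eq_imp_distinct_iff)
    have "prod_list (map (\<lambda>(N, i, x). e N x) L) = prod_list (map (\<lambda>(N, i, x). e N x) L')"
      unfolding prod_mset_prod_list[symmetric] mset_map m ..
    then show "tree_tensor ns d e L = (tree_tensor ns d e L' :: 'k)"
      unfolding tree_tensor_def nodes_def s dd sgnp_even[OF even] by simp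
  qed
next
  case False
  then obtain N where N: "N \<in> set ns" "d N \<noteq> deg (in_graph \<Gamma> (set ns) N)" by blast
  \<comment> \<open>Outside the degree of the generator its space is zero, so one misgraded factor
    kills the whole product.\<close>
  then have e0: "e N = 0" using e unfolding symmetric_generators_def by auto
  have "tree_tensor ns d e L = 0" for L
  proof (cases "nodes L = set ns")
    case True
    then obtain i where "(N, i, ()) \<in> set L" using N unfolding nodes_def by force
    then have "(0::'k) \<in> set (map (\<lambda>(N, i, x). e N x) L)" using e0 by force
    then have "prod_list (map (\<lambda>(N, i, x). e N x) L) = 0" by (simp add: prod_list_zero_iff)
    then show ?thesis unfolding tree_tensor_def by simp
  qed (simp add: tree_tensor_def)
  then have "tree_tensor ns d e = 0" by auto
  then show ?thesis using fs.subspace_0[OF subspace_tree_space] by simp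
qed

lemma basis_tree_eq_tensor:
  assumes simple: "simple_graph \<Gamma>" and T: "admissible_tree \<Gamma> T" and ns: "distinct ns" "set ns = T"
  shows "(basis_tree \<Gamma> T :: _ \<Rightarrow> 'k::field) = tree_tensor ns (\<lambda>N. deg (in_graph \<Gamma> T N)) (\<lambda>_ _. 1)"
proof
  fix L :: "unit decoration"
  have even: "even (koszul_exp (\<lambda>N. deg (in_graph \<Gamma> T N)) ns ys)" for ys
    by (rule koszul_exp_even) (use even_deg in simp)
  have one: "prod_list (map (\<lambda>(N, i, x). g N i x) L) = 1" if "\<And>N i x. g N i x = (1 :: 'k)" for g
    by (induction L) (auto simp: that)
  show "(basis_tree \<Gamma> T L :: 'k) = tree_tensor ns (\<lambda>N. deg (in_graph \<Gamma> T N)) (\<lambda>_ _. 1) L"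
    unfolding basis_tree_def tree_tensor_def sgnp_even[OF even] decorates_def ns(2)
    by (cases "nodes L = T") (use T in \<open>simp_all add: one\<close>)
qed

lemma tree_homog_eq:
  assumes simple: "simple_graph \<Gamma>"
  shows "tree_homog (symmetric_generators deg) \<Gamma> n = (tree_space \<Gamma> n :: (_ \<Rightarrow> 'k::field) set)"
proof
  show "tree_homog (symmetric_generators deg) \<Gamma> n \<subseteq> (tree_space \<Gamma> n :: (_ \<Rightarrow> 'k) set)"
    unfolding tree_homog_def
    by (rule fs.span_minimal[OF _ subspace_tree_space]) (use tree_tensor_in[OF _ _ simple] in auto)
  show "tree_space \<Gamma> n \<subseteq> (tree_homog (symmetric_generators deg) \<Gamma> n :: (_ \<Rightarrow> 'k) set)"
  proof
    fix F :: "unit decoration \<Rightarrow> 'k" assume F: "F \<in> tree_space \<Gamma> n"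
    have "basis_tree \<Gamma> T \<in> (tree_homog (symmetric_generators deg) \<Gamma> n :: (_ \<Rightarrow> 'k) set)"
      if T: "admissible_tree \<Gamma> T" "tree_degree deg \<Gamma> T = n" for T
    proof -
      obtain ns where ns: "distinct ns" "set ns = T"
        using finite_distinct_list[OF admissible_finite[OF simple T(1)]] by blast
      have "(\<lambda>_. 1) \<in> homog (symmetric_generators deg :: (_, 'k) collection) (in_graph \<Gamma> T N) (deg (in_graph \<Gamma> T N))"
        if "N \<in> T" for N
        using card_children[OF simple T(1) that] by (simp add: symmetric_generators_def)
      then show ?thesis
        unfolding tree_homog_def basis_tree_eq_tensor[OF simple T(1) ns]
        using ns T unfolding tree_degree_def
        by (intro fs.span_base CollectI exI[of _ ns] exI[of _ "\<lambda>N. deg (in_graph \<Gamma> T N)"] exI[of _ "\<lambda>_ _. 1"] conjI refl) simp_all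
    qed
    moreover have "fs.subspace (tree_homog (symmetric_generators deg) \<Gamma> n :: (_ \<Rightarrow> 'k) set)"
      unfolding tree_homog_def by (rule fs.subspace_span)
    ultimately have "(\<Sum>T | admissible_tree \<Gamma> T \<and> tree_degree deg \<Gamma> T = n.
        fscale (F (decoration_of deg \<Gamma> T)) (basis_tree \<Gamma> T)) \<in> tree_homog (symmetric_generators deg) \<Gamma> n"
      by (intro fs.subspace_sum fs.subspace_scale) simp_all
    then show "F \<in> tree_homog (symmetric_generators deg) \<Gamma> n"
      by (subst tree_space_expand[OF simple F])
  qed
qed

lemma tree_pull_eq:
  "tree_pull (symmetric_generators deg) \<Gamma> \<Gamma>' f n F L =
     (if admissible_tree \<Gamma> (nodes L) then F (relabel (lift \<Gamma> f) L) else 0)"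
  unfolding tree_pull_def relabel_def by (simp add: symmetric_generators_def map_slots_ident)

lemma nodes_relabel: "nodes (relabel g L) = g ` nodes L"
  unfolding nodes_def relabel_def image_image set_map by (intro image_cong) auto

lemma map_fst_relabel: "map fst (relabel g L) = map g (map fst L)"
  unfolding relabel_def by (induction L) auto

context
  fixes \<Gamma> \<Gamma>' :: graph and f
  assumes simple: "simple_graph \<Gamma>" and simple': "simple_graph \<Gamma>'" and iso: "graph_iso \<Gamma> \<Gamma>' f"
begin

lemma lift_inj_nodes: "admissible_tree \<Gamma> T \<Longrightarrow> inj_on (lift \<Gamma> f) T"
  by (rule inj_on_subset[OF lift_inj[OF simple simple' iso]], rule subsetI, rule CollectI)
    (rule admissible_node(1))

lemma deg_lift:
  "admissible_tree \<Gamma> T \<Longrightarrow> N \<in> T \<Longrightarrow> deg (in_graph \<Gamma>' (lift \<Gamma> f ` T) (lift \<Gamma> f N)) = deg (in_graph \<Gamma> T N)"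
  using card_lift_children[OF simple simple' iso] by (intro deg_cong)

lemma tree_degree_lift:
  "admissible_tree \<Gamma> T \<Longrightarrow> tree_degree deg \<Gamma>' (lift \<Gamma> f ` T) = tree_degree deg \<Gamma> T"
  unfolding tree_degree_def by (subst sum.reindex[OF lift_inj_nodes]) (auto intro!: sum.cong simp: deg_lift)

lemma decorates_relabel_iff:
  assumes a: "admissible_tree \<Gamma> (nodes L)"
  shows "decorates deg \<Gamma>' (relabel (lift \<Gamma> f) L) \<longleftrightarrow> decorates deg \<Gamma> L"
proof -
  have "distinct (map fst (relabel (lift \<Gamma> f) L)) \<longleftrightarrow> distinct (map fst L)"
    using lift_inj_nodes[OF a] unfolding map_fst_relabel distinct_map[of _ "map fst L"] nodes_def by auto
  moreover have "N \<in> nodes L" if "(N, i, x) \<in> set L" for N i x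
    using that unfolding nodes_def by force
  ultimately show ?thesis
    unfolding decorates_def nodes_relabel using a lift_admissible[OF simple simple' iso a] deg_lift[OF a]
    by (auto simp: relabel_def)
qed

lemma tree_pull_in:
  assumes F: "F \<in> tree_space \<Gamma>' n"
  shows "tree_pull (symmetric_generators deg) \<Gamma> \<Gamma>' f n F \<in> tree_space \<Gamma> n"
proof (rule tree_spaceI)
  fix L assume n0: "tree_pull (symmetric_generators deg) \<Gamma> \<Gamma>' f n F L \<noteq> 0"
  then have a: "admissible_tree \<Gamma> (nodes L)" and n: "F (relabel (lift \<Gamma> f) L) \<noteq> 0"
    unfolding tree_pull_eq by (auto split: if_splits)
  show "decorates deg \<Gamma> L" using tree_spaceD(1)[OF F n] decorates_relabel_iff[OF a] by simp
  show "tree_degree deg \<Gamma> (nodes L) = n"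
    using tree_spaceD(2)[OF F n] unfolding nodes_relabel tree_degree_lift[OF a] .
next
  fix L L' :: "unit decoration" assume m: "mset L = mset L'"
  then have "nodes L = nodes L'" unfolding nodes_def by (metis mset_eq_setD)
  moreover have "mset (relabel (lift \<Gamma> f) L) = mset (relabel (lift \<Gamma> f) L')"
    unfolding relabel_def using m by simp
  then have "F (relabel (lift \<Gamma> f) L) = F (relabel (lift \<Gamma> f) L')" by (rule tree_spaceD(3)[OF F])
  ultimately show "tree_pull (symmetric_generators deg) \<Gamma> \<Gamma>' f n F L = tree_pull (symmetric_generators deg) \<Gamma> \<Gamma>' f n F L'"
    unfolding tree_pull_eq by simp
qed

end

end

section \<open>The free contractad\<close>

lemma contractadI:
  assumes "graphical_collection P"
    and "\<And>\<Gamma> G i j a b. connected_graph \<Gamma> \<Longrightarrow> tube \<Gamma> G \<Longrightarrow> a \<in> homog P (contract \<Gamma> G) i \<Longrightarrow>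
      b \<in> homog P (induced \<Gamma> G) j \<Longrightarrow> pcomp P \<Gamma> G i j a b \<in> homog P \<Gamma> (i + j)"
    and "\<And>\<Gamma> G i j a. connected_graph \<Gamma> \<Longrightarrow> tube \<Gamma> G \<Longrightarrow> a \<in> homog P (contract \<Gamma> G) i \<Longrightarrow>
      linear_on (homog P (induced \<Gamma> G) j) (pcomp P \<Gamma> G i j a)"
    and "\<And>\<Gamma> G i j b. connected_graph \<Gamma> \<Longrightarrow> tube \<Gamma> G \<Longrightarrow> b \<in> homog P (induced \<Gamma> G) j \<Longrightarrow>
      linear_on (homog P (contract \<Gamma> G) i) (\<lambda>a. pcomp P \<Gamma> G i j a b)"
    and "\<And>\<Gamma> \<Gamma>' f G i j a b. connected_graph \<Gamma> \<Longrightarrow> connected_graph \<Gamma>' \<Longrightarrow> graph_iso \<Gamma> \<Gamma>' f \<Longrightarrow> tube \<Gamma> G \<Longrightarrow>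
      a \<in> homog P (contract \<Gamma>' (f ` G)) i \<Longrightarrow> b \<in> homog P (induced \<Gamma>' (f ` G)) j \<Longrightarrow>
      pull P \<Gamma> \<Gamma>' f (i + j) (pcomp P \<Gamma>' (f ` G) i j a b) =
        pcomp P \<Gamma> G i j (pull P (contract \<Gamma> G) (contract \<Gamma>' (f ` G)) (lift \<Gamma> f) i a)
          (pull P (induced \<Gamma> G) (induced \<Gamma>' (f ` G)) f j b)"
    and "\<And>\<Gamma> K G i j k a b c. connected_graph \<Gamma> \<Longrightarrow> tube \<Gamma> K \<Longrightarrow> tube \<Gamma> G \<Longrightarrow> K \<subseteq> G \<Longrightarrow>
      a \<in> homog P (contract \<Gamma> G) i \<Longrightarrow> b \<in> homog P (contract (induced \<Gamma> G) K) j \<Longrightarrow>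
      c \<in> homog P (induced \<Gamma> K) k \<Longrightarrow>
      pcomp P \<Gamma> K (i + j) k (pcomp P (contract \<Gamma> K) (contract_tube K G) i j a b) c =
        pcomp P \<Gamma> G i (j + k) a (pcomp P (induced \<Gamma> G) K j k b c)"
    and "\<And>\<Gamma> G H i j k a b c. connected_graph \<Gamma> \<Longrightarrow> tube \<Gamma> G \<Longrightarrow> tube \<Gamma> H \<Longrightarrow> G \<inter> H = {} \<Longrightarrow>
      a \<in> homog P (contract (contract \<Gamma> G) H) i \<Longrightarrow> b \<in> homog P (induced \<Gamma> G) j \<Longrightarrow>
      c \<in> homog P (induced \<Gamma> H) k \<Longrightarrow>
      pcomp P \<Gamma> H (i + j) k (pcomp P (contract \<Gamma> H) G i j a b) c =
        fscale (sgnp (j * k)) (pcomp P \<Gamma> G (i + k) j (pcomp P (contract \<Gamma> G) H i k a c) b)"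
    and "\<And>\<Gamma>. connected_graph \<Gamma> \<Longrightarrow> card (verts \<Gamma>) = 1 \<Longrightarrow> iden P \<Gamma> \<in> homog P \<Gamma> 0"
    and "\<And>\<Gamma> \<Gamma>' f. connected_graph \<Gamma> \<Longrightarrow> connected_graph \<Gamma>' \<Longrightarrow> card (verts \<Gamma>) = 1 \<Longrightarrow>
      graph_iso \<Gamma> \<Gamma>' f \<Longrightarrow> pull P \<Gamma> \<Gamma>' f 0 (iden P \<Gamma>') = iden P \<Gamma>"
    and "\<And>\<Gamma> d x. connected_graph \<Gamma> \<Longrightarrow> x \<in> homog P \<Gamma> d \<Longrightarrow>
      pcomp P \<Gamma> (verts \<Gamma>) 0 d (iden P (contract \<Gamma> (verts \<Gamma>))) x = x"
    and "\<And>\<Gamma> v d x. connected_graph \<Gamma> \<Longrightarrow> v \<in> verts \<Gamma> \<Longrightarrow> x \<in> homog P \<Gamma> d \<Longrightarrow>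
      pcomp P \<Gamma> {v} d 0 x (iden P (induced \<Gamma> {v})) = x"
  shows "contractad P"
  unfolding contractad_def
  by (intro conjI allI impI ballI; (elim conjE)?; rule assms; assumption)

lemma graphical_collectionI:
  assumes "\<And>\<Gamma> d. connected_graph \<Gamma> \<Longrightarrow> fs.subspace (homog P \<Gamma> d)"
    and "\<And>\<Gamma> \<Gamma>' f d. connected_graph \<Gamma> \<Longrightarrow> connected_graph \<Gamma>' \<Longrightarrow> graph_iso \<Gamma> \<Gamma>' f \<Longrightarrow>
      linear_on (homog P \<Gamma>' d) (pull P \<Gamma> \<Gamma>' f d)"
    and "\<And>\<Gamma> \<Gamma>' f d x. connected_graph \<Gamma> \<Longrightarrow> connected_graph \<Gamma>' \<Longrightarrow> graph_iso \<Gamma> \<Gamma>' f \<Longrightarrow>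
      x \<in> homog P \<Gamma>' d \<Longrightarrow> pull P \<Gamma> \<Gamma>' f d x \<in> homog P \<Gamma> d"
    and "\<And>\<Gamma> \<Gamma>' f g d x. connected_graph \<Gamma> \<Longrightarrow> connected_graph \<Gamma>' \<Longrightarrow> graph_iso \<Gamma> \<Gamma>' f \<Longrightarrow>
      (\<forall>v\<in>verts \<Gamma>. f v = g v) \<Longrightarrow> x \<in> homog P \<Gamma>' d \<Longrightarrow> pull P \<Gamma> \<Gamma>' f d x = pull P \<Gamma> \<Gamma>' g d x"
    and "\<And>\<Gamma> d x. connected_graph \<Gamma> \<Longrightarrow> x \<in> homog P \<Gamma> d \<Longrightarrow> pull P \<Gamma> \<Gamma> id d x = x"
    and "\<And>\<Gamma> \<Gamma>' \<Gamma>'' f g d x. connected_graph \<Gamma> \<Longrightarrow> connected_graph \<Gamma>' \<Longrightarrow> connected_graph \<Gamma>'' \<Longrightarrow>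
      graph_iso \<Gamma> \<Gamma>' f \<Longrightarrow> graph_iso \<Gamma>' \<Gamma>'' g \<Longrightarrow> x \<in> homog P \<Gamma>'' d \<Longrightarrow>
      pull P \<Gamma> \<Gamma>'' (g \<circ> f) d x = pull P \<Gamma> \<Gamma>' f d (pull P \<Gamma>' \<Gamma>'' g d x)"
  shows "graphical_collection P"
  unfolding graphical_collection_def image_subset_iff
  by (intro conjI allI impI ballI; (elim conjE)?; rule assms; assumption)

lemma iso_inverse:
  assumes "graph_iso \<Gamma> \<Gamma>' f"
  shows "graph_iso \<Gamma>' \<Gamma> (inv_into (verts \<Gamma>) f)"
proof -
  let ?g = "inv_into (verts \<Gamma>) f"
  have b: "bij_betw f (verts \<Gamma>) (verts \<Gamma>')" using assms unfolding graph_iso_def by blast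
  have g: "bij_betw ?g (verts \<Gamma>') (verts \<Gamma>)" using bij_betw_inv_into[OF b] .
  have "{u, v} \<in> edges \<Gamma>' \<longleftrightarrow> {?g u, ?g v} \<in> edges \<Gamma>" if "u \<in> verts \<Gamma>'" "v \<in> verts \<Gamma>'" for u v
  proof -
    have "?g u \<in> verts \<Gamma>" "?g v \<in> verts \<Gamma>" using bij_betwE[OF g] that by simp_all
    then have "{?g u, ?g v} \<in> edges \<Gamma> \<longleftrightarrow> {f (?g u), f (?g v)} \<in> edges \<Gamma>'"
      using assms unfolding graph_iso_def by blast
    then show ?thesis using bij_betw_inv_into_right[OF b] that by simp
  qed
  then show ?thesis unfolding graph_iso_def using g by simp
qed

lemma lift_lift:
  assumes "simple_graph \<Gamma>" "simple_graph \<Gamma>'" "graph_iso \<Gamma> \<Gamma>' f"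
  shows "lift \<Gamma>' g (lift \<Gamma> f N) = lift \<Gamma> (g \<circ> f) N"
  unfolding lift_def[of \<Gamma>' g] leaves_lift[OF assms] unfolding lift_def by (simp add: image_image)

lemma lift_cong: "(\<And>v. v \<in> verts \<Gamma> \<Longrightarrow> f v = g v) \<Longrightarrow> lift \<Gamma> f N = lift \<Gamma> g N"
  unfolding lift_def leaves_def by (metis (mono_tags, lifting) image_cong mem_Collect_eq)

lemma lift_ident: "N = \<Union>(leaves \<Gamma> N) \<Longrightarrow> (\<And>v. v \<in> verts \<Gamma> \<Longrightarrow> f v = v) \<Longrightarrow> lift \<Gamma> f N = N"
  using lift_cong[of \<Gamma> f id] by (simp add: lift_def)

lemma lift_inverse:
  assumes "simple_graph \<Gamma>" "simple_graph \<Gamma>'" "graph_iso \<Gamma> \<Gamma>' f" "N = \<Union>(leaves \<Gamma> N)"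
  shows "lift \<Gamma>' (inv_into (verts \<Gamma>) f) (lift \<Gamma> f N) = N"
  unfolding lift_lift[OF assms(1-3)]
  by (rule lift_ident[OF assms(4)]) (use iso_inj[OF assms(1-3)] in simp)

definition lower_part_of :: "vert set \<Rightarrow> 'b decoration \<Rightarrow> 'b decoration" where
  "lower_part_of G L = filter (\<lambda>(N, d, x). \<not> N \<subseteq> \<Union>G) L"

definition upper_part_of :: "vert set \<Rightarrow> 'b decoration \<Rightarrow> 'b decoration" where
  "upper_part_of G L = filter (\<lambda>(N, d, x). N \<subseteq> \<Union>G) L"

lemma in_nodes: "N \<in> nodes L \<longleftrightarrow> (\<exists>i x. (N, i, x) \<in> set L)"
  unfolding nodes_def image_iff Bex_def split_paired_Ex by simp

lemma nodes_lower: "nodes (lower_part_of G L) = {N \<in> nodes L. \<not> N \<subseteq> \<Union>G}"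
  by (rule set_eqI) (auto simp: in_nodes lower_part_of_def)

lemma nodes_upper: "nodes (upper_part_of G L) = {N \<in> nodes L. N \<subseteq> \<Union>G}"
  by (rule set_eqI) (auto simp: in_nodes upper_part_of_def)

lemma nodes_lower_upper: "nodes (lower_part_of G L) \<union> nodes (upper_part_of G L) = nodes L"
  unfolding nodes_lower nodes_upper by auto

lemma set_lower_upper: "set L = set (lower_part_of G L) \<union> set (upper_part_of G L)"
  unfolding lower_part_of_def upper_part_of_def by auto

lemma distinct_lower_upper:
  "distinct (map fst (lower_part_of G L)) \<Longrightarrow> distinct (map fst (upper_part_of G L)) \<Longrightarrow> distinct (map fst L)"
proof (induction L)
  case (Cons a L)
  obtain N i x where a: "a = (N, i, x)" by (cases a)
  have d: "distinct (map fst L)"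
    using Cons by (auto simp: lower_part_of_def upper_part_of_def a split: if_splits)
  have "N \<notin> nodes L"
  proof
    assume "N \<in> nodes L"
    then have "(N \<subseteq> \<Union>G \<longrightarrow> N \<in> nodes (upper_part_of G L)) \<and> (\<not> N \<subseteq> \<Union>G \<longrightarrow> N \<in> nodes (lower_part_of G L))"
      unfolding nodes_lower nodes_upper by auto
    then show False using Cons.prems
      by (cases "N \<subseteq> \<Union>G") (auto simp: lower_part_of_def upper_part_of_def a nodes_def)
  qed
  then show ?case using d by (simp add: a nodes_def)
qed simp

lemma pcomp_free_raw:
  "pcomp (free_contractad E) \<Gamma> G i j a b =
     (\<lambda>L. sgnp (unshuffle_exp (\<lambda>(N, d, x). N \<subseteq> \<Union>G) (\<lambda>(N, d, x). d) L) *
        a (lower_part_of G L) * b (upper_part_of G L))"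
  unfolding free_contractad_def lower_part_of_def upper_part_of_def by simp

context even_degrees
begin

abbreviation free :: "(unit decoration, 'k::field) contractad_data" where
  "free \<equiv> free_contractad (symmetric_generators deg)"

lemma homog_free: "connected_graph \<Gamma> \<Longrightarrow> homog free \<Gamma> n = tree_space \<Gamma> n"
  using tree_homog_eq[OF connected_simple] by (simp add: free_contractad_def)

lemma pull_free: "pull free = tree_pull (symmetric_generators deg)"
  by (simp add: free_contractad_def)

lemma iden_free: "iden free = (\<lambda>\<Gamma> L. if L = [] then 1 else 0)"
  by (simp add: free_contractad_def)

text \<open>The unshuffling sign matters only where both factors are non-zero, and there all
  decorations have even degree.\<close>

lemma pcomp_free:
  assumes a: "a \<in> tree_space (contract \<Gamma> G) i" and b: "b \<in> tree_space (induced \<Gamma> G) j"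
  shows "pcomp free \<Gamma> G i j a b = (\<lambda>L. a (lower_part_of G L) * b (upper_part_of G L))"
proof
  fix L
  show "pcomp free \<Gamma> G i j a b L = a (lower_part_of G L) * b (upper_part_of G L)"
  proof (cases "a (lower_part_of G L) = 0 \<or> b (upper_part_of G L) = 0")
    case False
    then have d: "decorates deg (contract \<Gamma> G) (lower_part_of G L)" "decorates deg (induced \<Gamma> G) (upper_part_of G L)"
      using tree_spaceD(1)[OF a] tree_spaceD(1)[OF b] by auto
    have "even (unshuffle_exp (\<lambda>(N, d, x). N \<subseteq> \<Union>G) (\<lambda>(N, d, x). d) L)"
    proof (rule unshuffle_exp_even)
      fix y assume "y \<in> set L"
      moreover obtain N i where y: "y = (N, i, ())" by (metis old.unit.exhaust surj_pair)
      ultimately have "(N, i, ()) \<in> set (lower_part_of G L) \<union> set (upper_part_of G L)"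
        using set_lower_upper by metis
      then show "even (case y of (N, d, x) \<Rightarrow> d)"
        using decorates_even[OF d(1)] decorates_even[OF d(2)] y by auto
    qed
    then show ?thesis unfolding pcomp_free_raw by simp
  qed (auto simp: pcomp_free_raw)
qed

context
  fixes \<Gamma> G T1 T2
  assumes simple: "simple_graph \<Gamma>" and G: "tube \<Gamma> G"
    and T1: "admissible_tree (contract \<Gamma> G) T1" and T2: "admissible_tree (induced \<Gamma> G) T2"
begin

lemma deg_graft_lower: "N \<in> T1 \<Longrightarrow> deg (in_graph \<Gamma> (T1 \<union> T2) N) = deg (in_graph (contract \<Gamma> G) T1 N)"
  using graft_children_lower[OF simple G T1 T2] by (intro deg_cong) simp

lemma deg_graft_upper: "N \<in> T2 \<Longrightarrow> deg (in_graph \<Gamma> (T1 \<union> T2) N) = deg (in_graph (induced \<Gamma> G) T2 N)"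
  using graft_children_upper[OF simple G T1 T2] by (intro deg_cong) simp

lemma graft_disjoint: "T1 \<inter> T2 = {}"
  using lower_node[OF simple G T1 T2] upper_node[OF simple G T1 T2] by blast

lemma graft_finite: "finite T1" "finite T2"
  using admissible_finite[OF simple_contract[OF simple G] T1]
    admissible_finite[OF connected_simple[OF connected_induced[OF simple G]] T2] by simp_all

lemma tree_degree_graft:
  "tree_degree deg \<Gamma> (T1 \<union> T2) = tree_degree deg (contract \<Gamma> G) T1 + tree_degree deg (induced \<Gamma> G) T2"
  unfolding tree_degree_def sum.union_disjoint[OF graft_finite graft_disjoint]
  using deg_graft_lower deg_graft_upper by simp

end

lemma decorates_graft:
  assumes simple: "simple_graph \<Gamma>" and G: "tube \<Gamma> G"
    and 1: "decorates deg (contract \<Gamma> G) (lower_part_of G L)" and 2: "decorates deg (induced \<Gamma> G) (upper_part_of G L)"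
  shows "decorates deg \<Gamma> L"
proof -
  let ?T1 = "nodes (lower_part_of G L)" and ?T2 = "nodes (upper_part_of G L)"
  have T: "admissible_tree (contract \<Gamma> G) ?T1" "admissible_tree (induced \<Gamma> G) ?T2"
    using 1 2 unfolding decorates_def by simp_all
  have n: "nodes L = ?T1 \<union> ?T2" using nodes_lower_upper by metis
  have "i = deg (in_graph \<Gamma> (nodes L) N)" if "(N, i, x) \<in> set L" for N i x
  proof -
    have "(N, i, x) \<in> set (lower_part_of G L) \<or> (N, i, x) \<in> set (upper_part_of G L)"
      using that by (auto simp: lower_part_of_def upper_part_of_def)
    then show ?thesis
    proof
      assume 1: "(N, i, x) \<in> set (lower_part_of G L)"
      then have "N \<in> ?T1" unfolding in_nodes by blast
      moreover have "i = deg (in_graph (contract \<Gamma> G) ?T1 N)" using 1 assms(3) unfolding decorates_def by blast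
      ultimately show ?thesis using deg_graft_lower[OF simple G T] unfolding n by simp
    next
      assume 2: "(N, i, x) \<in> set (upper_part_of G L)"
      then have "N \<in> ?T2" unfolding in_nodes by blast
      moreover have "i = deg (in_graph (induced \<Gamma> G) ?T2 N)" using 2 assms(4) unfolding decorates_def by blast
      ultimately show ?thesis using deg_graft_upper[OF simple G T] unfolding n by simp
    qed
  qed
  moreover have "distinct (map fst L)" using distinct_lower_upper 1 2 unfolding decorates_def by blast
  moreover have "admissible_tree \<Gamma> (nodes L)" unfolding n by (rule graft_admissible[OF simple G T])
  ultimately show ?thesis unfolding decorates_def by blast
qed

lemma mset_lower: "mset L = mset L' \<Longrightarrow> mset (lower_part_of G L) = mset (lower_part_of G L')"
  and mset_upper: "mset L = mset L' \<Longrightarrow> mset (upper_part_of G L) = mset (upper_part_of G L')"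
  unfolding lower_part_of_def upper_part_of_def by simp_all

lemma pcomp_free_in:
  assumes simple: "simple_graph \<Gamma>" and G: "tube \<Gamma> G"
    and a: "a \<in> tree_space (contract \<Gamma> G) i" and b: "b \<in> tree_space (induced \<Gamma> G) j"
  shows "pcomp free \<Gamma> G i j a b \<in> tree_space \<Gamma> (i + j)"
  unfolding pcomp_free[OF a b]
proof (rule tree_spaceI)
  fix L assume "a (lower_part_of G L) * b (upper_part_of G L) \<noteq> 0"
  then have n: "a (lower_part_of G L) \<noteq> 0" "b (upper_part_of G L) \<noteq> 0" by auto
  note d = tree_spaceD(1)[OF a n(1)] tree_spaceD(1)[OF b n(2)]
  show "decorates deg \<Gamma> L" by (rule decorates_graft[OF simple G d])
  have T: "admissible_tree (contract \<Gamma> G) (nodes (lower_part_of G L))"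
    "admissible_tree (induced \<Gamma> G) (nodes (upper_part_of G L))"
    using d unfolding decorates_def by simp_all
  show "tree_degree deg \<Gamma> (nodes L) = i + j"
    using tree_degree_graft[OF simple G T] tree_spaceD(2)[OF a n(1)] tree_spaceD(2)[OF b n(2)]
    unfolding nodes_lower_upper by simp
next
  fix L L' :: "unit decoration" assume m: "mset L = mset L'"
  show "a (lower_part_of G L) * b (upper_part_of G L) = a (lower_part_of G L') * b (upper_part_of G L')"
    using tree_spaceD(3)[OF a mset_lower[OF m]] tree_spaceD(3)[OF b mset_upper[OF m]] by (rule arg_cong2)
qed

lemma graphical_free: "graphical_collection (free :: (_, 'k::field) contractad_data)"
proof (rule graphical_collectionI, goal_cases)
  case (1 \<Gamma> d)
  show ?case unfolding homog_free[OF 1] by (rule subspace_tree_space)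
next
  case (2 \<Gamma> \<Gamma>' f d)
  then show ?case unfolding linear_on_def pull_free tree_pull_eq by (auto simp: fun_eq_iff fscale_def tree_pull_eq)
next
  case (3 \<Gamma> \<Gamma>' f d x)
  have "x \<in> tree_space \<Gamma>' d" using 3(4) by (simp add: homog_free[OF 3(2)])
  then show ?case unfolding pull_free homog_free[OF 3(1)]
    by (rule tree_pull_in[OF connected_simple[OF 3(1)] connected_simple[OF 3(2)] 3(3)])
next
  case (4 \<Gamma> \<Gamma>' f g d x)
  have "lift \<Gamma> f N = lift \<Gamma> g N" for N by (rule lift_cong) (use 4(4) in blast)
  then have eq: "lift \<Gamma> f = lift \<Gamma> g" by (rule ext)
  show ?case by (rule ext) (simp add: pull_free tree_pull_eq eq)
next
  case (5 \<Gamma> d x)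
  show ?case
  proof
    fix L :: "unit decoration"
    have x: "x \<in> tree_space \<Gamma> d" using 5 by (simp add: homog_free)
    have "relabel (lift \<Gamma> id) L = L" if a: "admissible_tree \<Gamma> (nodes L)"
    proof -
      have "(lift \<Gamma> id N, i, z) = (N, i, z)" if "(N, i, z) \<in> set L" for N i z
      proof -
        have "N \<in> nodes L" using that unfolding nodes_def by force
        then have "lift \<Gamma> id N = N" by (intro lift_ident admissible_node(1)[OF a]) simp_all
        then show ?thesis by simp
      qed
      then show ?thesis unfolding relabel_def by (intro map_idI) auto
    qed
    moreover have "x L = 0" if "\<not> admissible_tree \<Gamma> (nodes L)"
      using tree_spaceD(1)[OF x] that unfolding decorates_def by blast
    ultimately show "pull free \<Gamma> \<Gamma> id d x L = x L" unfolding pull_free tree_pull_eq by simp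
  qed
next
  case (6 \<Gamma> \<Gamma>' \<Gamma>'' f g d x)
  note s = connected_simple[OF 6(1)] connected_simple[OF 6(2)]
  show ?case
  proof
    fix L :: "unit decoration"
    have "relabel (lift \<Gamma>' g) (relabel (lift \<Gamma> f) L) = relabel (lift \<Gamma> (g \<circ> f)) L"
      unfolding relabel_def map_map
      by (rule map_cong[OF refl]) (clarsimp simp: lift_lift[OF s 6(4)])
    moreover have "admissible_tree \<Gamma> (nodes L) \<Longrightarrow> admissible_tree \<Gamma>' (lift \<Gamma> f ` nodes L)"
      by (rule lift_admissible[OF s 6(4)])
    ultimately show "pull free \<Gamma> \<Gamma>'' (g \<circ> f) d x L = pull free \<Gamma> \<Gamma>' f d (pull free \<Gamma>' \<Gamma>'' g d x) L"
      unfolding pull_free tree_pull_eq by (simp add: nodes_relabel)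
  qed
qed

lemma lower_lower: "\<Union>K \<subseteq> \<Union>G \<Longrightarrow> lower_part_of G (lower_part_of K L) = lower_part_of G L"
  unfolding lower_part_of_def filter_filter by (rule filter_cong[OF refl]) (clarsimp, blast)

lemma upper_upper: "\<Union>K \<subseteq> \<Union>G \<Longrightarrow> upper_part_of K (upper_part_of G L) = upper_part_of K L"
  unfolding upper_part_of_def filter_filter by (rule filter_cong[OF refl]) (clarsimp, blast)

lemma upper_lower: "upper_part_of G (lower_part_of K L) = lower_part_of K (upper_part_of G L)"
  unfolding upper_part_of_def lower_part_of_def filter_filter by (rule filter_cong) auto

lemma lower_commute: "lower_part_of G (lower_part_of K L) = lower_part_of K (lower_part_of G L)"
  unfolding lower_part_of_def filter_filter by (rule filter_cong) auto

lemma part_cong: "\<Union>G = \<Union>H \<Longrightarrow> lower_part_of G = lower_part_of H" "\<Union>G = \<Union>H \<Longrightarrow> upper_part_of G = upper_part_of H"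
  unfolding lower_part_of_def upper_part_of_def by simp_all

lemma even_degree_or_zero: "b \<in> tree_space \<Gamma> n \<Longrightarrow> b L \<noteq> 0 \<Longrightarrow> even n"
  using tree_spaceD(2)[of b \<Gamma> n L] even_deg unfolding tree_degree_def by (metis dvd_sum)

text \<open>Both sides split a decoration into its nodes outside \<open>G\<close>, those in
  \<open>G\<close> but outside \<open>K\<close>, and those inside \<open>K\<close>, and multiply the
  three values.\<close>

lemma free_sequential:
  assumes "connected_graph \<Gamma>" "tube \<Gamma> K" "tube \<Gamma> G" "K \<subseteq> G"
    and "a \<in> homog free (contract \<Gamma> G) i" "b \<in> homog free (contract (induced \<Gamma> G) K) j"
      "c \<in> homog free (induced \<Gamma> K) k"
  shows "pcomp free \<Gamma> K (i + j) k (pcomp free (contract \<Gamma> K) (contract_tube K G) i j a b) c =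
     pcomp free \<Gamma> G i (j + k) a (pcomp free (induced \<Gamma> G) K j k b c)"
proof -
  note s = connected_simple[OF assms(1)]
  have KG: "\<Union>(contract_tube K G) = \<Union>G"
    by (rule Union_contract_tube[OF tube_nonempty[OF s assms(2)] assms(4)])
  have sub: "\<Union>K \<subseteq> \<Union>G" using assms(4) by blast
  note sG = connected_simple[OF connected_induced[OF s assms(3)]]
  note tK = tube_induced[OF s assms(2-4)]
  have a: "a \<in> tree_space (contract \<Gamma> G) i"
    using assms(5) by (simp add: homog_free[OF connected_contract[OF assms(1,3)]])
  have b: "b \<in> tree_space (contract (induced \<Gamma> G) K) j"
    using assms(6) by (simp add: homog_free[OF connected_contract[OF connected_induced[OF s assms(3)] tK]])
  have c: "c \<in> tree_space (induced \<Gamma> K) k"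
    using assms(7) by (simp add: homog_free[OF connected_induced[OF s assms(2)]])
  have a': "a \<in> tree_space (contract (contract \<Gamma> K) (contract_tube K G)) i"
    unfolding contract_contract[OF s assms(2-4)] by (rule a)
  have b': "b \<in> tree_space (induced (contract \<Gamma> K) (contract_tube K G)) j"
    unfolding induced_contract[OF s assms(2-4)] by (rule b)
  have c': "c \<in> tree_space (induced (induced \<Gamma> G) K) k"
    unfolding induced_induced[OF assms(4)] by (rule c)
  note ab = pcomp_free_in[OF simple_contract[OF s assms(2)] tube_contract_tube[OF s assms(2-4)] a' b']
  note bc = pcomp_free_in[OF sG tK b c']
  show ?thesis
    unfolding pcomp_free[OF ab c] pcomp_free[OF a bc] unfolding pcomp_free[OF a' b'] pcomp_free[OF b c']
    unfolding part_cong[OF KG] lower_lower[OF sub] upper_upper[OF sub] upper_lower by (simp add: mult.assoc)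
qed

lemma free_parallel:
  assumes "connected_graph \<Gamma>" "tube \<Gamma> G" "tube \<Gamma> H" "G \<inter> H = {}"
    and "a \<in> homog free (contract (contract \<Gamma> G) H) i" "b \<in> homog free (induced \<Gamma> G) j"
      "c \<in> homog free (induced \<Gamma> H) k"
  shows "pcomp free \<Gamma> H (i + j) k (pcomp free (contract \<Gamma> H) G i j a b) c =
     fscale (sgnp (j * k)) (pcomp free \<Gamma> G (i + k) j (pcomp free (contract \<Gamma> G) H i k a c) b)"
proof
  fix L
  note s = connected_simple[OF assms(1)]
  have HG: "H \<inter> G = {}" using assms(4) by blast
  note tH = tube_contract_disjoint[OF s assms(2,3,4)] and tG = tube_contract_disjoint[OF s assms(3,2) HG]
  have a: "a \<in> tree_space (contract (contract \<Gamma> G) H) i"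
    using assms(5) by (simp add: homog_free[OF connected_contract[OF connected_contract[OF assms(1,2)] tH]])
  have b: "b \<in> tree_space (induced \<Gamma> G) j"
    using assms(6) by (simp add: homog_free[OF connected_induced[OF s assms(2)]])
  have c: "c \<in> tree_space (induced \<Gamma> H) k"
    using assms(7) by (simp add: homog_free[OF connected_induced[OF s assms(3)]])
  have a': "a \<in> tree_space (contract (contract \<Gamma> H) G) i"
    unfolding contract_commute[OF s assms(2,3,4), symmetric] by (rule a)
  have b': "b \<in> tree_space (induced (contract \<Gamma> H) G) j"
    unfolding induced_contract_disjoint[OF s assms(3,2) HG] by (rule b)
  have c': "c \<in> tree_space (induced (contract \<Gamma> G) H) k"
    unfolding induced_contract_disjoint[OF s assms(2,3,4)] by (rule c)
  note ab = pcomp_free_in[OF simple_contract[OF s assms(3)] tG a' b']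
  note ac = pcomp_free_in[OF simple_contract[OF s assms(2)] tH a c']
  \<comment> \<open>A non-zero value of \<open>b\<close> forces \<open>j\<close> to be even, so the
    Koszul sign is 1 whenever it counts.\<close>
  have sg: "sgnp (j * k) * (x * b (upper_part_of G L)) = x * b (upper_part_of G L)" for x
    using even_degree_or_zero[OF b, of "upper_part_of G L"] by (cases "b (upper_part_of G L) = 0") simp_all
  have 1: "pcomp free \<Gamma> H (i + j) k (pcomp free (contract \<Gamma> H) G i j a b) c L =
      a (lower_part_of G (lower_part_of H L)) * b (upper_part_of G (lower_part_of H L)) * c (upper_part_of H L)"
    unfolding pcomp_free[OF ab c] unfolding pcomp_free[OF a' b'] ..
  have 2: "fscale (sgnp (j * k)) (pcomp free \<Gamma> G (i + k) j (pcomp free (contract \<Gamma> G) H i k a c) b) L =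
      a (lower_part_of H (lower_part_of G L)) * c (upper_part_of H (lower_part_of G L)) * b (upper_part_of G L)"
    unfolding pcomp_free[OF ac b] unfolding pcomp_free[OF a c'] fscale_def sg ..
  show "pcomp free \<Gamma> H (i + j) k (pcomp free (contract \<Gamma> H) G i j a b) c L =
      fscale (sgnp (j * k)) (pcomp free \<Gamma> G (i + k) j (pcomp free (contract \<Gamma> G) H i k a c) b) L"
  \<comment> \<open>The empty name lies in both \<open>\<Union>G\<close> and
    \<open>\<Union>H\<close>, so the two upper parts would overlap on it. No node of an admissible
    tree is empty, so such lists give zero on both sides.\<close>
  proof (cases "{} \<in> nodes L")
    case True
    have "b (upper_part_of G L) = 0" "c (upper_part_of H L) = 0"
    proof -
      have "{} \<in> nodes (upper_part_of G L)" "{} \<in> nodes (upper_part_of H L)" unfolding nodes_upper using True by auto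
      moreover have "{} \<notin> nodes L'" if "decorates deg \<Delta> L'" "simple_graph \<Delta>" for \<Delta> L'
        using node_nonempty[OF that(2), of "nodes L'" "{}"] that(1) unfolding decorates_def by blast
      moreover note connected_simple[OF connected_induced[OF s assms(2)]] connected_simple[OF connected_induced[OF s assms(3)]]
      ultimately show "b (upper_part_of G L) = 0" "c (upper_part_of H L) = 0"
        using tree_spaceD(1)[OF b] tree_spaceD(1)[OF c] by blast+
    qed
    then show ?thesis unfolding 1 2 by simp
  next
    case False
    have "\<Union>G \<inter> \<Union>H = {}"
      using vert_disjoint[OF s] tube_subset[OF s assms(2)] tube_subset[OF s assms(3)] assms(4) by blast
    then have k: "\<not> (N \<subseteq> \<Union>H \<and> N \<subseteq> \<Union>G)" if "N \<noteq> {}" for N using that by blast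
    have kL: "\<not> (case y of (N, d, x) \<Rightarrow> N \<subseteq> \<Union>H) \<or> \<not> (case y of (N, d, x) \<Rightarrow> N \<subseteq> \<Union>G)" if "y \<in> set L" for y
    proof -
      have "fst y \<in> nodes L" using that by (simp add: nodes_def)
      then have "fst y \<noteq> {}" using False by metis
      from k[OF this] show ?thesis by (simp add: case_prod_beta)
    qed
    have "upper_part_of G (lower_part_of H L) = upper_part_of G L" "upper_part_of H (lower_part_of G L) = upper_part_of H L"
      unfolding upper_part_of_def lower_part_of_def filter_filter
      by (rule filter_cong[OF refl], use kL in \<open>simp only: case_prod_beta, metis\<close>)+
    then show ?thesis unfolding 1 2 using lower_commute[of G H L] by simp
  qed
qed

text \<open>The two sides test admissibility on different graphs. If both parts are admissible, so
  is their grafting; conversely a non-zero value of \<open>a\<close> or \<open>b\<close> certifies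
  an admissible tree over \<Gamma>', which the inverse isomorphism carries back.\<close>

lemma free_equivariance:
  assumes "connected_graph \<Gamma>" "connected_graph \<Gamma>'" and iso: "graph_iso \<Gamma> \<Gamma>' f" and G: "tube \<Gamma> G"
    and a: "a \<in> homog free (contract \<Gamma>' (f ` G)) i" and b: "b \<in> homog free (induced \<Gamma>' (f ` G)) j"
  shows "pull free \<Gamma> \<Gamma>' f (i + j) (pcomp free \<Gamma>' (f ` G) i j a b) =
     pcomp free \<Gamma> G i j (pull free (contract \<Gamma> G) (contract \<Gamma>' (f ` G)) (lift \<Gamma> f) i a)
       (pull free (induced \<Gamma> G) (induced \<Gamma>' (f ` G)) f j b)"
proof
  fix L
  note s = connected_simple[OF assms(1)] and s' = connected_simple[OF assms(2)]
  note G' = tube_iso[OF s s' iso G]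
  note sC = simple_contract[OF s G] and sC' = simple_contract[OF s' G']
  note sI = connected_simple[OF connected_induced[OF s G]] and sI' = connected_simple[OF connected_induced[OF s' G']]
  note isoC = iso_contract[OF s s' iso G] and isoI = iso_induced[OF s s' iso tube_subset[OF s G]]
  have a1: "a \<in> tree_space (contract \<Gamma>' (f ` G)) i" using a by (simp add: homog_free[OF connected_contract[OF assms(2) G']])
  have b1: "b \<in> tree_space (induced \<Gamma>' (f ` G)) j" using b by (simp add: homog_free[OF connected_induced[OF s' G']])
  note a2 = tree_pull_in[OF sC sC' isoC a1] and b2 = tree_pull_in[OF sI sI' isoI b1]
  let ?a = "a (lower_part_of (f ` G) (relabel (lift \<Gamma> f) L))" and ?b = "b (upper_part_of (f ` G) (relabel (lift \<Gamma> f) L))"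
  let ?l = "lower_part_of G L" and ?u = "upper_part_of G L"
  have lhs: "pull free \<Gamma> \<Gamma>' f (i + j) (pcomp free \<Gamma>' (f ` G) i j a b) L =
      (if admissible_tree \<Gamma> (nodes L) then ?a * ?b else 0)"
    unfolding pull_free tree_pull_eq pcomp_free[OF a1 b1] ..
  have rhs: "pcomp free \<Gamma> G i j (pull free (contract \<Gamma> G) (contract \<Gamma>' (f ` G)) (lift \<Gamma> f) i a)
       (pull free (induced \<Gamma> G) (induced \<Gamma>' (f ` G)) f j b) L =
      (if admissible_tree (contract \<Gamma> G) (nodes ?l) then a (relabel (lift (contract \<Gamma> G) (lift \<Gamma> f)) ?l) else 0) *
      (if admissible_tree (induced \<Gamma> G) (nodes ?u) then b (relabel (lift (induced \<Gamma> G) f) ?u) else 0)"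
    unfolding pull_free pcomp_free[OF a2 b2] unfolding tree_pull_eq ..
  have lift_ind: "lift (induced \<Gamma> G) f N = lift \<Gamma> f N" if "N \<subseteq> \<Union>G" for N
    unfolding lift_def leaves_in_tube[OF s G that] ..
  have ru: "relabel (lift (induced \<Gamma> G) f) ?u = relabel (lift \<Gamma> f) ?u"
    unfolding relabel_def by (rule map_cong[OF refl]) (auto simp: upper_part_of_def lift_ind)
  have rl: "relabel (lift (contract \<Gamma> G) (lift \<Gamma> f)) ?l = relabel (lift \<Gamma> f) ?l"
    if "admissible_tree (contract \<Gamma> G) (nodes ?l)"
  proof -
    have "lift (contract \<Gamma> G) (lift \<Gamma> f) N = lift \<Gamma> f N" if "(N, i, x) \<in> set ?l" for N i x
    proof -
      have "N \<in> nodes ?l" using that unfolding nodes_def by force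
      then show ?thesis
        by (intro lift_contract[OF s s' iso G] admissible_node(1)[OF \<open>admissible_tree (contract \<Gamma> G) (nodes ?l)\<close>])
    qed
    then show ?thesis unfolding relabel_def by (intro map_cong[OF refl]) auto
  qed
  show "pull free \<Gamma> \<Gamma>' f (i + j) (pcomp free \<Gamma>' (f ` G) i j a b) L =
     pcomp free \<Gamma> G i j (pull free (contract \<Gamma> G) (contract \<Gamma>' (f ` G)) (lift \<Gamma> f) i a)
       (pull free (induced \<Gamma> G) (induced \<Gamma>' (f ` G)) f j b) L"
  proof (cases "admissible_tree \<Gamma> (nodes L)")
    case False
    have "\<not> (admissible_tree (contract \<Gamma> G) (nodes ?l) \<and> admissible_tree (induced \<Gamma> G) (nodes ?u))"
      using graft_admissible[OF s G, of "nodes ?l" "nodes ?u"] False unfolding nodes_lower_upper by blast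
    then show ?thesis unfolding lhs rhs using False by auto
  next
    case True
    have spG: "\<Union>G = \<Union>(leaves \<Gamma> (\<Union>G))" using leaves_Union[OF s tube_subset[OF s G]] by simp
    \<comment> \<open>Lying inside the tube is preserved and reflected by relabelling, so splitting
      a decoration commutes with relabelling it.\<close>
    have m: "lift \<Gamma> f N \<subseteq> \<Union>(f ` G) \<longleftrightarrow> N \<subseteq> \<Union>G" if "(N, i, x) \<in> set L" for N i x
    proof -
      have "N \<in> nodes L" using that unfolding nodes_def by force
      from lift_mono_iff[OF s s' iso admissible_node(1)[OF True this] spG] show ?thesis
        unfolding lift_Union[OF s s' iso tube_subset[OF s G]] .
    qed
    have el: "lower_part_of (f ` G) (relabel (lift \<Gamma> f) L) = relabel (lift \<Gamma> f) ?l"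
      unfolding lower_part_of_def relabel_def filter_map
      by (rule arg_cong[where f="map _"], rule filter_cong[OF refl]) (clarify, simp add: m)
    have eu: "upper_part_of (f ` G) (relabel (lift \<Gamma> f) L) = relabel (lift \<Gamma> f) ?u"
      unfolding upper_part_of_def relabel_def filter_map
      by (rule arg_cong[where f="map _"], rule filter_cong[OF refl]) (clarify, simp add: m)
    let ?g = "inv_into (verts \<Gamma>) f"
    note iso' = iso_inverse[OF iso]
    have gf: "?g ` f ` G = G"
      using iso_inj[OF s s' iso] tube_subset[OF s G] by (rule inv_into_image_cancel)
    have inv: "lift \<Gamma>' ?g ` lift \<Gamma> f ` T = T" if "T \<subseteq> nodes L" for T
    proof -
      have "lift \<Gamma>' ?g (lift \<Gamma> f N) = N" if "N \<in> T" for N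
        using lift_inverse[OF s s' iso admissible_node(1)[OF True]] that \<open>T \<subseteq> nodes L\<close> by blast
      then show ?thesis by (simp add: image_image)
    qed
    have sub: "nodes ?l \<subseteq> nodes L" "nodes ?u \<subseteq> nodes L" unfolding nodes_lower nodes_upper by auto
    have al: "admissible_tree (contract \<Gamma> G) (nodes ?l)" if "a (relabel (lift \<Gamma> f) ?l) \<noteq> 0"
    proof -
      have ad: "admissible_tree (contract \<Gamma>' (f ` G)) (lift \<Gamma> f ` nodes ?l)"
        using tree_spaceD(1)[OF a1 that] unfolding decorates_def nodes_relabel by blast
      have "admissible_tree (contract \<Gamma> (?g ` f ` G)) (lift (contract \<Gamma>' (f ` G)) (lift \<Gamma>' ?g) ` lift \<Gamma> f ` nodes ?l)"
        by (rule lift_admissible[OF sC' _ iso_contract[OF s' s iso' G'] ad]) (simp add: gf sC)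
      moreover have "lift (contract \<Gamma>' (f ` G)) (lift \<Gamma>' ?g) ` lift \<Gamma> f ` nodes ?l = lift \<Gamma>' ?g ` lift \<Gamma> f ` nodes ?l"
        by (intro image_cong refl lift_contract[OF s' s iso' G'] admissible_node(1)[OF ad])
      ultimately show ?thesis unfolding gf inv[OF sub(1)] by simp
    qed
    have au: "admissible_tree (induced \<Gamma> G) (nodes ?u)" if "b (relabel (lift \<Gamma> f) ?u) \<noteq> 0"
    proof -
      have ad: "admissible_tree (induced \<Gamma>' (f ` G)) (lift \<Gamma> f ` nodes ?u)"
        using tree_spaceD(1)[OF b1 that] unfolding decorates_def nodes_relabel by blast
      have "admissible_tree (induced \<Gamma> (?g ` f ` G)) (lift (induced \<Gamma>' (f ` G)) ?g ` lift \<Gamma> f ` nodes ?u)"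
        by (rule lift_admissible[OF sI' _ iso_induced[OF s' s iso' tube_subset[OF s' G']] ad]) (simp add: gf sI)
      moreover have "lift (induced \<Gamma>' (f ` G)) ?g ` lift \<Gamma> f ` nodes ?u = lift \<Gamma>' ?g ` lift \<Gamma> f ` nodes ?u"
      proof (intro image_cong refl)
        fix N assume "N \<in> lift \<Gamma> f ` nodes ?u"
        then have NG: "N \<subseteq> \<Union>(f ` G)" using node_root[OF sI' ad] by simp
        show "lift (induced \<Gamma>' (f ` G)) ?g N = lift \<Gamma>' ?g N"
          unfolding lift_def leaves_in_tube[OF s' G' NG] ..
      qed
      ultimately show ?thesis unfolding gf inv[OF sub(2)] by simp
    qed
    show ?thesis unfolding lhs rhs el eu ru using True al au rl by auto
  qed
qed

lemma contractad_free: "contractad (free :: (_, 'k::field) contractad_data)"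
proof (rule contractadI, goal_cases)
  case 1
  show ?case by (rule graphical_free)
next
  case (2 \<Gamma> G i j a b)
  note s = connected_simple[OF 2(1)]
  show ?case
    using 2(3,4) pcomp_free_in[OF s 2(2)]
    unfolding homog_free[OF 2(1)] homog_free[OF connected_contract[OF 2(1,2)]]
      homog_free[OF connected_induced[OF s 2(2)]] by blast
next
  case (3 \<Gamma> G i j a)
  show ?case unfolding linear_on_def pcomp_free_raw by (simp add: fun_eq_iff fscale_def algebra_simps)
next
  case (4 \<Gamma> G i j b)
  show ?case unfolding linear_on_def pcomp_free_raw by (simp add: fun_eq_iff fscale_def algebra_simps)
next
  case (5 \<Gamma> \<Gamma>' f G i j a b)
  then show ?case by (rule free_equivariance)
next
  case (6 \<Gamma> K G i j k a b c)
  then show ?case by (rule free_sequential)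
next
  case (7 \<Gamma> G H i j k a b c)
  then show ?case by (rule free_parallel)
next
  case (8 \<Gamma>)
  have "(\<lambda>L :: unit decoration. if L = [] then 1 else 0) \<in> (tree_space \<Gamma> 0 :: (_ \<Rightarrow> 'k) set)"
    by (rule tree_spaceI)
      (use 8 in \<open>auto simp: decorates_def nodes_def admissible_tree_def tree_degree_def split: if_splits\<close>)
  then show ?case unfolding homog_free[OF 8(1)] iden_free .
next
  case (9 \<Gamma> \<Gamma>' f)
  have "admissible_tree \<Gamma> {}" using 9(3) by (simp add: admissible_tree_def)
  then show ?case unfolding pull_free iden_free by (auto simp: fun_eq_iff tree_pull_eq relabel_def nodes_def)
next
  case (10 \<Gamma> d x)
  note s = connected_simple[OF 10(1)]
  have x: "x \<in> tree_space \<Gamma> d" using 10 by (simp add: homog_free)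
  have "(\<lambda>L :: unit decoration. if L = [] then 1 else 0) \<in> (tree_space (contract \<Gamma> (verts \<Gamma>)) 0 :: (_ \<Rightarrow> 'k) set)"
    by (rule tree_spaceI)
      (auto simp: decorates_def nodes_def admissible_tree_def tree_degree_def verts_contract split: if_splits)
  moreover have "x \<in> tree_space (induced \<Gamma> (verts \<Gamma>)) d" unfolding induced_verts[OF s] by (rule x)
  ultimately have e1: "pcomp free \<Gamma> (verts \<Gamma>) 0 d (iden free (contract \<Gamma> (verts \<Gamma>))) x =
      (\<lambda>L. (if lower_part_of (verts \<Gamma>) L = [] then 1 else 0) * x (upper_part_of (verts \<Gamma>) L))"
    unfolding iden_free by (rule pcomp_free)
  have e2: "(if lower_part_of (verts \<Gamma>) L = [] then 1 else 0) * x (upper_part_of (verts \<Gamma>) L) = x L" for L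
  proof (cases "lower_part_of (verts \<Gamma>) L = []")
    case True
    then have "upper_part_of (verts \<Gamma>) L = L"
      unfolding lower_part_of_def upper_part_of_def filter_empty_conv filter_id_conv by auto
    then show ?thesis using True by simp
  next
    case False
    then have "nodes (lower_part_of (verts \<Gamma>) L) \<noteq> {}" by (simp add: nodes_def)
    then obtain N where "N \<in> nodes (lower_part_of (verts \<Gamma>) L)" by (metis ex_in_conv)
    then have N: "N \<in> nodes L" "\<not> N \<subseteq> \<Union>(verts \<Gamma>)" unfolding nodes_lower by simp_all
    have "x L = 0"
    proof (rule ccontr)
      assume "x L \<noteq> 0"
      then have "admissible_tree \<Gamma> (nodes L)" using tree_spaceD(1)[OF x] unfolding decorates_def by blast
      from node_root[OF s this N(1)] N(2) show False by simp
    qed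
    then show ?thesis using False by simp
  qed
  show ?case unfolding e1 by (rule ext) (rule e2)
next
  case (11 \<Gamma> v d x)
  note s = connected_simple[OF 11(1)]
  have x: "x \<in> tree_space \<Gamma> d" using 11 by (simp add: homog_free)
  then have "x \<in> tree_space (contract \<Gamma> {v}) d" unfolding contract_singleton[OF s 11(2)] .
  moreover have "(\<lambda>L :: unit decoration. if L = [] then 1 else 0) \<in> (tree_space (induced \<Gamma> {v}) 0 :: (_ \<Rightarrow> 'k) set)"
    by (rule tree_spaceI)
      (auto simp: decorates_def nodes_def admissible_tree_def tree_degree_def split: if_splits)
  ultimately have e1: "pcomp free \<Gamma> {v} d 0 x (iden free (induced \<Gamma> {v})) =
      (\<lambda>L. x (lower_part_of {v} L) * (if upper_part_of {v} L = [] then 1 else 0))"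
    unfolding iden_free by (rule pcomp_free)
  have e2: "x (lower_part_of {v} L) * (if upper_part_of {v} L = [] then 1 else 0) = x L" for L
  proof (cases "upper_part_of {v} L = []")
    case True
    then have "lower_part_of {v} L = L"
      unfolding lower_part_of_def upper_part_of_def filter_empty_conv filter_id_conv by auto
    then show ?thesis using True by simp
  next
    case False
    then have "nodes (upper_part_of {v} L) \<noteq> {}" by (simp add: nodes_def)
    then obtain N where "N \<in> nodes (upper_part_of {v} L)" by (metis ex_in_conv)
    then have N: "N \<in> nodes L" "N \<subseteq> v" unfolding nodes_upper by simp_all
    have "x L = 0"
    proof (rule ccontr)
      assume "x L \<noteq> 0"
      then have "admissible_tree \<Gamma> (nodes L)" using tree_spaceD(1)[OF x] unfolding decorates_def by blast
      from vert_node_proper[OF s this 11(2) N(1)] N(2) show False by simp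
    qed
    then show ?thesis using False by simp
  qed
  show ?case unfolding e1 by (rule ext) (rule e2)
qed

end

section \<open>Surjective images and linear algebra\<close>

text \<open>Every axiom is an equation or a membership between composites of elements; lifting the
  elements along \<phi> reduces it to the same axiom in \<open>P\<close>. In this way
  \<open>gcHyper\<close> inherits the axioms of the free contractad.\<close>

lemma contractad_image:
  fixes P :: "('b, 'k::field) contractad_data" and Q :: "('c, 'k) contractad_data"
  assumes P: "contractad P" and m: "contractad_morphism P Q \<phi>"
    and surj: "\<And>\<Gamma> d. connected_graph \<Gamma> \<Longrightarrow> \<phi> \<Gamma> d ` homog P \<Gamma> d = homog Q \<Gamma> d"
  shows "contractad Q"
proof -
  note c = P[unfolded contractad_def]
  note gr = c[THEN conjunct1, unfolded graphical_collection_def]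
  note sub = gr[THEN conjunct1, rule_format]
    and plin = gr[THEN conjunct2, THEN conjunct1, rule_format, OF conjI, OF _ conjI]
    and pcong = gr[THEN conjunct2, THEN conjunct2, THEN conjunct1, rule_format]
    and pid = gr[THEN conjunct2, THEN conjunct2, THEN conjunct2, THEN conjunct1, rule_format]
    and pcmp = gr[THEN conjunct2, THEN conjunct2, THEN conjunct2, THEN conjunct2, rule_format]
  note c2 = c[THEN conjunct2]
  note bil = c2[THEN conjunct1, rule_format, OF conjI]
  note c3 = c2[THEN conjunct2] note equiv = c3[THEN conjunct1, rule_format]
  note c4 = c3[THEN conjunct2] note seq = c4[THEN conjunct1, rule_format]
  note c5 = c4[THEN conjunct2] note par = c5[THEN conjunct1, rule_format]
  note c6 = c5[THEN conjunct2] note unit_in = c6[THEN conjunct1, rule_format, OF conjI]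
  note c7 = c6[THEN conjunct2] note unit_pull = c7[THEN conjunct1, rule_format]
  note c8 = c7[THEN conjunct2] note unit_left = c8[THEN conjunct1, rule_format]
  note unit_right = c8[THEN conjunct2, rule_format, OF conjI]
  note m0 = m[unfolded contractad_morphism_def]
  note mlin = m0[THEN conjunct1, rule_format, THEN conjunct1]
  note mpull = m0[THEN conjunct2, THEN conjunct1, rule_format, OF conjI, OF _ conjI]
  note mcomp = m0[THEN conjunct2, THEN conjunct2, THEN conjunct1, rule_format, OF conjI]
  note miden = m0[THEN conjunct2, THEN conjunct2, THEN conjunct2, rule_format, OF conjI]
  have madd: "\<phi> \<Gamma> d (x + y) = \<phi> \<Gamma> d x + \<phi> \<Gamma> d y"
    and mscale: "\<phi> \<Gamma> d (fscale r x) = fscale r (\<phi> \<Gamma> d x)"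
    if "connected_graph \<Gamma>" "x \<in> homog P \<Gamma> d" "y \<in> homog P \<Gamma> d" for \<Gamma> d x y r
    using mlin[OF that(1), of d] that(2,3) unfolding linear_on_def by blast+
  have into: "\<phi> \<Gamma> d x \<in> homog Q \<Gamma> d" if "connected_graph \<Gamma>" "x \<in> homog P \<Gamma> d" for \<Gamma> d x
    using surj[OF that(1), of d] that(2) by blast
  have pre: "\<exists>x'\<in>homog P \<Gamma> d. x = \<phi> \<Gamma> d x'" if "connected_graph \<Gamma>" "x \<in> homog Q \<Gamma> d" for \<Gamma> d x
    using surj[OF that(1), of d] that(2) by blast
  have add: "x + y \<in> homog P \<Gamma> d" and scale: "fscale r x \<in> homog P \<Gamma> d"
    if "connected_graph \<Gamma>" "x \<in> homog P \<Gamma> d" "y \<in> homog P \<Gamma> d" for \<Gamma> d x y r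
    using fs.subspace_add[OF sub[OF that(1)] that(2,3)] fs.subspace_scale[OF sub[OF that(1)] that(2)] by blast+
  have pin: "pull P \<Gamma> \<Gamma>' f d x \<in> homog P \<Gamma> d"
    and padd: "pull P \<Gamma> \<Gamma>' f d (x + y) = pull P \<Gamma> \<Gamma>' f d x + pull P \<Gamma> \<Gamma>' f d y"
    and pscale: "pull P \<Gamma> \<Gamma>' f d (fscale r x) = fscale r (pull P \<Gamma> \<Gamma>' f d x)"
    if "connected_graph \<Gamma>" "connected_graph \<Gamma>'" "graph_iso \<Gamma> \<Gamma>' f" "x \<in> homog P \<Gamma>' d" "y \<in> homog P \<Gamma>' d"
    for \<Gamma> \<Gamma>' f d x y r
    using plin[OF that(1-3), of d] that(4,5) unfolding linear_on_def by blast+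
  show ?thesis
  proof (rule contractadI, goal_cases)
    case 1
    show ?case
    proof (rule graphical_collectionI, goal_cases)
      case (1 \<Gamma> d)
      show ?case
      proof (rule fs.subspaceI)
        have "(0 :: 'b \<Rightarrow> 'k) \<in> homog P \<Gamma> d" by (rule fs.subspace_0[OF sub[OF 1]])
        then have "\<phi> \<Gamma> d (fscale 0 0) = fscale 0 (\<phi> \<Gamma> d 0)" using mscale[OF 1] by blast
        then have "\<phi> \<Gamma> d 0 = 0" by (simp add: fs.scale_zero_left)
        then show "0 \<in> homog Q \<Gamma> d" using into[OF 1 \<open>0 \<in> homog P \<Gamma> d\<close>] by simp
        fix x y r assume x: "x \<in> homog Q \<Gamma> d"
        then obtain x' where x': "x' \<in> homog P \<Gamma> d" "x = \<phi> \<Gamma> d x'" using pre[OF 1] by blast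
        show "fscale r x \<in> homog Q \<Gamma> d"
          using into[OF 1 scale[OF 1 x'(1) x'(1)]] mscale[OF 1 x'(1) x'(1)] x'(2) by simp
        assume "y \<in> homog Q \<Gamma> d"
        then obtain y' where y': "y' \<in> homog P \<Gamma> d" "y = \<phi> \<Gamma> d y'" using pre[OF 1] by blast
        show "x + y \<in> homog Q \<Gamma> d"
          using into[OF 1 add[OF 1 x'(1) y'(1)]] madd[OF 1 x'(1) y'(1)] x'(2) y'(2) by simp
      qed
    next
      case (2 \<Gamma> \<Gamma>' f d)
      show ?case unfolding linear_on_def
      proof (intro conjI ballI allI)
        fix x r assume "x \<in> homog Q \<Gamma>' d"
        then obtain x' where x': "x' \<in> homog P \<Gamma>' d" "x = \<phi> \<Gamma>' d x'" using pre[OF 2(2)] by blast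
        note px = pin[OF 2 x'(1) x'(1)]
        show "pull Q \<Gamma> \<Gamma>' f d (fscale r x) = fscale r (pull Q \<Gamma> \<Gamma>' f d x)"
          unfolding x'(2) mscale[OF 2(2) x'(1) x'(1), symmetric] mpull[OF 2 scale[OF 2(2) x'(1) x'(1)], symmetric]
            mpull[OF 2 x'(1), symmetric] pscale[OF 2 x'(1) x'(1)] mscale[OF 2(1) px px] ..
        fix y assume "y \<in> homog Q \<Gamma>' d"
        then obtain y' where y': "y' \<in> homog P \<Gamma>' d" "y = \<phi> \<Gamma>' d y'" using pre[OF 2(2)] by blast
        note py = pin[OF 2 y'(1) y'(1)]
        show "pull Q \<Gamma> \<Gamma>' f d (x + y) = pull Q \<Gamma> \<Gamma>' f d x + pull Q \<Gamma> \<Gamma>' f d y"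
          unfolding x'(2) y'(2) madd[OF 2(2) x'(1) y'(1), symmetric] mpull[OF 2 add[OF 2(2) x'(1) y'(1)], symmetric]
            mpull[OF 2 x'(1), symmetric] mpull[OF 2 y'(1), symmetric] padd[OF 2 x'(1) y'(1)] madd[OF 2(1) px py] ..
      qed
    next
      case (3 \<Gamma> \<Gamma>' f d x)
      then obtain x' where x': "x' \<in> homog P \<Gamma>' d" "x = \<phi> \<Gamma>' d x'" using pre by blast
      show ?case unfolding x'(2) mpull[OF 3(1-3) x'(1), symmetric]
        by (rule into[OF 3(1) pin[OF 3(1-3) x'(1) x'(1)]])
    next
      case (4 \<Gamma> \<Gamma>' f g d x)
      then obtain x' where x': "x' \<in> homog P \<Gamma>' d" "x = \<phi> \<Gamma>' d x'" using pre by blast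
      \<comment> \<open>\<open>g\<close> must itself be known to be an isomorphism before \<phi> can
        be moved past the pullback along it.\<close>
      have g: "graph_iso \<Gamma> \<Gamma>' g" using 4(3,4) unfolding graph_iso_def
        by (metis (no_types, lifting) bij_betw_cong)
      have "pull P \<Gamma> \<Gamma>' f d x' = pull P \<Gamma> \<Gamma>' g d x'" using pcong[of \<Gamma> \<Gamma>' f g x' d] 4(1-4) x'(1) by blast
      then show ?case unfolding x'(2) mpull[OF 4(1-3) x'(1), symmetric] mpull[OF 4(1,2) g x'(1), symmetric] by simp
    next
      case (5 \<Gamma> d x)
      then obtain x' where x': "x' \<in> homog P \<Gamma> d" "x = \<phi> \<Gamma> d x'" using pre by blast
      have "graph_iso \<Gamma> \<Gamma> id" unfolding graph_iso_def by simp
      from mpull[OF 5(1) 5(1) this x'(1)] show ?case unfolding x'(2) pid[OF 5(1) x'(1)] by simp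
    next
      case (6 \<Gamma> \<Gamma>' \<Gamma>'' f g d x)
      then obtain x' where x': "x' \<in> homog P \<Gamma>'' d" "x = \<phi> \<Gamma>'' d x'" using pre by blast
      have gf: "graph_iso \<Gamma> \<Gamma>'' (g \<circ> f)"
        using 6(4,5) bij_betwE[of f] unfolding graph_iso_def by (auto intro: bij_betw_trans)
      have "pull P \<Gamma> \<Gamma>'' (g \<circ> f) d x' = pull P \<Gamma> \<Gamma>' f d (pull P \<Gamma>' \<Gamma>'' g d x')"
        using pcmp[of \<Gamma> \<Gamma>' \<Gamma>'' f g x' d] 6(1-5) x'(1) by blast
      then show ?case
        unfolding x'(2) mpull[OF 6(1,3) gf x'(1), symmetric] mpull[OF 6(2,3,5) x'(1), symmetric]
          mpull[OF 6(1,2,4) pin[OF 6(2,3,5) x'(1) x'(1)], symmetric] by simp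
    qed
  next
    case (2 \<Gamma> G i j a b)
    note cc = connected_contract[OF 2(1,2)] and ci = connected_induced[OF connected_simple[OF 2(1)] 2(2)]
    obtain a' where a': "a' \<in> homog P (contract \<Gamma> G) i" "a = \<phi> (contract \<Gamma> G) i a'" using pre[OF cc 2(3)] by blast
    obtain b' where b': "b' \<in> homog P (induced \<Gamma> G) j" "b = \<phi> (induced \<Gamma> G) j b'" using pre[OF ci 2(4)] by blast
    have "pcomp P \<Gamma> G i j a' b' \<in> homog P \<Gamma> (i + j)" using bil[OF 2(1,2)] a'(1) b'(1) by blast
    from into[OF 2(1) this] show ?case unfolding a'(2) b'(2) mcomp[OF 2(1,2) a'(1) b'(1)] .
  next
    case (3 \<Gamma> G i j a)
    note cc = connected_contract[OF 3(1,2)] and ci = connected_induced[OF connected_simple[OF 3(1)] 3(2)]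
    obtain a' where a': "a' \<in> homog P (contract \<Gamma> G) i" "a = \<phi> (contract \<Gamma> G) i a'" using pre[OF cc 3(3)] by blast
    have l: "linear_on (homog P (induced \<Gamma> G) j) (pcomp P \<Gamma> G i j a')" using bil[OF 3(1,2)] a'(1) by blast
    have cin: "pcomp P \<Gamma> G i j a' b' \<in> homog P \<Gamma> (i + j)" if "b' \<in> homog P (induced \<Gamma> G) j" for b'
      using bil[OF 3(1,2)] a'(1) that by blast
    show ?case unfolding linear_on_def
    proof (intro conjI ballI allI)
      fix x r assume "x \<in> homog Q (induced \<Gamma> G) j"
      then obtain x' where x': "x' \<in> homog P (induced \<Gamma> G) j" "x = \<phi> (induced \<Gamma> G) j x'" using pre[OF ci] by blast
      have lx: "pcomp P \<Gamma> G i j a' (fscale r x') = fscale r (pcomp P \<Gamma> G i j a' x')"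
        using l x'(1) unfolding linear_on_def by blast
      show "pcomp Q \<Gamma> G i j a (fscale r x) = fscale r (pcomp Q \<Gamma> G i j a x)"
        unfolding x'(2) a'(2) mscale[OF ci x'(1) x'(1), symmetric] mcomp[OF 3(1,2) a'(1) x'(1), symmetric]
          mcomp[OF 3(1,2) a'(1) scale[OF ci x'(1) x'(1)], symmetric] lx mscale[OF 3(1) cin[OF x'(1)] cin[OF x'(1)]] ..
      fix y assume "y \<in> homog Q (induced \<Gamma> G) j"
      then obtain y' where y': "y' \<in> homog P (induced \<Gamma> G) j" "y = \<phi> (induced \<Gamma> G) j y'" using pre[OF ci] by blast
      have ly: "pcomp P \<Gamma> G i j a' (x' + y') = pcomp P \<Gamma> G i j a' x' + pcomp P \<Gamma> G i j a' y'"
        using l x'(1) y'(1) unfolding linear_on_def by blast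
      show "pcomp Q \<Gamma> G i j a (x + y) = pcomp Q \<Gamma> G i j a x + pcomp Q \<Gamma> G i j a y"
        unfolding x'(2) y'(2) a'(2) madd[OF ci x'(1) y'(1), symmetric] mcomp[OF 3(1,2) a'(1) x'(1), symmetric]
          mcomp[OF 3(1,2) a'(1) y'(1), symmetric]
          mcomp[OF 3(1,2) a'(1) add[OF ci x'(1) y'(1)], symmetric] ly madd[OF 3(1) cin[OF x'(1)] cin[OF y'(1)]] ..
    qed
  next
    case (4 \<Gamma> G i j b)
    note cc = connected_contract[OF 4(1,2)] and ci = connected_induced[OF connected_simple[OF 4(1)] 4(2)]
    obtain b' where b': "b' \<in> homog P (induced \<Gamma> G) j" "b = \<phi> (induced \<Gamma> G) j b'" using pre[OF ci 4(3)] by blast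
    have l: "linear_on (homog P (contract \<Gamma> G) i) (\<lambda>a. pcomp P \<Gamma> G i j a b')" using bil[OF 4(1,2)] b'(1) by blast
    have cin: "pcomp P \<Gamma> G i j a' b' \<in> homog P \<Gamma> (i + j)" if "a' \<in> homog P (contract \<Gamma> G) i" for a'
      using bil[OF 4(1,2)] b'(1) that by blast
    show ?case unfolding linear_on_def
    proof (intro conjI ballI allI)
      fix x r assume "x \<in> homog Q (contract \<Gamma> G) i"
      then obtain x' where x': "x' \<in> homog P (contract \<Gamma> G) i" "x = \<phi> (contract \<Gamma> G) i x'" using pre[OF cc] by blast
      have lx: "pcomp P \<Gamma> G i j (fscale r x') b' = fscale r (pcomp P \<Gamma> G i j x' b')"
        using l x'(1) unfolding linear_on_def by blast
      show "pcomp Q \<Gamma> G i j (fscale r x) b = fscale r (pcomp Q \<Gamma> G i j x b)"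
        unfolding x'(2) b'(2) mscale[OF cc x'(1) x'(1), symmetric] mcomp[OF 4(1,2) x'(1) b'(1), symmetric]
          mcomp[OF 4(1,2) scale[OF cc x'(1) x'(1)] b'(1), symmetric] lx mscale[OF 4(1) cin[OF x'(1)] cin[OF x'(1)]] ..
      fix y assume "y \<in> homog Q (contract \<Gamma> G) i"
      then obtain y' where y': "y' \<in> homog P (contract \<Gamma> G) i" "y = \<phi> (contract \<Gamma> G) i y'" using pre[OF cc] by blast
      have ly: "pcomp P \<Gamma> G i j (x' + y') b' = pcomp P \<Gamma> G i j x' b' + pcomp P \<Gamma> G i j y' b'"
        using l x'(1) y'(1) unfolding linear_on_def by blast
      show "pcomp Q \<Gamma> G i j (x + y) b = pcomp Q \<Gamma> G i j x b + pcomp Q \<Gamma> G i j y b"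
        unfolding x'(2) y'(2) b'(2) madd[OF cc x'(1) y'(1), symmetric] mcomp[OF 4(1,2) x'(1) b'(1), symmetric]
          mcomp[OF 4(1,2) y'(1) b'(1), symmetric]
          mcomp[OF 4(1,2) add[OF cc x'(1) y'(1)] b'(1), symmetric] ly madd[OF 4(1) cin[OF x'(1)] cin[OF y'(1)]] ..
    qed
  next
    case (5 \<Gamma> \<Gamma>' f G i j a b)
    note s = connected_simple[OF 5(1)] and s' = connected_simple[OF 5(2)]
    note G' = tube_iso[OF s s' 5(3,4)]
    note cc = connected_contract[OF 5(1,4)] and ci = connected_induced[OF s 5(4)]
    note cc' = connected_contract[OF 5(2) G'] and ci' = connected_induced[OF s' G']
    note ic = iso_contract[OF s s' 5(3,4)] and ii = iso_induced[OF s s' 5(3) tube_subset[OF s 5(4)]]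
    obtain a' where a': "a' \<in> homog P (contract \<Gamma>' (f ` G)) i" "a = \<phi> (contract \<Gamma>' (f ` G)) i a'" using pre[OF cc' 5(5)] by blast
    obtain b' where b': "b' \<in> homog P (induced \<Gamma>' (f ` G)) j" "b = \<phi> (induced \<Gamma>' (f ` G)) j b'" using pre[OF ci' 5(6)] by blast
    have cin: "pcomp P \<Gamma>' (f ` G) i j a' b' \<in> homog P \<Gamma>' (i + j)" using bil[OF 5(2) G'] a'(1) b'(1) by blast
    have e: "pull P \<Gamma> \<Gamma>' f (i + j) (pcomp P \<Gamma>' (f ` G) i j a' b') =
        pcomp P \<Gamma> G i j (pull P (contract \<Gamma> G) (contract \<Gamma>' (f ` G)) (lift \<Gamma> f) i a')
          (pull P (induced \<Gamma> G) (induced \<Gamma>' (f ` G)) f j b')"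
      using equiv[of \<Gamma> \<Gamma>' f G a' i b' j] 5(1-4) a'(1) b'(1) by blast
    show ?case
      unfolding a'(2) b'(2) mcomp[OF 5(2) G' a'(1) b'(1), symmetric] mpull[OF 5(1-3) cin, symmetric] e
        mpull[OF cc cc' ic a'(1), symmetric] mpull[OF ci ci' ii b'(1), symmetric]
      by (rule mcomp[OF 5(1,4) pin[OF cc cc' ic a'(1) a'(1)] pin[OF ci ci' ii b'(1) b'(1)]])
  next
    case (6 \<Gamma> K G i j k a b c)
    note s = connected_simple[OF 6(1)]
    note cG = connected_induced[OF s 6(3)]
    note tK = tube_induced[OF s 6(2-4)] and tG = tube_contract_tube[OF s 6(2-4)]
    note cK = connected_contract[OF 6(1,2)]
    obtain a' where a': "a' \<in> homog P (contract \<Gamma> G) i" "a = \<phi> (contract \<Gamma> G) i a'"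
      using pre[OF connected_contract[OF 6(1,3)] 6(5)] by blast
    obtain b' where b': "b' \<in> homog P (contract (induced \<Gamma> G) K) j" "b = \<phi> (contract (induced \<Gamma> G) K) j b'"
      using pre[OF connected_contract[OF cG tK] 6(6)] by blast
    obtain c' where c': "c' \<in> homog P (induced \<Gamma> K) k" "c = \<phi> (induced \<Gamma> K) k c'"
      using pre[OF connected_induced[OF s 6(2)] 6(7)] by blast
    note e1 = contract_contract[OF s 6(2-4)] and e2 = induced_contract[OF s 6(2-4)] and e3 = induced_induced[OF 6(4)]
    note m1 = mcomp[OF cK tG, unfolded e1 e2, OF a'(1) b'(1)]
    note m2 = mcomp[OF cG tK, unfolded e3, OF b'(1) c'(1)]
    have i1: "pcomp P (contract \<Gamma> K) (contract_tube K G) i j a' b' \<in> homog P (contract \<Gamma> K) (i + j)"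
      using bil[OF cK tG, unfolded e1 e2] a'(1) b'(1) by blast
    have i2: "pcomp P (induced \<Gamma> G) K j k b' c' \<in> homog P (induced \<Gamma> G) (j + k)"
      using bil[OF cG tK, unfolded e3] b'(1) c'(1) by blast
    have e: "pcomp P \<Gamma> K (i + j) k (pcomp P (contract \<Gamma> K) (contract_tube K G) i j a' b') c' =
        pcomp P \<Gamma> G i (j + k) a' (pcomp P (induced \<Gamma> G) K j k b' c')"
      using seq[of \<Gamma> K G a' i b' j c' k] 6(1-4) a'(1) b'(1) c'(1) by blast
    show ?case
      unfolding a'(2) b'(2) c'(2) m1[symmetric] m2[symmetric]
        mcomp[OF 6(1,2) i1 c'(1), symmetric] mcomp[OF 6(1,3) a'(1) i2, symmetric] e
      by (simp add: add.assoc)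
  next
    case (7 \<Gamma> G H i j k a b c)
    note s = connected_simple[OF 7(1)]
    have HG: "H \<inter> G = {}" using 7(4) by blast
    note tH = tube_contract_disjoint[OF s 7(2-4)] and tG = tube_contract_disjoint[OF s 7(3,2) HG]
    note cG = connected_contract[OF 7(1,2)] and cH = connected_contract[OF 7(1,3)]
    obtain a' where a': "a' \<in> homog P (contract (contract \<Gamma> G) H) i" "a = \<phi> (contract (contract \<Gamma> G) H) i a'"
      using pre[OF connected_contract[OF cG tH] 7(5)] by blast
    obtain b' where b': "b' \<in> homog P (induced \<Gamma> G) j" "b = \<phi> (induced \<Gamma> G) j b'"
      using pre[OF connected_induced[OF s 7(2)] 7(6)] by blast
    obtain c' where c': "c' \<in> homog P (induced \<Gamma> H) k" "c = \<phi> (induced \<Gamma> H) k c'"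
      using pre[OF connected_induced[OF s 7(3)] 7(7)] by blast
    note e1 = contract_commute[OF s 7(2-4), symmetric] and e2 = induced_contract_disjoint[OF s 7(3,2) HG]
      and e3 = induced_contract_disjoint[OF s 7(2-4)]
    note m1 = mcomp[OF cH tG, unfolded e1 e2, OF a'(1) b'(1)]
    note m2 = mcomp[OF cG tH, unfolded e3, OF a'(1) c'(1)]
    have i1: "pcomp P (contract \<Gamma> H) G i j a' b' \<in> homog P (contract \<Gamma> H) (i + j)"
      using bil[OF cH tG, unfolded e1 e2] a'(1) b'(1) by blast
    have i2: "pcomp P (contract \<Gamma> G) H i k a' c' \<in> homog P (contract \<Gamma> G) (i + k)"
      using bil[OF cG tH, unfolded e3] a'(1) c'(1) by blast
    have i3: "pcomp P \<Gamma> G (i + k) j (pcomp P (contract \<Gamma> G) H i k a' c') b' \<in> homog P \<Gamma> (i + k + j)"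
      using bil[OF 7(1,2)] i2 b'(1) by blast
    have e: "pcomp P \<Gamma> H (i + j) k (pcomp P (contract \<Gamma> H) G i j a' b') c' =
        fscale (sgnp (j * k)) (pcomp P \<Gamma> G (i + k) j (pcomp P (contract \<Gamma> G) H i k a' c') b')"
      using par[of \<Gamma> G H a' i b' j c' k] 7(1-4) a'(1) b'(1) c'(1) by blast
    \<comment> \<open>The two composites have their degrees summed in different orders, and \<phi>
      takes the degree as an argument.\<close>
    have d: "i + j + k = i + k + j" by simp
    show ?case
      unfolding a'(2) b'(2) c'(2) m1[symmetric] m2[symmetric]
        mcomp[OF 7(1,3) i1 c'(1), symmetric] mcomp[OF 7(1,2) i2 b'(1), symmetric] e d
      by (rule mscale[OF 7(1) i3 i3])
  next
    case (8 \<Gamma>)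
    show ?case using into[OF 8(1) unit_in[OF 8]] unfolding miden[OF 8] .
  next
    case (9 \<Gamma> \<Gamma>' f)
    have c1: "card (verts \<Gamma>') = 1"
      using 9(3) iso_card[OF connected_simple[OF 9(1)] connected_simple[OF 9(2)] 9(4)] by simp
    have "pull P \<Gamma> \<Gamma>' f 0 (iden P \<Gamma>') = iden P \<Gamma>" using unit_pull[of \<Gamma> \<Gamma>' f] 9 by blast
    then show ?case
      unfolding miden[OF 9(1,3), symmetric] miden[OF 9(2) c1, symmetric]
        mpull[OF 9(1,2,4) unit_in[OF 9(2) c1], symmetric] by simp
  next
    case (10 \<Gamma> d x)
    then obtain x' where x': "x' \<in> homog P \<Gamma> d" "x = \<phi> \<Gamma> d x'" using pre by blast
    note t = tube_verts[OF 10(1)] and s = connected_simple[OF 10(1)]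
    have c1: "card (verts (contract \<Gamma> (verts \<Gamma>))) = 1" by (simp add: verts_contract)
    note cc = connected_contract[OF 10(1) t]
    from mcomp[OF 10(1) t unit_in[OF cc c1], unfolded induced_verts[OF s], OF x'(1)] unit_left[OF 10(1) x'(1)]
    show ?case unfolding miden[OF cc c1, symmetric] x'(2) by simp
  next
    case (11 \<Gamma> v d x)
    then obtain x' where x': "x' \<in> homog P \<Gamma> d" "x = \<phi> \<Gamma> d x'" using pre by blast
    note s = connected_simple[OF 11(1)]
    note t = tube_singleton[OF s 11(2)]
    have c1: "card (verts (induced \<Gamma> {v})) = 1" by simp
    note ci = connected_induced[OF s t]
    from mcomp[OF 11(1) t, unfolded contract_singleton[OF s 11(2)], OF x'(1) unit_in[OF ci c1]] unit_right[OF 11(1,2) x'(1)]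
    show ?case unfolding miden[OF ci c1, symmetric] x'(2) by simp
  qed
qed

section \<open>Linear functionals on function spaces\<close>

definition functional :: "(('b \<Rightarrow> 'k::field) \<Rightarrow> 'k) \<Rightarrow> bool" where
  "functional g \<longleftrightarrow> (\<forall>x y. g (x + y) = g x + g y) \<and> (\<forall>c x. g (fscale c x) = c * g x)"

lemma functional_zero:
  assumes "functional g"
  shows "g 0 = 0"
proof -
  have "g (fscale 0 0) = 0 * g 0" using assms unfolding functional_def by blast
  then show ?thesis by (simp only: fs.scale_zero_left mult_zero_left)
qed

lemma functional_sum:
  assumes g: "functional g"
  shows "g (\<Sum>i\<in>A. fscale (c i) (v i)) = (\<Sum>i\<in>A. c i * g (v i))"
proof (induction A rule: infinite_finite_induct)
  case (infinite A)
  show ?case unfolding sum.infinite[OF infinite] by (rule functional_zero[OF g])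
next
  case empty
  show ?case unfolding sum.empty by (rule functional_zero[OF g])
next
  case (insert x F)
  have "g (\<Sum>i\<in>insert x F. fscale (c i) (v i)) = g (fscale (c x) (v x) + (\<Sum>i\<in>F. fscale (c i) (v i)))"
    by (simp only: sum.insert[OF insert.hyps])
  also have "\<dots> = c x * g (v x) + g (\<Sum>i\<in>F. fscale (c i) (v i))" using g unfolding functional_def by metis
  finally show ?case by (simp only: sum.insert[OF insert.hyps] insert.IH)
qed

lemma functional_extend_independent:
  fixes f :: "('b \<Rightarrow> 'k::field) \<Rightarrow> 'k"
  assumes "fs.independent B"
  shows "\<exists>g. functional g \<and> (\<forall>x\<in>B. g x = f x)"
proof -
  interpret vk: vector_space "(*) :: 'k \<Rightarrow> 'k \<Rightarrow> 'k" by unfold_locales (simp_all add: algebra_simps)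
  interpret vp: vector_space_pair "fscale :: 'k \<Rightarrow> ('b \<Rightarrow> 'k) \<Rightarrow> 'b \<Rightarrow> 'k" "(*) :: 'k \<Rightarrow> 'k \<Rightarrow> 'k" ..
  obtain g where "Vector_Spaces.linear (fscale :: 'k \<Rightarrow> ('b \<Rightarrow> 'k) \<Rightarrow> 'b \<Rightarrow> 'k) (*) g" "\<forall>x\<in>B. g x = f x"
    using vp.linear_independent_extend[OF assms] by blast
  then show ?thesis unfolding functional_def Vector_Spaces.linear_iff by blast
qed

text \<open>Elements of the dual are linear only on a subspace \<open>S\<close>. Prescribing the
  values on a basis of \<open>S\<close> yields a functional on the ambient space that agrees with
  them on \<open>S\<close>.\<close>

lemma functional_extend:
  assumes S: "fs.subspace S" and add: "\<And>x y. x \<in> S \<Longrightarrow> y \<in> S \<Longrightarrow> f (x + y) = f x + f y"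
    and scale: "\<And>c x. x \<in> S \<Longrightarrow> f (fscale c x) = c * f x"
  shows "\<exists>g. functional g \<and> (\<forall>x\<in>S. g x = f x)"
proof -
  obtain B where B: "B \<subseteq> S" "fs.independent B" "S \<subseteq> fs.span B" using fs.maximal_independent_subset by blast
  obtain g where g: "functional g" "\<forall>x\<in>B. g x = f x" using functional_extend_independent[OF B(2), of f] by blast
  have "x \<in> S \<and> g x = f x" if "x \<in> fs.span B" for x
    using that
  proof (rule fs.span_induct[of x B "\<lambda>x. x \<in> S \<and> g x = f x"])
    have "0 \<in> S" by (rule fs.subspace_0[OF S])
    moreover have "g 0 = 0" by (rule functional_zero[OF g(1)])
    moreover have "f (fscale 0 0) = 0 * f 0" by (rule scale[OF calculation(1)])
    then have "f 0 = 0" by (simp only: fs.scale_zero_left mult_zero_left)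
    ultimately show "fs.subspace {x. x \<in> S \<and> g x = f x}"
      using S g(1) add scale unfolding functional_def fs.subspace_def by simp
    show "x \<in> S \<and> g x = f x" if "x \<in> B" for x using that B g by blast
  qed
  then show ?thesis using g B by blast
qed

text \<open>\<open>F\<close> can be added to a basis of \<open>S\<close>; prescribe 0 on the basis
  and 1 on \<open>F\<close>.\<close>

lemma functional_separate:
  assumes S: "fs.subspace S" and F: "F \<notin> S"
  shows "\<exists>g. functional g \<and> (\<forall>x\<in>S. g x = 0) \<and> g F \<noteq> 0"
proof -
  obtain B where B: "B \<subseteq> S" "fs.independent B" "S \<subseteq> fs.span B" using fs.maximal_independent_subset by blast
  have sp: "fs.span B = S" using B fs.span_minimal[OF B(1) S] by blast
  then have "fs.independent (insert F B)" using B F fs.independent_insertI by blast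
  then obtain g where g: "functional g" "\<forall>x\<in>insert F B. g x = (if x = F then 1 else 0)"
    using functional_extend_independent[of "insert F B" "\<lambda>x. if x = F then 1 else 0"] by blast
  have "g x = 0" if "x \<in> fs.span B" for x
    using that
  proof (rule fs.span_induct[of x B "\<lambda>x. g x = 0"])
    show "fs.subspace {x. g x = 0}"
      using g(1) functional_zero[OF g(1)] unfolding functional_def fs.subspace_def by simp
    show "g x = 0" if "x \<in> B" for x using that g F B by auto
  qed
  then show ?thesis using g sp by auto
qed

text \<open>Gaussian elimination: subtracting a rank one tensor removes a row and a column.\<close>

lemma tensor_of_slices:
  fixes X :: "'b \<times> 'c \<Rightarrow> 'k::field"
  assumes U: "fs.subspace U" and W: "fs.subspace W"
    and fin: "finite {y. \<exists>z. X (y, z) \<noteq> 0}"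
    and u: "\<And>z. (\<lambda>y. X (y, z)) \<in> U" and w: "\<And>y. (\<lambda>z. X (y, z)) \<in> W"
  shows "X \<in> tensor U W"
  using fin u w
proof (induction "card {y. \<exists>z. X (y, z) \<noteq> 0}" arbitrary: X rule: less_induct)
  case less
  show ?case
  proof (cases "\<exists>y z. X (y, z) \<noteq> 0")
    case False
    then have "X = 0" by auto
    then show ?thesis unfolding tensor_def by (simp only: fs.span_zero)
  next
    case True
    then obtain y0 z0 where n: "X (y0, z0) \<noteq> 0" by blast
    \<comment> \<open>The normalisation makes \<open>v y0 = 1\<close>, so \<open>Y\<close> vanishes
      on the row \<open>y0\<close> and gains no new row: the number of non-zero rows drops.\<close>
    define v where "v = fscale (inverse (X (y0, z0))) (\<lambda>y. X (y, z0))"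
    define w0 where "w0 = (\<lambda>z. X (y0, z))"
    define R where "R = (\<lambda>(y, z). v y * w0 z)"
    define Y where "Y = (\<lambda>(y, z). X (y, z) - R (y, z))"
    have vU: "v \<in> U" unfolding v_def by (intro fs.subspace_scale[OF U] less.prems)
    have wW: "w0 \<in> W" unfolding w0_def by (rule less.prems)
    have sub: "{y. \<exists>z. Y (y, z) \<noteq> 0} \<subseteq> {y. \<exists>z. X (y, z) \<noteq> 0} - {y0}"
    proof
      fix y assume "y \<in> {y. \<exists>z. Y (y, z) \<noteq> 0}"
      then obtain z where z: "Y (y, z) \<noteq> 0" by blast
      have "y \<noteq> y0" using z n unfolding Y_def R_def v_def w0_def fscale_def by auto
      moreover have "X (y, z) \<noteq> 0 \<or> X (y, z0) \<noteq> 0" using z unfolding Y_def R_def v_def fscale_def by auto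
      ultimately show "y \<in> {y. \<exists>z. X (y, z) \<noteq> 0} - {y0}" by blast
    qed
    have "{y. \<exists>z. Y (y, z) \<noteq> 0} \<subset> {y. \<exists>z. X (y, z) \<noteq> 0}" using sub n by blast
    then have card: "card {y. \<exists>z. Y (y, z) \<noteq> 0} < card {y. \<exists>z. X (y, z) \<noteq> 0}"
      by (rule psubset_card_mono[OF less.prems(1)])
    have YU: "(\<lambda>y. Y (y, z)) \<in> U" for z
    proof -
      have "(\<lambda>y. Y (y, z)) = (\<lambda>y. X (y, z)) - fscale (w0 z) v"
        unfolding Y_def R_def fscale_def by (auto simp: fun_eq_iff)
      then show ?thesis using fs.subspace_diff[OF U less.prems(2) fs.subspace_scale[OF U vU]] by simp
    qed
    have YW: "(\<lambda>z. Y (y, z)) \<in> W" for y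
    proof -
      have "(\<lambda>z. Y (y, z)) = (\<lambda>z. X (y, z)) - fscale (v y) w0"
        unfolding Y_def R_def fscale_def by (auto simp: fun_eq_iff)
      then show ?thesis using fs.subspace_diff[OF W less.prems(3) fs.subspace_scale[OF W wW]] by simp
    qed
    have "Y \<in> tensor U W"
      by (rule less.hyps[OF card _ YU YW]) (rule finite_subset[OF sub], simp add: less.prems(1))
    moreover have "R \<in> tensor U W"
      unfolding R_def tensor_def by (rule fs.span_base) (use vU wW in blast)
    ultimately have "Y + R \<in> tensor U W" unfolding tensor_def by (rule fs.span_add)
    moreover have "Y + R = X" unfolding Y_def by auto
    ultimately show ?thesis by simp
  qed
qed

section \<open>The double suspension\<close>

lemma sgnp_add: "sgnp (a + b) = (sgnp a * sgnp b :: 'k::field)"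
  by (simp add: sgnp_def)

lemma sgnp_square [simp]: "sgnp a * sgnp a = (1 :: 'k::field)"
  by (simp add: sgnp_def)

lemma sgnp_cong: "even (a - b) \<Longrightarrow> sgnp a = (sgnp b :: 'k::field)"
  by (simp add: sgnp_def)

section \<open>Signs of reorderings\<close>

lemma before_Nil [simp]: "\<not> before [] a b"
  by (simp add: before_def)

lemma before_Cons [simp]: "before (x # xs) a b \<longleftrightarrow> (a = x \<and> b \<in> set xs) \<or> before xs a b"
proof
  assume "before (x # xs) a b"
  then obtain p q where pq: "p < q" "q < length (x # xs)" "(x # xs) ! p = a" "(x # xs) ! q = b"
    unfolding before_def by blast
  then obtain q' where q: "q = Suc q'" by (cases q) auto
  show "(a = x \<and> b \<in> set xs) \<or> before xs a b"
  proof (cases p)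
    case 0
    then show ?thesis using pq q by auto
  next
    case (Suc p')
    then have "p' < q'" "q' < length xs" "xs ! p' = a" "xs ! q' = b" using pq q by auto
    then show ?thesis unfolding before_def by blast
  qed
next
  assume "(a = x \<and> b \<in> set xs) \<or> before xs a b"
  then show "before (x # xs) a b"
  proof
    assume "a = x \<and> b \<in> set xs"
    then obtain i where "i < length xs" "xs ! i = b" "a = x" by (auto simp: in_set_conv_nth)
    then have "0 < Suc i \<and> Suc i < length (x # xs) \<and> (x # xs) ! 0 = a \<and> (x # xs) ! Suc i = b" by simp
    then show ?thesis unfolding before_def by blast
  next
    assume "before xs a b"
    then obtain p q where "p < q" "q < length xs" "xs ! p = a" "xs ! q = b" unfolding before_def by blast
    then have "Suc p < Suc q \<and> Suc q < length (x # xs) \<and> (x # xs) ! Suc p = a \<and> (x # xs) ! Suc q = b" by simp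
    then show ?thesis unfolding before_def by blast
  qed
qed

lemma before_in: "before xs a b \<Longrightarrow> a \<in> set xs \<and> b \<in> set xs"
  by (induction xs) auto

lemma before_filter: "before (filter P xs) a b \<longleftrightarrow> before xs a b \<and> P a \<and> P b"
  by (induction xs) (auto dest: before_in)

lemma before_append: "before (xs @ ys) a b \<longleftrightarrow> before xs a b \<or> before ys a b \<or> (a \<in> set xs \<and> b \<in> set ys)"
  by (induction xs) auto

lemma before_map: "before (map f xs) u v \<longleftrightarrow> (\<exists>a b. u = f a \<and> v = f b \<and> before xs a b)"
  by (induction xs) auto

lemma before_antisym: "distinct xs \<Longrightarrow> before xs a b \<Longrightarrow> \<not> before xs b a"
  by (induction xs) (auto dest: before_in)

lemma before_total: "a \<in> set xs \<Longrightarrow> b \<in> set xs \<Longrightarrow> a \<noteq> b \<Longrightarrow> before xs a b \<or> before xs b a"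
  by (induction xs) auto

definition discord :: "'x list \<Rightarrow> 'x list \<Rightarrow> ('x \<times> 'x) set" where
  "discord xs ys = {(a, b). before xs a b \<and> before ys b a}"

text \<open>The sign of the permutation between two orderings of the same set, counted by
  inversions.\<close>

definition order_sign :: "'x list \<Rightarrow> 'x list \<Rightarrow> 'k::field" where
  "order_sign xs ys = sgnp (int (card (discord xs ys)))"

lemma discord_finite: "finite (discord xs ys)"
  by (rule finite_subset[of _ "set xs \<times> set xs"]) (auto simp: discord_def dest: before_in)

lemma order_sign_refl: "distinct xs \<Longrightarrow> order_sign xs xs = (1 :: 'k::field)"
proof -
  assume "distinct xs"
  from before_antisym[OF this] have "discord xs xs = {}" unfolding discord_def by auto
  then show ?thesis unfolding order_sign_def by simp
qed

lemma order_sign_sym: "order_sign xs ys = (order_sign ys xs :: 'k::field)"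
proof -
  have "discord ys xs = prod.swap ` discord xs ys" unfolding discord_def by force
  then have "card (discord ys xs) = card (discord xs ys)" by (simp add: card_image)
  then show ?thesis unfolding order_sign_def by simp
qed

lemma order_sign_map:
  assumes "inj_on f (set xs)" "set ys = set xs"
  shows "order_sign (map f xs) (map f ys) = (order_sign xs ys :: 'k::field)"
proof -
  have "discord (map f xs) (map f ys) = map_prod f f ` discord xs ys"
  proof (rule set_eqI, rule iffI)
    fix y assume "y \<in> discord (map f xs) (map f ys)"
    then obtain u v where y: "y = (u, v)" "before (map f xs) u v" "before (map f ys) v u"
      unfolding discord_def by blast
    then obtain a b a' b' where ab: "u = f a" "v = f b" "before xs a b" "u = f a'" "v = f b'" "before ys b' a'"
      unfolding before_map by blast
    then have "a = a'" "b = b'" using before_in[OF ab(3)] before_in[OF ab(6)] assms inj_onD by metis+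
    then have "(a, b) \<in> discord xs ys" using ab unfolding discord_def by simp
    then show "y \<in> map_prod f f ` discord xs ys" using y ab by force
  next
    fix y assume "y \<in> map_prod f f ` discord xs ys"
    then show "y \<in> discord (map f xs) (map f ys)" unfolding discord_def before_map by auto
  qed
  moreover have "inj_on (map_prod f f) (discord xs ys)"
  proof (rule inj_onI)
    fix x y assume "x \<in> discord xs ys" "y \<in> discord xs ys" "map_prod f f x = map_prod f f y"
    then show "x = y" using before_in[of xs "fst x" "snd x"] before_in[of xs "fst y" "snd y"] inj_onD[OF assms(1)]
      unfolding discord_def by (auto simp: prod_eq_iff)
  qed
  ultimately show ?thesis unfolding order_sign_def by (simp add: card_image)
qed

lemma order_sign_Cons:
  assumes "x \<notin> set xs" "x \<notin> set ys"
  shows "order_sign (x # xs) (x # ys) = (order_sign xs ys :: 'k::field)"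
proof -
  have "discord (x # xs) (x # ys) = discord xs ys"
    using assms unfolding discord_def by (auto dest: before_in)
  then show ?thesis unfolding order_sign_def by simp
qed

text \<open>Bringing \<open>x\<close> to the front inverts exactly its pairs with the entries of
  \<open>ys\<close>.\<close>

lemma order_sign_move:
  assumes "x \<notin> set ys" "x \<notin> set zs" "x \<notin> set m" "set m = set ys \<union> set zs"
  shows "order_sign (ys @ x # zs) (x # m) = (sgnp (int (card (set ys))) * order_sign (ys @ zs) m :: 'k::field)"
proof -
  have "discord (ys @ x # zs) (x # m) = (\<lambda>y. (y, x)) ` set ys \<union> discord (ys @ zs) m"
    using assms unfolding discord_def before_append by (auto dest: before_in)
  moreover have "(\<lambda>y. (y, x)) ` set ys \<inter> discord (ys @ zs) m = {}"
    using assms unfolding discord_def by (auto dest: before_in)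
  moreover have "card ((\<lambda>y. (y, x)) ` set ys) = card (set ys)" by (rule card_image) (auto simp: inj_on_def)
  ultimately have "card (discord (ys @ x # zs) (x # m)) = card (set ys) + card (discord (ys @ zs) m)"
    by (simp add: card_Un_disjoint discord_finite)
  then show ?thesis unfolding order_sign_def by (simp add: sgnp_add)
qed

text \<open>An adjacent transposition changes only the relative order of \<open>u\<close> and
  \<open>v\<close>, so it adds or removes one inversion.\<close>

lemma order_sign_swap:
  assumes d: "distinct (xs @ u # v # ys)" and l: "distinct l" "set l = set (xs @ u # v # ys)"
  shows "order_sign (xs @ v # u # ys) l = (- order_sign (xs @ u # v # ys) l :: 'k::field)"
proof -
  let ?A = "discord (xs @ u # v # ys) l" and ?B = "discord (xs @ v # u # ys) l"
  have uv: "u \<noteq> v" using d by auto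
  have b: "before (xs @ v # u # ys) a b \<longleftrightarrow> (before (xs @ u # v # ys) a b \<and> (a, b) \<noteq> (u, v)) \<or> (a, b) = (v, u)" for a b
    using d unfolding before_append before_Cons by (auto dest: before_in)
  have un: "before (xs @ u # v # ys) u v" "\<not> before (xs @ u # v # ys) v u"
    using d unfolding before_append before_Cons by (auto dest: before_in)
  have "before l u v \<or> before l v u" by (rule before_total) (use l uv in auto)
  then consider "before l v u" "\<not> before l u v" | "before l u v" "\<not> before l v u"
    using before_antisym[OF l(1)] by blast
  then show ?thesis
  proof cases
    case 1
    then have e: "?A = insert (u, v) ?B" and ni: "(u, v) \<notin> ?B" using b un uv unfolding discord_def by auto
    have "card ?A = Suc (card ?B)" unfolding e by (rule card_insert_disjoint[OF discord_finite ni])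
    then show ?thesis unfolding order_sign_def by (simp add: sgnp_def)
  next
    case 2
    then have e: "?B = insert (v, u) ?A" and ni: "(v, u) \<notin> ?A" using b un uv unfolding discord_def by auto
    have "card ?B = Suc (card ?A)" unfolding e by (rule card_insert_disjoint[OF discord_finite ni])
    then show ?thesis unfolding order_sign_def by (simp add: sgnp_def)
  qed
qed

definition mixed :: "('x \<Rightarrow> bool) \<Rightarrow> 'x list \<Rightarrow> ('x \<times> 'x) set" where
  "mixed P l = {(a, b). before l a b \<and> P a \<and> \<not> P b}"

lemma mixed_finite: "finite (mixed P l)"
  by (rule finite_subset[of _ "set l \<times> set l"]) (auto simp: mixed_def dest: before_in)

text \<open>With all degrees equal to -1 each mixed pair contributes 1; distinctness lets pairs of
  positions be counted as pairs of entries.\<close>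

lemma unshuffle_exp_eq_card:
  assumes d: "distinct l"
  shows "unshuffle_exp P (\<lambda>_. -1) l = int (card (mixed P l))"
proof -
  let ?I = "{(p, q). p < q \<and> q < length l \<and> P (l ! p) \<and> \<not> P (l ! q)}"
  have "unshuffle_exp P (\<lambda>_. -1) l = int (card ?I)"
    unfolding unshuffle_exp_def by (simp add: case_prod_beta)
  moreover have "mixed P l = (\<lambda>(p, q). (l ! p, l ! q)) ` ?I"
  proof (rule set_eqI, rule iffI)
    fix y assume "y \<in> mixed P l"
    then obtain a b where ab: "y = (a, b)" "before l a b" "P a" "\<not> P b" unfolding mixed_def by blast
    then obtain p q where "p < q" "q < length l" "l ! p = a" "l ! q = b" unfolding before_def by blast
    then show "y \<in> (\<lambda>(p, q). (l ! p, l ! q)) ` ?I" using ab by (intro image_eqI[of _ _ "(p, q)"]) auto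
  next
    fix y assume "y \<in> (\<lambda>(p, q). (l ! p, l ! q)) ` ?I"
    then show "y \<in> mixed P l" unfolding mixed_def before_def by auto
  qed
  moreover have "inj_on (\<lambda>(p, q). (l ! p, l ! q)) ?I"
    by (rule inj_onI) (use d in \<open>auto simp: nth_eq_iff_index_eq\<close>)
  ultimately show ?thesis by (simp add: card_image)
qed

lemma card_sym_diff:
  assumes "finite A" "finite B"
  shows "even (int (card (A - B)) + int (card (B - A)) + int (card A) + int (card B))"
proof -
  have "card A = card (A - B) + card (A \<inter> B)"
    using card_Int_Diff[OF assms(1), of B] by simp
  moreover have "card B = card (B - A) + card (A \<inter> B)"
    using card_Int_Diff[OF assms(2), of A] by (simp add: Int_commute)
  ultimately show ?thesis by simp
qed

text \<open>Pairs with exactly one entry satisfying \<open>P\<close> are discordant iff they are in exactly one of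
  the two sets of mixed pairs.\<close>

lemma order_sign_filter:
  assumes l: "distinct l" "distinct m" "set m = set l"
  shows "order_sign l m = (sgnp (unshuffle_exp P (\<lambda>_. -1) l) * sgnp (unshuffle_exp P (\<lambda>_. -1) m) *
     (order_sign (filter P l) (filter P m) * order_sign (filter (\<lambda>x. \<not> P x) l) (filter (\<lambda>x. \<not> P x) m)) :: 'k::field)"
proof -
  let ?D = "discord l m" and ?A = "mixed P l" and ?B = "mixed P m"
  let ?PP = "discord (filter P l) (filter P m)" and ?NN = "discord (filter (\<lambda>x. \<not> P x) l) (filter (\<lambda>x. \<not> P x) m)"
  have t: "before m b a \<longleftrightarrow> \<not> before m a b" if "before l a b" for a b
    using before_in[OF that] before_antisym[OF l(1) that] before_total[of a m b] before_antisym[OF l(2)] l(3) that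
    by (metis)
  have t': "before l b a \<longleftrightarrow> \<not> before l a b" if "before m a b" for a b
    using before_in[OF that] before_antisym[OF l(2) that] before_total[of a l b] before_antisym[OF l(1)] l(3) that
    by (metis)
  have e: "?D = ?PP \<union> ?NN \<union> (?A - ?B) \<union> prod.swap ` (?B - ?A)"
  proof (rule set_eqI, rule iffI)
    fix y assume "y \<in> ?D"
    then obtain a b where y: "y = (a, b)" "before l a b" "before m b a" unfolding discord_def by blast
    consider "P a" "P b" | "\<not> P a" "\<not> P b" | "P a" "\<not> P b" | "\<not> P a" "P b" by blast
    then show "y \<in> ?PP \<union> ?NN \<union> (?A - ?B) \<union> prod.swap ` (?B - ?A)"
    proof cases
      case 4
      then have "(b, a) \<in> ?B - ?A" using y t'[OF y(3)] unfolding mixed_def by simp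
      then have "prod.swap (b, a) \<in> prod.swap ` (?B - ?A)" by (rule imageI)
      then show ?thesis using y by simp
    qed (use y t[OF y(2)] in \<open>auto simp: discord_def before_filter mixed_def\<close>)
  next
    fix y assume "y \<in> ?PP \<union> ?NN \<union> (?A - ?B) \<union> prod.swap ` (?B - ?A)"
    then show "y \<in> ?D" using t t' unfolding discord_def before_filter mixed_def by auto
  qed
  have fin: "finite ?PP" "finite ?NN" "finite (?A - ?B)" "finite (prod.swap ` (?B - ?A))"
    by (simp_all add: discord_finite mixed_finite)
  have "card ?D = card ?PP + card ?NN + card (?A - ?B) + card (prod.swap ` (?B - ?A))"
    unfolding e
    apply (subst card_Un_disjoint)
    using fin apply simp
    using fin apply simp
    apply (auto simp: discord_def before_filter mixed_def)[1]
    apply (subst card_Un_disjoint)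
    using fin apply simp
    using fin apply simp
    apply (auto simp: discord_def before_filter mixed_def)[1]
    apply (subst card_Un_disjoint)
    using fin apply simp
    using fin apply simp
    apply (auto simp: discord_def before_filter mixed_def)[1]
    apply simp
    done
  moreover have "card (prod.swap ` (?B - ?A)) = card (?B - ?A)" by (simp add: card_image)
  ultimately have "even (int (card ?D) - (int (card ?A) + int (card ?B) + (int (card ?PP) + int (card ?NN))))"
    using card_sym_diff[OF mixed_finite mixed_finite, of P l P m] by simp argo
  from sgnp_cong[OF this, where 'k='k] show ?thesis
    unfolding order_sign_def unshuffle_exp_eq_card[OF l(1)] unshuffle_exp_eq_card[OF l(2)] sgnp_add .
qed

text \<open>Sorting by adjacent transpositions: the head of \<open>m\<close> is moved to the front
  of \<open>l\<close>, at the cost of one sign per entry passed. The swap rule concerns whole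
  orderings, so the part already sorted is carried along as the prefix \<open>pre\<close>.\<close>

lemma suspension_unique_aux:
  fixes s :: "vert list \<Rightarrow> 'k::field"
  assumes s: "\<And>xs u v ys. is_ordering \<Gamma> (xs @ u # v # ys) \<Longrightarrow> s (xs @ v # u # ys) = - s (xs @ u # v # ys)"
  shows "is_ordering \<Gamma> (pre @ l) \<Longrightarrow> is_ordering \<Gamma> (pre @ m) \<Longrightarrow> set l = set m \<Longrightarrow>
     s (pre @ l) = order_sign l m * s (pre @ m)"
proof (induction m arbitrary: pre l)
  case Nil
  then show ?case by (simp add: order_sign_refl)
next
  case (Cons x m)
  then obtain ys zs where l: "l = ys @ x # zs" by (metis list.set_intros(1) split_list)
  have move: "is_ordering \<Gamma> (pre @ ys @ x # zs) \<Longrightarrow>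
      s (pre @ ys @ x # zs) = sgnp (int (length ys)) * s (pre @ x # ys @ zs)" for zs
  proof (induction ys arbitrary: zs rule: rev_induct)
    case (snoc y ys)
    have o: "is_ordering \<Gamma> ((pre @ ys) @ x # y # zs)" using snoc.prems unfolding is_ordering_def by auto
    have "s (pre @ (ys @ [y]) @ x # zs) = - s ((pre @ ys) @ x # y # zs)" using s[OF o] by simp
    also have "s ((pre @ ys) @ x # y # zs) = sgnp (int (length ys)) * s (pre @ x # ys @ y # zs)"
      using snoc.IH[of "y # zs"] o by simp
    finally show ?case by (simp add: sgnp_def)
  qed simp
  have d: "distinct l" "distinct (x # m)" "distinct (pre @ ys @ x # zs)"
    using Cons.prems l unfolding is_ordering_def by auto
  then have xn: "x \<notin> set ys" "x \<notin> set zs" "x \<notin> set m" using l by auto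
  have sm: "set m = set ys \<union> set zs" using Cons.prems(3) xn unfolding l by auto
  have o1: "is_ordering \<Gamma> ((pre @ [x]) @ ys @ zs)" using Cons.prems(1) unfolding l is_ordering_def by auto
  have o2: "is_ordering \<Gamma> ((pre @ [x]) @ m)" using Cons.prems(2) by simp
  have "s (pre @ l) = sgnp (int (length ys)) * s ((pre @ [x]) @ ys @ zs)"
    using move[of zs] Cons.prems(1) unfolding l by simp
  also have "s ((pre @ [x]) @ ys @ zs) = order_sign (ys @ zs) m * s ((pre @ [x]) @ m)"
    by (rule Cons.IH[OF o1 o2]) (use sm in simp)
  finally show ?case
    unfolding l order_sign_move[OF xn sm] using d l by (simp add: distinct_card)
qed

lemma sgnp_minus_one: "sgnp (-1) = (-1 :: 'k::field)"
  by (simp add: sgnp_def)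

lemma suspension_unique:
  assumes "s \<in> suspension_space (-1) \<Gamma>" "is_ordering \<Gamma> l" "is_ordering \<Gamma> m"
  shows "s l = order_sign l m * (s m :: 'k::field)"
proof -
  have "s ([] @ l) = order_sign l m * s ([] @ m)"
  proof (rule suspension_unique_aux[of \<Gamma>])
    fix xs u v ys assume "is_ordering \<Gamma> (xs @ u # v # ys)"
    then show "s (xs @ v # u # ys) = - s (xs @ u # v # ys)"
      using assms(1) unfolding suspension_space_def by (simp add: sgnp_minus_one)
  qed (use assms(2,3) in \<open>simp_all add: is_ordering_def\<close>)
  then show ?thesis by simp
qed

lemma suspension_generator:
  assumes l: "is_ordering \<Gamma> m"
  shows "(\<lambda>l. if is_ordering \<Gamma> l then order_sign l m else 0 :: 'k::field) \<in> suspension_space (-1) \<Gamma>"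
  unfolding suspension_space_def
proof (intro CollectI conjI allI impI)
  fix xs u v ys assume o: "is_ordering \<Gamma> (xs @ u # v # ys)"
  then have o': "is_ordering \<Gamma> (xs @ v # u # ys)" unfolding is_ordering_def by auto
  have "order_sign (xs @ v # u # ys) m = (- order_sign (xs @ u # v # ys) m :: 'k)"
    by (rule order_sign_swap) (use o l in \<open>auto simp: is_ordering_def\<close>)
  then show "(if is_ordering \<Gamma> (xs @ v # u # ys) then order_sign (xs @ v # u # ys) m else 0 :: 'k) =
      sgnp (-1) * (if is_ordering \<Gamma> (xs @ u # v # ys) then order_sign (xs @ u # v # ys) m else 0)"
    using o o' by (simp add: sgnp_minus_one)
qed simp

text \<open>Multiplicativity of the sign without counting inversions: the sign relative to
  \<open>n\<close> is itself an element of the suspension, and the values of such elements on two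
  orderings differ by \<open>order_sign\<close>.\<close>

lemma order_sign_trans:
  assumes "is_ordering \<Gamma> l" "is_ordering \<Gamma> m" "is_ordering \<Gamma> n"
  shows "order_sign l n = (order_sign l m * order_sign m n :: 'k::field)"
  using suspension_unique[OF suspension_generator[OF assms(3)] assms(1,2)] assms by simp

lemma ordering_exists: "simple_graph \<Gamma> \<Longrightarrow> \<exists>l. is_ordering \<Gamma> l"
  unfolding is_ordering_def using finite_distinct_list[OF finite_verts] by blast

text \<open>The suspension is the line spanned by the sign relative to a fixed ordering
  \<open>m\<close>, so tensoring with it gives a copy of \<open>V\<close>.\<close>

lemma tensor_suspension:
  assumes m: "is_ordering \<Gamma> m" and V: "fs.subspace (V :: ('b \<Rightarrow> 'k::field) set)"
  shows "tensor (suspension_space (-1) \<Gamma>) V =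
     (\<lambda>v (l, x). if is_ordering \<Gamma> l then order_sign l m * v x else 0) ` V" (is "_ = ?h ` V")
proof
  have add: "?h (v + w) = ?h v + ?h w" for v w :: "'b \<Rightarrow> 'k" by (auto simp: fun_eq_iff algebra_simps)
  have scale: "?h (fscale c v) = fscale c (?h v)" for c and v :: "'b \<Rightarrow> 'k" by (auto simp: fun_eq_iff fscale_def)
  have sub: "fs.subspace (?h ` V)"
  proof (rule fs.subspaceI)
    have h0: "?h 0 = 0" by (auto simp: fun_eq_iff)
    show "0 \<in> ?h ` V" by (rule image_eqI[where x=0], rule h0[symmetric], rule fs.subspace_0[OF V])
    fix x y c assume "x \<in> ?h ` V"
    then obtain v where v: "v \<in> V" "x = ?h v" by blast
    show "fscale c x \<in> ?h ` V" unfolding v(2) scale[symmetric] by (intro imageI fs.subspace_scale[OF V] v)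
    assume "y \<in> ?h ` V"
    then obtain w where w: "w \<in> V" "y = ?h w" by blast
    show "x + y \<in> ?h ` V" unfolding v(2) w(2) add[symmetric] by (intro imageI fs.subspace_add[OF V] v w)
  qed
  show "tensor (suspension_space (-1) \<Gamma>) V \<subseteq> ?h ` V"
    unfolding tensor_def
  proof (rule fs.span_minimal[OF _ sub])
    show "{\<lambda>(x, y). v x * w y |v w. v \<in> suspension_space (-1) \<Gamma> \<and> w \<in> V} \<subseteq> ?h ` V"
    proof
      fix X :: "vert list \<times> 'b \<Rightarrow> 'k" assume "X \<in> {\<lambda>(x, y). v x * w y |v w. v \<in> suspension_space (-1) \<Gamma> \<and> w \<in> V}"
      then obtain s w where s: "s \<in> suspension_space (-1) \<Gamma>" "w \<in> V" "X = (\<lambda>(x, y). s x * w y)" by blast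
      have "X = ?h (fscale (s m) w)"
      proof
        fix y :: "vert list \<times> 'b"
        obtain l x where y: "y = (l, x)" by (cases y)
        show "X y = ?h (fscale (s m) w) y"
        proof (cases "is_ordering \<Gamma> l")
          case True
          then show ?thesis unfolding y s(3) using suspension_unique[OF s(1) True m] by (simp add: fscale_def)
        next
          case False
          then have "s l = 0" using s(1) unfolding suspension_space_def by blast
          then show ?thesis unfolding y s(3) using False by simp
        qed
      qed
      then show "X \<in> ?h ` V" using fs.subspace_scale[OF V s(2)] by blast
    qed
  qed
  show "?h ` V \<subseteq> tensor (suspension_space (-1) \<Gamma>) V"
  proof
    fix X assume "X \<in> ?h ` V"
    then obtain v where v: "v \<in> V" "X = ?h v" by blast
    have "X = (\<lambda>(l, x). (if is_ordering \<Gamma> l then order_sign l m else 0) * v x)" unfolding v(2) by (auto simp: fun_eq_iff)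
    then have "X = (\<lambda>(l, x). (if is_ordering \<Gamma> l then order_sign l m else 0) * v x) \<and>
        (\<lambda>l. if is_ordering \<Gamma> l then order_sign l m else 0) \<in> suspension_space (-1) \<Gamma> \<and> v \<in> V"
      using suspension_generator[OF m] v(1) by simp
    then show "X \<in> tensor (suspension_space (-1) \<Gamma>) V"
      unfolding tensor_def by (intro fs.span_base CollectI exI)
  qed
qed

text \<open>Two copies of the sign line multiply to a canonical line: the product of the signs of
  \<open>l\<close> and \<open>m\<close> relative to a third ordering is
  \<open>order_sign l m\<close>, whatever the third ordering. Thus no orientation of the vertices
  enters.\<close>

definition double_suspension ::
  "graph \<Rightarrow> ('b \<Rightarrow> 'k::field) \<Rightarrow> vert list \<times> vert list \<times> 'b \<Rightarrow> 'k" where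
  "double_suspension \<Gamma> \<phi> = (\<lambda>(l, m, x).
     if is_ordering \<Gamma> l \<and> is_ordering \<Gamma> m then order_sign l m * \<phi> x else 0)"

lemma homog_double_suspend:
  fixes D :: "('b, 'a::field) contractad_data"
  assumes simple: "simple_graph \<Gamma>" and V: "fs.subspace (homog D \<Gamma> (d - 2 * suspension_degree (-1) \<Gamma>))"
  shows "homog (suspend (-1) (suspend (-1) D)) \<Gamma> d =
     double_suspension \<Gamma> ` homog D \<Gamma> (d - 2 * suspension_degree (-1) \<Gamma>)"
proof -
  obtain m where m: "is_ordering \<Gamma> m" using ordering_exists[OF simple] by blast
  let ?V = "homog D \<Gamma> (d - 2 * suspension_degree (-1) \<Gamma>)"
  have dd: "d - suspension_degree (-1) \<Gamma> - suspension_degree (-1) \<Gamma> = d - 2 * suspension_degree (-1) \<Gamma>" by simp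
  have T: "fs.subspace (tensor (suspension_space (-1) \<Gamma>) ?V)" unfolding tensor_def by (rule fs.subspace_span)
  have "homog (suspend (-1) (suspend (-1) D)) \<Gamma> d =
      tensor (suspension_space (-1) \<Gamma>) (tensor (suspension_space (-1) \<Gamma>) ?V)"
    unfolding suspend_def by (simp add: dd)
  also have "\<dots> = (\<lambda>v (l, m', x). if is_ordering \<Gamma> l then order_sign l m * (if is_ordering \<Gamma> m' then order_sign m' m * v x else 0) else 0) ` ?V"
    unfolding tensor_suspension[OF m T] unfolding tensor_suspension[OF m V] image_image
    by (rule image_cong[OF refl]) (auto simp: fun_eq_iff)
  also have "\<dots> = double_suspension \<Gamma> ` ?V"
  proof (rule image_cong[OF refl])
    fix v assume "v \<in> ?V"
    have "order_sign l m * order_sign m' m = (order_sign l m' :: 'a)" if "is_ordering \<Gamma> l" "is_ordering \<Gamma> m'" for l m'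
      using order_sign_trans[OF that(1) m that(2), where 'k='a] order_sign_sym[of m m', where 'k='a] by simp
    then show "(\<lambda>(l, m', x). if is_ordering \<Gamma> l then order_sign l m * (if is_ordering \<Gamma> m' then order_sign m' m * v x else 0) else 0) =
        double_suspension \<Gamma> v"
      unfolding double_suspension_def by (auto simp: fun_eq_iff mult.assoc[symmetric])
  qed
  finally show ?thesis .
qed

lemma double_suspension_inj:
  assumes "simple_graph \<Gamma>" "double_suspension \<Gamma> \<phi> = double_suspension \<Gamma> \<psi>"
  shows "\<phi> = \<psi>"
proof
  fix x
  obtain l where l: "is_ordering \<Gamma> l" using ordering_exists[OF assms(1)] by blast
  have "double_suspension \<Gamma> \<phi> (l, l, x) = double_suspension \<Gamma> \<psi> (l, l, x)" using assms(2) by simp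
  then show "\<phi> x = \<psi> x" using l unfolding double_suspension_def is_ordering_def by (simp add: order_sign_refl)
qed

text \<open>The pullback of a suspension acts on slices for fixed orderings. Here they are scalar
  multiples of \<phi>, which is where the hypothesis \<open>hom\<close> comes in.\<close>

lemma pull_double_suspend:
  fixes \<phi> :: "'a \<Rightarrow> 'k::field"
  assumes iso: "bij_betw f (verts \<Gamma>) (verts \<Gamma>')"
    and hom: "\<And>c. pull D \<Gamma> \<Gamma>' f (d - 2 * suspension_degree (-1) \<Gamma>) (fscale c \<phi>) =
        fscale c (pull D \<Gamma> \<Gamma>' f (d - 2 * suspension_degree (-1) \<Gamma>) \<phi>)"
  shows "pull (suspend (-1) (suspend (-1) D)) \<Gamma> \<Gamma>' f d (double_suspension \<Gamma>' \<phi>) =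
     double_suspension \<Gamma> (pull D \<Gamma> \<Gamma>' f (d - 2 * suspension_degree (-1) \<Gamma>) \<phi>)"
proof
  fix y :: "vert list \<times> vert list \<times> 'a"
  obtain l m x where y: "y = (l, m, x)" by (cases y)
  have dd: "d - suspension_degree (-1) \<Gamma> - suspension_degree (-1) \<Gamma> = d - 2 * suspension_degree (-1) \<Gamma>" by simp
  have inj: "inj_on f (verts \<Gamma>)" using iso unfolding bij_betw_def by blast
  have im: "f ` verts \<Gamma> = verts \<Gamma>'" using iso unfolding bij_betw_def by blast
  have ord: "is_ordering \<Gamma>' (map f k)" if "is_ordering \<Gamma> k" for k
    using that inj im unfolding is_ordering_def by (simp add: distinct_map)
  show "pull (suspend (-1) (suspend (-1) D)) \<Gamma> \<Gamma>' f d (double_suspension \<Gamma>' \<phi>) y =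
     double_suspension \<Gamma> (pull D \<Gamma> \<Gamma>' f (d - 2 * suspension_degree (-1) \<Gamma>) \<phi>) y"
  proof (cases "is_ordering \<Gamma> l \<and> is_ordering \<Gamma> m")
    case True
    then have e: "(\<lambda>x. double_suspension \<Gamma>' \<phi> (map f l, map f m, x)) = fscale (order_sign l m) \<phi>"
      using ord[of l] ord[of m] order_sign_map[of f l m] inj unfolding double_suspension_def is_ordering_def fscale_def
      by auto
    then show ?thesis unfolding y suspend_def using True by (simp add: dd e hom) (simp add: double_suspension_def fscale_def)
  next
    case False
    then show ?thesis unfolding y suspend_def double_suspension_def by auto
  qed
qed

lemma distinct_filter_iff:
  "distinct l \<longleftrightarrow> distinct (filter P l) \<and> distinct (filter (\<lambda>x. \<not> P x) l)"
  by (induction l) (simp_all del: distinct_filter, blast)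

text \<open>An equivalence is wanted: on a list that is no ordering of \<Gamma> the composite must
  vanish, so one of its two parts has to fail as well.\<close>

lemma ordering_parts:
  assumes simple: "simple_graph \<Gamma>" and G: "tube \<Gamma> G"
  shows "is_ordering (contract \<Gamma> G) (\<Union>G # filter (\<lambda>v. v \<notin> G) l) \<and> is_ordering (induced \<Gamma> G) (filter (\<lambda>v. v \<in> G) l)
     \<longleftrightarrow> is_ordering \<Gamma> l"
proof -
  have n: "\<Union>G \<notin> verts \<Gamma> - G" by (rule Union_tube_notin[OF simple G])
  have GV: "G \<subseteq> verts \<Gamma>" by (rule tube_subset[OF simple G])
  have dist: "distinct l \<longleftrightarrow> distinct (filter (\<lambda>v. v \<notin> G) l) \<and> distinct (filter (\<lambda>v. v \<in> G) l)"
    using distinct_filter_iff[of l "\<lambda>v. v \<notin> G"] unfolding not_not .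
  have dV: "{x \<in> verts \<Gamma>. x \<notin> G} = verts \<Gamma> - G" by (simp add: set_diff_eq)
  have iV: "{x \<in> verts \<Gamma>. x \<in> G} = G" by (rule set_eqI) (use GV in \<open>simp add: subset_iff, meson\<close>)
  show ?thesis
  proof
    assume a: "is_ordering (contract \<Gamma> G) (\<Union>G # filter (\<lambda>v. v \<notin> G) l) \<and> is_ordering (induced \<Gamma> G) (filter (\<lambda>v. v \<in> G) l)"
    then have s: "insert (\<Union>G) {x \<in> set l. x \<notin> G} = insert (\<Union>G) (verts \<Gamma> - G)" "\<Union>G \<notin> {x \<in> set l. x \<notin> G}"
      "{x \<in> set l. x \<in> G} = G"
      unfolding is_ordering_def verts_contract verts_induced by simp_all
    have "{x \<in> set l. x \<notin> G} = verts \<Gamma> - G" using s(1,2) n by (metis Diff_insert_absorb)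
    moreover have "set l = {x \<in> set l. x \<notin> G} \<union> {x \<in> set l. x \<in> G}"
      by (rule set_eqI) (simp, argo)
    moreover have "verts \<Gamma> - G \<union> G = verts \<Gamma>" using GV by (simp add: Un_absorb2)
    ultimately have "set l = verts \<Gamma>" unfolding s(3) by argo
    moreover have "distinct l" using a unfolding is_ordering_def dist by simp
    ultimately show "is_ordering \<Gamma> l" unfolding is_ordering_def by blast
  next
    assume "is_ordering \<Gamma> l"
    then show "is_ordering (contract \<Gamma> G) (\<Union>G # filter (\<lambda>v. v \<notin> G) l) \<and> is_ordering (induced \<Gamma> G) (filter (\<lambda>v. v \<in> G) l)"
      using n unfolding is_ordering_def verts_contract verts_induced by (simp add: dV iV)
  qed
qed

text \<open>Each of the two suspensions contributes one unshuffling sign; together with the signs of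
  the two parts they make up the sign of the whole reordering. The common head
  \<open>\<Union>G\<close> adds no inversion.\<close>

lemma order_sign_parts:
  assumes simple: "simple_graph \<Gamma>" and G: "tube \<Gamma> G" and l: "is_ordering \<Gamma> l" "is_ordering \<Gamma> m"
  shows "sgnp (unshuffle_exp (\<lambda>v. v \<notin> G) (\<lambda>_. -1) l) * sgnp (unshuffle_exp (\<lambda>v. v \<notin> G) (\<lambda>_. -1) m) *
     (order_sign (\<Union>G # filter (\<lambda>v. v \<notin> G) l) (\<Union>G # filter (\<lambda>v. v \<notin> G) m) *
      order_sign (filter (\<lambda>v. v \<in> G) l) (filter (\<lambda>v. v \<in> G) m)) = (order_sign l m :: 'k::field)"
proof -
  have n: "\<Union>G \<notin> verts \<Gamma> - G" by (rule Union_tube_notin[OF simple G])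
  then have "\<Union>G \<notin> set (filter (\<lambda>v. v \<notin> G) l)" "\<Union>G \<notin> set (filter (\<lambda>v. v \<notin> G) m)"
    using l unfolding is_ordering_def by auto
  from order_sign_Cons[OF this, where 'k='k]
  show ?thesis
    using order_sign_filter[of l m "\<lambda>v. v \<notin> G", where 'k='k] l unfolding is_ordering_def by simp
qed

text \<open>The unshuffling signs and the order signs of the parts combine to the order sign of the
  whole. The Koszul sign for exchanging the suspension of the upper factor with the lower element
  occurs twice, once with the lower element already suspended and once without; only the product of
  the two suspension degrees survives.\<close>

lemma pcomp_double_suspend:
  fixes \<phi> \<psi> :: "'a \<Rightarrow> 'b::field"
  assumes simple: "simple_graph \<Gamma>" and G: "tube \<Gamma> G"
    and hom: "\<And>c c'. pcomp D \<Gamma> G i j (fscale c \<phi>) (fscale c' \<psi>) = fscale (c * c') (pcomp D \<Gamma> G i j \<phi> \<psi>)"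
  shows "pcomp (suspend (-1) (suspend (-1) D)) \<Gamma> G
       (i + 2 * suspension_degree (-1) (contract \<Gamma> G)) (j + 2 * suspension_degree (-1) (induced \<Gamma> G))
       (double_suspension (contract \<Gamma> G) \<phi>) (double_suspension (induced \<Gamma> G) \<psi>) =
     fscale (sgnp (suspension_degree (-1) (contract \<Gamma> G) * suspension_degree (-1) (induced \<Gamma> G)))
       (double_suspension \<Gamma> (pcomp D \<Gamma> G i j \<phi> \<psi>))"
proof
  fix y :: "vert list \<times> vert list \<times> 'a"
  obtain l m x where y: "y = (l, m, x)" by (cases y)
  let ?c = "suspension_degree (-1) (contract \<Gamma> G)" and ?t = "suspension_degree (-1) (induced \<Gamma> G)"
  let ?lo = "\<lambda>l. \<Union>G # filter (\<lambda>v. v \<notin> G) l" and ?up = "filter (\<lambda>v. v \<in> G)"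
  have d: "i + 2 * ?c - ?c - ?c = i" "j + 2 * ?t - ?t - ?t = j" "i + 2 * ?c - ?c = i + ?c" by simp_all
  have s: "sgnp ((i + ?c) * ?t) * sgnp (i * ?t) = (sgnp (?c * ?t) :: 'b)"
    unfolding sgnp_add[symmetric] by (rule sgnp_cong) (simp add: algebra_simps)
  let ?a = "if is_ordering (contract \<Gamma> G) (?lo l) \<and> is_ordering (contract \<Gamma> G) (?lo m) then order_sign (?lo l) (?lo m) else (0 :: 'b)"
  let ?b = "if is_ordering (induced \<Gamma> G) (?up l) \<and> is_ordering (induced \<Gamma> G) (?up m) then order_sign (?up l) (?up m) else (0 :: 'b)"
  have ea: "(\<lambda>x. double_suspension (contract \<Gamma> G) \<phi> (?lo l, ?lo m, x)) = fscale ?a \<phi>"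
    unfolding double_suspension_def fscale_def by auto
  have eb: "(\<lambda>x. double_suspension (induced \<Gamma> G) \<psi> (?up l, ?up m, x)) = fscale ?b \<psi>"
    unfolding double_suspension_def fscale_def by auto
  have "pcomp (suspend (-1) (suspend (-1) D)) \<Gamma> G (i + 2 * ?c) (j + 2 * ?t)
       (double_suspension (contract \<Gamma> G) \<phi>) (double_suspension (induced \<Gamma> G) \<psi>) y =
      sgnp ((i + ?c) * ?t) * sgnp (unshuffle_exp (\<lambda>v. v \<notin> G) (\<lambda>_. -1) l) *
      (sgnp (i * ?t) * sgnp (unshuffle_exp (\<lambda>v. v \<notin> G) (\<lambda>_. -1) m) *
       pcomp D \<Gamma> G i j (fscale ?a \<phi>) (fscale ?b \<psi>) x)"
    unfolding y ea[symmetric] eb[symmetric] suspend_def by (simp add: Let_def d)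
  also have "\<dots> = sgnp (?c * ?t) * (sgnp (unshuffle_exp (\<lambda>v. v \<notin> G) (\<lambda>_. -1) l) *
      sgnp (unshuffle_exp (\<lambda>v. v \<notin> G) (\<lambda>_. -1) m) * (?a * ?b)) * pcomp D \<Gamma> G i j \<phi> \<psi> x"
    unfolding s[symmetric] hom unfolding fscale_def by (simp only: mult_ac)
  also have "sgnp (unshuffle_exp (\<lambda>v. v \<notin> G) (\<lambda>_. -1) l) *
      sgnp (unshuffle_exp (\<lambda>v. v \<notin> G) (\<lambda>_. -1) m) * (?a * ?b) =
      (if is_ordering \<Gamma> l \<and> is_ordering \<Gamma> m then order_sign l m else 0)"
  proof (cases "is_ordering \<Gamma> l \<and> is_ordering \<Gamma> m")
    case True
    then have o: "is_ordering (contract \<Gamma> G) (?lo l)" "is_ordering (contract \<Gamma> G) (?lo m)"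
      "is_ordering (induced \<Gamma> G) (?up l)" "is_ordering (induced \<Gamma> G) (?up m)"
      using ordering_parts[OF simple G] by blast+
    show ?thesis using order_sign_parts[OF simple G, of l m, where 'k='b] True o by simp
  next
    case False
    then have z: "?a * ?b = 0" using ordering_parts[OF simple G, of l] ordering_parts[OF simple G, of m] by auto
    show ?thesis unfolding z using False by (simp only: if_False mult_zero_right)
  qed
  finally show "pcomp (suspend (-1) (suspend (-1) D)) \<Gamma> G (i + 2 * ?c) (j + 2 * ?t)
       (double_suspension (contract \<Gamma> G) \<phi>) (double_suspension (induced \<Gamma> G) \<psi>) y =
      fscale (sgnp (?c * ?t)) (double_suspension \<Gamma> (pcomp D \<Gamma> G i j \<phi> \<psi>)) y"
    unfolding y fscale_def double_suspension_def by (simp add: mult.assoc)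
qed

section \<open>The pairing of trees\<close>

text \<open>The degree of the cogenerators \<open>s E\<close>, one more than that of the gravity
  generators.\<close>

definition shifted_degree :: "graph \<Rightarrow> int" where "shifted_degree \<Gamma> = 2"

interpretation hyper: even_degrees hyper_degree
  by unfold_locales (simp_all add: hyper_degree_def)

interpretation shifted: even_degrees shifted_degree
  by unfold_locales (simp_all add: shifted_degree_def)

abbreviation rank :: "graph \<Rightarrow> int" where "rank \<equiv> suspension_degree (-1)"

lemma rank_eq: "rank \<Gamma> = int (card (verts \<Gamma>)) - 1"
  by (simp add: suspension_degree_def)

lemma rank_split:
  assumes "simple_graph \<Gamma>" "tube \<Gamma> G"
  shows "rank (contract \<Gamma> G) + rank (induced \<Gamma> G) = rank \<Gamma>"
  using card_verts_contract[OF assms] card_mono[OF finite_verts[OF assms(1)] tube_subset[OF assms]]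
  unfolding rank_eq by simp

lemma tree_degree_hyper:
  assumes "simple_graph \<Gamma>" "admissible_tree \<Gamma> T"
  shows "tree_degree hyper_degree \<Gamma> T = 2 * rank \<Gamma> - 2 * int (card T)"
proof -
  have "tree_degree hyper_degree \<Gamma> T = 2 * (\<Sum>N\<in>T. int (card (verts (in_graph \<Gamma> T N)))) - 4 * int (card T)"
    unfolding tree_degree_def hyper_degree_def by (simp add: sum_distrib_left sum_subtractf algebra_simps)
  then show ?thesis unfolding sum_card_children[OF assms] rank_eq by simp
qed

lemma tree_degree_shifted: "tree_degree shifted_degree \<Gamma> T = 2 * int (card T)"
  unfolding tree_degree_def shifted_degree_def by simp

lemma set_decoration_of:
  assumes "finite T"
  shows "set (decoration_of deg \<Gamma> T) = (\<lambda>N. (N, deg (in_graph \<Gamma> T N), ())) ` T"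
  unfolding decoration_of_def set_map using some_list(2)[OF assms] by simp

lemma distinct_decoration_of:
  assumes "finite T"
  shows "distinct (decoration_of deg \<Gamma> T)"
  unfolding decoration_of_def distinct_map using some_list(1)[OF assms] by (auto simp: inj_on_def)

lemma (in even_degrees) tree_space_eval:
  assumes F: "F \<in> tree_space \<Gamma> n" and L: "decorates deg \<Gamma> L"
  shows "F L = F (decoration_of deg \<Gamma> (nodes L))"
proof (rule tree_spaceD(3)[OF F], rule decorates_mset_eq[OF L])
  have f: "finite (nodes L)" unfolding nodes_def by simp
  show "decorates deg \<Gamma> (decoration_of deg \<Gamma> (nodes L))"
    using L by (intro decorates_decoration_of[OF f]) (simp add: decorates_def)
  show "nodes L = nodes (decoration_of deg \<Gamma> (nodes L))" by (rule nodes_decoration_of[OF f, symmetric])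
qed

lemma (in even_degrees) tree_space_degree:
  assumes F: "F \<in> tree_space \<Gamma> n" and T: "finite T" and n: "F (decoration_of deg \<Gamma> T) \<noteq> 0"
  shows "tree_degree deg \<Gamma> T = n" "admissible_tree \<Gamma> T"
  using tree_spaceD(1,2)[OF F n] unfolding decorates_def nodes_decoration_of[OF T] by blast+

lemma (in even_degrees) tree_space_eqI:
  assumes F: "F \<in> tree_space \<Gamma> n" and F': "F' \<in> tree_space \<Gamma> n"
    and eq: "\<And>T. admissible_tree \<Gamma> T \<Longrightarrow> F (decoration_of deg \<Gamma> T) = F' (decoration_of deg \<Gamma> T)"
  shows "F = F'"
proof
  fix L
  show "F L = F' L"
  proof (cases "decorates deg \<Gamma> L")
    case True
    then show ?thesis
      unfolding tree_space_eval[OF F True] tree_space_eval[OF F' True] by (intro eq) (simp add: decorates_def)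
  next
    case False
    then show ?thesis using tree_spaceD(1)[OF F, of L] tree_spaceD(1)[OF F', of L] by argo
  qed
qed

lemma (in even_degrees) basis_tree_eval:
  assumes "finite T'" "admissible_tree \<Gamma> T'"
  shows "basis_tree \<Gamma> T (decoration_of deg \<Gamma> T') = (if T' = T then 1 else 0)"
  unfolding basis_tree_def nodes_decoration_of[OF assms(1)] using decorates_decoration_of[OF assms] by simp

lemma (in even_degrees) graft_decoration:
  assumes simple: "simple_graph \<Gamma>" and G: "tube \<Gamma> G"
    and T: "admissible_tree (contract \<Gamma> G) T1" "admissible_tree (induced \<Gamma> G) T2"
  shows "mset (lower_part_of G (decoration_of deg \<Gamma> (T1 \<union> T2))) = mset (decoration_of deg (contract \<Gamma> G) T1)"
    and "mset (upper_part_of G (decoration_of deg \<Gamma> (T1 \<union> T2))) = mset (decoration_of deg (induced \<Gamma> G) T2)"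
proof -
  note fin = graft_finite[OF simple G T]
  then have f: "finite (T1 \<union> T2)" by simp
  have d: "distinct (lower_part_of G (decoration_of deg \<Gamma> (T1 \<union> T2)))" "distinct (upper_part_of G (decoration_of deg \<Gamma> (T1 \<union> T2)))"
    unfolding lower_part_of_def upper_part_of_def using distinct_decoration_of[OF f] by simp_all
  have "set (lower_part_of G (decoration_of deg \<Gamma> (T1 \<union> T2))) =
      (\<lambda>N. (N, deg (in_graph \<Gamma> (T1 \<union> T2) N), ())) ` {N \<in> T1 \<union> T2. \<not> N \<subseteq> \<Union>G}"
    unfolding lower_part_of_def set_filter set_decoration_of[OF f] by auto
  also have "\<dots> = (\<lambda>N. (N, deg (in_graph \<Gamma> (T1 \<union> T2) N), ())) ` T1" unfolding lower_part[OF simple G T] ..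
  also have "\<dots> = set (decoration_of deg (contract \<Gamma> G) T1)"
    unfolding set_decoration_of[OF fin(1)] by (rule image_cong) (simp_all add: deg_graft_lower[OF simple G T])
  finally show "mset (lower_part_of G (decoration_of deg \<Gamma> (T1 \<union> T2))) = mset (decoration_of deg (contract \<Gamma> G) T1)"
    using set_eq_iff_mset_eq_distinct[OF d(1) distinct_decoration_of[OF fin(1)]] by blast
  have "set (upper_part_of G (decoration_of deg \<Gamma> (T1 \<union> T2))) =
      (\<lambda>N. (N, deg (in_graph \<Gamma> (T1 \<union> T2) N), ())) ` {N \<in> T1 \<union> T2. N \<subseteq> \<Union>G}"
    unfolding upper_part_of_def set_filter set_decoration_of[OF f] by auto
  also have "\<dots> = (\<lambda>N. (N, deg (in_graph \<Gamma> (T1 \<union> T2) N), ())) ` T2" unfolding upper_part[OF simple G T] ..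
  also have "\<dots> = set (decoration_of deg (induced \<Gamma> G) T2)"
    unfolding set_decoration_of[OF fin(2)] by (rule image_cong) (simp_all add: deg_graft_upper[OF simple G T])
  finally show "mset (upper_part_of G (decoration_of deg \<Gamma> (T1 \<union> T2))) = mset (decoration_of deg (induced \<Gamma> G) T2)"
    using set_eq_iff_mset_eq_distinct[OF d(2) distinct_decoration_of[OF fin(2)]] by blast
qed

lemma (in even_degrees) graft_decoration_append:
  assumes simple: "simple_graph \<Gamma>" and G: "tube \<Gamma> G"
    and T: "admissible_tree (contract \<Gamma> G) T1" "admissible_tree (induced \<Gamma> G) T2"
  shows "mset (decoration_of deg (contract \<Gamma> G) T1 @ decoration_of deg (induced \<Gamma> G) T2) =
     mset (decoration_of deg \<Gamma> (T1 \<union> T2))"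
proof -
  have "mset (lower_part_of G L) + mset (upper_part_of G L) = mset L" for L :: "unit decoration"
    unfolding lower_part_of_def upper_part_of_def mset_filter by (induction L) auto
  from this[of "decoration_of deg \<Gamma> (T1 \<union> T2)"] show ?thesis
    unfolding graft_decoration[OF assms] by simp
qed

text \<open>The bilinear form for which the basis trees on both sides are dual bases. Each argument
  is read off at the canonical decoration for its own degrees.\<close>

definition pairing :: "graph \<Rightarrow> (unit decoration \<Rightarrow> 'k::field) \<Rightarrow> (unit decoration \<Rightarrow> 'k) \<Rightarrow> 'k" where
  "pairing \<Gamma> F x = (\<Sum>T | admissible_tree \<Gamma> T.
     F (decoration_of hyper_degree \<Gamma> T) * x (decoration_of shifted_degree \<Gamma> T))"

lemma pairing_add_left: "pairing \<Gamma> (F + F') x = pairing \<Gamma> F x + pairing \<Gamma> F' x"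
  and pairing_add_right: "pairing \<Gamma> F (x + x') = pairing \<Gamma> F x + pairing \<Gamma> F x'"
  and pairing_scale_left: "pairing \<Gamma> (fscale c F) x = c * pairing \<Gamma> F x"
  and pairing_scale_right: "pairing \<Gamma> F (fscale c x) = c * pairing \<Gamma> F x"
  and pairing_diff_left: "pairing \<Gamma> (F - F') x = pairing \<Gamma> F x - pairing \<Gamma> F' x"
  unfolding pairing_def fscale_def
  by (simp_all add: sum.distrib sum_distrib_left sum_subtractf algebra_simps)

lemma pairing_zero_left [simp]: "pairing \<Gamma> 0 x = 0"
  and pairing_zero_right [simp]: "pairing \<Gamma> F 0 = 0"
  unfolding pairing_def by simp_all

lemma functional_pairing: "functional (pairing \<Gamma> F)"
  unfolding functional_def using pairing_add_right pairing_scale_right by blast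

lemma pairing_sum_left: "pairing \<Gamma> (\<Sum>i\<in>A. F i) x = (\<Sum>i\<in>A. pairing \<Gamma> (F i) x)"
proof (induction A rule: infinite_finite_induct)
  case (infinite A)
  show ?case unfolding sum.infinite[OF infinite] by (rule pairing_zero_left)
next
  case empty
  show ?case by (simp only: sum.empty pairing_zero_left)
next
  case (insert i A)
  show ?case by (simp only: sum.insert[OF insert.hyps] pairing_add_left insert.IH)
qed

context
  fixes \<Gamma> :: graph assumes simple: "simple_graph \<Gamma>"
begin

lemma finite_trees: "finite {T. admissible_tree \<Gamma> T}"
  by (rule finite_admissible[OF simple])

lemma pairing_basis_right:
  assumes T: "admissible_tree \<Gamma> T"
  shows "pairing \<Gamma> F (shifted.basis_tree \<Gamma> T) = F (decoration_of hyper_degree \<Gamma> T)"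
proof -
  have "pairing \<Gamma> F (shifted.basis_tree \<Gamma> T) =
      (\<Sum>T' | admissible_tree \<Gamma> T'. if T' = T then F (decoration_of hyper_degree \<Gamma> T') else 0)"
    unfolding pairing_def
  proof (rule sum.cong[OF refl])
    fix T' assume "T' \<in> {T. admissible_tree \<Gamma> T}"
    then have "admissible_tree \<Gamma> T'" by simp
    note ev = shifted.basis_tree_eval[OF admissible_finite[OF simple this] this]
    show "F (decoration_of hyper_degree \<Gamma> T') * shifted.basis_tree \<Gamma> T (decoration_of shifted_degree \<Gamma> T') = (if T' = T then F (decoration_of hyper_degree \<Gamma> T') else 0)"
      unfolding ev by simp
  qed
  also have "\<dots> = F (decoration_of hyper_degree \<Gamma> T)" using finite_trees T by simp
  finally show ?thesis .
qed

lemma pairing_basis_left: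
  assumes T: "admissible_tree \<Gamma> T"
  shows "pairing \<Gamma> (hyper.basis_tree \<Gamma> T) x = x (decoration_of shifted_degree \<Gamma> T)"
proof -
  have "pairing \<Gamma> (hyper.basis_tree \<Gamma> T) x =
      (\<Sum>T' | admissible_tree \<Gamma> T'. if T' = T then x (decoration_of shifted_degree \<Gamma> T') else 0)"
    unfolding pairing_def
  proof (rule sum.cong[OF refl])
    fix T' assume "T' \<in> {T. admissible_tree \<Gamma> T}"
    then have "admissible_tree \<Gamma> T'" by simp
    note ev = hyper.basis_tree_eval[OF admissible_finite[OF simple this] this]
    show "hyper.basis_tree \<Gamma> T (decoration_of hyper_degree \<Gamma> T') * x (decoration_of shifted_degree \<Gamma> T') = (if T' = T then x (decoration_of shifted_degree \<Gamma> T') else 0)"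
      unfolding ev by simp
  qed
  also have "\<dots> = x (decoration_of shifted_degree \<Gamma> T)" using finite_trees T by simp
  finally show ?thesis .
qed

section \<open>Composition as the transpose of decomposition\<close>

context
  fixes G assumes G: "tube \<Gamma> G"
begin

text \<open>Only trees obtained by grafting contribute to the sum, and grafting is injective, so the
  sum may be indexed by pairs of trees.\<close>

lemma pairing_pcomp:
  fixes x :: "unit decoration \<Rightarrow> 'k::field"
  assumes a: "a \<in> hyper.tree_space (contract \<Gamma> G) i" and b: "b \<in> hyper.tree_space (induced \<Gamma> G) j"
  shows "pairing \<Gamma> (pcomp hyper.free \<Gamma> G i j a b) x =
     (\<Sum>T1 | admissible_tree (contract \<Gamma> G) T1. \<Sum>T2 | admissible_tree (induced \<Gamma> G) T2.
        a (decoration_of hyper_degree (contract \<Gamma> G) T1) * b (decoration_of hyper_degree (induced \<Gamma> G) T2) *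
        x (decoration_of shifted_degree \<Gamma> (T1 \<union> T2)))"
proof -
  let ?A1 = "{T. admissible_tree (contract \<Gamma> G) T}" and ?A2 = "{T. admissible_tree (induced \<Gamma> G) T}"
  let ?A = "{T. admissible_tree \<Gamma> T}"
  let ?u = "\<lambda>(T1, T2). T1 \<union> T2 :: vert set"
  let ?g = "\<lambda>T. pcomp hyper.free \<Gamma> G i j a b (decoration_of hyper_degree \<Gamma> T) * x (decoration_of shifted_degree \<Gamma> T)"
  have inj: "inj_on ?u (?A1 \<times> ?A2)"
  proof (rule inj_onI)
    fix p q assume p: "p \<in> ?A1 \<times> ?A2" and q: "q \<in> ?A1 \<times> ?A2" and e: "?u p = ?u q"
    obtain P1 P2 Q1 Q2 where pq: "p = (P1, P2)" "q = (Q1, Q2)" by (cases p, cases q)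
    have P: "admissible_tree (contract \<Gamma> G) P1" "admissible_tree (induced \<Gamma> G) P2"
      and Q: "admissible_tree (contract \<Gamma> G) Q1" "admissible_tree (induced \<Gamma> G) Q2" using p q pq by simp_all
    have e': "P1 \<union> P2 = Q1 \<union> Q2" using e pq by simp
    have "P1 = Q1" using lower_part[OF simple G P] lower_part[OF simple G Q] unfolding e' by (rule trans[OF sym])
    moreover have "P2 = Q2" using upper_part[OF simple G P] upper_part[OF simple G Q] unfolding e' by (rule trans[OF sym])
    ultimately show "p = q" using pq by simp
  qed
  have val: "?g (T1 \<union> T2) = a (decoration_of hyper_degree (contract \<Gamma> G) T1) *
      b (decoration_of hyper_degree (induced \<Gamma> G) T2) * x (decoration_of shifted_degree \<Gamma> (T1 \<union> T2))"
    if T: "admissible_tree (contract \<Gamma> G) T1" "admissible_tree (induced \<Gamma> G) T2" for T1 T2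
    unfolding hyper.pcomp_free[OF a b]
      hyper.tree_spaceD(3)[OF a hyper.graft_decoration(1)[OF simple G T]]
      hyper.tree_spaceD(3)[OF b hyper.graft_decoration(2)[OF simple G T]] ..
  have zero: "?g T = 0" if T: "T \<in> ?A - ?u ` (?A1 \<times> ?A2)" for T
  proof (rule ccontr)
    assume "?g T \<noteq> 0"
    then have n: "a (lower_part_of G (decoration_of hyper_degree \<Gamma> T)) \<noteq> 0" "b (upper_part_of G (decoration_of hyper_degree \<Gamma> T)) \<noteq> 0"
      unfolding hyper.pcomp_free[OF a b] by auto
    let ?T1 = "nodes (lower_part_of G (decoration_of hyper_degree \<Gamma> T))"
    let ?T2 = "nodes (upper_part_of G (decoration_of hyper_degree \<Gamma> T))"
    have t: "?T1 \<in> ?A1" "?T2 \<in> ?A2"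
      using hyper.tree_spaceD(1)[OF a n(1)] hyper.tree_spaceD(1)[OF b n(2)] unfolding decorates_def by simp_all
    have "finite T" using admissible_finite[OF simple] T by blast
    then have "?T1 \<union> ?T2 = T" unfolding nodes_lower_upper by (rule nodes_decoration_of)
    then have "?u (?T1, ?T2) = T" by simp
    then have "T \<in> ?u ` (?A1 \<times> ?A2)" using t by (metis (no_types, lifting) SigmaI imageI)
    then show False using T by simp
  qed
  have "pairing \<Gamma> (pcomp hyper.free \<Gamma> G i j a b) x = sum ?g ?A" unfolding pairing_def ..
  also have "\<dots> = sum ?g (?u ` (?A1 \<times> ?A2))"
  proof (rule sum.mono_neutral_right[OF finite_trees])
    show "?u ` (?A1 \<times> ?A2) \<subseteq> ?A" using graft_admissible[OF simple G] by auto
    show "\<forall>T\<in>?A - ?u ` (?A1 \<times> ?A2). ?g T = 0" using zero by blast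
  qed
  also have "\<dots> = (\<Sum>p\<in>?A1 \<times> ?A2. ?g (?u p))" by (subst sum.reindex[OF inj]) simp
  also have "\<dots> = (\<Sum>(T1, T2)\<in>?A1 \<times> ?A2. a (decoration_of hyper_degree (contract \<Gamma> G) T1) *
      b (decoration_of hyper_degree (induced \<Gamma> G) T2) * x (decoration_of shifted_degree \<Gamma> (T1 \<union> T2)))"
  proof (rule sum.cong[OF refl])
    fix p assume "p \<in> ?A1 \<times> ?A2"
    then obtain T1 T2 where p: "p = (T1, T2)" "admissible_tree (contract \<Gamma> G) T1" "admissible_tree (induced \<Gamma> G) T2"
      by blast
    show "?g (?u p) = (case p of (T1, T2) \<Rightarrow> a (decoration_of hyper_degree (contract \<Gamma> G) T1) *
      b (decoration_of hyper_degree (induced \<Gamma> G) T2) * x (decoration_of shifted_degree \<Gamma> (T1 \<union> T2)))"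
      unfolding p(1) prod.case by (rule val[OF p(2,3)])
  qed
  also have "\<dots> = (\<Sum>T1\<in>?A1. \<Sum>T2\<in>?A2. a (decoration_of hyper_degree (contract \<Gamma> G) T1) *
      b (decoration_of hyper_degree (induced \<Gamma> G) T2) * x (decoration_of shifted_degree \<Gamma> (T1 \<union> T2)))"
    by (rule sum.cartesian_product[symmetric])
  finally show ?thesis .
qed

definition cut :: "int \<Rightarrow> int \<Rightarrow> (unit decoration \<Rightarrow> 'k::field) \<Rightarrow> unit decoration \<times> unit decoration \<Rightarrow> 'k" where
  "cut i j x = decomp (cofree_cocontractad (symmetric_generators shifted_degree)) \<Gamma> G i j x"

lemma cut_eq:
  "cut i j x (L, L') = (if admissible_tree (contract \<Gamma> G) (nodes L) \<and> admissible_tree (induced \<Gamma> G) (nodes L') \<and>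
     total_degree L = i \<and> total_degree L' = j then x (L @ L') else 0)"
  unfolding cut_def cofree_cocontractad_def by simp

lemma cut_eval:
  assumes x: "x \<in> shifted.tree_space \<Gamma> e"
    and T: "admissible_tree (contract \<Gamma> G) T1" "admissible_tree (induced \<Gamma> G) T2"
    and c: "2 * int (card T1) = i" "2 * int (card T2) = j"
  shows "cut i j x (decoration_of shifted_degree (contract \<Gamma> G) T1, decoration_of shifted_degree (induced \<Gamma> G) T2) =
     x (decoration_of shifted_degree \<Gamma> (T1 \<union> T2))"
proof -
  note fin = shifted.graft_finite[OF simple G T]
  have "total_degree (decoration_of shifted_degree (contract \<Gamma> G) T1) = i"
    using decorates_total_degree[OF decorates_decoration_of[OF fin(1) T(1), of shifted_degree]]
    unfolding nodes_decoration_of[OF fin(1)] tree_degree_shifted c .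
  moreover have "total_degree (decoration_of shifted_degree (induced \<Gamma> G) T2) = j"
    using decorates_total_degree[OF decorates_decoration_of[OF fin(2) T(2), of shifted_degree]]
    unfolding nodes_decoration_of[OF fin(2)] tree_degree_shifted c .
  ultimately show ?thesis
    unfolding cut_eq nodes_decoration_of[OF fin(1)] nodes_decoration_of[OF fin(2)]
      shifted.tree_spaceD(3)[OF x shifted.graft_decoration_append[OF simple G T]]
    using T by simp
qed

definition pairing2 ::
  "(unit decoration \<Rightarrow> 'k::field) \<Rightarrow> (unit decoration \<Rightarrow> 'k) \<Rightarrow> (unit decoration \<times> unit decoration \<Rightarrow> 'k) \<Rightarrow> 'k" where
  "pairing2 a b X = (\<Sum>T1 | admissible_tree (contract \<Gamma> G) T1. \<Sum>T2 | admissible_tree (induced \<Gamma> G) T2.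
        a (decoration_of hyper_degree (contract \<Gamma> G) T1) * b (decoration_of hyper_degree (induced \<Gamma> G) T2) *
        X (decoration_of shifted_degree (contract \<Gamma> G) T1, decoration_of shifted_degree (induced \<Gamma> G) T2))"

text \<open>Composition in the free contractad and decomposition in the cofree cocontractad are
  transposes. The degrees of the decomposition are forced: where \<open>a\<close> and
  \<open>b\<close> are non-zero, their degrees fix the numbers of nodes of the two trees.\<close>

lemma pairing_pcomp_cut:
  assumes a: "a \<in> hyper.tree_space (contract \<Gamma> G) i" and b: "b \<in> hyper.tree_space (induced \<Gamma> G) j"
    and x: "x \<in> shifted.tree_space \<Gamma> e"
  shows "pairing \<Gamma> (pcomp hyper.free \<Gamma> G i j a b) x =
     pairing2 a b (cut (2 * rank (contract \<Gamma> G) - i) (2 * rank (induced \<Gamma> G) - j) x)"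
  unfolding pairing_pcomp[OF a b] pairing2_def
proof (intro sum.cong refl)
  fix T1 T2 assume "T1 \<in> {T. admissible_tree (contract \<Gamma> G) T}" "T2 \<in> {T. admissible_tree (induced \<Gamma> G) T}"
  then have T: "admissible_tree (contract \<Gamma> G) T1" "admissible_tree (induced \<Gamma> G) T2" by simp_all
  note fin = shifted.graft_finite[OF simple G T]
  let ?a = "a (decoration_of hyper_degree (contract \<Gamma> G) T1)" and ?b = "b (decoration_of hyper_degree (induced \<Gamma> G) T2)"
  have "?a = 0 \<or> ?b = 0 \<or>
    cut (2 * rank (contract \<Gamma> G) - i) (2 * rank (induced \<Gamma> G) - j) x
      (decoration_of shifted_degree (contract \<Gamma> G) T1, decoration_of shifted_degree (induced \<Gamma> G) T2) =
     x (decoration_of shifted_degree \<Gamma> (T1 \<union> T2))"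
  proof (cases "?a = 0 \<or> ?b = 0")
    case False
    then have n: "?a \<noteq> 0" "?b \<noteq> 0" by auto
    have "2 * int (card T1) = 2 * rank (contract \<Gamma> G) - i"
      using hyper.tree_space_degree(1)[OF a fin(1) n(1)] tree_degree_hyper[OF simple_contract[OF simple G] T(1)] by simp
    moreover have "2 * int (card T2) = 2 * rank (induced \<Gamma> G) - j"
      using hyper.tree_space_degree(1)[OF b fin(2) n(2)]
        tree_degree_hyper[OF connected_simple[OF connected_induced[OF simple G]] T(2)] by simp
    ultimately show ?thesis using cut_eval[OF x T] by blast
  qed blast
  then show "?a * ?b * x (decoration_of shifted_degree \<Gamma> (T1 \<union> T2)) = ?a * ?b *
    cut (2 * rank (contract \<Gamma> G) - i) (2 * rank (induced \<Gamma> G) - j) x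
      (decoration_of shifted_degree (contract \<Gamma> G) T1, decoration_of shifted_degree (induced \<Gamma> G) T2)"
    by auto
qed

text \<open>This order of contraction, lower factor first, is the one used by the composition of
  \<open>dual_contractad\<close>.\<close>

lemma pairing2_iterated:
  "pairing2 a b X = pairing (induced \<Gamma> G) b (\<lambda>z. pairing (contract \<Gamma> G) a (\<lambda>y. X (y, z)))"
  unfolding pairing2_def pairing_def sum_distrib_left
  by (subst sum.swap) (intro sum.cong refl, simp add: mult_ac)

lemma pairing2_iterated':
  "pairing2 a b X = pairing (contract \<Gamma> G) a (\<lambda>y. pairing (induced \<Gamma> G) b (\<lambda>z. X (y, z)))"
  unfolding pairing2_def pairing_def sum_distrib_left by (intro sum.cong refl) (simp add: mult_ac)

lemma pairing2_tensor: "pairing2 a b (\<lambda>(y, z). v y * w z) = pairing (contract \<Gamma> G) a v * pairing (induced \<Gamma> G) b w"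
  unfolding pairing2_iterated prod.case
  unfolding pairing_def by (simp add: sum_distrib_left sum_distrib_right mult_ac)

lemma pairing2_add: "pairing2 a b (X + Y) = pairing2 a b X + pairing2 a b Y"
  and pairing2_scale: "pairing2 a b (fscale c X) = c * pairing2 a b X"
  unfolding pairing2_def fscale_def by (simp_all add: sum.distrib sum_distrib_left algebra_simps)

lemma pairing2_zero: "pairing2 a b 0 = 0"
  unfolding pairing2_def by simp

lemma pairing2_annihilates:
  assumes X: "X \<in> tensor U W"
    and n: "(\<forall>v\<in>U. pairing (contract \<Gamma> G) a v = 0) \<or> (\<forall>w\<in>W. pairing (induced \<Gamma> G) b w = 0)"
  shows "pairing2 a b X = 0"
  using X unfolding tensor_def
proof (rule fs.span_induct[where P="\<lambda>X. pairing2 a b X = 0"])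
  show "fs.subspace {X. pairing2 a b X = 0}"
    unfolding fs.subspace_def by (simp add: pairing2_zero pairing2_add pairing2_scale)
  show "pairing2 a b X = 0" if XX: "X \<in> {\<lambda>(x, y). v x * w y |v w. v \<in> U \<and> w \<in> W}" for X
  proof -
    obtain v w where X: "X = (\<lambda>(x, y). v x * w y)" "v \<in> U" "w \<in> W" using XX by blast
    show ?thesis unfolding X(1) pairing2_tensor using n X(2,3) by auto
  qed
qed

end
end

text \<open>An isomorphism induces a bijection of trees, so pulling back along it is adjoint to
  pulling back along its inverse.\<close>

lemma pairing_pull:
  fixes x :: "unit decoration \<Rightarrow> 'k::field"
  assumes simple: "simple_graph \<Gamma>" and simple': "simple_graph \<Gamma>'"
    and f: "graph_iso \<Gamma> \<Gamma>' f" and g: "graph_iso \<Gamma>' \<Gamma> g"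
    and gf: "\<And>v. v \<in> verts \<Gamma> \<Longrightarrow> g (f v) = v"
    and F: "F \<in> hyper.tree_space \<Gamma>' d" and x: "x \<in> shifted.tree_space \<Gamma> e"
  shows "pairing \<Gamma> (tree_pull (symmetric_generators hyper_degree) \<Gamma> \<Gamma>' f d F) x =
     pairing \<Gamma>' F (tree_pull (symmetric_generators shifted_degree) \<Gamma>' \<Gamma> g e x)"
proof -
  have fg: "f (g v) = v" if v: "v \<in> verts \<Gamma>'" for v
  proof -
    have "v \<in> f ` verts \<Gamma>" using v iso_image[OF simple simple' f] by simp
    then obtain w where "w \<in> verts \<Gamma>" "v = f w" by (rule imageE)
    then show ?thesis using gf by simp
  qed
  have inv: "lift \<Gamma>' g ` lift \<Gamma> f ` T = T" if "admissible_tree \<Gamma> T" for T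
  proof -
    have "lift \<Gamma>' g (lift \<Gamma> f N) = N" if "N \<in> T" for N
      unfolding lift_lift[OF simple simple' f]
      by (rule lift_ident[OF admissible_node(1)[OF \<open>admissible_tree \<Gamma> T\<close> that]]) (simp add: gf)
    then show ?thesis by (simp add: image_image)
  qed
  have inv': "lift \<Gamma> f ` lift \<Gamma>' g ` T = T" if "admissible_tree \<Gamma>' T" for T
  proof -
    have "lift \<Gamma> f (lift \<Gamma>' g N) = N" if "N \<in> T" for N
      unfolding lift_lift[OF simple' simple g]
      by (rule lift_ident[OF admissible_node(1)[OF \<open>admissible_tree \<Gamma>' T\<close> that]]) (simp add: fg)
    then show ?thesis by (simp add: image_image)
  qed
  have F1: "F (relabel (lift \<Gamma> f) (decoration_of hyper_degree \<Gamma> T)) = F (decoration_of hyper_degree \<Gamma>' (lift \<Gamma> f ` T))"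
    if T: "admissible_tree \<Gamma> T" for T
  proof -
    note fin = admissible_finite[OF simple T]
    have n: "nodes (decoration_of hyper_degree \<Gamma> T) = T" by (rule nodes_decoration_of[OF fin])
    have "decorates hyper_degree \<Gamma>' (relabel (lift \<Gamma> f) (decoration_of hyper_degree \<Gamma> T))"
      using hyper.decorates_relabel_iff[OF simple simple' f, of "decoration_of hyper_degree \<Gamma> T"]
        decorates_decoration_of[OF fin T] T unfolding n by blast
    from hyper.tree_space_eval[OF F this] show ?thesis unfolding hyper.nodes_relabel n .
  qed
  have x1: "x (relabel (lift \<Gamma>' g) (decoration_of shifted_degree \<Gamma>' T)) = x (decoration_of shifted_degree \<Gamma> (lift \<Gamma>' g ` T))"
    if T: "admissible_tree \<Gamma>' T" for T
  proof -
    note fin = admissible_finite[OF simple' T]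
    have n: "nodes (decoration_of shifted_degree \<Gamma>' T) = T" by (rule nodes_decoration_of[OF fin])
    have "decorates shifted_degree \<Gamma> (relabel (lift \<Gamma>' g) (decoration_of shifted_degree \<Gamma>' T))"
      using shifted.decorates_relabel_iff[OF simple' simple g, of "decoration_of shifted_degree \<Gamma>' T"]
        decorates_decoration_of[OF fin T] T unfolding n by blast
    from shifted.tree_space_eval[OF x this] show ?thesis unfolding hyper.nodes_relabel n .
  qed
  have n: "nodes (decoration_of deg \<Gamma> T) = T" if "admissible_tree \<Gamma> T" for T deg
    by (rule nodes_decoration_of[OF admissible_finite[OF simple that]])
  have n': "nodes (decoration_of deg \<Gamma>' T) = T" if "admissible_tree \<Gamma>' T" for T deg
    by (rule nodes_decoration_of[OF admissible_finite[OF simple' that]])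
  show ?thesis
    unfolding pairing_def hyper.tree_pull_eq shifted.tree_pull_eq
  proof (rule sum.reindex_bij_witness[where i="image (lift \<Gamma>' g)" and j="image (lift \<Gamma> f)"])
    fix T assume "T \<in> {T. admissible_tree \<Gamma> T}"
    then have T: "admissible_tree \<Gamma> T" by simp
    note T' = lift_admissible[OF simple simple' f T]
    show "lift \<Gamma>' g ` lift \<Gamma> f ` T = T" by (rule inv[OF T])
    show "lift \<Gamma> f ` T \<in> {T. admissible_tree \<Gamma>' T}" using T' by simp
    show "F (decoration_of hyper_degree \<Gamma>' (lift \<Gamma> f ` T)) *
        (if admissible_tree \<Gamma>' (nodes (decoration_of shifted_degree \<Gamma>' (lift \<Gamma> f ` T)))
         then x (relabel (lift \<Gamma>' g) (decoration_of shifted_degree \<Gamma>' (lift \<Gamma> f ` T))) else 0) =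
        (if admissible_tree \<Gamma> (nodes (decoration_of hyper_degree \<Gamma> T))
         then F (relabel (lift \<Gamma> f) (decoration_of hyper_degree \<Gamma> T)) else 0) * x (decoration_of shifted_degree \<Gamma> T)"
      unfolding n[OF T] n'[OF T'] x1[OF T'] F1[OF T] inv[OF T] using T T' by simp
  next
    fix T assume "T \<in> {T. admissible_tree \<Gamma>' T}"
    then have T: "admissible_tree \<Gamma>' T" by simp
    show "lift \<Gamma> f ` lift \<Gamma>' g ` T = T" by (rule inv'[OF T])
    show "lift \<Gamma>' g ` T \<in> {T. admissible_tree \<Gamma> T}" using lift_admissible[OF simple' simple g T] by simp
  qed
qed

lemma pairing_iden:
  assumes "simple_graph \<Gamma>" "card (verts \<Gamma>) = 1"
  shows "pairing \<Gamma> (iden hyper.free \<Gamma>) x = x []"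
proof -
  have "{T. admissible_tree \<Gamma> T} = {{}}" using admissible_one_vertex[OF assms] by auto
  moreover have "decoration_of deg \<Gamma> {} = []" for deg
    using set_decoration_of[of "{}" deg \<Gamma>] by simp
  ultimately show ?thesis unfolding pairing_def hyper.iden_free by simp
qed

text \<open>The values of \<open>g\<close> on the basis trees of the complementary degree serve as
  the coefficients of \<open>F\<close>.\<close>

lemma functional_as_pairing:
  fixes g :: "(unit decoration \<Rightarrow> 'k::field) \<Rightarrow> 'k"
  assumes simple: "simple_graph \<Gamma>" and g: "functional g"
  shows "\<exists>F\<in>hyper.tree_space \<Gamma> d. \<forall>x\<in>shifted.tree_space \<Gamma> (2 * rank \<Gamma> - d). pairing \<Gamma> F x = g x"
proof -
  let ?A = "{T. admissible_tree \<Gamma> T \<and> tree_degree shifted_degree \<Gamma> T = 2 * rank \<Gamma> - d}"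
  let ?F = "\<Sum>T\<in>?A. fscale (g (shifted.basis_tree \<Gamma> T)) (hyper.basis_tree \<Gamma> T)"
  have "?F \<in> hyper.tree_space \<Gamma> d"
  proof (rule fs.subspace_sum[OF hyper.subspace_tree_space], rule fs.subspace_scale[OF hyper.subspace_tree_space])
    fix T assume "T \<in> ?A"
    then have "tree_degree hyper_degree \<Gamma> T = d"
      using tree_degree_hyper[OF simple, of T] unfolding tree_degree_shifted by simp
    then show "hyper.basis_tree \<Gamma> T \<in> hyper.tree_space \<Gamma> d" using hyper.basis_tree_in[of \<Gamma> T] by simp
  qed
  moreover have "pairing \<Gamma> ?F x = g x" if x: "x \<in> shifted.tree_space \<Gamma> (2 * rank \<Gamma> - d)" for x
  proof -
    have "pairing \<Gamma> ?F x = (\<Sum>T\<in>?A. g (shifted.basis_tree \<Gamma> T) * x (decoration_of shifted_degree \<Gamma> T))"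
      unfolding pairing_sum_left pairing_scale_left
      by (rule sum.cong[OF refl]) (simp add: pairing_basis_left[OF simple])
    also have "\<dots> = g (\<Sum>T\<in>?A. fscale (x (decoration_of shifted_degree \<Gamma> T)) (shifted.basis_tree \<Gamma> T))"
      unfolding functional_sum[OF g] by (simp add: mult.commute)
    finally show ?thesis unfolding shifted.tree_space_expand[OF simple x, symmetric] .
  qed
  ultimately show ?thesis by blast
qed

lemma functional_as_pairing':
  fixes g :: "(unit decoration \<Rightarrow> 'k::field) \<Rightarrow> 'k"
  assumes simple: "simple_graph \<Gamma>" and g: "functional g"
  shows "\<exists>x\<in>shifted.tree_space \<Gamma> (2 * rank \<Gamma> - d). \<forall>F\<in>hyper.tree_space \<Gamma> d. pairing \<Gamma> F x = g F"
proof -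
  let ?A = "{T. admissible_tree \<Gamma> T \<and> tree_degree hyper_degree \<Gamma> T = d}"
  let ?x = "\<Sum>T\<in>?A. fscale (g (hyper.basis_tree \<Gamma> T)) (shifted.basis_tree \<Gamma> T)"
  have "?x \<in> shifted.tree_space \<Gamma> (2 * rank \<Gamma> - d)"
  proof (rule fs.subspace_sum[OF shifted.subspace_tree_space], rule fs.subspace_scale[OF shifted.subspace_tree_space])
    fix T assume "T \<in> ?A"
    then have "tree_degree shifted_degree \<Gamma> T = 2 * rank \<Gamma> - d"
      using tree_degree_hyper[OF simple, of T] unfolding tree_degree_shifted by simp
    then show "shifted.basis_tree \<Gamma> T \<in> shifted.tree_space \<Gamma> (2 * rank \<Gamma> - d)" using shifted.basis_tree_in[of \<Gamma> T] by simp
  qed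
  moreover have "pairing \<Gamma> F ?x = g F" if F: "F \<in> hyper.tree_space \<Gamma> d" for F
  proof -
    have "pairing \<Gamma> F ?x = (\<Sum>T\<in>?A. g (hyper.basis_tree \<Gamma> T) * F (decoration_of hyper_degree \<Gamma> T))"
      unfolding functional_sum[OF functional_pairing]
      by (rule sum.cong[OF refl]) (simp add: pairing_basis_right[OF simple])
    also have "\<dots> = g (\<Sum>T\<in>?A. fscale (F (decoration_of hyper_degree \<Gamma> T)) (hyper.basis_tree \<Gamma> T))"
      unfolding functional_sum[OF g] by (simp add: mult.commute)
    finally show ?thesis unfolding hyper.tree_space_expand[OF simple F, symmetric] .
  qed
  ultimately show ?thesis by blast
qed

section \<open>Relations\<close>

lemma length_nodes: "distinct (map fst L) \<Longrightarrow> length L = card (nodes L)"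
  unfolding nodes_def using distinct_card[of "map fst L"] by simp

lemma unshuffle_exp_pair: "unshuffle_exp P w [a, b] = (if P a \<and> \<not> P b then w a * w b else 0)"
proof -
  have "{(p, q). p < q \<and> q < length [a, b] \<and> P ([a, b] ! p) \<and> \<not> P ([a, b] ! q)} =
      (if P a \<and> \<not> P b then {(0, 1)} else {})"
    by (auto simp: less_Suc_eq)
  then show ?thesis unfolding unshuffle_exp_def by simp
qed

lemma generator_eq:
  "generator deg \<Gamma> L = (if L = [(\<Union>(verts \<Gamma>), deg \<Gamma>, ())] then 1 else 0 :: 'k::field)"
proof (cases "distinct (map fst L) \<and> nodes L = {\<Union>(verts \<Gamma>)} \<and> (\<forall>(N, i, x)\<in>set L. i = deg \<Gamma>)")
  case True
  then have "length L = 1" using length_nodes[of L] by simp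
  then obtain y where y: "L = [y]" by (cases L) auto
  obtain N i where N: "y = (N, i, ())" by (metis old.unit.exhaust surj_pair)
  have "L = [(\<Union>(verts \<Gamma>), deg \<Gamma>, ())]" using True unfolding y N nodes_def by simp
  moreover have "koszul_exp (\<lambda>_. deg \<Gamma>) [\<Union>(verts \<Gamma>)] ys = 0" for ys
    unfolding koszul_exp_def by simp
  ultimately show ?thesis using True unfolding generator_def tree_tensor_def by simp
next
  case False
  then have "L \<noteq> [(\<Union>(verts \<Gamma>), deg \<Gamma>, ())]" unfolding nodes_def by auto
  then show ?thesis using False unfolding generator_def tree_tensor_def by auto
qed

context
  fixes \<Gamma> :: graph assumes conn: "connected_graph \<Gamma>" and two: "2 \<le> card (verts \<Gamma>)"
begin

lemma root_leaves: "leaves \<Gamma> (\<Union>(verts \<Gamma>)) = verts \<Gamma>"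
  using leaves_Union[OF connected_simple[OF conn]] by simp

lemma admissible_corolla: "admissible_tree \<Gamma> {\<Union>(verts \<Gamma>)}"
  unfolding admissible_tree_def using root_leaves two tube_verts[OF conn] by simp

lemma children_corolla: "verts (in_graph \<Gamma> {\<Union>(verts \<Gamma>)} (\<Union>(verts \<Gamma>))) = verts \<Gamma>"
proof -
  note s = connected_simple[OF conn]
  have "M \<subset> \<Union>(verts \<Gamma>)" if "M \<in> verts \<Gamma>" for M
    using vert_node_proper[OF s admissible_corolla that, of "\<Union>(verts \<Gamma>)"] that by auto
  then show ?thesis unfolding verts_in_graph by auto
qed

end

lemma (in even_degrees) generator_basis:
  assumes conn: "connected_graph \<Gamma>" and two: "2 \<le> card (verts \<Gamma>)"
  shows "generator deg \<Gamma> = basis_tree \<Gamma> {\<Union>(verts \<Gamma>)}"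
proof
  fix L
  have d: "deg (in_graph \<Gamma> {\<Union>(verts \<Gamma>)} (\<Union>(verts \<Gamma>))) = deg \<Gamma>"
    by (rule deg_cong) (simp only: children_corolla[OF conn two])
  have "L = [(\<Union>(verts \<Gamma>), deg \<Gamma>, ())] \<longleftrightarrow> decorates deg \<Gamma> L \<and> nodes L = {\<Union>(verts \<Gamma>)}"
  proof
    assume "L = [(\<Union>(verts \<Gamma>), deg \<Gamma>, ())]"
    then show "decorates deg \<Gamma> L \<and> nodes L = {\<Union>(verts \<Gamma>)}"
      unfolding decorates_def nodes_def using admissible_corolla[OF conn two] d by simp
  next
    assume a: "decorates deg \<Gamma> L \<and> nodes L = {\<Union>(verts \<Gamma>)}"
    then have "length L = 1" using length_nodes[of L] unfolding decorates_def by simp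
    then obtain y where y: "L = [y]" by (cases L) auto
    obtain N i where N: "y = (N, i, ())" by (metis old.unit.exhaust surj_pair)
    show "L = [(\<Union>(verts \<Gamma>), deg \<Gamma>, ())]"
      using a d unfolding y N decorates_def nodes_def by simp
  qed
  then show "generator deg \<Gamma> L = basis_tree \<Gamma> {\<Union>(verts \<Gamma>)} L" unfolding generator_eq basis_tree_def by simp
qed

lemma (in even_degrees) generator_in:
  assumes conn: "connected_graph \<Gamma>" and two: "2 \<le> card (verts \<Gamma>)"
  shows "generator deg \<Gamma> \<in> tree_space \<Gamma> (deg \<Gamma>)"
proof -
  have "tree_degree deg \<Gamma> {\<Union>(verts \<Gamma>)} = deg \<Gamma>"
    unfolding tree_degree_def using deg_cong[of "in_graph \<Gamma> {\<Union>(verts \<Gamma>)} (\<Union>(verts \<Gamma>))" \<Gamma>] children_corolla[OF conn two] by simp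
  then show ?thesis unfolding generator_basis[OF assms] using basis_tree_in[of \<Gamma> "{\<Union>(verts \<Gamma>)}"] by simp
qed

section \<open>Trees with two vertices\<close>

definition cherry :: "graph \<Rightarrow> vert set \<Rightarrow> vert set" where
  "cherry \<Gamma> G = {\<Union>(verts \<Gamma>), \<Union>G}"

text \<open>The tubes that give trees with two vertices: a singleton tube would require a generator
  on the one-vertex graph, where there is none.\<close>

definition big_tube :: "graph \<Rightarrow> vert set \<Rightarrow> bool" where
  "big_tube \<Gamma> G \<longleftrightarrow> proper_tube \<Gamma> G \<and> 2 \<le> card G"

context
  fixes \<Gamma> :: graph assumes conn: "connected_graph \<Gamma>"
begin

lemma finite_tubes: "finite {G. big_tube \<Gamma> G \<and> P G}"
proof (rule finite_subset)
  show "{G. big_tube \<Gamma> G \<and> P G} \<subseteq> Pow (verts \<Gamma>)"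
    unfolding big_tube_def proper_tube_def tube_def by auto
  show "finite (Pow (verts \<Gamma>))" using finite_verts[OF connected_simple[OF conn]] by simp
qed

lemma finite_edges: "finite (edges \<Gamma>)"
proof (rule finite_subset)
  show "edges \<Gamma> \<subseteq> Pow (verts \<Gamma>)" using edge_subset[OF connected_simple[OF conn]] by blast
  show "finite (Pow (verts \<Gamma>))" using finite_verts[OF connected_simple[OF conn]] by simp
qed

context
  fixes G assumes G: "big_tube \<Gamma> G"
begin

lemma big_tubeD: "tube \<Gamma> G" "G \<noteq> verts \<Gamma>" "2 \<le> card G" "G \<subseteq> verts \<Gamma>"
  using G unfolding big_tube_def proper_tube_def tube_def by auto

lemma big_tube_card: "card G < card (verts \<Gamma>)"
  using psubset_card_mono[OF finite_verts[OF connected_simple[OF conn]], of G] big_tubeD by blast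

lemma big_tube_psubset: "\<Union>G \<subset> \<Union>(verts \<Gamma>)"
proof -
  note s = connected_simple[OF conn]
  have "\<Union>G \<noteq> \<Union>(verts \<Gamma>)"
  proof
    assume "\<Union>G = \<Union>(verts \<Gamma>)"
    then have "leaves \<Gamma> (\<Union>G) = leaves \<Gamma> (\<Union>(verts \<Gamma>))" by simp
    then show False using leaves_Union[OF s] big_tubeD by auto
  qed
  then show ?thesis using big_tubeD by blast
qed

lemma cards_big_tube:
  "2 \<le> card (verts \<Gamma>)" "2 \<le> card (verts (contract \<Gamma> G))" "2 \<le> card (verts (induced \<Gamma> G))"
  using big_tube_card big_tubeD(3) card_verts_contract[OF connected_simple[OF conn] big_tubeD(1)] by simp_all

lemma degree_big_tube:
  "hyper_degree (contract \<Gamma> G) + hyper_degree (induced \<Gamma> G) = 2 * (int (card (verts \<Gamma>)) - 3)"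
  using card_verts_contract[OF connected_simple[OF conn] big_tubeD(1)] big_tube_card
  unfolding hyper_degree_def by simp

lemma hyper_comp_in:
  "generator_comp hyper_degree \<Gamma> G \<in> hyper.tree_space \<Gamma> (2 * (int (card (verts \<Gamma>)) - 3))"
  using hyper.pcomp_free_in[OF connected_simple[OF conn] big_tubeD(1)
    hyper.generator_in[OF connected_contract[OF conn big_tubeD(1)] cards_big_tube(2)]
    hyper.generator_in[OF connected_induced[OF connected_simple[OF conn] big_tubeD(1)] cards_big_tube(3)]]
  unfolding degree_big_tube generator_comp_def .

lemma corollas:
  "admissible_tree (contract \<Gamma> G) {\<Union>(verts \<Gamma>)}" "admissible_tree (induced \<Gamma> G) {\<Union>G}"
  using admissible_corolla[OF connected_contract[OF conn big_tubeD(1)] cards_big_tube(2)]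
    admissible_corolla[OF connected_induced[OF connected_simple[OF conn] big_tubeD(1)] cards_big_tube(3)]
  unfolding Union_verts_contract[OF connected_simple[OF conn] big_tubeD(1)] by simp_all

lemma cherry_graft: "{\<Union>(verts \<Gamma>)} \<union> {\<Union>G} = cherry \<Gamma> G"
  unfolding cherry_def by blast

lemma admissible_cherry: "admissible_tree \<Gamma> (cherry \<Gamma> G)"
  using graft_admissible[OF connected_simple[OF conn] big_tubeD(1) corollas] unfolding cherry_graft .

lemma card_cherry: "card (cherry \<Gamma> G) = 2"
  using big_tube_psubset unfolding cherry_def by auto

lemma finite_cherry: "finite (cherry \<Gamma> G)"
  unfolding cherry_def by simp

text \<open>The composite of two generators is the basis tree with nodes
  \<open>\<Union>(verts \<Gamma>)\<close> and \<open>\<Union>G\<close>, so pairing with it reads off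
  one coefficient.\<close>

lemma pairing_hyper_comp:
  "pairing \<Gamma> (generator_comp hyper_degree \<Gamma> G) x = x (decoration_of shifted_degree \<Gamma> (cherry \<Gamma> G))"
proof -
  note s = connected_simple[OF conn]
  let ?C = "contract \<Gamma> G" and ?I = "induced \<Gamma> G"
  note cC = connected_contract[OF conn big_tubeD(1)] and cI = connected_induced[OF s big_tubeD(1)]
  have e: "generator hyper_degree ?C = hyper.basis_tree ?C {\<Union>(verts \<Gamma>)}"
    "generator hyper_degree ?I = hyper.basis_tree ?I {\<Union>G}"
    using hyper.generator_basis[OF cC cards_big_tube(2)] hyper.generator_basis[OF cI cards_big_tube(3)]
    unfolding Union_verts_contract[OF s big_tubeD(1)] by simp_all
  have "pairing \<Gamma> (generator_comp hyper_degree \<Gamma> G) x =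
      (\<Sum>T1 | admissible_tree ?C T1. \<Sum>T2 | admissible_tree ?I T2.
        generator hyper_degree ?C (decoration_of hyper_degree ?C T1) *
        generator hyper_degree ?I (decoration_of hyper_degree ?I T2) *
        x (decoration_of shifted_degree \<Gamma> (T1 \<union> T2)))"
    unfolding generator_comp_def
    by (rule pairing_pcomp[OF s big_tubeD(1) hyper.generator_in[OF cC cards_big_tube(2)]
          hyper.generator_in[OF cI cards_big_tube(3)]])
  also have "\<dots> = (\<Sum>T1 | admissible_tree ?C T1. \<Sum>T2 | admissible_tree ?I T2.
        if T2 = {\<Union>G} then if T1 = {\<Union>(verts \<Gamma>)} then x (decoration_of shifted_degree \<Gamma> (T1 \<union> T2)) else 0 else 0)"
  proof (intro sum.cong refl)
    fix T1 T2 assume "T1 \<in> {T. admissible_tree ?C T}" "T2 \<in> {T. admissible_tree ?I T}"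
    then have T: "admissible_tree ?C T1" "admissible_tree ?I T2" by simp_all
    note f = hyper.graft_finite[OF s big_tubeD(1) T]
    show "generator hyper_degree ?C (decoration_of hyper_degree ?C T1) *
        generator hyper_degree ?I (decoration_of hyper_degree ?I T2) *
        x (decoration_of shifted_degree \<Gamma> (T1 \<union> T2)) =
      (if T2 = {\<Union>G} then if T1 = {\<Union>(verts \<Gamma>)} then x (decoration_of shifted_degree \<Gamma> (T1 \<union> T2)) else 0 else 0)"
      unfolding e hyper.basis_tree_eval[OF f(1) T(1)] hyper.basis_tree_eval[OF f(2) T(2)] by simp
  qed
  also have "\<dots> = (\<Sum>T1 | admissible_tree ?C T1.
        if T1 = {\<Union>(verts \<Gamma>)} then x (decoration_of shifted_degree \<Gamma> (T1 \<union> {\<Union>G})) else 0)"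
    using corollas(2) finite_admissible[OF connected_simple[OF cI]] by (intro sum.cong refl) simp
  also have "\<dots> = x (decoration_of shifted_degree \<Gamma> ({\<Union>(verts \<Gamma>)} \<union> {\<Union>G}))"
    using corollas(1) finite_admissible[OF connected_simple[OF cC]] by simp
  finally show ?thesis unfolding cherry_graft .
qed

lemma grav_comp_eq:
  "generator_comp grav_degree \<Gamma> G L = sgnp (unshuffle_exp (\<lambda>(N, d, x). N \<subseteq> \<Union>G) (\<lambda>(N, d, x). d) L) *
     (if lower_part_of G L = [(\<Union>(verts \<Gamma>), 1, ())] then 1 else 0) *
     (if upper_part_of G L = [(\<Union>G, 1, ())] then 1 else 0 :: 'k::field)"
  unfolding generator_comp_def pcomp_free_raw generator_eq
    Union_verts_contract[OF connected_simple[OF conn] big_tubeD(1)] by (simp add: grav_degree_def)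

text \<open>On the two orderings of the vertices of the cherry, the signs of \<open>shift_squared\<close> and of the
  composition of odd generators are \<open>(-1, 1)\<close> and \<open>(1, -1)\<close>.\<close>

lemma shift_squared_grav_comp:
  "shift_squared (generator_comp grav_degree \<Gamma> G) = fscale (-1 :: 'k::field) (shifted.basis_tree \<Gamma> (cherry \<Gamma> G))"
proof
  fix L :: "unit decoration"
  let ?r = "\<Union>(verts \<Gamma>)" and ?g = "\<Union>G"
  have r: "\<not> ?r \<subseteq> ?g" "?g \<subseteq> ?r" "?r \<noteq> ?g" using big_tube_psubset by auto
  show "shift_squared (generator_comp grav_degree \<Gamma> G) L = fscale (-1 :: 'k) (shifted.basis_tree \<Gamma> (cherry \<Gamma> G)) L"
  proof (cases "length L = 2")
    case False
    have "\<not> (decorates shifted_degree \<Gamma> L \<and> nodes L = cherry \<Gamma> G)"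
      using False length_nodes[of L] card_cherry unfolding decorates_def by auto
    moreover have "shift_squared (generator_comp grav_degree \<Gamma> G) L = (0 :: 'k)"
      using False unfolding shift_squared_def by (auto split: list.splits)
    ultimately show ?thesis unfolding fscale_def shifted.basis_tree_def by simp
  next
    case True
    then obtain p q where "L = [p, q]" by (auto simp: numeral_2_eq_2 length_Suc_conv)
    moreover obtain N i where "p = (N, i, ())" by (metis old.unit.exhaust surj_pair)
    moreover obtain M j where "q = (M, j, ())" by (metis old.unit.exhaust surj_pair)
    ultimately have L: "L = [(N, i, ()), (M, j, ())]" by simp
    let ?A = "N = ?r \<and> M = ?g \<and> i = 2 \<and> j = 2" and ?B = "N = ?g \<and> M = ?r \<and> i = 2 \<and> j = 2"
    have b: "decorates shifted_degree \<Gamma> L \<and> nodes L = cherry \<Gamma> G \<longleftrightarrow> ?A \<or> ?B"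
    proof
      assume a: "decorates shifted_degree \<Gamma> L \<and> nodes L = cherry \<Gamma> G"
      then have "{N, M} = {?r, ?g}" "i = 2" "j = 2"
        unfolding L decorates_def nodes_def cherry_def shifted_degree_def by simp_all
      then show "?A \<or> ?B" by (metis doubleton_eq_iff)
    next
      assume "?A \<or> ?B"
      then have "nodes L = cherry \<Gamma> G" "distinct (map fst L)" "\<forall>(N, i, x)\<in>set L. i = 2"
        unfolding L nodes_def cherry_def using r(3) by auto
      then show "decorates shifted_degree \<Gamma> L \<and> nodes L = cherry \<Gamma> G"
        unfolding decorates_def shifted_degree_def using admissible_cherry by simp
    qed
    let ?L = "[(N, i - 1, ()), (M, j - 1, ())]"
    have u: "unshuffle_exp (\<lambda>(N, d, x). N \<subseteq> ?g) (\<lambda>(N, d, x). d) [(N, 1, ()), (M, 1, ())] =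
        (if N \<subseteq> ?g \<and> \<not> M \<subseteq> ?g then 1 else 0)"
      unfolding unshuffle_exp_pair by simp
    have gc: "generator_comp grav_degree \<Gamma> G ?L = (if ?A then 1 else if ?B then -1 else (0 :: 'k))"
    proof (cases "?A \<or> ?B")
      case True
      then have ij: "i = 2" "j = 2" by auto
      show ?thesis using True r u unfolding grav_comp_eq ij
        by (auto simp: lower_part_of_def upper_part_of_def sgnp_def)
    next
      case False
      then have "\<not> (lower_part_of G ?L = [(?r, 1, ())] \<and> upper_part_of G ?L = [(?g, 1, ())])"
        by (auto simp: lower_part_of_def upper_part_of_def split: if_splits)
      then have z: "(if lower_part_of G ?L = [(?r, 1, ())] then 1 else 0) *
          (if upper_part_of G ?L = [(?g, 1, ())] then 1 else 0) = (0 :: 'k)"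
        by (simp only: de_Morgan_conj split: if_split) simp
      have "\<not> ?A" "\<not> ?B" using False by blast+
      then show ?thesis unfolding grav_comp_eq mult.assoc z by (simp only: if_False mult_zero_right)
    qed
    have "shift_squared (generator_comp grav_degree \<Gamma> G) L =
        (if M \<subseteq> N then sgnp (i - 1) else sgnp i) * (generator_comp grav_degree \<Gamma> G ?L :: 'k)"
      unfolding L shift_squared_def by simp
    also have "\<dots> = (if ?A \<or> ?B then -1 else 0)"
    proof -
      have a1: "(if M \<subseteq> N then sgnp (i - 1) else sgnp i) = (-1 :: 'k)" if ?A
        using that r(2) by (simp add: sgnp_def)
      have a2: "(if M \<subseteq> N then sgnp (i - 1) else sgnp i) = (1 :: 'k)" if ?B
        using that r(1) by (simp add: sgnp_def)
      have a3: "\<not> ?A" if ?B using that r(3) by metis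
      have key: "c * (if A then 1 else if B then -1 else 0) = (if A \<or> B then -1 else 0)"
        if "A \<Longrightarrow> c = -1" "B \<Longrightarrow> c = 1" "B \<Longrightarrow> \<not> A" for A B and c :: 'k
        using that by (cases A; cases B) simp_all
      show ?thesis unfolding gc by (rule key[OF a1 a2 a3])
    qed
    finally show ?thesis unfolding fscale_def shifted.basis_tree_def b by simp
  qed
qed

end

lemma cherry_inj:
  assumes "big_tube \<Gamma> G" "big_tube \<Gamma> H" "cherry \<Gamma> G = cherry \<Gamma> H"
  shows "G = H"
proof -
  note s = connected_simple[OF conn]
  have "\<Union>G = \<Union>H"
    using assms(3) big_tube_psubset[OF assms(1)] big_tube_psubset[OF assms(2)]
    unfolding cherry_def by (metis doubleton_eq_iff psubset_eq)
  then have "leaves \<Gamma> (\<Union>G) = leaves \<Gamma> (\<Union>H)" by simp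
  then show ?thesis
    unfolding leaves_Union[OF s big_tubeD(4)[OF assms(1)]] leaves_Union[OF s big_tubeD(4)[OF assms(2)]] .
qed

text \<open>Besides the root there is exactly one node, and its leaves form the tube.\<close>

lemma cherry_exists:
  assumes T: "admissible_tree \<Gamma> T" and c: "card T = 2"
  shows "\<exists>G. big_tube \<Gamma> G \<and> T = cherry \<Gamma> G"
proof -
  note s = connected_simple[OF conn]
  have "T \<noteq> {}" using c by auto
  then have "2 \<le> card (verts \<Gamma>)" using node_card_verts[OF s T] by blast
  then have r: "\<Union>(verts \<Gamma>) \<in> T" by (rule admissible_root[OF T])
  have "card (T - {\<Union>(verts \<Gamma>)}) = 1" using c r by simp
  then obtain N where N: "T - {\<Union>(verts \<Gamma>)} = {N}" by (meson card_1_singletonE)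
  then have NT: "N \<in> T" "N \<noteq> \<Union>(verts \<Gamma>)" by blast+
  note n = admissible_node[OF T NT(1)]
  have "leaves \<Gamma> N \<noteq> verts \<Gamma>" using n(1) NT(2) by metis
  then have "big_tube \<Gamma> (leaves \<Gamma> N)" unfolding big_tube_def proper_tube_def using n(2,3) by simp
  moreover have "T = cherry \<Gamma> (leaves \<Gamma> N)" unfolding cherry_def n(1)[symmetric]
    by (rule sym) (rule insert_Diff[OF r, unfolded N])
  ultimately show ?thesis by blast
qed

text \<open>Shifted degree 4 means two vertices, and every such tree comes from a tube.\<close>

lemma tree_space_four_eqI:
  assumes x: "x \<in> shifted.tree_space \<Gamma> 4" and y: "y \<in> shifted.tree_space \<Gamma> 4"
    and eq: "\<And>G. big_tube \<Gamma> G \<Longrightarrow> x (decoration_of shifted_degree \<Gamma> (cherry \<Gamma> G)) = y (decoration_of shifted_degree \<Gamma> (cherry \<Gamma> G))"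
  shows "x = y"
proof (rule shifted.tree_space_eqI[OF x y])
  fix T assume T: "admissible_tree \<Gamma> T"
  note fin = admissible_finite[OF connected_simple[OF conn] T]
  show "x (decoration_of shifted_degree \<Gamma> T) = y (decoration_of shifted_degree \<Gamma> T)"
  proof (cases "card T = 2")
    case True
    then show ?thesis using cherry_exists[OF T] eq by metis
  next
    case False
    then have "tree_degree shifted_degree \<Gamma> T \<noteq> 4" unfolding tree_degree_shifted by simp
    then have "x (decoration_of shifted_degree \<Gamma> T) = 0" "y (decoration_of shifted_degree \<Gamma> T) = 0"
      using shifted.tree_space_degree(1)[OF x fin] shifted.tree_space_degree(1)[OF y fin] by blast+
    then show ?thesis by simp
  qed
qed

lemma cherry_in: "big_tube \<Gamma> G \<Longrightarrow> shifted.basis_tree \<Gamma> (cherry \<Gamma> G) \<in> shifted.tree_space \<Gamma> 4"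
  using shifted.basis_tree_in[of \<Gamma> "cherry \<Gamma> G"] card_cherry[of G] unfolding tree_degree_shifted by simp

lemma cherry_eval:
  assumes "big_tube \<Gamma> G" "big_tube \<Gamma> H"
  shows "shifted.basis_tree \<Gamma> (cherry \<Gamma> G) (decoration_of shifted_degree \<Gamma> (cherry \<Gamma> H)) = (if G = H then 1 else 0)"
  unfolding shifted.basis_tree_eval[OF finite_cherry[OF assms(2)] admissible_cherry[OF assms(2)]]
  using cherry_inj[OF assms] by auto

text \<open>A third vertex makes the edge a proper subset.\<close>

lemma big_tube_edge:
  assumes "3 \<le> card (verts \<Gamma>)" "e \<in> edges \<Gamma>"
  shows "big_tube \<Gamma> e"
proof -
  note s = connected_simple[OF conn]
  have c: "card e = 2" by (rule edge_card[OF s assms(2)])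
  then obtain u v where e: "e = {u, v}" by (meson card_2_iff)
  have "{u} \<union> {v} = e" using e by blast
  then have "joined \<Gamma> e"
    using joined_Un[OF s joined_singleton[OF s, of u] joined_singleton[OF s, of v], of u v] assms(2) e by simp
  then have "tube \<Gamma> e" unfolding tube_iff[OF s] using edge_subset[OF s assms(2)] by blast
  moreover have "e \<noteq> verts \<Gamma>" using c assms(1) by auto
  ultimately show ?thesis unfolding big_tube_def proper_tube_def using c by simp
qed

lemma edge_of_tube:
  assumes "tube \<Gamma> G" "card G = 2"
  shows "G \<in> edges \<Gamma>"
proof -
  note s = connected_simple[OF conn]
  obtain u v where G: "G = {u, v}" "u \<noteq> v" using assms(2) by (meson card_2_iff)
  have "joined \<Gamma> G" using assms(1) tube_iff[OF s] by blast
  then have "\<exists>x\<in>{u}. \<exists>y\<in>G - {u}. {x, y} \<in> edges \<Gamma>" by (rule joinedD) (use G in auto)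
  then show ?thesis using G by auto
qed

lemma tubes_over_edge:
  assumes "e \<in> edges \<Gamma>"
  shows "{G. proper_tube \<Gamma> G \<and> e \<subseteq> G} = {G. big_tube \<Gamma> G \<and> e \<subseteq> G}"
proof -
  note s = connected_simple[OF conn]
  have "2 \<le> card G" if "proper_tube \<Gamma> G" "e \<subseteq> G" for G
  proof -
    have "finite G" using that(1) tube_finite[OF s] unfolding proper_tube_def by blast
    then show ?thesis using card_mono[OF _ that(2)] edge_card[OF s assms] by simp
  qed
  then show ?thesis unfolding big_tube_def by blast
qed

text \<open>The value on \<open>x\<close> of one side of a hypercommutative relation. Equality of
  these sums over all edges is the condition through which the gravity and the hypercommutative
  relations are compared.\<close>

definition edge_sum :: "(unit decoration \<Rightarrow> 'k::field) \<Rightarrow> vert set \<Rightarrow> 'k" where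
  "edge_sum x e = (\<Sum>G | big_tube \<Gamma> G \<and> e \<subseteq> G. x (decoration_of shifted_degree \<Gamma> (cherry \<Gamma> G)))"

lemma pairing_hyper_relations:
  fixes x :: "unit decoration \<Rightarrow> 'k::field"
  shows "(\<forall>r\<in>hyper_relations \<Gamma> (2 * rank \<Gamma> - 4). pairing \<Gamma> r x = 0) \<longleftrightarrow>
     (\<forall>e\<in>edges \<Gamma>. \<forall>e'\<in>edges \<Gamma>. edge_sum x e = edge_sum x e')"
proof -
  have p: "pairing \<Gamma> ((\<Sum>G | proper_tube \<Gamma> G \<and> e \<subseteq> G. generator_comp hyper_degree \<Gamma> G) -
      (\<Sum>G | proper_tube \<Gamma> G \<and> e' \<subseteq> G. generator_comp hyper_degree \<Gamma> G)) x = edge_sum x e - edge_sum x e'"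
    if "e \<in> edges \<Gamma>" "e' \<in> edges \<Gamma>" for e e'
    unfolding pairing_diff_left pairing_sum_left tubes_over_edge[OF that(1)] tubes_over_edge[OF that(2)] edge_sum_def
    by (intro arg_cong2[where f="(-)"] sum.cong refl) (simp_all add: pairing_hyper_comp)
  have d: "2 * rank \<Gamma> - 4 = 2 * (int (card (verts \<Gamma>)) - 3)" unfolding rank_eq by simp
  show ?thesis
  proof
    assume a: "\<forall>r\<in>hyper_relations \<Gamma> (2 * rank \<Gamma> - 4). pairing \<Gamma> r x = 0"
    show "\<forall>e\<in>edges \<Gamma>. \<forall>e'\<in>edges \<Gamma>. edge_sum x e = edge_sum x e'"
    proof (intro ballI)
      fix e e' assume e: "e \<in> edges \<Gamma>" "e' \<in> edges \<Gamma>"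
      have "(\<Sum>G | proper_tube \<Gamma> G \<and> e \<subseteq> G. generator_comp hyper_degree \<Gamma> G) -
        (\<Sum>G | proper_tube \<Gamma> G \<and> e' \<subseteq> G. generator_comp hyper_degree \<Gamma> G) \<in> (hyper_relations \<Gamma> (2 * rank \<Gamma> - 4) :: (_ \<Rightarrow> 'k) set)"
        unfolding hyper_relations_def d using e by blast
      then have "edge_sum x e - edge_sum x e' = 0" unfolding p[OF e, symmetric] by (rule bspec[OF a])
      then show "edge_sum x e = edge_sum x e'" by simp
    qed
  next
    assume a: "\<forall>e\<in>edges \<Gamma>. \<forall>e'\<in>edges \<Gamma>. edge_sum x e = edge_sum x e'"
    show "\<forall>r\<in>hyper_relations \<Gamma> (2 * rank \<Gamma> - 4). pairing \<Gamma> r x = 0"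
    proof
      fix r :: "unit decoration \<Rightarrow> 'k" assume "r \<in> hyper_relations \<Gamma> (2 * rank \<Gamma> - 4)"
      then obtain e e' where e: "e \<in> edges \<Gamma>" "e' \<in> edges \<Gamma>"
        "r = (\<Sum>G | proper_tube \<Gamma> G \<and> e \<subseteq> G. generator_comp hyper_degree \<Gamma> G) -
          (\<Sum>G | proper_tube \<Gamma> G \<and> e' \<subseteq> G. generator_comp hyper_degree \<Gamma> G)"
        unfolding hyper_relations_def by blast
      have "edge_sum x e = edge_sum x e'" by (rule bspec[OF bspec[OF a e(1)] e(2)])
      then show "pairing \<Gamma> r x = 0" unfolding e(3) p[OF e(1,2)] by simp
    qed
  qed
qed

lemma hyper_relations_in: "hyper_relations \<Gamma> d \<subseteq> hyper.tree_space \<Gamma> d"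
proof
  fix r :: "unit decoration \<Rightarrow> 'k::field" assume "r \<in> hyper_relations \<Gamma> d"
  then obtain e e' where e: "e \<in> edges \<Gamma>" "e' \<in> edges \<Gamma>" "d = 2 * (int (card (verts \<Gamma>)) - 3)"
    "r = (\<Sum>G | proper_tube \<Gamma> G \<and> e \<subseteq> G. generator_comp hyper_degree \<Gamma> G) -
      (\<Sum>G | proper_tube \<Gamma> G \<and> e' \<subseteq> G. generator_comp hyper_degree \<Gamma> G)"
    unfolding hyper_relations_def by blast
  have "(\<Sum>G | proper_tube \<Gamma> G \<and> e \<subseteq> G. generator_comp hyper_degree \<Gamma> G) \<in> hyper.tree_space \<Gamma> d"
    if "e \<in> edges \<Gamma>" for e
    unfolding tubes_over_edge[OF that] e(3)
    by (rule fs.subspace_sum[OF hyper.subspace_tree_space]) (rule hyper_comp_in, blast)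
  then show "r \<in> hyper.tree_space \<Gamma> d"
    unfolding e(4) using e(1,2) by (intro fs.subspace_diff[OF hyper.subspace_tree_space])
qed

text \<open>The shifted degree is twice the number of vertices, so a homogeneous element either
  consists of trees with two vertices or has none of them.\<close>

lemma weight_two_part_eq:
  assumes x: "x \<in> shifted.tree_space \<Gamma> d"
  shows "weight_two_part x = (if d = 4 then x else 0)"
proof
  fix L
  have l: "2 * int (length L) = d" if "x L \<noteq> 0"
    using shifted.tree_spaceD(1,2)[OF x that] length_nodes[of L] unfolding tree_degree_shifted decorates_def by simp
  show "weight_two_part x L = (if d = 4 then x else 0) L"
    using l unfolding weight_two_part_def by (cases "x L = 0") auto
qed

end

lemma shift_squared_add: "shift_squared (F + F') = shift_squared F + shift_squared F'"
  by (rule ext) (auto simp: shift_squared_def algebra_simps split: list.splits)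

lemma shift_squared_diff: "shift_squared (F - F') = shift_squared F - shift_squared F'"
  by (rule ext) (auto simp: shift_squared_def algebra_simps split: list.splits)

lemma shift_squared_zero: "shift_squared 0 = 0"
  by (rule ext) (auto simp: shift_squared_def split: list.splits)

lemma shift_squared_sum: "shift_squared (\<Sum>i\<in>A. F i) = (\<Sum>i\<in>A. shift_squared (F i))"
proof (induction A rule: infinite_finite_induct)
  case (infinite A)
  show ?case unfolding sum.infinite[OF infinite] by (rule shift_squared_zero)
next
  case empty
  show ?case unfolding sum.empty by (rule shift_squared_zero)
next
  case (insert i A)
  show ?case by (simp only: sum.insert[OF insert.hyps] shift_squared_add insert.IH)
qed

section \<open>The Koszul dual cocontractad\<close>

lemma functional_edge_sum:
  assumes "connected_graph \<Gamma>"
  shows "functional (\<lambda>x :: _ \<Rightarrow> 'k::field. edge_sum \<Gamma> x e)"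
  unfolding functional_def edge_sum_def[OF assms] fscale_def by (simp add: sum.distrib sum_distrib_left)

lemma functional_eval: "functional (\<lambda>x :: 'b \<Rightarrow> 'k::field. x L)"
  unfolding functional_def fscale_def by simp

lemma functional_diff:
  assumes "functional g" shows "g (x - y) = g x - g y"
proof -
  have "g (x - y) + g y = g (x - y + y)" using assms unfolding functional_def by metis
  then show ?thesis by (simp add: algebra_simps)
qed

lemma functional_add: "functional g \<Longrightarrow> g (x + y) = g x + g y"
  and functional_scale: "functional g \<Longrightarrow> g (fscale c x) = c * g x"
  unfolding functional_def by blast+

context
  fixes \<Gamma> :: graph assumes conn: "connected_graph \<Gamma>" and three: "3 \<le> card (verts \<Gamma>)"
begin

lemma edge_sum_cherry:
  assumes "big_tube \<Gamma> H" "e \<in> edges \<Gamma>"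
  shows "edge_sum \<Gamma> (shifted.basis_tree \<Gamma> (cherry \<Gamma> H)) e = (if e \<subseteq> H then 1 else 0 :: 'k::field)"
proof -
  have "edge_sum \<Gamma> (shifted.basis_tree \<Gamma> (cherry \<Gamma> H)) e =
      (\<Sum>G | big_tube \<Gamma> G \<and> e \<subseteq> G. if G = H then 1 else 0 :: 'k)"
    unfolding edge_sum_def[OF conn]
  proof (rule sum.cong[OF refl])
    fix G assume "G \<in> {G. big_tube \<Gamma> G \<and> e \<subseteq> G}"
    then have G: "big_tube \<Gamma> G" by simp
    show "shifted.basis_tree \<Gamma> (cherry \<Gamma> H) (decoration_of shifted_degree \<Gamma> (cherry \<Gamma> G)) = (if G = H then 1 else 0 :: 'k)"
      unfolding cherry_eval[OF conn assms(1) G] by auto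
  qed
  also have "\<dots> = (if e \<subseteq> H then 1 else 0)"
    using finite_tubes[OF conn, of "\<lambda>G. e \<subseteq> G"] assms(1) by simp
  finally show ?thesis .
qed

lemma edge_subset_edge: "e \<in> edges \<Gamma> \<Longrightarrow> e' \<in> edges \<Gamma> \<Longrightarrow> e \<subseteq> e' \<longleftrightarrow> e' = e"
  using edge_card[OF connected_simple[OF conn]] by (metis card.infinite card_subset_eq subset_refl zero_neq_numeral)

definition relation1 :: "unit decoration \<Rightarrow> 'k::field" where
  "relation1 = shift_squared (\<Sum>e\<in>edges \<Gamma>. generator_comp grav_degree \<Gamma> e)"

definition relation2 :: "vert set \<Rightarrow> unit decoration \<Rightarrow> 'k::field" where
  "relation2 G = shift_squared ((\<Sum>e\<in>edges (induced \<Gamma> G). generator_comp grav_degree \<Gamma> e) - generator_comp grav_degree \<Gamma> G)"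

lemma relation1_eq:
  "relation1 = (\<Sum>e\<in>edges \<Gamma>. fscale (-1 :: 'k::field) (shifted.basis_tree \<Gamma> (cherry \<Gamma> e)))"
  unfolding relation1_def shift_squared_sum
  by (rule sum.cong[OF refl]) (rule shift_squared_grav_comp[OF conn big_tube_edge[OF conn three]])

lemma relation2_eq:
  assumes "big_tube \<Gamma> G"
  shows "relation2 G = (\<Sum>e\<in>{e \<in> edges \<Gamma>. e \<subseteq> G}. fscale (-1 :: 'k::field) (shifted.basis_tree \<Gamma> (cherry \<Gamma> e))) -
    fscale (-1) (shifted.basis_tree \<Gamma> (cherry \<Gamma> G))"
proof -
  have "edges (induced \<Gamma> G) = {e \<in> edges \<Gamma>. e \<subseteq> G}" unfolding induced_def by simp
  moreover have "(\<Sum>e\<in>{e \<in> edges \<Gamma>. e \<subseteq> G}. shift_squared (generator_comp grav_degree \<Gamma> e)) =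
      (\<Sum>e\<in>{e \<in> edges \<Gamma>. e \<subseteq> G}. fscale (-1 :: 'k) (shifted.basis_tree \<Gamma> (cherry \<Gamma> e)))"
  proof (rule sum.cong[OF refl])
    fix e assume "e \<in> {e \<in> edges \<Gamma>. e \<subseteq> G}"
    then have "e \<in> edges \<Gamma>" by simp
    then show "shift_squared (generator_comp grav_degree \<Gamma> e) = fscale (-1 :: 'k) (shifted.basis_tree \<Gamma> (cherry \<Gamma> e))"
      by (rule shift_squared_grav_comp[OF conn big_tube_edge[OF conn three]])
  qed
  ultimately show ?thesis
    unfolding relation2_def shift_squared_diff shift_squared_sum shift_squared_grav_comp[OF conn assms] by simp
qed

lemma relation1_apply:
  assumes g: "functional (g :: (_ \<Rightarrow> 'k::field) \<Rightarrow> 'k)"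
  shows "g relation1 = - (\<Sum>e\<in>edges \<Gamma>. g (shifted.basis_tree \<Gamma> (cherry \<Gamma> e)))"
  unfolding relation1_eq functional_sum[OF g] by (simp add: sum_negf)

lemma relation2_apply:
  assumes g: "functional (g :: (_ \<Rightarrow> 'k::field) \<Rightarrow> 'k)" and "big_tube \<Gamma> G"
  shows "g (relation2 G) = g (shifted.basis_tree \<Gamma> (cherry \<Gamma> G)) -
     (\<Sum>e\<in>{e \<in> edges \<Gamma>. e \<subseteq> G}. g (shifted.basis_tree \<Gamma> (cherry \<Gamma> e)))"
  unfolding relation2_eq[OF assms(2)] functional_diff[OF g] functional_sum[OF g] functional_scale[OF g]
  by (simp add: sum_negf)

text \<open>Among the edges only \<open>e\<close> itself contains \<open>e\<close>, so every edge
  receives the same single contribution.\<close>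

lemma edge_sum_relation1:
  assumes e: "e \<in> edges \<Gamma>"
  shows "edge_sum \<Gamma> relation1 e = (-1 :: 'k::field)"
proof -
  have "(\<Sum>e'\<in>edges \<Gamma>. edge_sum \<Gamma> (shifted.basis_tree \<Gamma> (cherry \<Gamma> e')) e) = (\<Sum>e'\<in>edges \<Gamma>. if e' = e then 1 else 0 :: 'k)"
  proof (rule sum.cong[OF refl])
    fix e' assume e': "e' \<in> edges \<Gamma>"
    show "edge_sum \<Gamma> (shifted.basis_tree \<Gamma> (cherry \<Gamma> e')) e = (if e' = e then 1 else 0 :: 'k)"
      unfolding edge_sum_cherry[OF big_tube_edge[OF conn three e'] e] edge_subset_edge[OF e e'] ..
  qed
  also have "\<dots> = 1" using finite_edges[OF conn] e by simp
  finally show ?thesis unfolding relation1_apply[OF functional_edge_sum[OF conn]] by simp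
qed

text \<open>For \<open>e\<close> inside \<open>G\<close> the contributions of \<open>G\<close> and
  of \<open>e\<close> itself cancel; for any other edge there are none.\<close>

lemma edge_sum_relation2:
  assumes e: "e \<in> edges \<Gamma>" and G: "big_tube \<Gamma> G"
  shows "edge_sum \<Gamma> (relation2 G) e = (0 :: 'k::field)"
proof -
  have "(\<Sum>e'\<in>{e \<in> edges \<Gamma>. e \<subseteq> G}. edge_sum \<Gamma> (shifted.basis_tree \<Gamma> (cherry \<Gamma> e')) e) =
      (\<Sum>e'\<in>{e \<in> edges \<Gamma>. e \<subseteq> G}. if e' = e then 1 else 0 :: 'k)"
  proof (rule sum.cong[OF refl])
    fix e' assume "e' \<in> {e \<in> edges \<Gamma>. e \<subseteq> G}"
    then have e': "e' \<in> edges \<Gamma>" by simp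
    show "edge_sum \<Gamma> (shifted.basis_tree \<Gamma> (cherry \<Gamma> e')) e = (if e' = e then 1 else 0 :: 'k)"
      unfolding edge_sum_cherry[OF big_tube_edge[OF conn three e'] e] edge_subset_edge[OF e e'] ..
  qed
  also have "\<dots> = (if e \<subseteq> G then 1 else 0)" using finite_edges[OF conn] e by simp
  finally show ?thesis
    unfolding relation2_apply[OF functional_edge_sum[OF conn] G] edge_sum_cherry[OF G e] by simp
qed

lemma grav_relations_image:
  "shift_squared ` grav_relations \<Gamma> 2 = insert relation1 (relation2 ` {G. big_tube \<Gamma> G \<and> 3 \<le> card G})"
proof -
  have "{G. big_tube \<Gamma> G \<and> 3 \<le> card G} = {G. proper_tube \<Gamma> G \<and> 3 \<le> card G}" unfolding big_tube_def by auto
  then show ?thesis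
    unfolding grav_relations_def relation1_def relation2_def using three by (auto simp: image_iff)
qed

lemma span_relations_edge_sum:
  assumes x: "x \<in> fs.span (shift_squared ` grav_relations \<Gamma> 2)" and e: "e \<in> edges \<Gamma>" "e' \<in> edges \<Gamma>"
  shows "edge_sum \<Gamma> x e = (edge_sum \<Gamma> x e' :: 'k::field)"
  using x
proof (rule fs.span_induct[where P="\<lambda>x. edge_sum \<Gamma> x e = edge_sum \<Gamma> x e'"])
  note f = functional_edge_sum[OF conn]
  show "fs.subspace {x. edge_sum \<Gamma> x e = (edge_sum \<Gamma> x e' :: 'k)}"
    unfolding fs.subspace_def by (simp add: functional_zero[OF f] functional_add[OF f] functional_scale[OF f])
  fix x :: "unit decoration \<Rightarrow> 'k" assume "x \<in> shift_squared ` grav_relations \<Gamma> 2"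
  then consider "x = relation1" | G where "big_tube \<Gamma> G" "x = relation2 G" unfolding grav_relations_image by blast
  then show "edge_sum \<Gamma> x e = edge_sum \<Gamma> x e'"
  proof cases
    case 1
    then show ?thesis using edge_sum_relation1[OF e(1), where 'k='k] edge_sum_relation1[OF e(2), where 'k='k] by simp
  next
    case 2
    then show ?thesis using edge_sum_relation2[OF e(1) 2(1), where 'k='k] edge_sum_relation2[OF e(2) 2(1), where 'k='k] by simp
  qed
qed

text \<open>The relation of a tube with at least three vertices has coefficient 1 at its own tree
  and otherwise involves only edges. So the coefficients at large tubes can be matched freely, and
  constancy of the edge sums then fixes the coefficients at edges.\<close>

lemma edge_sum_span_relations:
  fixes x :: "unit decoration \<Rightarrow> 'k::field"
  assumes x: "x \<in> shifted.tree_space \<Gamma> 4" and c: "\<forall>e\<in>edges \<Gamma>. \<forall>e'\<in>edges \<Gamma>. edge_sum \<Gamma> x e = edge_sum \<Gamma> x e'"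
  shows "x \<in> fs.span (shift_squared ` grav_relations \<Gamma> 2)"
proof -
  \<comment> \<open>The common edge sum; in the absence of edges any value will do.\<close>
  obtain a where a: "\<And>e. e \<in> edges \<Gamma> \<Longrightarrow> edge_sum \<Gamma> x e = a"
  proof (cases "edges \<Gamma> = {}")
    case True
    then show thesis using that by simp
  next
    case False
    then obtain e where "e \<in> edges \<Gamma>" by blast
    then show thesis using c that[of "edge_sum \<Gamma> x e"] by blast
  qed
  let ?P = "{G. big_tube \<Gamma> G \<and> 3 \<le> card G}"
  let ?ev = "\<lambda>H y. y (decoration_of shifted_degree \<Gamma> (cherry \<Gamma> H)) :: 'k"
  \<comment> \<open>The coefficient of each large tube is copied from \<open>x\<close>. The factor
    \<open>- a\<close> compensates the coefficient -1 of every edge in \<open>relation1\<close>: an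
    edge is left with \<open>a\<close> minus the coefficients of the large tubes containing it,
    which is its coefficient in \<open>x\<close>.\<close>
  define y where "y = fscale (- a) relation1 + (\<Sum>G\<in>?P. fscale (?ev G x) (relation2 G))"
  have finP: "finite ?P" by (rule finite_tubes[OF conn])
  have cin: "shifted.basis_tree \<Gamma> (cherry \<Gamma> e) \<in> (shifted.tree_space \<Gamma> 4 :: (_ \<Rightarrow> 'k) set)" if "e \<in> edges \<Gamma>" for e
    by (rule cherry_in[OF conn big_tube_edge[OF conn three that]])
  have r1: "relation1 \<in> (shifted.tree_space \<Gamma> 4 :: (_ \<Rightarrow> 'k) set)"
    unfolding relation1_eq
    by (rule fs.subspace_sum[OF shifted.subspace_tree_space]) (rule fs.subspace_scale[OF shifted.subspace_tree_space cin])
  have r2: "relation2 G \<in> (shifted.tree_space \<Gamma> 4 :: (_ \<Rightarrow> 'k) set)" if "big_tube \<Gamma> G" for G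
    unfolding relation2_eq[OF that]
    by (rule fs.subspace_diff[OF shifted.subspace_tree_space],
        rule fs.subspace_sum[OF shifted.subspace_tree_space],
        rule fs.subspace_scale[OF shifted.subspace_tree_space cin], simp,
        rule fs.subspace_scale[OF shifted.subspace_tree_space cherry_in[OF conn that]])
  have yin: "y \<in> shifted.tree_space \<Gamma> 4"
    unfolding y_def
    by (intro fs.subspace_add[OF shifted.subspace_tree_space] fs.subspace_scale[OF shifted.subspace_tree_space]
        fs.subspace_sum[OF shifted.subspace_tree_space] r1 r2) simp
  have ysp: "y \<in> fs.span (shift_squared ` grav_relations \<Gamma> 2)"
    unfolding y_def grav_relations_image
    by (intro fs.span_add fs.span_scale fs.span_sum fs.span_base) auto
  have "x = y"
  proof (rule tree_space_four_eqI[OF conn x yin])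
    fix H assume H: "big_tube \<Gamma> H"
    have ev: "functional (?ev H)" by (rule functional_eval)
    have ce: "?ev H (shifted.basis_tree \<Gamma> (cherry \<Gamma> G)) = (if G = H then 1 else 0)" if "big_tube \<Gamma> G" for G
      by (rule cherry_eval[OF conn that H])
    have cee: "(\<Sum>e\<in>A. ?ev H (shifted.basis_tree \<Gamma> (cherry \<Gamma> e))) = (if H \<in> A then 1 else 0)" if A: "A \<subseteq> edges \<Gamma>" for A
    proof -
      have "(\<Sum>e\<in>A. ?ev H (shifted.basis_tree \<Gamma> (cherry \<Gamma> e))) = (\<Sum>e\<in>A. if e = H then 1 else 0)"
        by (rule sum.cong[OF refl]) (use A ce[OF big_tube_edge[OF conn three]] in blast)
      then show ?thesis using finite_subset[OF A finite_edges[OF conn]] by simp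
    qed
    have v1: "?ev H relation1 = - (if H \<in> edges \<Gamma> then 1 else 0)"
      unfolding relation1_apply[OF ev] cee[OF subset_refl] ..
    have v2: "?ev H (relation2 G) = (if G = H then 1 else 0) - (if H \<in> edges \<Gamma> \<and> H \<subseteq> G then 1 else 0)" if "big_tube \<Gamma> G" for G
      unfolding relation2_apply[OF ev that] ce[OF that] using cee[of "{e \<in> edges \<Gamma>. e \<subseteq> G}"] by simp
    have "?ev H y = a * (if H \<in> edges \<Gamma> then 1 else 0) +
        (\<Sum>G\<in>?P. ?ev G x * ((if G = H then 1 else 0) - (if H \<in> edges \<Gamma> \<and> H \<subseteq> G then 1 else 0)))"
    proof -
      have "(\<Sum>G\<in>?P. ?ev G x * ?ev H (relation2 G)) =
        (\<Sum>G\<in>?P. ?ev G x * ((if G = H then 1 else 0) - (if H \<in> edges \<Gamma> \<and> H \<subseteq> G then 1 else 0)))"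
        by (rule sum.cong[OF refl]) (simp add: v2)
      then show ?thesis
        unfolding y_def functional_add[OF ev] functional_scale[OF ev] functional_sum[OF ev] v1 by simp
    qed
    also have "\<dots> = ?ev H x"
    proof (cases "H \<in> edges \<Gamma>")
      case True
      have cH: "card H = 2" by (rule edge_card[OF connected_simple[OF conn] True])
      \<comment> \<open>Besides \<open>H\<close>, every big tube over the edge \<open>H\<close> has
        at least three vertices, because one with two vertices equals \<open>H\<close>.\<close>
      have tubes: "{G. big_tube \<Gamma> G \<and> H \<subseteq> G} = insert H {G \<in> ?P. H \<subseteq> G}"
      proof (rule set_eqI, rule iffI)
        fix G assume G: "G \<in> {G. big_tube \<Gamma> G \<and> H \<subseteq> G}"
        show "G \<in> insert H {G \<in> ?P. H \<subseteq> G}"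
        proof (cases "card G = 2")
          case True
          then have "finite G" by (metis card.infinite zero_neq_numeral)
          then have "H = G" using card_subset_eq[of G H] G cH True by simp
          then show ?thesis by simp
        next
          case False
          then have "3 \<le> card G" using G unfolding big_tube_def by simp
          then show ?thesis using G by simp
        qed
      next
        fix G assume "G \<in> insert H {G \<in> ?P. H \<subseteq> G}"
        then show "G \<in> {G. big_tube \<Gamma> G \<and> H \<subseteq> G}" using H by auto
      qed
      have "a = (\<Sum>G\<in>insert H {G \<in> ?P. H \<subseteq> G}. ?ev G x)"
        using a[OF True] unfolding edge_sum_def[OF conn] tubes by simp
      also have "\<dots> = ?ev H x + (\<Sum>G\<in>{G \<in> ?P. H \<subseteq> G}. ?ev G x)"
      proof (rule sum.insert)
        show "finite {G \<in> ?P. H \<subseteq> G}" by (rule finite_subset[OF _ finP]) blast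
        show "H \<notin> {G \<in> ?P. H \<subseteq> G}" using cH by simp
      qed
      also have "(\<Sum>G\<in>{G \<in> ?P. H \<subseteq> G}. ?ev G x) = (\<Sum>G\<in>?P. if H \<subseteq> G then ?ev G x else 0)"
        by (rule sum.inter_filter[OF finP])
      finally have a1: "a = ?ev H x + (\<Sum>G\<in>?P. if H \<subseteq> G then ?ev G x else 0)" .
      have "(\<Sum>G\<in>?P. ?ev G x * ((if G = H then 1 else 0) - (if H \<in> edges \<Gamma> \<and> H \<subseteq> G then 1 else 0))) =
          (\<Sum>G\<in>?P. - (if H \<subseteq> G then ?ev G x else 0))"
        by (rule sum.cong[OF refl]) (use True cH in auto)
      then show ?thesis using a1 True by (simp add: sum_negf)
    next
      case False
      then have "card H \<noteq> 2" using edge_of_tube[OF conn, of H] big_tubeD(1)[OF conn H] by blast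
      then have HP: "H \<in> ?P" using H unfolding big_tube_def by simp
      have "(\<Sum>G\<in>?P. ?ev G x * ((if G = H then 1 else 0) - (if H \<in> edges \<Gamma> \<and> H \<subseteq> G then 1 else 0))) =
          (\<Sum>G\<in>?P. if G = H then ?ev G x else 0)"
        by (rule sum.cong[OF refl]) (use False in simp)
      also have "\<dots> = ?ev H x" using finP HP by (simp only: sum.delta' if_True sum.delta)
      finally show ?thesis using False by simp
    qed
    finally show "?ev H x = ?ev H y" by simp
  qed
  then show ?thesis using ysp by simp
qed

end

text \<open>Both conditions hold trivially unless \<open>d = 4\<close>, and in that degree both say
  that the edge sums agree. With fewer than three vertices there are no trees with two vertices, so
  \<open>x\<close> is zero.\<close>

lemma weight_two_iff:
  fixes x :: "unit decoration \<Rightarrow> 'k::field"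
  assumes conn: "connected_graph \<Gamma>" and x: "x \<in> shifted.tree_space \<Gamma> d"
  shows "weight_two_part x \<in> fs.span (shift_squared ` grav_relations \<Gamma> (d - 2)) \<longleftrightarrow>
     (\<forall>r\<in>hyper_relations \<Gamma> (2 * rank \<Gamma> - d). pairing \<Gamma> r x = 0)"
proof (cases "d = 4")
  case False
  then have "hyper_relations \<Gamma> (2 * rank \<Gamma> - d) = ({} :: (_ \<Rightarrow> 'k) set)"
    unfolding hyper_relations_def rank_eq by auto
  then show ?thesis unfolding weight_two_part_eq[OF conn x] using False fs.span_zero by simp
next
  case True
  have x4: "x \<in> shifted.tree_space \<Gamma> 4" using x True by simp
  have w: "weight_two_part x = x" unfolding weight_two_part_eq[OF conn x] using True by simp
  show ?thesis
  proof (cases "3 \<le> card (verts \<Gamma>)")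
    case False
    then have n: "\<not> big_tube \<Gamma> G" for G using big_tube_card[OF conn, of G] big_tubeD(3)[OF conn, of G] by linarith
    have "x = 0" by (rule tree_space_four_eqI[OF conn x4 fs.subspace_0[OF shifted.subspace_tree_space]]) (use n in blast)
    then show ?thesis unfolding w using fs.span_zero by simp
  next
    case three: True
    show ?thesis
      unfolding w True using pairing_hyper_relations[OF conn, of x]
        span_relations_edge_sum[OF conn three, of x] edge_sum_span_relations[OF conn three x4] by auto
  qed
qed

section \<open>Ideals and the ideal generated by the hypercommutative relations\<close>

lemma contractad_idealD:
  assumes "contractad_ideal P J"
  shows "connected_graph \<Gamma> \<Longrightarrow> fs.subspace (J \<Gamma> d)"
    and "connected_graph \<Gamma> \<Longrightarrow> connected_graph \<Gamma>' \<Longrightarrow> graph_iso \<Gamma> \<Gamma>' f \<Longrightarrow> r \<in> J \<Gamma>' d \<Longrightarrow> pull P \<Gamma> \<Gamma>' f d r \<in> J \<Gamma> d"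
    and "connected_graph \<Gamma> \<Longrightarrow> tube \<Gamma> G \<Longrightarrow> a \<in> homog P (contract \<Gamma> G) i \<Longrightarrow> b \<in> homog P (induced \<Gamma> G) j \<Longrightarrow>
      a \<in> J (contract \<Gamma> G) i \<or> b \<in> J (induced \<Gamma> G) j \<Longrightarrow> pcomp P \<Gamma> G i j a b \<in> J \<Gamma> (i + j)"
proof -
  note h = assms[unfolded contractad_ideal_def]
  show "connected_graph \<Gamma> \<Longrightarrow> fs.subspace (J \<Gamma> d)" by (rule h[THEN conjunct1, rule_format, THEN conjunct1])
  assume c: "connected_graph \<Gamma>"
  show "pull P \<Gamma> \<Gamma>' f d r \<in> J \<Gamma> d" if "connected_graph \<Gamma>'" "graph_iso \<Gamma> \<Gamma>' f" "r \<in> J \<Gamma>' d"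
  proof -
    have "pull P \<Gamma> \<Gamma>' f d ` J \<Gamma>' d \<subseteq> J \<Gamma> d"
      by (rule h[THEN conjunct2, THEN conjunct1, rule_format]) (use c that in simp)
    then show ?thesis using that(3) by (simp add: image_subset_iff)
  qed
  show "pcomp P \<Gamma> G i j a b \<in> J \<Gamma> (i + j)"
    if "tube \<Gamma> G" "a \<in> homog P (contract \<Gamma> G) i" "b \<in> homog P (induced \<Gamma> G) j"
      "a \<in> J (contract \<Gamma> G) i \<or> b \<in> J (induced \<Gamma> G) j"
    by (rule h[THEN conjunct2, THEN conjunct2, rule_format]) (use c that in simp)
qed

definition relation_ideal :: "graph \<Rightarrow> int \<Rightarrow> (unit decoration \<Rightarrow> 'k::field) set" where
  "relation_ideal = generated_ideal hyper.free hyper_relations"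

text \<open>The spaces of trees themselves form an ideal containing the relations, so the
  intersection that defines the generated ideal stays within them.\<close>

lemma whole_ideal: "contractad_ideal (hyper.free :: (_, 'k::field) contractad_data) hyper.tree_space"
  unfolding contractad_ideal_def
proof (intro conjI allI impI; (elim conjE)?)
  fix \<Gamma> d assume c: "connected_graph \<Gamma>"
  show "fs.subspace (hyper.tree_space \<Gamma> d :: (_ \<Rightarrow> 'k) set)" by (rule hyper.subspace_tree_space)
  show "hyper.tree_space \<Gamma> d \<subseteq> homog (hyper.free :: (_, 'k) contractad_data) \<Gamma> d" by (simp add: hyper.homog_free[OF c])
next
  fix \<Gamma> \<Gamma>' f d assume c: "connected_graph \<Gamma>" "connected_graph \<Gamma>'" "graph_iso \<Gamma> \<Gamma>' f"
  show "pull hyper.free \<Gamma> \<Gamma>' f d ` hyper.tree_space \<Gamma>' d \<subseteq> (hyper.tree_space \<Gamma> d :: (_ \<Rightarrow> 'k) set)"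
    unfolding hyper.pull_free
    using hyper.tree_pull_in[OF connected_simple[OF c(1)] connected_simple[OF c(2)] c(3), where 'a='k] by blast
next
  fix \<Gamma> G i j and a b :: "unit decoration \<Rightarrow> 'k"
  assume c: "connected_graph \<Gamma>" "tube \<Gamma> G" "a \<in> homog hyper.free (contract \<Gamma> G) i" "b \<in> homog hyper.free (induced \<Gamma> G) j"
  note s = connected_simple[OF c(1)]
  have "a \<in> hyper.tree_space (contract \<Gamma> G) i" using c(3) by (simp add: hyper.homog_free[OF connected_contract[OF c(1,2)]])
  moreover have "b \<in> hyper.tree_space (induced \<Gamma> G) j" using c(4) by (simp add: hyper.homog_free[OF connected_induced[OF s c(2)]])
  ultimately show "pcomp hyper.free \<Gamma> G i j a b \<in> hyper.tree_space \<Gamma> (i + j)" by (rule hyper.pcomp_free_in[OF s c(2)])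
qed

lemma relation_ideal_iff:
  "r \<in> relation_ideal \<Gamma> d \<longleftrightarrow> (\<forall>J. contractad_ideal hyper.free J \<and>
     (\<forall>\<Gamma> d. connected_graph \<Gamma> \<longrightarrow> hyper_relations \<Gamma> d \<subseteq> J \<Gamma> d) \<longrightarrow> r \<in> J \<Gamma> d)"
  unfolding relation_ideal_def generated_ideal_def by blast

lemma relation_ideal_in: "r \<in> relation_ideal \<Gamma> d \<Longrightarrow> r \<in> hyper.tree_space \<Gamma> d"
  unfolding relation_ideal_iff using whole_ideal hyper_relations_in by blast

lemma hyper_relations_in_ideal: "connected_graph \<Gamma> \<Longrightarrow> r \<in> hyper_relations \<Gamma> d \<Longrightarrow> r \<in> relation_ideal \<Gamma> d"
  unfolding relation_ideal_iff by blast

lemma subspace_relation_ideal: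
  assumes "connected_graph \<Gamma>"
  shows "fs.subspace (relation_ideal \<Gamma> d :: (_ \<Rightarrow> 'k::field) set)"
proof -
  have "fs.subspace S" if S: "S \<in> {J \<Gamma> d |J. contractad_ideal (hyper.free :: (_, 'k) contractad_data) J \<and>
      (\<forall>\<Gamma> d. connected_graph \<Gamma> \<longrightarrow> hyper_relations \<Gamma> d \<subseteq> J \<Gamma> d)}" for S
  proof -
    obtain J where "S = J \<Gamma> d" "contractad_ideal (hyper.free :: (_, 'k) contractad_data) J" using S by blast
    then show ?thesis using contractad_idealD(1) assms by metis
  qed
  then show ?thesis unfolding relation_ideal_def generated_ideal_def by (intro fs.subspace_Inter ballI)
qed

lemma relation_ideal_pull:
  assumes "connected_graph \<Gamma>" "connected_graph \<Gamma>'" "graph_iso \<Gamma> \<Gamma>' f" "r \<in> relation_ideal \<Gamma>' d"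
  shows "tree_pull (symmetric_generators hyper_degree) \<Gamma> \<Gamma>' f d r \<in> (relation_ideal \<Gamma> d :: (_ \<Rightarrow> 'k::field) set)"
  unfolding relation_ideal_iff
proof (intro allI impI)
  fix J :: "graph \<Rightarrow> int \<Rightarrow> (unit decoration \<Rightarrow> 'k) set"
  assume J: "contractad_ideal hyper.free J \<and> (\<forall>\<Gamma> d. connected_graph \<Gamma> \<longrightarrow> hyper_relations \<Gamma> d \<subseteq> J \<Gamma> d)"
  have "r \<in> J \<Gamma>' d" by (rule assms(4)[unfolded relation_ideal_iff, rule_format, OF J])
  then show "tree_pull (symmetric_generators hyper_degree) \<Gamma> \<Gamma>' f d r \<in> J \<Gamma> d"
    unfolding hyper.pull_free[symmetric] by (rule contractad_idealD(2)[OF conjunct1[OF J] assms(1-3)])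
qed

lemma relation_ideal_pcomp:
  assumes c: "connected_graph \<Gamma>" "tube \<Gamma> G"
    and a: "a \<in> hyper.tree_space (contract \<Gamma> G) i" and b: "b \<in> hyper.tree_space (induced \<Gamma> G) j"
    and r: "a \<in> relation_ideal (contract \<Gamma> G) i \<or> b \<in> relation_ideal (induced \<Gamma> G) j"
  shows "pcomp hyper.free \<Gamma> G i j a b \<in> (relation_ideal \<Gamma> (i + j) :: (_ \<Rightarrow> 'k::field) set)"
  unfolding relation_ideal_iff
proof (intro allI impI)
  fix J :: "graph \<Rightarrow> int \<Rightarrow> (unit decoration \<Rightarrow> 'k) set"
  assume J: "contractad_ideal hyper.free J \<and> (\<forall>\<Gamma> d. connected_graph \<Gamma> \<longrightarrow> hyper_relations \<Gamma> d \<subseteq> J \<Gamma> d)"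
  have rJ: "y \<in> J \<Delta> n" if "y \<in> relation_ideal \<Delta> n" for y \<Delta> n
    by (rule that[unfolded relation_ideal_iff, rule_format, OF J])
  show "pcomp hyper.free \<Gamma> G i j a b \<in> J \<Gamma> (i + j)"
  proof (rule contractad_idealD(3)[OF conjunct1[OF J] c])
    show "a \<in> homog hyper.free (contract \<Gamma> G) i" using a by (simp add: hyper.homog_free[OF connected_contract[OF c]])
    show "b \<in> homog hyper.free (induced \<Gamma> G) j"
      using b by (simp add: hyper.homog_free[OF connected_induced[OF connected_simple[OF c(1)] c(2)]])
    show "a \<in> J (contract \<Gamma> G) i \<or> b \<in> J (induced \<Gamma> G) j" using r rJ by blast
  qed
qed

section \<open>The annihilator of the relation ideal\<close>

abbreviation cofree :: "(unit decoration, 'k::field) cocontractad_data" where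
  "cofree \<equiv> cofree_cocontractad (symmetric_generators shifted_degree)"

lemma homog_cofree: "connected_graph \<Gamma> \<Longrightarrow> homog cofree \<Gamma> e = shifted.tree_space \<Gamma> e"
  using shifted.tree_homog_eq[OF connected_simple] by (simp add: cofree_cocontractad_def)

lemma pull_cofree: "pull cofree = tree_pull (symmetric_generators shifted_degree)"
  by (simp add: cofree_cocontractad_def)

text \<open>This turns out to be the Koszul dual cocontractad of the gravity presentation.\<close>

definition koszul_perp :: "graph \<Rightarrow> int \<Rightarrow> (unit decoration \<Rightarrow> 'k::field) set" where
  "koszul_perp \<Gamma> e = {x \<in> shifted.tree_space \<Gamma> e. \<forall>r\<in>relation_ideal \<Gamma> (2 * rank \<Gamma> - e). pairing \<Gamma> r x = 0}"

lemma subspace_koszul_perp: "fs.subspace (koszul_perp \<Gamma> e :: (_ \<Rightarrow> 'k::field) set)"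
proof (rule fs.subspaceI)
  note s = shifted.subspace_tree_space
  show "0 \<in> koszul_perp \<Gamma> e" unfolding koszul_perp_def by (simp add: fs.subspace_0[OF s])
  fix x y :: "unit decoration \<Rightarrow> 'k" and c :: 'k
  assume x: "x \<in> koszul_perp \<Gamma> e"
  then show "fscale c x \<in> koszul_perp \<Gamma> e"
    unfolding koszul_perp_def by (auto simp: pairing_scale_right intro: fs.subspace_scale[OF s])
  assume "y \<in> koszul_perp \<Gamma> e"
  then show "x + y \<in> koszul_perp \<Gamma> e"
    using x unfolding koszul_perp_def by (auto simp: pairing_add_right intro: fs.subspace_add[OF s])
qed

lemma rank_iso: "graph_iso \<Gamma> \<Gamma>' f \<Longrightarrow> rank \<Gamma>' = rank \<Gamma>"
  unfolding rank_eq graph_iso_def using bij_betw_same_card by fastforce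

text \<open>Pullback along \<open>f\<close> is adjoint to pullback along its inverse, under which
  the ideal is stable.\<close>

lemma koszul_perp_pull:
  assumes c: "connected_graph \<Gamma>" "connected_graph \<Gamma>'" "graph_iso \<Gamma> \<Gamma>' f" and x: "x \<in> koszul_perp \<Gamma>' e"
  shows "tree_pull (symmetric_generators shifted_degree) \<Gamma> \<Gamma>' f e x \<in> (koszul_perp \<Gamma> e :: (_ \<Rightarrow> 'k::field) set)"
proof -
  note s = connected_simple[OF c(1)] connected_simple[OF c(2)]
  let ?g = "inv_into (verts \<Gamma>) f"
  note g = iso_inverse[OF c(3)]
  have b: "bij_betw f (verts \<Gamma>) (verts \<Gamma>')" using c(3) unfolding graph_iso_def by blast
  have fg: "f (?g v) = v" if "v \<in> verts \<Gamma>'" for v using bij_betw_inv_into_right[OF b that] .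
  have xt: "x \<in> shifted.tree_space \<Gamma>' e" and xp: "\<And>r. r \<in> relation_ideal \<Gamma>' (2 * rank \<Gamma>' - e) \<Longrightarrow> pairing \<Gamma>' r x = 0"
    using x unfolding koszul_perp_def by blast+
  have "pairing \<Gamma> r (tree_pull (symmetric_generators shifted_degree) \<Gamma> \<Gamma>' f e x) = 0"
    if r: "r \<in> relation_ideal \<Gamma> (2 * rank \<Gamma> - e)" for r
  proof -
    have "pairing \<Gamma> r (tree_pull (symmetric_generators shifted_degree) \<Gamma> \<Gamma>' f e x) =
        pairing \<Gamma>' (tree_pull (symmetric_generators hyper_degree) \<Gamma>' \<Gamma> ?g (2 * rank \<Gamma> - e) r) x"
      by (rule pairing_pull[OF s(2,1) g c(3) fg relation_ideal_in[OF r] xt, symmetric])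
    also have "\<dots> = 0"
      by (rule xp) (use relation_ideal_pull[OF c(2,1) g r] rank_iso[OF c(3)] in simp)
    finally show ?thesis .
  qed
  then show ?thesis unfolding koszul_perp_def using shifted.tree_pull_in[OF s c(3) xt] by blast
qed

text \<open>Supplies the finiteness required when a tensor is built from its slices.\<close>

lemma finite_decorates:
  assumes "simple_graph \<Gamma>" shows "finite {L. decorates deg \<Gamma> L}"
proof (rule finite_subset)
  let ?S = "\<lambda>T. (\<lambda>N. (N, deg (in_graph \<Gamma> T N), ())) ` T"
  show "{L. decorates deg \<Gamma> L} \<subseteq> (\<Union>T\<in>{T. admissible_tree \<Gamma> T}. {L. set L \<subseteq> ?S T \<and> length L \<le> card T})"
  proof
    fix L assume "L \<in> {L. decorates deg \<Gamma> L}"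
    then have d: "decorates deg \<Gamma> L" by simp
    then have "admissible_tree \<Gamma> (nodes L)" "length L = card (nodes L)"
      unfolding decorates_def using length_nodes by blast+
    then show "L \<in> (\<Union>T\<in>{T. admissible_tree \<Gamma> T}. {L. set L \<subseteq> ?S T \<and> length L \<le> card T})"
      using decorates_set[OF d] by (intro UN_I[of "nodes L"]) simp_all
  qed
  show "finite (\<Union>T\<in>{T. admissible_tree \<Gamma> T}. {L. set L \<subseteq> ?S T \<and> length L \<le> card T})"
    using finite_admissible[OF assms] admissible_finite[OF assms]
    by (intro finite_UN_I finite_lists_length_le finite_imageI) simp_all
qed

lemma total_degree_mset: "mset L = mset L' \<Longrightarrow> total_degree L = total_degree L'"
  unfolding total_degree_def by (metis mset_map sum_mset_sum_list)

lemma nodes_mset: "mset L = mset L' \<Longrightarrow> nodes L = nodes L'"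
  unfolding nodes_def by (metis mset_eq_setD)

context
  fixes \<Gamma> :: graph and G :: "vert set" and x :: "unit decoration \<Rightarrow> 'k::field" and i j :: int
  assumes conn: "connected_graph \<Gamma>" and G: "tube \<Gamma> G" and x: "x \<in> shifted.tree_space \<Gamma> (i + j)"
begin

text \<open>The shifted degree is the constant 2, so a decoration of the whole tree restricts to
  decorations of the two parts without comparing their input graphs.\<close>

lemma cut_nonzero:
  assumes "cut \<Gamma> G i j x (y, z) \<noteq> 0"
  shows "decorates shifted_degree (contract \<Gamma> G) y" "decorates shifted_degree (induced \<Gamma> G) z"
    "total_degree y = i" "total_degree z = j"
proof -
  note s = connected_simple[OF conn]
  have a: "admissible_tree (contract \<Gamma> G) (nodes y)" "admissible_tree (induced \<Gamma> G) (nodes z)"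
    "total_degree y = i" "total_degree z = j" "x (y @ z) \<noteq> 0"
    using assms unfolding cut_eq[OF s G] by (auto split: if_splits)
  then show "total_degree y = i" "total_degree z = j" by simp_all
  have "decorates shifted_degree \<Gamma> (y @ z)" by (rule shifted.tree_spaceD(1)[OF x a(5)])
  then show "decorates shifted_degree (contract \<Gamma> G) y" "decorates shifted_degree (induced \<Gamma> G) z"
    using a(1,2) unfolding decorates_def shifted_degree_def by auto
qed

lemma cut_mset:
  assumes "mset y = mset y'" "mset z = mset z'"
  shows "cut \<Gamma> G i j x (y, z) = cut \<Gamma> G i j x (y', z')"
proof -
  have "x (y @ z) = x (y' @ z')" by (rule shifted.tree_spaceD(3)[OF x]) (simp add: assms)
  then show ?thesis
    unfolding cut_eq[OF connected_simple[OF conn] G] nodes_mset[OF assms(1)] nodes_mset[OF assms(2)]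
      total_degree_mset[OF assms(1)] total_degree_mset[OF assms(2)] by simp
qed

lemma cut_slice_left: "(\<lambda>y. cut \<Gamma> G i j x (y, z)) \<in> shifted.tree_space (contract \<Gamma> G) i"
proof (rule shifted.tree_spaceI)
  fix y assume n: "cut \<Gamma> G i j x (y, z) \<noteq> 0"
  show "decorates shifted_degree (contract \<Gamma> G) y" by (rule cut_nonzero(1)[OF n])
  show "tree_degree shifted_degree (contract \<Gamma> G) (nodes y) = i"
    using decorates_total_degree[OF cut_nonzero(1)[OF n]] cut_nonzero(3)[OF n] by simp
qed (rule cut_mset, simp_all)

lemma cut_slice_right: "(\<lambda>z. cut \<Gamma> G i j x (y, z)) \<in> shifted.tree_space (induced \<Gamma> G) j"
proof (rule shifted.tree_spaceI)
  fix z assume n: "cut \<Gamma> G i j x (y, z) \<noteq> 0"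
  show "decorates shifted_degree (induced \<Gamma> G) z" by (rule cut_nonzero(2)[OF n])
  show "tree_degree shifted_degree (induced \<Gamma> G) (nodes z) = j"
    using decorates_total_degree[OF cut_nonzero(2)[OF n]] cut_nonzero(4)[OF n] by simp
qed (rule cut_mset, simp_all)

context
  assumes perp: "x \<in> koszul_perp \<Gamma> (i + j)"
begin

text \<open>For a fixed upper decoration \<open>z\<close> the slice is recovered by pairing the
  upper factor with the basis tree of \<open>z\<close>. Composing \<open>r\<close> with that tree
  gives an element of the ideal, which annihilates \<open>x\<close>; by transposition
  \<open>r\<close> annihilates the slice.\<close>

lemma cut_perp_left: "(\<lambda>y. cut \<Gamma> G i j x (y, z)) \<in> koszul_perp (contract \<Gamma> G) i"
  unfolding koszul_perp_def
proof (intro CollectI conjI ballI cut_slice_left)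
  note s = connected_simple[OF conn]
  note sI = connected_simple[OF connected_induced[OF s G]]
  let ?C = "contract \<Gamma> G" and ?I = "induced \<Gamma> G"
  fix r :: "unit decoration \<Rightarrow> 'k" assume r: "r \<in> relation_ideal ?C (2 * rank ?C - i)"
  show "pairing ?C r (\<lambda>y. cut \<Gamma> G i j x (y, z)) = 0"
  \<comment> \<open>An arbitrary list \<open>z\<close> need not decorate a tree; a single non-zero
    entry of the slice guarantees that it does, and otherwise the slice is zero.\<close>
  proof (cases "\<exists>y. cut \<Gamma> G i j x (y, z) \<noteq> 0")
    case False
    then have "(\<lambda>y. cut \<Gamma> G i j x (y, z)) = 0" by auto
    then show ?thesis by simp
  next
    case True
    then obtain y0 where y0: "cut \<Gamma> G i j x (y0, z) \<noteq> 0" by blast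
    let ?T = "nodes z"
    note d = cut_nonzero(2)[OF y0]
    have T: "admissible_tree ?I ?T" using d unfolding decorates_def by blast
    note fin = admissible_finite[OF sI T]
    \<comment> \<open>The slice depends on \<open>z\<close> only up to order, so the canonical
      decoration of the same tree may replace it.\<close>
    have m: "mset z = mset (decoration_of shifted_degree ?I ?T)"
      by (rule decorates_mset_eq[OF d decorates_decoration_of[OF fin T] nodes_decoration_of[OF fin, symmetric]])
    \<comment> \<open>The decomposition degree fixes the number of nodes, which places the basis
      tree in the complementary degree.\<close>
    have j: "2 * int (card ?T) = j"
      using decorates_total_degree[OF d] cut_nonzero(4)[OF y0] unfolding tree_degree_shifted by simp
    let ?b = "hyper.basis_tree ?I ?T :: unit decoration \<Rightarrow> 'k"
    have b: "?b \<in> hyper.tree_space ?I (2 * rank ?I - j)"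
      using hyper.basis_tree_in[of ?I ?T] tree_degree_hyper[OF sI T] j by simp
    have "pcomp hyper.free \<Gamma> G (2 * rank ?C - i) (2 * rank ?I - j) r ?b \<in> relation_ideal \<Gamma> (2 * rank ?C - i + (2 * rank ?I - j))"
      by (rule relation_ideal_pcomp[OF conn G relation_ideal_in[OF r] b]) (use r in blast)
    moreover have "2 * rank ?C - i + (2 * rank ?I - j) = 2 * rank \<Gamma> - (i + j)"
      using rank_split[OF s G] by simp
    ultimately have "pairing \<Gamma> (pcomp hyper.free \<Gamma> G (2 * rank ?C - i) (2 * rank ?I - j) r ?b) x = 0"
      using perp unfolding koszul_perp_def by simp
    then have "pairing2 \<Gamma> G r ?b (cut \<Gamma> G i j x) = 0"
      unfolding pairing_pcomp_cut[OF s G relation_ideal_in[OF r] b x] by simp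
    then have "pairing ?C r (\<lambda>y. cut \<Gamma> G i j x (y, decoration_of shifted_degree ?I ?T)) = 0"
      unfolding pairing2_iterated'[OF s G] pairing_basis_left[OF sI T] .
    then show ?thesis using cut_mset[OF refl m] by simp
  qed
qed

lemma cut_perp_right: "(\<lambda>z. cut \<Gamma> G i j x (y, z)) \<in> koszul_perp (induced \<Gamma> G) j"
  unfolding koszul_perp_def
proof (intro CollectI conjI ballI cut_slice_right)
  note s = connected_simple[OF conn]
  note sI = connected_simple[OF connected_induced[OF s G]] and sC = simple_contract[OF s G]
  let ?C = "contract \<Gamma> G" and ?I = "induced \<Gamma> G"
  fix r :: "unit decoration \<Rightarrow> 'k" assume r: "r \<in> relation_ideal ?I (2 * rank ?I - j)"
  show "pairing ?I r (\<lambda>z. cut \<Gamma> G i j x (y, z)) = 0"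
  proof (cases "\<exists>z. cut \<Gamma> G i j x (y, z) \<noteq> 0")
    case False
    then have "(\<lambda>z. cut \<Gamma> G i j x (y, z)) = 0" by auto
    then show ?thesis by simp
  next
    case True
    then obtain z0 where z0: "cut \<Gamma> G i j x (y, z0) \<noteq> 0" by blast
    let ?T = "nodes y"
    note d = cut_nonzero(1)[OF z0]
    have T: "admissible_tree ?C ?T" using d unfolding decorates_def by blast
    note fin = admissible_finite[OF sC T]
    have m: "mset y = mset (decoration_of shifted_degree ?C ?T)"
      by (rule decorates_mset_eq[OF d decorates_decoration_of[OF fin T] nodes_decoration_of[OF fin, symmetric]])
    have i: "2 * int (card ?T) = i"
      using decorates_total_degree[OF d] cut_nonzero(3)[OF z0] unfolding tree_degree_shifted by simp
    let ?b = "hyper.basis_tree ?C ?T :: unit decoration \<Rightarrow> 'k"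
    have b: "?b \<in> hyper.tree_space ?C (2 * rank ?C - i)"
      using hyper.basis_tree_in[of ?C ?T] tree_degree_hyper[OF sC T] i by simp
    have "pcomp hyper.free \<Gamma> G (2 * rank ?C - i) (2 * rank ?I - j) ?b r \<in> relation_ideal \<Gamma> (2 * rank ?C - i + (2 * rank ?I - j))"
      by (rule relation_ideal_pcomp[OF conn G b relation_ideal_in[OF r]]) (use r in blast)
    moreover have "2 * rank ?C - i + (2 * rank ?I - j) = 2 * rank \<Gamma> - (i + j)"
      using rank_split[OF s G] by simp
    ultimately have "pairing \<Gamma> (pcomp hyper.free \<Gamma> G (2 * rank ?C - i) (2 * rank ?I - j) ?b r) x = 0"
      using perp unfolding koszul_perp_def by simp
    then have "pairing2 \<Gamma> G ?b r (cut \<Gamma> G i j x) = 0"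
      unfolding pairing_pcomp_cut[OF s G b relation_ideal_in[OF r] x] by simp
    then have "pairing ?I r (\<lambda>z. cut \<Gamma> G i j x (decoration_of shifted_degree ?C ?T, z)) = 0"
      unfolding pairing2_iterated[OF s G] pairing_basis_left[OF sC T] .
    then show ?thesis using cut_mset[OF m refl] by simp
  qed
qed

lemma cut_perp: "cut \<Gamma> G i j x \<in> tensor (koszul_perp (contract \<Gamma> G) i) (koszul_perp (induced \<Gamma> G) j)"
proof (rule tensor_of_slices[OF subspace_koszul_perp subspace_koszul_perp _ cut_perp_left cut_perp_right])
  show "finite {y. \<exists>z. cut \<Gamma> G i j x (y, z) \<noteq> 0}"
  proof (rule finite_subset[OF _ finite_decorates[OF simple_contract[OF connected_simple[OF conn] G]]])
    show "{y. \<exists>z. cut \<Gamma> G i j x (y, z) \<noteq> 0} \<subseteq> {L. decorates shifted_degree (contract \<Gamma> G) L}"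
      using cut_nonzero(1) by blast
  qed
qed

end
end

lemma koszul_perp_subcocontractad: "subcocontractad cofree (koszul_perp :: _ \<Rightarrow> _ \<Rightarrow> (_ \<Rightarrow> 'k::field) set)"
  unfolding subcocontractad_def
proof (intro conjI allI impI; (elim conjE)?)
  fix \<Gamma> d assume c: "connected_graph \<Gamma>"
  show "fs.subspace (koszul_perp \<Gamma> d :: (_ \<Rightarrow> 'k) set)" by (rule subspace_koszul_perp)
  show "koszul_perp \<Gamma> d \<subseteq> homog (cofree :: (_, 'k) cocontractad_data) \<Gamma> d"
    unfolding homog_cofree[OF c] koszul_perp_def by blast
next
  fix \<Gamma> \<Gamma>' f d assume c: "connected_graph \<Gamma>" "connected_graph \<Gamma>'" "graph_iso \<Gamma> \<Gamma>' f"
  show "pull cofree \<Gamma> \<Gamma>' f d ` koszul_perp \<Gamma>' d \<subseteq> (koszul_perp \<Gamma> d :: (_ \<Rightarrow> 'k) set)"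
    unfolding pull_cofree using koszul_perp_pull[OF c, where 'k='k] by blast
next
  fix \<Gamma> G i j assume c: "connected_graph \<Gamma>" "tube \<Gamma> G"
  show "decomp cofree \<Gamma> G i j ` koszul_perp \<Gamma> (i + j) \<subseteq>
     (tensor (koszul_perp (contract \<Gamma> G) i) (koszul_perp (induced \<Gamma> G) j) :: (_ \<Rightarrow> 'k) set)"
  proof (rule image_subsetI)
    fix x :: "unit decoration \<Rightarrow> 'k" assume x: "x \<in> koszul_perp \<Gamma> (i + j)"
    then have "x \<in> shifted.tree_space \<Gamma> (i + j)" unfolding koszul_perp_def by blast
    from cut_perp[OF c this x]
    show "decomp cofree \<Gamma> G i j x \<in> tensor (koszul_perp (contract \<Gamma> G) i) (koszul_perp (induced \<Gamma> G) j)"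
      unfolding cut_def[OF connected_simple[OF c(1)] c(2)] .
  qed
qed

lemma subcocontractadD:
  assumes "subcocontractad Q C"
  shows "connected_graph \<Gamma> \<Longrightarrow> x \<in> C \<Gamma> d \<Longrightarrow> x \<in> homog Q \<Gamma> d"
    and "connected_graph \<Gamma> \<Longrightarrow> connected_graph \<Gamma>' \<Longrightarrow> graph_iso \<Gamma> \<Gamma>' f \<Longrightarrow> x \<in> C \<Gamma>' d \<Longrightarrow> pull Q \<Gamma> \<Gamma>' f d x \<in> C \<Gamma> d"
    and "connected_graph \<Gamma> \<Longrightarrow> tube \<Gamma> G \<Longrightarrow> x \<in> C \<Gamma> (i + j) \<Longrightarrow>
      decomp Q \<Gamma> G i j x \<in> tensor (C (contract \<Gamma> G) i) (C (induced \<Gamma> G) j)"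
proof -
  note h = assms[unfolded subcocontractad_def]
  assume c: "connected_graph \<Gamma>"
  show "x \<in> homog Q \<Gamma> d" if "x \<in> C \<Gamma> d"
    using h[THEN conjunct1, rule_format, OF c, THEN conjunct2] that by (rule subsetD)
  show "pull Q \<Gamma> \<Gamma>' f d x \<in> C \<Gamma> d" if "connected_graph \<Gamma>'" "graph_iso \<Gamma> \<Gamma>' f" "x \<in> C \<Gamma>' d"
  proof -
    have "pull Q \<Gamma> \<Gamma>' f d ` C \<Gamma>' d \<subseteq> C \<Gamma> d"
      by (rule h[THEN conjunct2, THEN conjunct1, rule_format]) (use c that in simp)
    then show ?thesis using that(3) by (simp add: image_subset_iff)
  qed
  show "decomp Q \<Gamma> G i j x \<in> tensor (C (contract \<Gamma> G) i) (C (induced \<Gamma> G) j)" if "tube \<Gamma> G" "x \<in> C \<Gamma> (i + j)"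
  proof -
    have "decomp Q \<Gamma> G i j ` C \<Gamma> (i + j) \<subseteq> tensor (C (contract \<Gamma> G) i) (C (induced \<Gamma> G) j)"
      by (rule h[THEN conjunct2, THEN conjunct2, rule_format]) (use c that in simp)
    then show ?thesis using that(2) by (simp add: image_subset_iff)
  qed
qed

text \<open>The annihilator \<open>J\<close> of \<open>C\<close> is an ideal, because pullback and
  composition are transposes of operations that respect \<open>C\<close>. By the condition on
  two-vertex parts it contains the relations, hence the generated ideal, so that ideal annihilates
  \<open>C\<close>.\<close>

lemma subcocontractad_le_perp:
  fixes C :: "graph \<Rightarrow> int \<Rightarrow> (unit decoration \<Rightarrow> 'k::field) set"
  assumes C: "subcocontractad cofree C"
    and w: "\<And>\<Gamma> d F. connected_graph \<Gamma> \<Longrightarrow> F \<in> C \<Gamma> d \<Longrightarrow>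
      weight_two_part F \<in> fs.span (shift_squared ` grav_relations \<Gamma> (d - 2))"
    and conn: "connected_graph \<Gamma>"
  shows "C \<Gamma> e \<subseteq> koszul_perp \<Gamma> e"
proof -
  have Cin: "x \<in> shifted.tree_space \<Gamma> d" if "connected_graph \<Gamma>" "x \<in> C \<Gamma> d" for \<Gamma> d x
  proof -
    have "x \<in> homog cofree \<Gamma> d" by (rule subcocontractadD(1)[OF C that])
    then show ?thesis by (simp add: homog_cofree[OF that(1)])
  qed
  have Cpull: "tree_pull (symmetric_generators shifted_degree) \<Gamma> \<Gamma>' f d x \<in> C \<Gamma> d"
    if "connected_graph \<Gamma>" "connected_graph \<Gamma>'" "graph_iso \<Gamma> \<Gamma>' f" "x \<in> C \<Gamma>' d" for \<Gamma> \<Gamma>' f d x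
    using subcocontractadD(2)[OF C that] unfolding pull_cofree .
  have Ccut: "cut \<Gamma> G i j x \<in> tensor (C (contract \<Gamma> G) i) (C (induced \<Gamma> G) j)"
    if "connected_graph \<Gamma>" "tube \<Gamma> G" "x \<in> C \<Gamma> (i + j)" for \<Gamma> G i j x
    unfolding cut_def[OF connected_simple[OF that(1)] that(2)] by (rule subcocontractadD(3)[OF C that])
  define J :: "graph \<Rightarrow> int \<Rightarrow> (unit decoration \<Rightarrow> 'k) set" where
    "J = (\<lambda>\<Gamma> d. {r \<in> hyper.tree_space \<Gamma> d. \<forall>x\<in>C \<Gamma> (2 * rank \<Gamma> - d). pairing \<Gamma> r x = 0})"
  have "contractad_ideal hyper.free J"
    unfolding contractad_ideal_def
  proof (intro conjI allI impI; (elim conjE)?)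
    fix \<Gamma> d assume c: "connected_graph \<Gamma>"
    note s = hyper.subspace_tree_space
    show "fs.subspace (J \<Gamma> d)"
    proof (rule fs.subspaceI)
      show "0 \<in> J \<Gamma> d" unfolding J_def by (simp add: fs.subspace_0[OF s])
      fix x y c assume x: "x \<in> J \<Gamma> d"
      then show "fscale c x \<in> J \<Gamma> d"
        unfolding J_def by (auto simp: pairing_scale_left intro: fs.subspace_scale[OF s])
      assume "y \<in> J \<Gamma> d"
      then show "x + y \<in> J \<Gamma> d"
        using x unfolding J_def by (auto simp: pairing_add_left intro: fs.subspace_add[OF s])
    qed
    show "J \<Gamma> d \<subseteq> homog hyper.free \<Gamma> d" unfolding hyper.homog_free[OF c] J_def by blast
  next
    fix \<Gamma> \<Gamma>' f d assume c: "connected_graph \<Gamma>" "connected_graph \<Gamma>'" "graph_iso \<Gamma> \<Gamma>' f"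
    note s = connected_simple[OF c(1)] connected_simple[OF c(2)]
    note g = iso_inverse[OF c(3)]
    have gf: "inv_into (verts \<Gamma>) f (f v) = v" if "v \<in> verts \<Gamma>" for v
      using inv_into_f_f[OF iso_inj[OF s c(3)] that] .
    show "pull hyper.free \<Gamma> \<Gamma>' f d ` J \<Gamma>' d \<subseteq> J \<Gamma> d"
    proof (rule image_subsetI)
      fix r assume r: "r \<in> J \<Gamma>' d"
      then have rt: "r \<in> hyper.tree_space \<Gamma>' d" unfolding J_def by blast
      have "pairing \<Gamma> (tree_pull (symmetric_generators hyper_degree) \<Gamma> \<Gamma>' f d r) x = 0"
        if x: "x \<in> C \<Gamma> (2 * rank \<Gamma> - d)" for x
      proof -
        have "pairing \<Gamma> (tree_pull (symmetric_generators hyper_degree) \<Gamma> \<Gamma>' f d r) x =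
            pairing \<Gamma>' r (tree_pull (symmetric_generators shifted_degree) \<Gamma>' \<Gamma> (inv_into (verts \<Gamma>) f) (2 * rank \<Gamma> - d) x)"
          by (rule pairing_pull[OF s c(3) g gf rt Cin[OF c(1) x]])
        moreover have "tree_pull (symmetric_generators shifted_degree) \<Gamma>' \<Gamma> (inv_into (verts \<Gamma>) f) (2 * rank \<Gamma> - d) x \<in> C \<Gamma>' (2 * rank \<Gamma>' - d)"
          using Cpull[OF c(2,1) g x] rank_iso[OF c(3)] by simp
        ultimately show ?thesis using r unfolding J_def by simp
      qed
      then show "pull hyper.free \<Gamma> \<Gamma>' f d r \<in> J \<Gamma> d"
        unfolding J_def hyper.pull_free using hyper.tree_pull_in[OF s c(3) rt] by blast
    qed
  next
    fix \<Gamma> G i j a b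
    assume c: "connected_graph \<Gamma>" "tube \<Gamma> G" and ab: "a \<in> homog hyper.free (contract \<Gamma> G) i"
      "b \<in> homog hyper.free (induced \<Gamma> G) j" and J: "a \<in> J (contract \<Gamma> G) i \<or> b \<in> J (induced \<Gamma> G) j"
    note s = connected_simple[OF c(1)]
    have a: "a \<in> hyper.tree_space (contract \<Gamma> G) i" using ab(1) by (simp add: hyper.homog_free[OF connected_contract[OF c]])
    have b: "b \<in> hyper.tree_space (induced \<Gamma> G) j" using ab(2) by (simp add: hyper.homog_free[OF connected_induced[OF s c(2)]])
    have "pairing \<Gamma> (pcomp hyper.free \<Gamma> G i j a b) x = 0" if x: "x \<in> C \<Gamma> (2 * rank \<Gamma> - (i + j))" for x
    proof -
      \<comment> \<open>Ranks add up under contraction, hence so do complementary degrees.\<close>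
      have e: "2 * rank \<Gamma> - (i + j) = (2 * rank (contract \<Gamma> G) - i) + (2 * rank (induced \<Gamma> G) - j)"
        using rank_split[OF s c(2)] by simp
      show ?thesis
        unfolding pairing_pcomp_cut[OF s c(2) a b Cin[OF c(1) x]]
      proof (rule pairing2_annihilates[OF s c(2) Ccut[OF c]])
        show "x \<in> C \<Gamma> ((2 * rank (contract \<Gamma> G) - i) + (2 * rank (induced \<Gamma> G) - j))" using x e by simp
        show "(\<forall>v\<in>C (contract \<Gamma> G) (2 * rank (contract \<Gamma> G) - i). pairing (contract \<Gamma> G) a v = 0) \<or>
            (\<forall>w\<in>C (induced \<Gamma> G) (2 * rank (induced \<Gamma> G) - j). pairing (induced \<Gamma> G) b w = 0)"
          using J unfolding J_def by blast
      qed
    qed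
    then show "pcomp hyper.free \<Gamma> G i j a b \<in> J \<Gamma> (i + j)"
      unfolding J_def using hyper.pcomp_free_in[OF s c(2) a b] by blast
  qed
  moreover have "hyper_relations \<Gamma> d \<subseteq> J \<Gamma> d" if c: "connected_graph \<Gamma>" for \<Gamma> d
  proof
    fix r :: "unit decoration \<Rightarrow> 'k" assume r: "r \<in> hyper_relations \<Gamma> d"
    have "pairing \<Gamma> r x = 0" if x: "x \<in> C \<Gamma> (2 * rank \<Gamma> - d)" for x
    proof -
      \<comment> \<open>Taking the complementary degree twice returns \<open>d\<close>.\<close>
      have "\<forall>r\<in>hyper_relations \<Gamma> (2 * rank \<Gamma> - (2 * rank \<Gamma> - d)). pairing \<Gamma> r x = 0"
        using weight_two_iff[OF c Cin[OF c x]] w[OF c x] by blast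
      then show ?thesis using r by simp
    qed
    then show "r \<in> J \<Gamma> d" unfolding J_def using r hyper_relations_in[OF c] by blast
  qed
  ultimately have J: "contractad_ideal hyper.free J \<and> (\<forall>\<Gamma> d. connected_graph \<Gamma> \<longrightarrow> hyper_relations \<Gamma> d \<subseteq> J \<Gamma> d)"
    by simp
  have sub: "r \<in> J \<Gamma> d" if "r \<in> relation_ideal \<Gamma> d" for r \<Gamma> d
    by (rule that[unfolded relation_ideal_iff, rule_format, OF J])
  show ?thesis
  proof
    fix x assume x: "x \<in> C \<Gamma> e"
    have "pairing \<Gamma> r x = 0" if "r \<in> relation_ideal \<Gamma> (2 * rank \<Gamma> - e)" for r
      using sub[OF that] x unfolding J_def by simp
    then show "x \<in> koszul_perp \<Gamma> e" unfolding koszul_perp_def using Cin[OF conn x] by blast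
  qed
qed

lemma shift_grav: "shift (symmetric_generators grav_degree) = symmetric_generators shifted_degree"
  unfolding shift_def symmetric_generators_def grav_degree_def shifted_degree_def by (auto simp: fun_eq_iff)

abbreviation koszul :: "(unit decoration, 'k::field) cocontractad_data" where
  "koszul \<equiv> koszul_dual_cocontractad (symmetric_generators grav_degree) grav_relations"

lemma koszul_fields:
  "pull koszul = pull cofree" "decomp koszul = decomp cofree" "counit koszul = counit cofree"
  unfolding koszul_dual_cocontractad_def quadratic_cocontractad_def shift_grav by simp_all

text \<open>The annihilator is one of the subcocontractads in the defining span and contains all the
  others, so the span is the annihilator itself.\<close>

lemma homog_koszul:
  assumes c: "connected_graph \<Gamma>"
  shows "homog koszul \<Gamma> e = (koszul_perp \<Gamma> e :: (_ \<Rightarrow> 'k::field) set)"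
proof -
  let ?S = "{C \<Gamma> e | C. subcocontractad cofree C \<and> (\<forall>\<Gamma> d. connected_graph \<Gamma> \<longrightarrow>
     (\<forall>F\<in>C \<Gamma> d. weight_two_part F \<in> fs.span (shift_squared ` grav_relations \<Gamma> (d - 2) :: (_ \<Rightarrow> 'k) set)))}"
  have h: "homog koszul \<Gamma> e = fs.span (\<Union>?S)"
    unfolding koszul_dual_cocontractad_def quadratic_cocontractad_def shift_grav by simp
  have "fs.span (\<Union>?S) \<subseteq> koszul_perp \<Gamma> e"
  proof (rule fs.span_minimal[OF _ subspace_koszul_perp], rule Union_least)
    fix S assume "S \<in> ?S"
    then obtain C where C: "S = C \<Gamma> e" "subcocontractad cofree C" "\<forall>\<Gamma> d. connected_graph \<Gamma> \<longrightarrow>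
     (\<forall>F\<in>C \<Gamma> d. weight_two_part F \<in> fs.span (shift_squared ` grav_relations \<Gamma> (d - 2) :: (_ \<Rightarrow> 'k) set))"
      by (elim CollectE exE conjE) (rule that)
    show "S \<subseteq> koszul_perp \<Gamma> e" unfolding C(1)
      by (rule subcocontractad_le_perp[OF C(2) C(3)[rule_format] c])
  qed
  moreover have w: "weight_two_part F \<in> fs.span (shift_squared ` grav_relations \<Gamma> (d - 2))"
    if "connected_graph \<Gamma>" "F \<in> koszul_perp \<Gamma> d" for \<Gamma> d and F :: "unit decoration \<Rightarrow> 'k"
  proof -
    have F: "F \<in> shifted.tree_space \<Gamma> d" "\<forall>r\<in>relation_ideal \<Gamma> (2 * rank \<Gamma> - d). pairing \<Gamma> r F = 0"
      using that(2) unfolding koszul_perp_def by blast+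
    have "\<forall>r\<in>hyper_relations \<Gamma> (2 * rank \<Gamma> - d). pairing \<Gamma> r F = 0"
      using F(2) hyper_relations_in_ideal[OF that(1)] by blast
    then show ?thesis unfolding weight_two_iff[OF that(1) F(1)] .
  qed
  have "koszul_perp \<Gamma> e \<in> ?S"
    by (intro CollectI exI[of _ koszul_perp] conjI refl koszul_perp_subcocontractad allI impI ballI) (rule w)
  then have "koszul_perp \<Gamma> e \<subseteq> fs.span (\<Union>?S)" by (intro order_trans[OF Union_upper fs.span_superset])
  ultimately show ?thesis unfolding h by (intro subset_antisym)
qed

section \<open>The hypercommutative contractad\<close>

text \<open>The Koszul sign \<open>sgnp (p * t)\<close> in the composition of the second suspension is the coboundary
  of \<open>kappa\<close>.\<close>

definition kappa :: "int \<Rightarrow> 'k::field" where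
  "kappa a = sgnp (a * (a - 1) div 2)"

text \<open>The number of pairs in a disjoint union of \<open>a\<close> and \<open>b\<close>
  elements is the sum of the two numbers of pairs and \<open>a * b\<close>; the identity persists
  for negative integers.\<close>

lemma kappa_add: "kappa (a + b) = (kappa a * kappa b * sgnp (a * b) :: 'k::field)"
proof -
  obtain m where m: "a * (a - 1) = 2 * m" using evenE[of "a * (a - 1)"] by auto
  obtain n where n: "b * (b - 1) = 2 * n" using evenE[of "b * (b - 1)"] by auto
  have "(a + b) * (a + b - 1) = 2 * (m + n + a * b)" using m n by (simp add: algebra_simps)
  then show ?thesis unfolding kappa_def m n by (simp add: sgnp_add)
qed

lemma kappa_square [simp]: "kappa a * kappa a = (1 :: 'k::field)"
  by (simp add: kappa_def)

lemma double_suspension_add: "double_suspension \<Gamma> (\<phi> + \<psi>) = double_suspension \<Gamma> \<phi> + double_suspension \<Gamma> \<psi>"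
  unfolding double_suspension_def by (auto simp: fun_eq_iff algebra_simps)

lemma double_suspension_scale: "double_suspension \<Gamma> (fscale c \<phi>) = fscale c (double_suspension \<Gamma> \<phi>)"
  unfolding double_suspension_def fscale_def by (auto simp: fun_eq_iff)

text \<open>The dual composition applies a functional that is zero outside the annihilator to a
  partially contracted decomposition, so the contracted vector has to be known to lie in the second
  factor.\<close>

lemma tensor_contract_left:
  fixes X :: "'b \<times> 'c \<Rightarrow> 'k::field"
  assumes X: "X \<in> tensor U W" and W: "fs.subspace W" and g: "functional g"
  shows "(\<lambda>z. g (\<lambda>y. X (y, z))) \<in> W"
  using X unfolding tensor_def
proof (rule fs.span_induct[where P="\<lambda>X. (\<lambda>z. g (\<lambda>y. X (y, z))) \<in> W"])
  have add: "(\<lambda>z. g (\<lambda>y. (X + Y) (y, z))) = (\<lambda>z. g (\<lambda>y. X (y, z))) + (\<lambda>z. g (\<lambda>y. Y (y, z)))" for X Y :: "'b \<times> 'c \<Rightarrow> 'k"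
  proof
    fix z
    have "(\<lambda>y. (X + Y) (y, z)) = (\<lambda>y. X (y, z)) + (\<lambda>y. Y (y, z))" by auto
    then show "g (\<lambda>y. (X + Y) (y, z)) = ((\<lambda>z. g (\<lambda>y. X (y, z))) + (\<lambda>z. g (\<lambda>y. Y (y, z)))) z"
      by (simp only: functional_add[OF g] plus_fun_apply)
  qed
  have scale: "(\<lambda>z. g (\<lambda>y. fscale c X (y, z))) = fscale c (\<lambda>z. g (\<lambda>y. X (y, z)))" for c and X :: "'b \<times> 'c \<Rightarrow> 'k"
  proof
    fix z
    have "(\<lambda>y. fscale c X (y, z)) = fscale c (\<lambda>y. X (y, z))" by (simp add: fscale_def)
    then show "g (\<lambda>y. fscale c X (y, z)) = fscale c (\<lambda>z. g (\<lambda>y. X (y, z))) z"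
      by (simp only: functional_scale[OF g]) (simp add: fscale_def)
  qed
  show "fs.subspace {X. (\<lambda>z. g (\<lambda>y. X (y, z))) \<in> W}"
  proof (rule fs.subspaceI)
    have "(\<lambda>z :: 'c. g (\<lambda>y. 0)) = 0"
    proof
      fix z
      have "(\<lambda>y. 0) = (0 :: 'b \<Rightarrow> 'k)" by (simp add: zero_fun_def)
      then show "g (\<lambda>y. 0) = (0 :: 'c \<Rightarrow> 'k) z" using functional_zero[OF g] by simp
    qed
    then show "0 \<in> {X. (\<lambda>z. g (\<lambda>y. X (y, z))) \<in> W}" using fs.subspace_0[OF W] by simp
    fix X Y :: "'b \<times> 'c \<Rightarrow> 'k" and c assume X: "X \<in> {X. (\<lambda>z. g (\<lambda>y. X (y, z))) \<in> W}"
    show "fscale c X \<in> {X. (\<lambda>z. g (\<lambda>y. X (y, z))) \<in> W}"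
      unfolding mem_Collect_eq scale by (rule fs.subspace_scale[OF W]) (use X in simp)
    assume Y: "Y \<in> {X. (\<lambda>z. g (\<lambda>y. X (y, z))) \<in> W}"
    show "X + Y \<in> {X. (\<lambda>z. g (\<lambda>y. X (y, z))) \<in> W}"
      unfolding mem_Collect_eq add by (rule fs.subspace_add[OF W]) (use X Y in simp_all)
  qed
  fix X :: "'b \<times> 'c \<Rightarrow> 'k" assume "X \<in> {\<lambda>(x, y). v x * w y |v w. v \<in> U \<and> w \<in> W}"
  then obtain v w where X: "X = (\<lambda>(x, y). v x * w y)" "w \<in> W" by blast
  have "(\<lambda>z. g (\<lambda>y. X (y, z))) = fscale (g v) w"
  proof
    fix z
    have "(\<lambda>y. X (y, z)) = fscale (w z) v" unfolding X(1) fscale_def by (simp add: mult.commute)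
    then show "g (\<lambda>y. X (y, z)) = fscale (g v) w z"
      by (simp only: functional_scale[OF g]) (simp add: fscale_def mult.commute)
  qed
  then show "(\<lambda>z. g (\<lambda>y. X (y, z))) \<in> W" using fs.subspace_scale[OF W X(2)] by simp
qed

section \<open>The comparison morphism and its compatibilities\<close>

abbreviation dual :: "(unit decoration \<Rightarrow> 'k, 'k::field) contractad_data" where
  "dual \<equiv> dual_contractad koszul"

text \<open>The elements of \<open>dual_contractad\<close> are functionals extended by zero outside
  their component, so \<open>pairing\<close> has to be cut off in the same way.\<close>

definition dual_pairing ::
  "graph \<Rightarrow> int \<Rightarrow> (unit decoration \<Rightarrow> 'k::field) \<Rightarrow> (unit decoration \<Rightarrow> 'k) \<Rightarrow> 'k" where
  "dual_pairing \<Gamma> d F = (\<lambda>x. if x \<in> koszul_perp \<Gamma> (2 * rank \<Gamma> - d) then pairing \<Gamma> F x else 0)"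

text \<open>The factor \<open>kappa (rank \<Gamma>)\<close> absorbs the Koszul sign that the two
  suspensions leave in compositions.\<close>

definition hyper_map ::
  "graph \<Rightarrow> int \<Rightarrow> (unit decoration \<Rightarrow> 'k::field) \<Rightarrow> vert list \<times> vert list \<times> (unit decoration \<Rightarrow> 'k) \<Rightarrow> 'k" where
  "hyper_map \<Gamma> d F = fscale (kappa (rank \<Gamma>)) (double_suspension \<Gamma> (dual_pairing \<Gamma> d F))"

lemma gcHyper_eq: "gcHyper = suspend (-1) (suspend (-1) dual)"
  unfolding gcHyper_def koszul_dual_def ..

lemma homog_dual:
  assumes "connected_graph \<Gamma>"
  shows "homog dual \<Gamma> d = {\<phi>. (\<forall>x\<in>koszul_perp \<Gamma> (-d). \<forall>y\<in>koszul_perp \<Gamma> (-d). \<phi> (x + y) = \<phi> x + \<phi> y) \<and>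
     (\<forall>c. \<forall>x\<in>koszul_perp \<Gamma> (-d). \<phi> (fscale c x) = c * \<phi> x) \<and> (\<forall>x. x \<notin> koszul_perp \<Gamma> (-d) \<longrightarrow> \<phi> x = (0 :: 'k::field))}"
  unfolding dual_contractad_def by (simp add: homog_koszul[OF assms])

lemma subspace_dual:
  assumes "connected_graph \<Gamma>"
  shows "fs.subspace (homog dual \<Gamma> d :: (_ \<Rightarrow> 'k::field) set)"
  unfolding homog_dual[OF assms] fs.subspace_def by (simp add: fscale_def algebra_simps)

lemma dual_pairing_in:
  assumes "connected_graph \<Gamma>"
  shows "dual_pairing \<Gamma> d F \<in> (homog dual \<Gamma> (d - 2 * rank \<Gamma>) :: (_ \<Rightarrow> 'k::field) set)"
proof -
  note add = fs.subspace_add[OF subspace_koszul_perp] and scale = fs.subspace_scale[OF subspace_koszul_perp]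
  show ?thesis
    unfolding homog_dual[OF assms] dual_pairing_def
    by (simp add: add scale pairing_add_right pairing_scale_right)
qed

lemma homog_gcHyper:
  assumes "connected_graph \<Gamma>"
  shows "homog gcHyper \<Gamma> d = (double_suspension \<Gamma> ` homog dual \<Gamma> (d - 2 * rank \<Gamma>) :: (_ \<Rightarrow> 'k::field) set)"
  unfolding gcHyper_eq by (rule homog_double_suspend[OF connected_simple[OF assms] subspace_dual[OF assms]])

lemma hyper_map_in:
  assumes "connected_graph \<Gamma>"
  shows "hyper_map \<Gamma> d F \<in> (homog gcHyper \<Gamma> d :: (_ \<Rightarrow> 'k::field) set)"
  unfolding homog_gcHyper[OF assms] hyper_map_def double_suspension_scale[symmetric]
  by (intro imageI fs.subspace_scale[OF subspace_dual[OF assms]] dual_pairing_in[OF assms])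

lemma dual_pairing_add: "dual_pairing \<Gamma> d (F + F') = dual_pairing \<Gamma> d F + dual_pairing \<Gamma> d F'"
  unfolding dual_pairing_def by (auto simp: fun_eq_iff pairing_add_left)

lemma fscale_apply: "fscale c f x = c * f x"
  by (simp add: fscale_def)

lemma dual_pairing_scale: "dual_pairing \<Gamma> d (fscale c F) = fscale c (dual_pairing \<Gamma> d F)"
  by (rule ext) (simp add: dual_pairing_def pairing_scale_left fscale_apply)

lemma hyper_map_linear: "linear_on V (hyper_map \<Gamma> d)"
  unfolding linear_on_def hyper_map_def dual_pairing_add dual_pairing_scale double_suspension_add double_suspension_scale
  by (simp add: fs.scale_right_distrib fs.scale_left_commute)

text \<open>A functional on the annihilator extends to the ambient function space, and on the
  finite-dimensional space of trees it is the pairing with some \<open>F\<close>.\<close>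

lemma hyper_map_surj:
  assumes conn: "connected_graph \<Gamma>"
  shows "hyper_map \<Gamma> d ` homog hyper.free \<Gamma> d = (homog gcHyper \<Gamma> d :: (_ \<Rightarrow> 'k::field) set)"
proof
  show "hyper_map \<Gamma> d ` homog hyper.free \<Gamma> d \<subseteq> (homog gcHyper \<Gamma> d :: (_ \<Rightarrow> 'k) set)"
    by (rule image_subsetI) (rule hyper_map_in[OF conn])
  show "(homog gcHyper \<Gamma> d :: (_ \<Rightarrow> 'k) set) \<subseteq> hyper_map \<Gamma> d ` homog hyper.free \<Gamma> d"
  proof
    fix Y :: "vert list \<times> vert list \<times> (unit decoration \<Rightarrow> 'k) \<Rightarrow> 'k" assume "Y \<in> homog gcHyper \<Gamma> d"
    then obtain \<phi> where \<phi>: "\<phi> \<in> homog dual \<Gamma> (d - 2 * rank \<Gamma>)" "Y = double_suspension \<Gamma> \<phi>"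
      unfolding homog_gcHyper[OF conn] by (elim imageE) (rule that)
    let ?U = "koszul_perp \<Gamma> (2 * rank \<Gamma> - d) :: (_ \<Rightarrow> 'k) set"
    have p: "\<And>x y. x \<in> ?U \<Longrightarrow> y \<in> ?U \<Longrightarrow> \<phi> (x + y) = \<phi> x + \<phi> y" "\<And>c x. x \<in> ?U \<Longrightarrow> \<phi> (fscale c x) = c * \<phi> x"
      "\<And>x. x \<notin> ?U \<Longrightarrow> \<phi> x = 0"
      using \<phi>(1) unfolding homog_dual[OF conn] by simp_all
    obtain g where g: "functional g" "\<forall>x\<in>?U. g x = \<phi> x"
      using functional_extend[OF subspace_koszul_perp p(1,2)] by metis
    obtain F where F: "F \<in> hyper.tree_space \<Gamma> d" "\<forall>x\<in>shifted.tree_space \<Gamma> (2 * rank \<Gamma> - d). pairing \<Gamma> F x = g x"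
      using functional_as_pairing[OF connected_simple[OF conn] g(1)] by metis
    have "dual_pairing \<Gamma> d F = \<phi>"
    proof
      fix x
      show "dual_pairing \<Gamma> d F x = \<phi> x"
      proof (cases "x \<in> ?U")
        case True
        then have "x \<in> shifted.tree_space \<Gamma> (2 * rank \<Gamma> - d)" unfolding koszul_perp_def by blast
        then have "pairing \<Gamma> F x = g x" by (rule bspec[OF F(2)])
        also have "\<dots> = \<phi> x" by (rule bspec[OF g(2) True])
        finally show ?thesis unfolding dual_pairing_def using True by simp
      next
        case False
        then show ?thesis unfolding dual_pairing_def p(3)[OF False] by simp
      qed
    qed
    \<comment> \<open>\<open>kappa\<close> is its own inverse, so scaling \<open>F\<close> by it
      undoes the sign in \<open>hyper_map\<close>.\<close>
    then have "hyper_map \<Gamma> d (fscale (kappa (rank \<Gamma>)) F) = Y"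
      unfolding hyper_map_def dual_pairing_scale double_suspension_scale \<phi>(2) by simp
    moreover have "fscale (kappa (rank \<Gamma>)) F \<in> homog hyper.free \<Gamma> d"
      unfolding hyper.homog_free[OF conn] by (rule fs.subspace_scale[OF hyper.subspace_tree_space F(1)])
    ultimately show "Y \<in> hyper_map \<Gamma> d ` homog hyper.free \<Gamma> d" by (metis imageI)
  qed
qed

text \<open>The double annihilator of the ideal is the ideal. A vector outside it is separated from
  it by a functional, which is the pairing with some \<open>x\<close>; this \<open>x\<close> lies in
  \<open>koszul_perp\<close> but does not kill the vector.\<close>

lemma hyper_map_kernel:
  assumes conn: "connected_graph \<Gamma>"
  shows "{F \<in> homog hyper.free \<Gamma> d. hyper_map \<Gamma> d F = 0} = (relation_ideal \<Gamma> d :: (_ \<Rightarrow> 'k::field) set)"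
proof -
  note s = connected_simple[OF conn]
  let ?U = "koszul_perp \<Gamma> (2 * rank \<Gamma> - d) :: (_ \<Rightarrow> 'k) set"
  have z: "hyper_map \<Gamma> d F = 0 \<longleftrightarrow> (\<forall>x\<in>?U. pairing \<Gamma> F x = 0)" for F
  proof
    assume "hyper_map \<Gamma> d F = 0"
    then have "fscale (kappa (rank \<Gamma>)) (hyper_map \<Gamma> d F) = double_suspension \<Gamma> 0"
      by (simp add: double_suspension_def fscale_def fun_eq_iff)
    then have "double_suspension \<Gamma> (dual_pairing \<Gamma> d F) = double_suspension \<Gamma> 0"
      unfolding hyper_map_def by simp
    then have e: "dual_pairing \<Gamma> d F = 0" by (rule double_suspension_inj[OF s])
    show "\<forall>x\<in>?U. pairing \<Gamma> F x = 0"
    proof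
      fix x assume x: "x \<in> ?U"
      have "dual_pairing \<Gamma> d F x = 0" unfolding e by simp
      then show "pairing \<Gamma> F x = 0" using x unfolding dual_pairing_def by simp
    qed
  next
    assume "\<forall>x\<in>?U. pairing \<Gamma> F x = 0"
    then have "dual_pairing \<Gamma> d F = 0" unfolding dual_pairing_def by (auto simp: fun_eq_iff)
    then show "hyper_map \<Gamma> d F = 0"
      unfolding hyper_map_def by (simp add: double_suspension_def fscale_def fun_eq_iff)
  qed
  show ?thesis
  proof (rule set_eqI, rule iffI)
    fix F :: "unit decoration \<Rightarrow> 'k" assume "F \<in> {F \<in> homog hyper.free \<Gamma> d. hyper_map \<Gamma> d F = 0}"
    then have F: "F \<in> hyper.tree_space \<Gamma> d" "\<forall>x\<in>?U. pairing \<Gamma> F x = 0"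
      unfolding z by (simp_all add: hyper.homog_free[OF conn])
    show "F \<in> relation_ideal \<Gamma> d"
    proof (rule ccontr)
      assume "F \<notin> relation_ideal \<Gamma> d"
      then obtain g where g: "functional g" "\<forall>r\<in>relation_ideal \<Gamma> d. g r = 0" "g F \<noteq> 0"
        using functional_separate[OF subspace_relation_ideal[OF conn]] by metis
      obtain x where x: "x \<in> shifted.tree_space \<Gamma> (2 * rank \<Gamma> - d)" "\<forall>F\<in>hyper.tree_space \<Gamma> d. pairing \<Gamma> F x = g F"
        using functional_as_pairing'[OF s g(1)] by metis
      have "pairing \<Gamma> r x = 0" if r: "r \<in> relation_ideal \<Gamma> d" for r
        using bspec[OF x(2) relation_ideal_in[OF r]] bspec[OF g(2) r] by simp
      then have "x \<in> ?U" unfolding koszul_perp_def using x(1) by simp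
      then have "pairing \<Gamma> F x = 0" by (rule bspec[OF F(2)])
      then show False using bspec[OF x(2) F(1)] g(3) by simp
    qed
  next
    fix F :: "unit decoration \<Rightarrow> 'k" assume F: "F \<in> relation_ideal \<Gamma> d"
    then have "\<forall>x\<in>?U. pairing \<Gamma> F x = 0" unfolding koszul_perp_def by simp
    then show "F \<in> {F \<in> homog hyper.free \<Gamma> d. hyper_map \<Gamma> d F = 0}"
      unfolding z using relation_ideal_in[OF F] by (simp add: hyper.homog_free[OF conn])
  qed
qed

text \<open>The dual acts through the inverse isomorphism, and adjointness with respect to
  \<open>pairing\<close> turns this back into the pullback along \<open>f\<close>.\<close>

lemma hyper_map_pull:
  assumes c: "connected_graph \<Gamma>" "connected_graph \<Gamma>'" "graph_iso \<Gamma> \<Gamma>' f"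
    and F: "F \<in> homog hyper.free \<Gamma>' d"
  shows "hyper_map \<Gamma> d (pull hyper.free \<Gamma> \<Gamma>' f d F) = (pull gcHyper \<Gamma> \<Gamma>' f d (hyper_map \<Gamma>' d F) :: _ \<Rightarrow> 'k::field)"
proof -
  note s = connected_simple[OF c(1)] connected_simple[OF c(2)]
  note g = iso_inverse[OF c(3)]
  have gf: "inv_into (verts \<Gamma>) f (f v) = v" if "v \<in> verts \<Gamma>" for v
    using inv_into_f_f[OF iso_inj[OF s c(3)] that] .
  have Ft: "F \<in> hyper.tree_space \<Gamma>' d" using F by (simp add: hyper.homog_free[OF c(2)])
  note r = rank_iso[OF c(3)]
  have m: "- (d - 2 * rank \<Gamma>) = 2 * rank \<Gamma> - d" by simp
  have hom: "pull dual \<Gamma> \<Gamma>' f n (fscale k \<phi>) = fscale k (pull dual \<Gamma> \<Gamma>' f n \<phi>)" for n k and \<phi> :: "_ \<Rightarrow> 'k"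
    unfolding dual_contractad_def by (auto simp: fun_eq_iff fscale_def)
  have e: "pull dual \<Gamma> \<Gamma>' f (d - 2 * rank \<Gamma>) (dual_pairing \<Gamma>' d F) =
      dual_pairing \<Gamma> d (tree_pull (symmetric_generators hyper_degree) \<Gamma> \<Gamma>' f d F)"
  proof
    fix x :: "unit decoration \<Rightarrow> 'k"
    let ?g = "inv_into (verts \<Gamma>) f"
    have l: "pull dual \<Gamma> \<Gamma>' f (d - 2 * rank \<Gamma>) (dual_pairing \<Gamma>' d F) x =
      (if x \<in> koszul_perp \<Gamma> (2 * rank \<Gamma> - d)
       then dual_pairing \<Gamma>' d F (tree_pull (symmetric_generators shifted_degree) \<Gamma>' \<Gamma> ?g (2 * rank \<Gamma> - d) x) else 0)"
      unfolding dual_contractad_def by (simp add: m homog_koszul[OF c(1)] koszul_fields pull_cofree)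
    show "pull dual \<Gamma> \<Gamma>' f (d - 2 * rank \<Gamma>) (dual_pairing \<Gamma>' d F) x =
      dual_pairing \<Gamma> d (tree_pull (symmetric_generators hyper_degree) \<Gamma> \<Gamma>' f d F) x"
    proof (cases "x \<in> koszul_perp \<Gamma> (2 * rank \<Gamma> - d)")
      case True
      then have xt: "x \<in> shifted.tree_space \<Gamma> (2 * rank \<Gamma> - d)" unfolding koszul_perp_def by blast
      have "tree_pull (symmetric_generators shifted_degree) \<Gamma>' \<Gamma> ?g (2 * rank \<Gamma> - d) x \<in> koszul_perp \<Gamma>' (2 * rank \<Gamma>' - d)"
        using koszul_perp_pull[OF c(2,1) g True] r by simp
      moreover have "pairing \<Gamma> (tree_pull (symmetric_generators hyper_degree) \<Gamma> \<Gamma>' f d F) x =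
          pairing \<Gamma>' F (tree_pull (symmetric_generators shifted_degree) \<Gamma>' \<Gamma> ?g (2 * rank \<Gamma> - d) x)"
        by (rule pairing_pull[OF s c(3) g gf Ft xt])
      ultimately show ?thesis unfolding l unfolding dual_pairing_def using True by simp
    next
      case False
      then show ?thesis unfolding l unfolding dual_pairing_def by simp
    qed
  qed
  have b: "bij_betw f (verts \<Gamma>) (verts \<Gamma>')" using c(3) unfolding graph_iso_def by blast
  have "pull gcHyper \<Gamma> \<Gamma>' f d (hyper_map \<Gamma>' d F) =
      pull (suspend (-1) (suspend (-1) dual)) \<Gamma> \<Gamma>' f d (double_suspension \<Gamma>' (fscale (kappa (rank \<Gamma>)) (dual_pairing \<Gamma>' d F)))"
    unfolding gcHyper_eq hyper_map_def double_suspension_scale r ..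
  also have "\<dots> = double_suspension \<Gamma> (pull dual \<Gamma> \<Gamma>' f (d - 2 * rank \<Gamma>) (fscale (kappa (rank \<Gamma>)) (dual_pairing \<Gamma>' d F)))"
    by (rule pull_double_suspend[OF b hom])
  also have "\<dots> = hyper_map \<Gamma> d (pull hyper.free \<Gamma> \<Gamma>' f d F)"
    unfolding hom e hyper_map_def hyper.pull_free double_suspension_scale ..
  finally show ?thesis ..
qed

text \<open>Homogeneity survives the extension by zero: scaling by a non-zero \<open>c\<close>
  preserves and reflects membership in \<open>koszul_perp\<close>, and for \<open>c = 0\<close> both
  sides vanish.\<close>

lemma dual_pairing_scale_arg: "dual_pairing \<Gamma> d F (fscale c x) = c * dual_pairing \<Gamma> d F x"
proof (cases "c = 0")
  case True
  then show ?thesis unfolding dual_pairing_def by (simp only: fs.scale_zero_left mult_zero_left pairing_zero_right if_cancel)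
next
  case False
  have "fscale c x \<in> koszul_perp \<Gamma> e \<longleftrightarrow> x \<in> koszul_perp \<Gamma> e" for e
  proof
    assume "fscale c x \<in> koszul_perp \<Gamma> e"
    then have "fscale (inverse c) (fscale c x) \<in> koszul_perp \<Gamma> e" by (rule fs.subspace_scale[OF subspace_koszul_perp])
    then show "x \<in> koszul_perp \<Gamma> e" using False by (simp add: fs.scale_scale)
  qed (rule fs.subspace_scale[OF subspace_koszul_perp])
  then show ?thesis unfolding dual_pairing_def by (simp add: pairing_scale_right)
qed

lemma dual_pcomp_scale:
  "pcomp dual \<Gamma> G m n (fscale c (dual_pairing \<Delta> i a)) (fscale c' (dual_pairing \<Delta>' j b)) =
     fscale (c * c') (pcomp dual \<Gamma> G m n (dual_pairing \<Delta> i a) (dual_pairing \<Delta>' j b) :: _ \<Rightarrow> 'k::field)"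
proof
  fix x :: "unit decoration \<Rightarrow> 'k"
  let ?h = "\<lambda>z. dual_pairing \<Delta> i a (\<lambda>y. decomp koszul \<Gamma> G (-m) (-n) x (y, z))"
  have "(\<lambda>z. fscale c (dual_pairing \<Delta> i a) (\<lambda>y. decomp koszul \<Gamma> G (-m) (-n) x (y, z))) = fscale c ?h"
    unfolding fscale_def ..
  then show "pcomp dual \<Gamma> G m n (fscale c (dual_pairing \<Delta> i a)) (fscale c' (dual_pairing \<Delta>' j b)) x =
     fscale (c * c') (pcomp dual \<Gamma> G m n (dual_pairing \<Delta> i a) (dual_pairing \<Delta>' j b)) x"
    unfolding dual_contractad_def fscale_def[of "c * c'"] fscale_def[of c']
    by (simp add: dual_pairing_scale_arg)
qed

text \<open>Slices of the decomposition and their contractions stay in \<open>koszul_perp\<close>,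
  so the extensions by zero never intervene and composition is the transpose of
  decomposition.\<close>

lemma dual_pcomp_eq:
  assumes conn: "connected_graph \<Gamma>" and G: "tube \<Gamma> G"
    and a: "a \<in> hyper.tree_space (contract \<Gamma> G) i" and b: "b \<in> hyper.tree_space (induced \<Gamma> G) j"
  shows "pcomp dual \<Gamma> G (i - 2 * rank (contract \<Gamma> G)) (j - 2 * rank (induced \<Gamma> G))
       (dual_pairing (contract \<Gamma> G) i a) (dual_pairing (induced \<Gamma> G) j b) =
     (dual_pairing \<Gamma> (i + j) (pcomp hyper.free \<Gamma> G i j a b) :: _ \<Rightarrow> 'k::field)"
proof
  fix x :: "unit decoration \<Rightarrow> 'k"
  note s = connected_simple[OF conn]
  let ?C = "contract \<Gamma> G" and ?I = "induced \<Gamma> G"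
  let ?p = "2 * rank ?C - i" and ?q = "2 * rank ?I - j"
  have d: "- (i - 2 * rank ?C + (j - 2 * rank ?I)) = 2 * rank \<Gamma> - (i + j)" "?p + ?q = 2 * rank \<Gamma> - (i + j)"
    using rank_split[OF s G] by simp_all
  have m: "- (i - 2 * rank ?C) = ?p" "- (j - 2 * rank ?I) = ?q" by simp_all
  let ?X = "cut \<Gamma> G ?p ?q x"
  have l: "pcomp dual \<Gamma> G (i - 2 * rank ?C) (j - 2 * rank ?I) (dual_pairing ?C i a) (dual_pairing ?I j b) x =
      (if x \<in> koszul_perp \<Gamma> (2 * rank \<Gamma> - (i + j))
       then sgnp ((i - 2 * rank ?C) * (j - 2 * rank ?I)) * dual_pairing ?I j b (\<lambda>z. dual_pairing ?C i a (\<lambda>y. ?X (y, z)))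
       else 0)"
    unfolding cut_def[OF s G] dual_contractad_def contractad_data.simps m koszul_fields homog_koszul[OF conn] d(1) ..
  show "pcomp dual \<Gamma> G (i - 2 * rank ?C) (j - 2 * rank ?I) (dual_pairing ?C i a) (dual_pairing ?I j b) x =
     dual_pairing \<Gamma> (i + j) (pcomp hyper.free \<Gamma> G i j a b) x"
  proof (cases "x \<in> koszul_perp \<Gamma> (2 * rank \<Gamma> - (i + j))")
    case False
    then show ?thesis unfolding l unfolding dual_pairing_def by simp
  next
    case True
    then have xp: "x \<in> koszul_perp \<Gamma> (?p + ?q)" unfolding d(2) .
    then have xt: "x \<in> shifted.tree_space \<Gamma> (?p + ?q)" unfolding koszul_perp_def by blast
    have "dual_pairing ?C i a (\<lambda>y. ?X (y, z)) = pairing ?C a (\<lambda>y. ?X (y, z))" for z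
      unfolding dual_pairing_def using cut_perp_left[OF conn G xt xp] by simp
    then have e: "(\<lambda>z. dual_pairing ?C i a (\<lambda>y. ?X (y, z))) = (\<lambda>z. pairing ?C a (\<lambda>y. ?X (y, z)))" by (rule ext)
    have "(\<lambda>z. pairing ?C a (\<lambda>y. ?X (y, z))) \<in> koszul_perp ?I ?q"
      by (rule tensor_contract_left[OF cut_perp[OF conn G xt xp] subspace_koszul_perp functional_pairing])
    then have "dual_pairing ?I j b (\<lambda>z. dual_pairing ?C i a (\<lambda>y. ?X (y, z))) = pairing2 \<Gamma> G a b ?X"
      unfolding e pairing2_iterated[OF s G] unfolding dual_pairing_def by simp
    \<comment> \<open>For odd \<open>i\<close> the element \<open>a\<close> is zero; for even
      \<open>i\<close> the sign is 1.\<close>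
    moreover have "sgnp ((i - 2 * rank ?C) * (j - 2 * rank ?I)) * pairing2 \<Gamma> G a b ?X = pairing2 \<Gamma> G a b ?X"
    proof (cases "even i")
      case True
      then show ?thesis by simp
    next
      case False
      have "a L = 0" for L using hyper.even_degree_or_zero[OF a, of L] False by blast
      then show ?thesis unfolding pairing2_def[OF s G] by simp
    qed
    ultimately show ?thesis
      unfolding l using True unfolding dual_pairing_def[of \<Gamma>] pairing_pcomp_cut[OF s G a b xt] by simp
  qed
qed

text \<open>The sign left by the double suspension is that of the product of the two ranks, exactly
  the defect of multiplicativity of \<open>kappa\<close> on their sum.\<close>

lemma hyper_map_pcomp:
  assumes conn: "connected_graph \<Gamma>" and G: "tube \<Gamma> G"
    and a: "a \<in> homog hyper.free (contract \<Gamma> G) i" and b: "b \<in> homog hyper.free (induced \<Gamma> G) j"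
  shows "hyper_map \<Gamma> (i + j) (pcomp hyper.free \<Gamma> G i j a b) =
     (pcomp gcHyper \<Gamma> G i j (hyper_map (contract \<Gamma> G) i a) (hyper_map (induced \<Gamma> G) j b) :: _ \<Rightarrow> 'k::field)"
proof -
  note s = connected_simple[OF conn]
  let ?C = "contract \<Gamma> G" and ?I = "induced \<Gamma> G"
  let ?c = "kappa (rank ?C) :: 'k" and ?d = "kappa (rank ?I) :: 'k"
  let ?\<phi> = "dual_pairing ?C i a" and ?\<psi> = "dual_pairing ?I j b"
  have at: "a \<in> hyper.tree_space ?C i" using a by (simp add: hyper.homog_free[OF connected_contract[OF conn G]])
  have bt: "b \<in> hyper.tree_space ?I j" using b by (simp add: hyper.homog_free[OF connected_induced[OF s G]])
  let ?m = "i - 2 * rank ?C" and ?n = "j - 2 * rank ?I"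
  have hom: "pcomp dual \<Gamma> G ?m ?n (fscale r (fscale ?c ?\<phi>)) (fscale r' (fscale ?d ?\<psi>)) =
      fscale (r * r') (pcomp dual \<Gamma> G ?m ?n (fscale ?c ?\<phi>) (fscale ?d ?\<psi>))" for r r'
    unfolding fs.scale_scale dual_pcomp_scale by (simp add: mult_ac)
  have "pcomp gcHyper \<Gamma> G i j (hyper_map ?C i a) (hyper_map ?I j b) =
      pcomp (suspend (-1) (suspend (-1) dual)) \<Gamma> G (?m + 2 * rank ?C) (?n + 2 * rank ?I)
        (double_suspension ?C (fscale ?c ?\<phi>)) (double_suspension ?I (fscale ?d ?\<psi>))"
    unfolding gcHyper_eq hyper_map_def double_suspension_scale by simp
  also have "\<dots> = fscale (sgnp (rank ?C * rank ?I)) (double_suspension \<Gamma> (pcomp dual \<Gamma> G ?m ?n (fscale ?c ?\<phi>) (fscale ?d ?\<psi>)))"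
    by (rule pcomp_double_suspend[OF s G hom])
  also have "\<dots> = fscale (?c * ?d * sgnp (rank ?C * rank ?I)) (double_suspension \<Gamma> (dual_pairing \<Gamma> (i + j) (pcomp hyper.free \<Gamma> G i j a b)))"
    unfolding dual_pcomp_scale dual_pcomp_eq[OF conn G at bt] double_suspension_scale fs.scale_scale
    by (simp add: mult_ac)
  also have "\<dots> = hyper_map \<Gamma> (i + j) (pcomp hyper.free \<Gamma> G i j a b)"
    unfolding hyper_map_def rank_split[OF s G, symmetric] kappa_add ..
  finally show ?thesis ..
qed

lemma hyper_map_iden:
  assumes conn: "connected_graph \<Gamma>" and one: "card (verts \<Gamma>) = 1"
  shows "hyper_map \<Gamma> 0 (iden hyper.free \<Gamma>) = (iden gcHyper \<Gamma> :: _ \<Rightarrow> 'k::field)"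
proof
  fix y :: "vert list \<times> vert list \<times> (unit decoration \<Rightarrow> 'k)"
  obtain l m x where y: "y = (l, m, x)" by (cases y)
  have r: "rank \<Gamma> = 0" unfolding rank_eq one by simp
  \<comment> \<open>A one-vertex graph has a single ordering.\<close>
  have sg: "order_sign l m = (1 :: 'k)" if o: "is_ordering \<Gamma> l" "is_ordering \<Gamma> m"
  proof -
    obtain v where v: "verts \<Gamma> = {v}" using one by (meson card_1_singletonE)
    have single: "k = [v]" if k: "is_ordering \<Gamma> k" for k
    proof -
      have "length k = 1" using k one distinct_card[of k] unfolding is_ordering_def by simp
      then obtain w where "k = [w]" by (cases k) auto
      then show ?thesis using k v unfolding is_ordering_def by simp
    qed
    have "l = m" using single[OF o(1)] single[OF o(2)] by simp
    then show ?thesis using o order_sign_refl unfolding is_ordering_def by blast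
  qed
  have "iden gcHyper \<Gamma> y = (if is_ordering \<Gamma> l \<and> is_ordering \<Gamma> m then if x \<in> koszul_perp \<Gamma> 0 then x [] else 0 else 0)"
    unfolding y gcHyper_eq suspend_def dual_contractad_def
    by (simp add: homog_koszul[OF conn] koszul_fields cofree_cocontractad_def)
  moreover have "hyper_map \<Gamma> 0 (iden hyper.free \<Gamma>) y =
      (if is_ordering \<Gamma> l \<and> is_ordering \<Gamma> m then order_sign l m * (if x \<in> koszul_perp \<Gamma> 0 then x [] else 0) else 0)"
    unfolding y hyper_map_def double_suspension_def dual_pairing_def r fscale_def
      pairing_iden[OF connected_simple[OF conn] one] by (simp add: kappa_def)
  ultimately show "hyper_map \<Gamma> 0 (iden hyper.free \<Gamma>) y = iden gcHyper \<Gamma> y" using sg by simp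
qed

lemma hyper_map_morphism:
  "contractad_morphism hyper.free (gcHyper :: (_, 'k::field) contractad_data) hyper_map"
  unfolding contractad_morphism_def
proof (intro conjI allI impI ballI; (elim conjE)?)
  fix \<Gamma> d assume c: "connected_graph \<Gamma>"
  show "linear_on (homog hyper.free \<Gamma> d) (hyper_map \<Gamma> d :: _ \<Rightarrow> _ \<Rightarrow> 'k)" by (rule hyper_map_linear)
  show "hyper_map \<Gamma> d ` homog hyper.free \<Gamma> d \<subseteq> (homog gcHyper \<Gamma> d :: (_ \<Rightarrow> 'k) set)"
    by (rule image_subsetI) (rule hyper_map_in[OF c])
qed (rule hyper_map_pull hyper_map_pcomp hyper_map_iden; assumption)+

text \<open>The generator is the basis tree whose only node is the root. An automorphism fixes the
  name of the root and is injective on nodes, so a tree is carried to this one iff it is this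
  one.\<close>

lemma generator_pull:
  assumes conn: "connected_graph \<Gamma>" and two: "2 \<le> card (verts \<Gamma>)" and f: "graph_iso \<Gamma> \<Gamma> f"
  shows "pull hyper.free \<Gamma> \<Gamma> f d (generator hyper_degree \<Gamma>) = (generator hyper_degree \<Gamma> :: _ \<Rightarrow> 'k::field)"
proof -
  note s = connected_simple[OF conn]
  have root: "lift \<Gamma> f (\<Union>(verts \<Gamma>)) = \<Union>(verts \<Gamma>)"
    using lift_Union[OF s s f, of "verts \<Gamma>"] iso_image[OF s s f] by simp
  have "(pull hyper.free \<Gamma> \<Gamma> f d :: (_ \<Rightarrow> 'k) \<Rightarrow> _) = pull hyper.free \<Gamma> \<Gamma> f (hyper_degree \<Gamma>)"
    unfolding hyper.pull_free tree_pull_def ..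
  moreover have "tree_pull (symmetric_generators hyper_degree) \<Gamma> \<Gamma> f (hyper_degree \<Gamma>) (generator hyper_degree \<Gamma>) =
      (generator hyper_degree \<Gamma> :: _ \<Rightarrow> 'k)"
  proof (rule hyper.tree_space_eqI)
    show "generator hyper_degree \<Gamma> \<in> hyper.tree_space \<Gamma> (hyper_degree \<Gamma>)" by (rule hyper.generator_in[OF conn two])
    then show "tree_pull (symmetric_generators hyper_degree) \<Gamma> \<Gamma> f (hyper_degree \<Gamma>) (generator hyper_degree \<Gamma>) \<in> hyper.tree_space \<Gamma> (hyper_degree \<Gamma>)"
      by (rule hyper.tree_pull_in[OF s s f])
    fix T assume T: "admissible_tree \<Gamma> T"
    note fin = admissible_finite[OF s T]
    have n: "nodes (decoration_of hyper_degree \<Gamma> T) = T" by (rule nodes_decoration_of[OF fin])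
    have d: "decorates hyper_degree \<Gamma> (relabel (lift \<Gamma> f) (decoration_of hyper_degree \<Gamma> T))"
      using hyper.decorates_relabel_iff[OF s s f, of "decoration_of hyper_degree \<Gamma> T"]
        decorates_decoration_of[OF fin T] T unfolding n by simp
    have r: "\<Union>(verts \<Gamma>) \<in> T" by (rule admissible_root[OF T two])
    have "lift \<Gamma> f ` T = {\<Union>(verts \<Gamma>)} \<longleftrightarrow> T = {\<Union>(verts \<Gamma>)}"
    proof
      assume "lift \<Gamma> f ` T = {\<Union>(verts \<Gamma>)}"
      then have "card T = 1" using card_image[OF hyper.lift_inj_nodes[OF s s f T]] by simp
      then show "T = {\<Union>(verts \<Gamma>)}" using r by (metis card_1_singletonE singletonD)
    next
      assume "T = {\<Union>(verts \<Gamma>)}"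
      then show "lift \<Gamma> f ` T = {\<Union>(verts \<Gamma>)}" using root by simp
    qed
    then show "tree_pull (symmetric_generators hyper_degree) \<Gamma> \<Gamma> f (hyper_degree \<Gamma>) (generator hyper_degree \<Gamma>) (decoration_of hyper_degree \<Gamma> T) =
        (generator hyper_degree \<Gamma> (decoration_of hyper_degree \<Gamma> T) :: 'k)"
      unfolding hyper.tree_pull_eq n hyper.generator_basis[OF conn two] hyper.basis_tree_eval[OF fin T]
        hyper.basis_tree_def[of _ _ "relabel _ _"] hyper.nodes_relabel using T d by simp
  qed
  ultimately show ?thesis by (simp add: hyper.pull_free)
qed

theorem proposition4p2p11:
  "contractad (gcHyper :: (_, 'k::field) contractad_data) \<and>
   (\<exists>\<nu> \<phi>.
      is_presentation (symmetric_generators hyper_degree) hyper_relations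
        (gcHyper :: (_, 'k) contractad_data) \<phi> \<and>
      (\<forall>\<Gamma>. connected_graph \<Gamma> \<and> 2 \<le> card (verts \<Gamma>) \<longrightarrow>
         \<nu> \<Gamma> \<in> homog (gcHyper :: (_, 'k) contractad_data) \<Gamma> (2 * (int (card (verts \<Gamma>)) - 2)) \<and>
         symmetric_element (gcHyper :: (_, 'k) contractad_data) \<Gamma>
           (2 * (int (card (verts \<Gamma>)) - 2)) (\<nu> \<Gamma>) \<and>
         \<phi> \<Gamma> (2 * (int (card (verts \<Gamma>)) - 2)) (generator hyper_degree \<Gamma>) = \<nu> \<Gamma>))"
proof (intro conjI exI allI impI; (elim conjE)?)
  show "contractad (gcHyper :: (_, 'k) contractad_data)"
    by (rule contractad_image[OF hyper.contractad_free hyper_map_morphism hyper_map_surj])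
  show "is_presentation (symmetric_generators hyper_degree) hyper_relations
      (gcHyper :: (_, 'k) contractad_data) hyper_map"
    unfolding is_presentation_def
    by (intro conjI allI impI hyper_map_morphism hyper_map_surj hyper_map_kernel[unfolded relation_ideal_def])
  fix \<Gamma> :: graph assume c: "connected_graph \<Gamma>" "2 \<le> card (verts \<Gamma>)"
  let ?d = "2 * (int (card (verts \<Gamma>)) - 2)"
  \<comment> \<open>This equation determines the open witness for \<nu>: the images of the
    generators of the free contractad.\<close>
  show "hyper_map \<Gamma> ?d (generator hyper_degree \<Gamma>) = hyper_map \<Gamma> ?d (generator hyper_degree \<Gamma>)" ..
  show "hyper_map \<Gamma> ?d (generator hyper_degree \<Gamma>) \<in> homog (gcHyper :: (_, 'k) contractad_data) \<Gamma> ?d"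
    by (rule hyper_map_in[OF c(1)])
  show "symmetric_element (gcHyper :: (_, 'k) contractad_data) \<Gamma> ?d (hyper_map \<Gamma> ?d (generator hyper_degree \<Gamma>))"
    unfolding symmetric_element_def
  proof (intro allI impI)
    fix f assume f: "graph_iso \<Gamma> \<Gamma> f"
    have "generator hyper_degree \<Gamma> \<in> homog hyper.free \<Gamma> ?d"
      using hyper.generator_in[OF c] by (simp add: hyper.homog_free[OF c(1)] hyper_degree_def)
    from hyper_map_pull[OF c(1) c(1) f this]
    show "pull gcHyper \<Gamma> \<Gamma> f ?d (hyper_map \<Gamma> ?d (generator hyper_degree \<Gamma>)) = (hyper_map \<Gamma> ?d (generator hyper_degree \<Gamma>) :: _ \<Rightarrow> 'k)"
      unfolding generator_pull[OF c f] ..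
  qed
qed

end
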